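(* Let $n,m\ge 1$ be integers, $\alpha,\beta>0$, and let $(s_{t_1,t_2})_{t_1,t_2>0}$ be a family of kernels $s_{t_1,t_2}\colon \mathbb{R}^{n+m}\times\mathbb{R}^{n+m}\to\mathbb{C}$ satisfying the full standard estimates (A), the Carleson $\times$ standard estimates (B) and the bi-parameter Carleson condition (C) stated in the context. For $f\colon\mathbb{R}^{n+m}\to\mathbb{C}$ put $$\theta_{t_1,t_2}f(x_1,x_2)=\iint_{\mathbb{R}^{n+m}} s_{t_1,t_2}(x_1,x_2,y_1,y_2)f(y_1,y_2)\,dy_1\,dy_2 .$$ Then for every $f\in L^2(\mathbb{R}^{n+m})$, $$\iint_{\mathbb{R}^{m+1}_+}\iint_{\mathbb{R}^{n+1}_+}|\theta_{t_1,t_2}f(x_1,x_2)|^2\,\frac{dx_1\,dt_1}{t_1}\,\frac{dx_2\,dt_2}{t_2}\le C\,\|f\|_{L^2(\mathbb{R}^{n+m})}^2 ,$$ where the constant $C$ depends only on the assumptions (A), (B), (C), that is, on $n,m,\alpha,\beta$ and the implicit constants in them.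
   Context: Notation. $x=(x_1,x_2)$, $y=(y_1,y_2)$, $z=(z_1,z_2)$ denote points of $\mathbb{R}^{n+m}=\mathbb{R}^n\times\mathbb{R}^m$, and $t_1,t_2>0$. $\mathbb{R}^{d+1}_+=\mathbb{R}^d\times(0,\infty)$. $A\lesssim B$ means $A\le CB$ with a constant $C$ independent of all the variables, cubes, grids and sets appearing in the condition. Kernels are assumed measurable. For a cube $I$, $\ell(I)$ is its sidelength, $|I|$ its Lebesgue measure, and $\widehat I=I\times(0,\ell(I))$ is the associated Carleson box. $W_I=I\times(\ell(I)/2,\ell(I))$ is the associated Whitney region. Dyadic grids. A dyadic grid in $\mathbb{R}^d$ is a collection $\{I+\sum_{i:\,2^{-i}<\ell(I)}2^{-i}w^i:\ I\in\mathcal{D}^0\}$, where $\mathcal{D}^0$ is the standard dyadic grid of $\mathbb{R}^d$ and $w=(w^i)_{i\in\mathbb{Z}}$, $w^i\in\{0,1\}^d$. (A) Full standard estimates. Size estimate: $$|s_{t_1,t_2}(x,y)|\lesssim\frac{t_1^{\alpha}}{(t_1+|x_1-y_1|)^{n+\alpha}}\,\frac{t_2^{\beta}}{(t_2+|x_2-y_2|)^{m+\beta}}.$$ Hölder estimate: $$|s_{t_1,t_2}(x,y)-s_{t_1,t_2}(x,(z_1,y_2))-s_{t_1,t_2}(x,(y_1,z_2))+s_{t_1,t_2}(x,z)|\lesssim\frac{|y_1-z_1|^{\alpha}}{(t_1+|x_1-y_1|)^{n+\alpha}}\,\frac{|y_2-z_2|^{\beta}}{(t_2+|x_2-y_2|)^{m+\beta}}$$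 whenever $|y_1-z_1|<t_1/2$ and $|y_2-z_2|<t_2/2$. Mixed Hölder and size estimates: $$|s_{t_1,t_2}(x,y)-s_{t_1,t_2}(x,(y_1,z_2))|\lesssim\frac{t_1^{\alpha}}{(t_1+|x_1-y_1|)^{n+\alpha}}\,\frac{|y_2-z_2|^{\beta}}{(t_2+|x_2-y_2|)^{m+\beta}}\quad\text{whenever }|y_2-z_2|<t_2/2,$$ $$|s_{t_1,t_2}(x,y)-s_{t_1,t_2}(x,(z_1,y_2))|\lesssim\frac{|y_1-z_1|^{\alpha}}{(t_1+|x_1-y_1|)^{n+\alpha}}\,\frac{t_2^{\beta}}{(t_2+|x_2-y_2|)^{m+\beta}}\quad\text{whenever }|y_1-z_1|<t_1/2.$$ (B) Carleson $\times$ standard estimates. For all cubes $I\subset\mathbb{R}^n$ and $J\subset\mathbb{R}^m$ (and all values of the free variables): $$\Big(\iint_{\widehat I}\Big|\int_I s_{t_1,t_2}(x_1,x_2,y_1,y_2)\,dy_1\Big|^2\frac{dx_1dt_1}{t_1}\Big)^{1/2}\lesssim|I|^{1/2}\frac{t_2^{\beta}}{(t_2+|x_2-y_2|)^{m+\beta}},$$ $$\Big(\iint_{\widehat J}\Big|\int_J s_{t_1,t_2}(x_1,x_2,y_1,y_2)\,dy_2\Big|^2\frac{dx_2dt_2}{t_2}\Big)^{1/2}\lesssim\frac{t_1^{\alpha}}{(t_1+|x_1-y_1|)^{n+\alpha}}|J|^{1/2},$$ $$\Big(\iint_{\widehat I}\Big|\int_I[s_{t_1,t_2}(x_1,x_2,y_1,y_2)-s_{t_1,t_2}(x_1,x_2,y_1,z_2)]\,dy_1\Big|^2\frac{dx_1dt_1}{t_1}\Big)^{1/2}\lesssim|I|^{1/2}\frac{|y_2-z_2|^{\beta}}{(t_2+|x_2-y_2|)^{m+\beta}}\quad\text{whenever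 }|y_2-z_2|<t_2/2,$$ $$\Big(\iint_{\widehat J}\Big|\int_J[s_{t_1,t_2}(x_1,x_2,y_1,y_2)-s_{t_1,t_2}(x_1,x_2,z_1,y_2)]\,dy_2\Big|^2\frac{dx_2dt_2}{t_2}\Big)^{1/2}\lesssim\frac{|y_1-z_1|^{\alpha}}{(t_1+|x_1-y_1|)^{n+\alpha}}|J|^{1/2}\quad\text{whenever }|y_1-z_1|<t_1/2.$$ (C) Bi-parameter Carleson condition. For every $\mathcal{D}=\mathcal{D}_n\times\mathcal{D}_m$, with $\mathcal{D}_n$ a dyadic grid in $\mathbb{R}^n$ and $\mathcal{D}_m$ a dyadic grid in $\mathbb{R}^m$, the numbers $$C_{IJ}^{\mathcal{D}}=\iint_{W_J}\iint_{W_I}|\theta_{t_1,t_2}1(x_1,x_2)|^2\,\frac{dx_1dt_1}{t_1}\,\frac{dx_2dt_2}{t_2},\qquad I\in\mathcal{D}_n,\ J\in\mathcal{D}_m,$$ (where $1$ is the constant function one) satisfy $$\sum_{I\times J\in\mathcal{D},\ I\times J\subset\Omega}C_{IJ}^{\mathcal{D}}\lesssim|\Omega|$$ for all sets $\Omega\subset\mathbb{R}^{n+m}$ such that $|\Omega|<\infty$ and such that for every $x\in\Omega$ there exists $I\times J\in\mathcal{D}$ with $x\in I\times J\subset\Omega$. *)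

theory Defs
  imports "HOL-Analysis.Analysis"
begin

text \<open>
  \<open>\<real>\<^sup>n\<close> and \<open>\<real>\<^sup>m\<close> are \<^typ>\<open>real ^ 'n\<close> and \<^typ>\<open>real ^ 'm\<close>, with \<open>n = CARD('n)\<close> and \<open>m = CARD('m)\<close>;
  points of \<open>\<real>\<^sup>n\<^sup>+\<^sup>m\<close> are pairs. A family of kernels is written \<open>s t\<^sub>1 t\<^sub>2 x y\<close>; its values for
  \<open>t\<^sub>1 \<le> 0\<close> or \<open>t\<^sub>2 \<le> 0\<close> are never used. Nonnegative integrals take values in \<^typ>\<open>ennreal\<close>,
  so each of the upper bounds below includes the finiteness of the integral or sum it bounds.
\<close>

type_synonym ('n, 'm) kernel =
  "real \<Rightarrow> real \<Rightarrow> (real ^ 'n) \<times> (real ^ 'm) \<Rightarrow> (real ^ 'n) \<times> (real ^ 'm) \<Rightarrow> complex"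


subsection \<open>Cubes and dyadic grids\<close>

text \<open>Cubes are half-open, so that the cubes of one generation of a dyadic grid form a partition.\<close>

definition cube :: "real ^ 'd \<Rightarrow> real \<Rightarrow> (real ^ 'd) set" where
  "cube a l = {x. \<forall>i. a $ i \<le> x $ i \<and> x $ i < a $ i + l}"

definition is_cube :: "(real ^ 'd) set \<Rightarrow> bool" where
  "is_cube I \<longleftrightarrow> (\<exists>a l. 0 < l \<and> I = cube a l)"

definition sidelength :: "(real ^ 'd) set \<Rightarrow> real" where
  "sidelength I = (THE l. 0 < l \<and> (\<exists>a. I = cube a l))"

definition carleson_box :: "(real ^ 'd) set \<Rightarrow> ((real ^ 'd) \<times> real) set" where
  "carleson_box I = I \<times> {0<..<sidelength I}"

definition whitney_region :: "(real ^ 'd) set \<Rightarrow> ((real ^ 'd) \<times> real) set" where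
  "whitney_region I = I \<times> {sidelength I / 2<..<sidelength I}"

definition standard_dyadic_grid :: "(real ^ 'd) set set" where
  "standard_dyadic_grid =
     {cube (\<chi> i. 2 powi (-k) * real_of_int (j $ i)) (2 powi (-k)) | (k :: int) (j :: int ^ 'd). True}"

text \<open>The sum defining the shift has infinitely many terms and converges absolutely.\<close>

definition shifted_dyadic_grid :: "(int \<Rightarrow> real ^ 'd) \<Rightarrow> (real ^ 'd) set set" where
  "shifted_dyadic_grid w =
     {(\<lambda>x. x + (\<Sum>\<^sub>\<infinity>i\<in>{i. 2 powi (-i) < sidelength I}. (2 powi (-i)) *\<^sub>R w i)) ` I | I.
        I \<in> standard_dyadic_grid}"

definition dyadic_grid :: "(real ^ 'd) set set \<Rightarrow> bool" where
  "dyadic_grid \<D> \<longleftrightarrow> (\<exists>w. (\<forall>i j. w i $ j \<in> {0, 1}) \<and> \<D> = shifted_dyadic_grid w)"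

lemma sidelength_cube:
  fixes a :: "real ^ 'd"
  assumes "0 < l"
  shows "sidelength (cube a l) = l"
proof -
  have cube_eq: "l' = l" if "0 < l'" "cube a l = cube b l'" for b :: "real ^ 'd" and l'
  proof -
    have sub: "v \<le> u" if "0 < v" "cube c v \<subseteq> cube d u" for c d :: "real ^ 'd" and u v :: real
    proof (rule ccontr)
      assume "\<not> v \<le> u"
      define \<epsilon> where "\<epsilon> = max u 0"
      have \<epsilon>: "0 \<le> \<epsilon>" "\<epsilon> < v" "u \<le> \<epsilon>" using \<open>\<not> v \<le> u\<close> \<open>0 < v\<close> by (auto simp: \<epsilon>_def)
      have "c \<in> cube c v" "(\<chi> i. c $ i + \<epsilon>) \<in> cube c v"
        using \<epsilon> \<open>0 < v\<close> by (auto simp: cube_def)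
      then have "c \<in> cube d u" "(\<chi> i. c $ i + \<epsilon>) \<in> cube d u" using that by auto
      then have "d $ i \<le> c $ i" "c $ i + \<epsilon> < d $ i + u" for i by (auto simp: cube_def)
      from this[of undefined] show False using \<epsilon> by linarith
    qed
    show ?thesis using sub[of l' b a l] sub[of l a b l'] that assms by auto
  qed
  show ?thesis
    unfolding sidelength_def using assms cube_eq by (intro the_equality) auto
qed


subsection \<open>The three conditions\<close>

text \<open>The real number \<open>K\<close> is the implicit constant. All variables range over the whole space,
  and \<open>t\<^sub>1, t\<^sub>2 > 0\<close>. Note that \<^term>\<open>0 powr \<alpha> = (0 :: real)\<close>.\<close>

definition size_factor :: "real \<Rightarrow> real \<Rightarrow> real ^ 'd \<Rightarrow> real ^ 'd \<Rightarrow> real" where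
  "size_factor \<alpha> t x y = t powr \<alpha> / (t + norm (x - y)) powr (real CARD('d) + \<alpha>)"

definition holder_factor :: "real \<Rightarrow> real \<Rightarrow> real ^ 'd \<Rightarrow> real ^ 'd \<Rightarrow> real ^ 'd \<Rightarrow> real" where
  "holder_factor \<alpha> t x y z =
     norm (y - z) powr \<alpha> / (t + norm (x - y)) powr (real CARD('d) + \<alpha>)"

definition full_standard_estimates :: "real \<Rightarrow> real \<Rightarrow> real \<Rightarrow> ('n::finite, 'm::finite) kernel \<Rightarrow> bool" where
  "full_standard_estimates \<alpha> \<beta> K s \<longleftrightarrow>
     (\<forall>t1>0. \<forall>t2>0. \<forall>x1 x2 y1 y2.
        norm (s t1 t2 (x1, x2) (y1, y2)) \<le> K * size_factor \<alpha> t1 x1 y1 * size_factor \<beta> t2 x2 y2) \<and>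
     (\<forall>t1>0. \<forall>t2>0. \<forall>x1 x2 y1 y2 z1 z2. norm (y1 - z1) < t1 / 2 \<longrightarrow> norm (y2 - z2) < t2 / 2 \<longrightarrow>
        norm (s t1 t2 (x1, x2) (y1, y2) - s t1 t2 (x1, x2) (z1, y2)
              - s t1 t2 (x1, x2) (y1, z2) + s t1 t2 (x1, x2) (z1, z2))
          \<le> K * holder_factor \<alpha> t1 x1 y1 z1 * holder_factor \<beta> t2 x2 y2 z2) \<and>
     (\<forall>t1>0. \<forall>t2>0. \<forall>x1 x2 y1 y2 z2. norm (y2 - z2) < t2 / 2 \<longrightarrow>
        norm (s t1 t2 (x1, x2) (y1, y2) - s t1 t2 (x1, x2) (y1, z2))
          \<le> K * size_factor \<alpha> t1 x1 y1 * holder_factor \<beta> t2 x2 y2 z2) \<and>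
     (\<forall>t1>0. \<forall>t2>0. \<forall>x1 x2 y1 y2 z1. norm (y1 - z1) < t1 / 2 \<longrightarrow>
        norm (s t1 t2 (x1, x2) (y1, y2) - s t1 t2 (x1, x2) (z1, y2))
          \<le> K * holder_factor \<alpha> t1 x1 y1 z1 * size_factor \<beta> t2 x2 y2)"

text \<open>The inequalities \<open>(\<integral>\<integral> \<dots>)\<^bsup>1/2\<^esup> \<le> B\<close> with \<open>B \<ge> 0\<close> are written as \<open>\<integral>\<integral> \<dots> \<le> B\<^sup>2\<close>,
  since \<^typ>\<open>ennreal\<close> has no square root.\<close>

definition carleson_standard_estimates :: "real \<Rightarrow> real \<Rightarrow> real \<Rightarrow> ('n::finite, 'm::finite) kernel \<Rightarrow> bool" where
  "carleson_standard_estimates \<alpha> \<beta> K s \<longleftrightarrow>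
     (\<forall>I. is_cube I \<longrightarrow> (\<forall>t2>0. \<forall>x2 y2.
        (\<integral>\<^sup>+(x1, t1)\<in>carleson_box I.
            ennreal ((norm (LINT y1:I|lebesgue. s t1 t2 (x1, x2) (y1, y2)))\<^sup>2 / t1) \<partial>lebesgue)
          \<le> ennreal ((K * sqrt (measure lebesgue I) * size_factor \<beta> t2 x2 y2)\<^sup>2))) \<and>
     (\<forall>J. is_cube J \<longrightarrow> (\<forall>t1>0. \<forall>x1 y1.
        (\<integral>\<^sup>+(x2, t2)\<in>carleson_box J.
            ennreal ((norm (LINT y2:J|lebesgue. s t1 t2 (x1, x2) (y1, y2)))\<^sup>2 / t2) \<partial>lebesgue)
          \<le> ennreal ((K * size_factor \<alpha> t1 x1 y1 * sqrt (measure lebesgue J))\<^sup>2))) \<and>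
     (\<forall>I. is_cube I \<longrightarrow> (\<forall>t2>0. \<forall>x2 y2 z2. norm (y2 - z2) < t2 / 2 \<longrightarrow>
        (\<integral>\<^sup>+(x1, t1)\<in>carleson_box I.
            ennreal ((norm (LINT y1:I|lebesgue.
              s t1 t2 (x1, x2) (y1, y2) - s t1 t2 (x1, x2) (y1, z2)))\<^sup>2 / t1) \<partial>lebesgue)
          \<le> ennreal ((K * sqrt (measure lebesgue I) * holder_factor \<beta> t2 x2 y2 z2)\<^sup>2))) \<and>
     (\<forall>J. is_cube J \<longrightarrow> (\<forall>t1>0. \<forall>x1 y1 z1. norm (y1 - z1) < t1 / 2 \<longrightarrow>
        (\<integral>\<^sup>+(x2, t2)\<in>carleson_box J.
            ennreal ((norm (LINT y2:J|lebesgue.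
              s t1 t2 (x1, x2) (y1, y2) - s t1 t2 (x1, x2) (z1, y2)))\<^sup>2 / t2) \<partial>lebesgue)
          \<le> ennreal ((K * holder_factor \<alpha> t1 x1 y1 z1 * sqrt (measure lebesgue J))\<^sup>2)))"

text \<open>Under the size estimate the integral defining \<open>\<theta> f\<close> converges absolutely for
  \<open>f \<in> L\<^sup>2\<close> and for \<open>f = 1\<close>.\<close>

definition theta :: "('n::finite, 'm::finite) kernel \<Rightarrow> real \<Rightarrow> real
    \<Rightarrow> ((real ^ 'n) \<times> (real ^ 'm) \<Rightarrow> complex) \<Rightarrow> (real ^ 'n) \<times> (real ^ 'm) \<Rightarrow> complex" where
  "theta s t1 t2 f x = (LINT y|lebesgue. s t1 t2 x y * f y)"

definition carleson_number :: "('n::finite, 'm::finite) kernel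
    \<Rightarrow> (real ^ 'n) set \<Rightarrow> (real ^ 'm) set \<Rightarrow> ennreal" where
  "carleson_number s I J =
     (\<integral>\<^sup>+(x2, t2)\<in>whitney_region J. (\<integral>\<^sup>+(x1, t1)\<in>whitney_region I.
        ennreal ((norm (theta s t1 t2 (\<lambda>_. 1) (x1, x2)))\<^sup>2 / t1 / t2) \<partial>lebesgue) \<partial>lebesgue)"

text \<open>The sets \<open>\<Omega>\<close> below are countable unions of dyadic rectangles, hence measurable.\<close>

definition biparameter_carleson_condition :: "real \<Rightarrow> ('n::finite, 'm::finite) kernel \<Rightarrow> bool" where
  "biparameter_carleson_condition K s \<longleftrightarrow>
     (\<forall>\<D>n \<D>m \<Omega>. dyadic_grid \<D>n \<longrightarrow> dyadic_grid \<D>m \<longrightarrow>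
        emeasure lebesgue \<Omega> < \<infinity> \<longrightarrow>
        (\<forall>x\<in>\<Omega>. \<exists>I\<in>\<D>n. \<exists>J\<in>\<D>m. x \<in> I \<times> J \<and> I \<times> J \<subseteq> \<Omega>) \<longrightarrow>
        (\<Sum>\<^sub>\<infinity>(I, J)\<in>{(I, J). I \<in> \<D>n \<and> J \<in> \<D>m \<and> I \<times> J \<subseteq> \<Omega>}. carleson_number s I J)
          \<le> ennreal K * emeasure lebesgue \<Omega>)"

text \<open>Joint measurability in \<open>(t\<^sub>1, t\<^sub>2, x, y)\<close>, for \<open>t\<^sub>1, t\<^sub>2 > 0\<close>.\<close>

definition measurable_kernel :: "('n::finite, 'm::finite) kernel \<Rightarrow> bool" where
  "measurable_kernel s \<longleftrightarrow>
     (\<lambda>(t1, t2, x, y). s t1 t2 x y)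
       \<in> borel_measurable (lebesgue_on ({0<..} \<times> {0<..} \<times> UNIV \<times> UNIV))"


subsection \<open>Square-integrable functions\<close>

definition square_integrable :: "('a::euclidean_space \<Rightarrow> complex) \<Rightarrow> bool" where
  "square_integrable f \<longleftrightarrow>
     f \<in> borel_measurable lebesgue \<and> integrable lebesgue (\<lambda>x. (norm (f x))\<^sup>2)"

definition L2_norm :: "('a::euclidean_space \<Rightarrow> complex) \<Rightarrow> real" where
  "L2_norm f = sqrt (LINT x|lebesgue. (norm (f x))\<^sup>2)"

end

theory Submission
  imports Defs
begin

text \<open>
  Replacing \<open>f\<close> by its conditional expectations on the dyadic cubes of size about \<open>t\<close> splits \<open>\<theta>\<^sub>t f\<close> into a part
  acting on \<open>f\<close> minus its average, where the Hoelder estimate and orthogonality of martingale differences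
  give decay, and a part in which the kernel only enters through \<open>\<theta>\<^sub>t 1\<close>, which is
  controlled by a Carleson embedding. In one parameter this proves a \<open>T1\<close> theorem whose kernel may take
  values in operators on an auxiliary \<open>L\<^sup>2\<close> space. In two parameters one decomposes successively in each variable:
  freezing the second pair of points, the size and Hoelder bounds of the one-parameter theorem become the
  kernel bounds of an operator-valued kernel in the second parameter. What remains is the part where
  both averages have been taken; it is controlled by the level sets of the dyadic strong maximal function,
  on which the bi-parameter Carleson condition is applied.
\<close>

subsection \<open>Dyadic cubes and averages\<close>

text \<open>Three obstacles shape the estimates. For a function D constant on cubes larger than t,
  the difference of D and D(x) is not small against the kernel when x lies near the boundary of its
  cube. Decay appears only after averaging over the cube, which suffices because D is constant
  there. The bounds in (B) integrate the kernel over the cube itself, whereas the embedding needs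
  its integral over the whole space; the tail is removed by the same averaging. The three parts of
  the operator are not alike: f minus its second average calls for the full one-parameter theorem in
  the first variable; once the second average is taken, only the integral of the kernel in y2 is
  seen, and the first-parameter kernel acts through Carleson embeddings in the second variable. A
  Lebesgue measurable kernel may have non-measurable sections, so it is replaced by a Borel version
  cut off by the size bound. Size then holds everywhere and makes the integrals converge, while
  differences and box integrals are controlled almost everywhere; hence the \<open>AE\<close> in the
  locales. Until the end f is a step function, so that martingale sums are finite.\<close>

lemma borel_measurable_fst_pair [measurable (raw)]:
  fixes f :: "'c \<Rightarrow> 'a::second_countable_topology \<times> 'b::second_countable_topology"
  shows "f \<in> M \<rightarrow>\<^sub>M borel \<Longrightarrow> (\<lambda>x. fst (f x)) \<in> M \<rightarrow>\<^sub>M borel"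
  by (rule measurable_compose[where N=borel])
     (auto intro!: borel_measurable_continuous_onI continuous_intros)

lemma borel_measurable_snd_pair [measurable (raw)]:
  fixes f :: "'c \<Rightarrow> 'a::second_countable_topology \<times> 'b::second_countable_topology"
  shows "f \<in> M \<rightarrow>\<^sub>M borel \<Longrightarrow> (\<lambda>x. snd (f x)) \<in> M \<rightarrow>\<^sub>M borel"
  by (rule measurable_compose[where N=borel])
     (auto intro!: borel_measurable_continuous_onI continuous_intros)

lemma borel_measurable_nth_vec [measurable (raw)]:
  "f \<in> M \<rightarrow>\<^sub>M borel \<Longrightarrow> (\<lambda>x. (f x :: real ^ 'd) $ i) \<in> M \<rightarrow>\<^sub>M borel"
  by (rule measurable_compose[OF _ borel_measurable_nth])

text \<open>Dyadic cubes of side \<open>2 powi (-k)\<close> are handled as classes of an equivalence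
  relation rather than as sets. Larger \<open>k\<close> means smaller cubes; negative
  \<open>k\<close> is allowed.\<close>

definition same_cube :: "int \<Rightarrow> real ^ 'd \<Rightarrow> real ^ 'd \<Rightarrow> bool" where
  "same_cube k x y \<longleftrightarrow> (\<forall>i. \<lfloor>2 powi k * x $ i\<rfloor> = \<lfloor>2 powi k * y $ i\<rfloor>)"

lemma same_cube_refl [simp]: "same_cube k x x"
  and same_cube_sym: "same_cube k x y \<Longrightarrow> same_cube k y x"
  and same_cube_trans: "same_cube k x y \<Longrightarrow> same_cube k y z \<Longrightarrow> same_cube k x z"
  by (auto simp: same_cube_def)

lemma same_cube_commute: "same_cube k x y \<longleftrightarrow> same_cube k y x"
  using same_cube_sym by blast

text \<open>The index of the coarse cube is the integer quotient of the fine index by a power of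
  two.\<close>

lemma same_cube_mono:
  assumes "k \<le> l" "same_cube l x y" shows "same_cube k x y"
proof -
  define n where "n = nat (l - k)"
  have l: "l = k + int n" using assms by (simp add: n_def)
  have "\<lfloor>2 powi k * x $ i\<rfloor> = \<lfloor>2 powi l * x $ i\<rfloor> div 2 ^ n" for x :: "real ^ 'd" and i
  proof -
    have "2 powi k * x $ i = (2 powi l * x $ i) / real_of_int (2 ^ n)"
      by (simp add: l power_int_add)
    then show ?thesis by (simp add: floor_divide_real_eq_div del: of_int_power)
  qed
  from this[of x] this[of y] show ?thesis using assms(2) unfolding same_cube_def by simp
qed

lemma pred_same_cube [measurable (raw)]:
  assumes [measurable]: "f \<in> M \<rightarrow>\<^sub>M borel" "g \<in> M \<rightarrow>\<^sub>M borel"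
  shows "Measurable.pred M (\<lambda>x. same_cube k (f x) (g x :: real ^ 'd))"
proof -
  \<comment> \<open>Integer parts are compared as reals, where equality of measurable functions is a
    measurable condition.\<close>
  have *: "Measurable.pred M (\<lambda>x. real_of_int \<lfloor>2 powi k * f x $ i\<rfloor> = real_of_int \<lfloor>2 powi k * g x $ i\<rfloor>)" for i
    unfolding pred_def
    by (intro borel_measurable_eq measurable_compose[OF _ borel_measurable_real_floor]) measurable
  have "Measurable.pred M (\<lambda>x. \<forall>i\<in>(UNIV::'d set). real_of_int \<lfloor>2 powi k * f x $ i\<rfloor> = real_of_int \<lfloor>2 powi k * g x $ i\<rfloor>)"
    by (intro pred_intros_finite *) auto
  then show ?thesis by (simp add: same_cube_def)
qed

section \<open>Half-open boxes and dyadic cubes as sets\<close>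

definition hbox :: "real ^ 'd \<Rightarrow> real ^ 'd \<Rightarrow> (real ^ 'd) set" where
  "hbox a b = {x. \<forall>i. a $ i \<le> x $ i \<and> x $ i < b $ i}"

lemma hbox_measurable [measurable]: "hbox a b \<in> sets borel"
proof -
  have "{x\<in>space borel. \<forall>i\<in>UNIV. a $ i \<le> x $ i \<and> x $ i < b $ i} \<in> sets borel"
    by measurable
  then show ?thesis by (simp add: hbox_def)
qed

text \<open>A half-open box lies between the open and the closed box, which have the same
  measure.\<close>

lemma emeasure_hbox:
  fixes a b :: "real ^ 'd"
  assumes "\<And>i. a $ i \<le> b $ i"
  shows "emeasure lborel (hbox a b) = ennreal (\<Prod>i\<in>UNIV. b $ i - a $ i)"
proof -
  have B: "(\<Prod>j\<in>Basis. (b - a) \<bullet> j) = (\<Prod>i\<in>UNIV. b $ i - a $ i)"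
  proof -
    have "(Basis :: (real ^ 'd) set) = range (\<lambda>i. axis i 1)" by (auto simp: Basis_vec_def)
    moreover have "inj (\<lambda>i::'d. axis i (1::real))" by (auto simp: inj_on_def axis_eq_axis)
    ultimately have "(\<Prod>j\<in>Basis. (b - a) \<bullet> j) = (\<Prod>i\<in>UNIV. (b - a) \<bullet> axis i 1)"
      using prod.reindex[of "\<lambda>i. axis i 1" UNIV "\<lambda>j. (b - a) \<bullet> j"] by (simp add: o_def)
    then show ?thesis by (simp add: inner_axis)
  qed
  have le: "\<forall>j\<in>Basis. a \<bullet> j \<le> b \<bullet> j"
    using assms by (auto simp: Basis_vec_def cart_eq_inner_axis[symmetric])
  have "box a b \<subseteq> hbox a b" "hbox a b \<subseteq> cbox a b"
    by (auto simp: hbox_def mem_box_cart less_imp_le)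
  then have "emeasure lborel (box a b) \<le> emeasure lborel (hbox a b)"
    "emeasure lborel (hbox a b) \<le> emeasure lborel (cbox a b)"
    by (auto intro!: emeasure_mono)
  then show ?thesis using le B by (simp add: emeasure_lborel_box_eq emeasure_lborel_cbox_eq)
qed

lemma cube_eq_hbox: "cube a l = hbox a (\<chi> i. a $ i + l)"
  by (auto simp: cube_def hbox_def)

lemma emeasure_cube: "0 \<le> l \<Longrightarrow> emeasure lborel (cube a l :: (real ^ 'd) set) = ennreal (l ^ CARD('d))"
  by (subst cube_eq_hbox, subst emeasure_hbox) auto

lemma cube_measurable [measurable]: "cube a l \<in> sets borel"
  by (simp add: cube_eq_hbox)

definition corner :: "int \<Rightarrow> real ^ 'd \<Rightarrow> real ^ 'd" where
  "corner k x = (\<chi> i. 2 powi (-k) * real_of_int \<lfloor>2 powi k * x $ i\<rfloor>)"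

abbreviation dcube :: "int \<Rightarrow> real ^ 'd \<Rightarrow> (real ^ 'd) set" where
  "dcube k x \<equiv> cube (corner k x) (2 powi (-k))"

text \<open>Links the two descriptions of dyadic cubes: conditions (B) and (C) speak of
  \<open>cube\<close>, while averages and step functions use \<open>same_cube\<close>.\<close>

lemma mem_dcube: "y \<in> dcube k x \<longleftrightarrow> same_cube k x y"
proof -
  have *: "2 powi (-k) * real_of_int n \<le> v \<and> v < 2 powi (-k) * real_of_int n + 2 powi (-k) \<longleftrightarrow> n = \<lfloor>2 powi k * v\<rfloor>"
    for n and v :: real
  proof -
    have p: "(0::real) < 2 powi k" "(2::real) powi (-k) = 1 / 2 powi k"
      by (auto simp: power_int_minus field_simps)
    have "n = \<lfloor>2 powi k * v\<rfloor> \<longleftrightarrow> real_of_int n \<le> 2 powi k * v \<and> 2 powi k * v < real_of_int n + 1"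
      using floor_unique[of n "2 powi k * v"] by auto
    then show ?thesis unfolding p(2) using p(1) by (simp add: field_simps)
  qed
  show ?thesis by (simp add: cube_def corner_def same_cube_def *)
qed

lemma dcube_eq: "dcube k x = {y. same_cube k x y}"
  by (auto simp: mem_dcube)

text \<open>The Euclidean norm is bounded by the l1 norm, hence the factor \<open>CARD('d)\<close>
  rather than its square root.\<close>

lemma same_cube_dist:
  fixes x y :: "real ^ 'd"
  assumes "same_cube k x y" shows "norm (x - y) \<le> real CARD('d) * 2 powi (-k)"
proof -
  have "\<bar>(x - y) $ i\<bar> \<le> 2 powi (-k)" for i
  proof -
    have "x \<in> dcube k x" "y \<in> dcube k x" using assms by (auto simp: mem_dcube)
    then show ?thesis by (auto simp: cube_def abs_le_iff dest!: spec[of _ i])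
  qed
  then have "(\<Sum>i\<in>UNIV. \<bar>(x - y) $ i\<bar>) \<le> (\<Sum>i\<in>(UNIV::'d set). 2 powi (-k))"
    by (intro sum_mono) auto
  then show ?thesis using norm_le_l1_cart[of "x - y"] by simp
qed

lemma emeasure_same_cube:
  "emeasure lborel {y. same_cube k (x :: real ^ 'd) y} = ennreal (2 powi (- (k * int CARD('d))))"
proof -
  have "(2 powi (-k)) ^ CARD('d) = (2::real) powi (- (k * int CARD('d)))"
    by (simp add: power_int_minus power_inverse power_int_mult)
  then show ?thesis by (simp flip: dcube_eq add: emeasure_cube)
qed

text \<open>The kernel of the averaging operator, \<open>1\<^sub>Q(y) / |Q|\<close> for the cube \<open>Q\<close> containing \<open>x\<close>.\<close>

definition avker :: "int \<Rightarrow> real ^ 'd \<Rightarrow> real ^ 'd \<Rightarrow> real" where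
  "avker k x y = (if same_cube k x y then 2 powi (k * int CARD('d)) else 0)"

lemma avker_nonneg [simp]: "0 \<le> avker k x y"
  and avker_commute: "avker k x y = avker k y x"
  by (auto simp: avker_def same_cube_commute)

lemma avker_measurable [measurable (raw)]:
  assumes [measurable]: "f \<in> M \<rightarrow>\<^sub>M borel" "g \<in> M \<rightarrow>\<^sub>M borel"
  shows "(\<lambda>x. avker k (f x) (g x :: real ^ 'd)) \<in> borel_measurable M"
  unfolding avker_def by measurable

lemma nn_integral_avker: "(\<integral>\<^sup>+y. ennreal (avker k (x :: real ^ 'd) y) \<partial>lborel) = 1"
proof -
  have "(\<integral>\<^sup>+y. ennreal (avker k x y) \<partial>lborel)
      = (\<integral>\<^sup>+y. ennreal (2 powi (k * int CARD('d))) * indicator {y. same_cube k x y} y \<partial>lborel)"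
    by (intro nn_integral_cong) (auto simp: avker_def indicator_def)
  also have "\<dots> = ennreal (2 powi (k * int CARD('d))) * ennreal (2 powi (- (k * int CARD('d))))"
    by (subst nn_integral_cmult) (auto simp: emeasure_same_cube)
  also have "\<dots> = 1" by (simp add: power_int_minus flip: ennreal_mult)
  finally show ?thesis .
qed

lemma integrable_avker: "integrable lborel (avker k (x :: real ^ 'd))"
  by (rule integrableI_bounded) (auto simp: nn_integral_avker)

lemma integral_avker: "(LINT y|lborel. avker k (x :: real ^ 'd) y) = 1"
  by (subst integral_eq_nn_integral) (auto simp: nn_integral_avker)

text \<open>Two points of one small cube lie in the same large cube, so the coarse kernel at x
  cannot tell y from z.\<close>

lemma avker_tower:
  assumes "k \<le> l" shows "avker k x y * avker l y z = avker k x z * avker l y z"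
proof -
  have "same_cube l y z \<Longrightarrow> same_cube k x y \<longleftrightarrow> same_cube k x z"
    using same_cube_mono[OF assms, of y z] by (meson same_cube_sym same_cube_trans)
  then show ?thesis by (auto simp: avker_def)
qed

text \<open>One constant serves both as bound and as radius of the support. On this class all
  integrals converge absolutely, Fubini applies, and averaging does not lead out of it.\<close>

definition bdd_supp :: "('a::euclidean_space \<Rightarrow> 'b::euclidean_space) \<Rightarrow> bool" where
  "bdd_supp f \<longleftrightarrow> f \<in> borel_measurable borel \<and> (\<exists>B. \<forall>x. norm (f x) \<le> B \<and> (B < norm x \<longrightarrow> f x = 0))"

lemma bdd_suppI:
  assumes "f \<in> borel_measurable borel" "\<And>x. norm (f x) \<le> B" "\<And>x. R < norm x \<Longrightarrow> f x = 0"
  shows "bdd_supp f"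
  unfolding bdd_supp_def using assms
  by (auto intro!: exI[of _ "max B R"] simp: max.strict_coboundedI2 intro: max.coboundedI1)

lemma bdd_supp_measurable [measurable_dest]: "bdd_supp f \<Longrightarrow> f \<in> borel_measurable borel"
  by (simp add: bdd_supp_def)

lemma bdd_supp_bound: 
  assumes "bdd_supp f"
  obtains B where "0 \<le> B" "\<And>x. norm (f x) \<le> B" "\<And>x. B < norm x \<Longrightarrow> f x = 0"
  using assms unfolding bdd_supp_def by (metis norm_ge_zero order_trans)

lemma bdd_supp_integrable: 
  assumes "bdd_supp f" shows "integrable lborel f"
proof -
  obtain B where B: "0 \<le> B" "\<And>x. norm (f x) \<le> B" "\<And>x. B < norm x \<Longrightarrow> f x = 0"
    using bdd_supp_bound[OF assms] by metis
  note [measurable] = bdd_supp_measurable[OF assms]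
  have "integrable lborel (\<lambda>x. B * indicator (cball 0 B) x)"
    by (intro integrable_mult_right integrable_real_indicator)
       (use emeasure_bounded_finite[OF bounded_cball] in auto)
  then show ?thesis
    by (rule Bochner_Integration.integrable_bound)
       (use B in \<open>auto simp: indicator_def not_le intro!: AE_I2\<close>)
qed

lemma bdd_supp_mult_bounded:
  assumes f: "bdd_supp f" and g: "g \<in> borel_measurable borel" "\<And>x. norm (g x) \<le> C * norm (f x)"
  shows "bdd_supp g"
proof -
  obtain B where B: "0 \<le> B" "\<And>x. norm (f x) \<le> B" "\<And>x. B < norm x \<Longrightarrow> f x = 0"
    using bdd_supp_bound[OF f] by metis
  show ?thesis
  proof (rule bdd_suppI[where B = "\<bar>C\<bar> * B" and R = B])
    show "norm (g x) \<le> \<bar>C\<bar> * B" for x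
      using g(2)[of x] B(1) B(2)[of x] by (smt (verit) mult_mono norm_ge_zero mult_right_mono)
    show "B < norm x \<Longrightarrow> g x = 0" for x using B(3)[of x] g(2)[of x] by simp
  qed fact
qed

lemma bdd_supp_add:
  assumes "bdd_supp f" "bdd_supp g" shows "bdd_supp (\<lambda>x. f x + g x)"
proof -
  obtain B where B: "0 \<le> B" "\<And>x. norm (f x) \<le> B" "\<And>x. B < norm x \<Longrightarrow> f x = 0"
    using bdd_supp_bound[OF assms(1)] by metis
  obtain C where C: "0 \<le> C" "\<And>x. norm (g x) \<le> C" "\<And>x. C < norm x \<Longrightarrow> g x = 0"
    using bdd_supp_bound[OF assms(2)] by metis
  show ?thesis
    by (rule bdd_suppI[where B="B + C" and R="max B C"])
       (use B C assms[THEN bdd_supp_measurable] in \<open>simp_all add: norm_triangle_mono\<close>)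
qed

lemma bdd_supp_minus: "bdd_supp f \<Longrightarrow> bdd_supp (\<lambda>x. - f x)"
  by (rule bdd_supp_mult_bounded[where C=1]) (auto simp: bdd_supp_measurable)

lemma bdd_supp_diff: "bdd_supp f \<Longrightarrow> bdd_supp g \<Longrightarrow> bdd_supp (\<lambda>x. f x - g x)"
  using bdd_supp_add[OF _ bdd_supp_minus] by fastforce

lemma bdd_supp_mult:
  fixes f :: "'a::euclidean_space \<Rightarrow> 'b::{euclidean_space, real_normed_algebra}"
  assumes "bdd_supp f" "g \<in> borel_measurable borel" "\<And>x. norm (g x) \<le> C"
  shows "bdd_supp (\<lambda>x. g x * f x)"
  using assms
  by (intro bdd_supp_mult_bounded[OF assms(1), where C=C] borel_measurable_times
        order_trans[OF norm_mult_ineq] mult_right_mono)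
     (auto intro: bdd_supp_measurable)

lemma bdd_supp_section:
  assumes "bdd_supp (f :: 'a::euclidean_space \<times> 'b::euclidean_space \<Rightarrow> 'c::euclidean_space)"
  shows "bdd_supp (\<lambda>x. f (x, y))" "bdd_supp (\<lambda>y. f (x, y))"
proof -
  note [measurable] = bdd_supp_measurable[OF assms]
  obtain B where B: "0 \<le> B" "\<And>x. norm (f x) \<le> B" "\<And>x. B < norm x \<Longrightarrow> f x = 0"
    using bdd_supp_bound[OF assms] by metis
  show "bdd_supp (\<lambda>x. f (x, y))"
    by (rule bdd_suppI[where B=B and R=B])
       (auto simp: B intro!: B(3) order.strict_trans2[OF _ norm_fst_le])
  show "bdd_supp (\<lambda>y. f (x, y))"
    by (rule bdd_suppI[where B=B and R=B])
       (auto simp: B intro!: B(3) order.strict_trans2[OF _ norm_snd_le])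
qed

section \<open>Conditional expectations with respect to dyadic cubes\<close>

definition avg :: "int \<Rightarrow> (real ^ 'd \<Rightarrow> 'b::euclidean_space) \<Rightarrow> real ^ 'd \<Rightarrow> 'b" where
  "avg k f x = (LINT y|lborel. avker k x y *\<^sub>R f y)"

lemma avg_measurable [measurable (raw)]:
  assumes [measurable]: "(\<lambda>(x, y). f x y) \<in> borel_measurable (M \<Otimes>\<^sub>M lborel)" "g \<in> M \<rightarrow>\<^sub>M borel"
  shows "(\<lambda>x. avg k (f x) (g x)) \<in> borel_measurable M"
  unfolding avg_def by measurable

lemma avg_same_cube: "same_cube k x x' \<Longrightarrow> avg k f x = avg k f x'"
proof -
  assume "same_cube k x x'"
  then have "avker k x = avker k x'"
    unfolding avker_def fun_eq_iff by (metis same_cube_trans same_cube_sym)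
  then show ?thesis by (simp add: avg_def)
qed

lemma avg_const:
  assumes "\<And>y. same_cube k x y \<Longrightarrow> f y = c" shows "avg k f x = c"
proof -
  have "avg k f x = (LINT y|lborel. avker k x y *\<^sub>R c)"
    unfolding avg_def by (intro Bochner_Integration.integral_cong) (auto simp: avker_def assms)
  also have "\<dots> = c" by (simp add: integrable_avker integral_avker)
  finally show ?thesis .
qed

lemma integrable_avker_mult:
  assumes [measurable]: "f \<in> borel_measurable borel" and B: "\<And>y. norm (f y) \<le> B"
  shows "integrable lborel (\<lambda>y. avker k x y *\<^sub>R (f y :: 'b::euclidean_space))"
proof (rule Bochner_Integration.integrable_bound[where f="\<lambda>y. avker k x y *\<^sub>R B"])
  show "integrable lborel (\<lambda>y. avker k x y *\<^sub>R B)"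
    by (simp add: integrable_avker)
  show "AE y in lborel. norm (avker k x y *\<^sub>R f y) \<le> norm (avker k x y *\<^sub>R B)"
  proof (rule AE_I2)
    fix y
    have "avker k x y * norm (f y) \<le> avker k x y * \<bar>B\<bar>"
      by (intro mult_left_mono order_trans[OF B abs_ge_self]) simp
    then show "norm (avker k x y *\<^sub>R f y) \<le> norm (avker k x y *\<^sub>R B)" by (simp add: abs_mult)
  qed
qed measurable

lemma integrable_avker_bdd_supp:
  assumes "bdd_supp f"
  shows "integrable lborel (\<lambda>y. avker k x y *\<^sub>R (f y :: 'b::euclidean_space))"
proof -
  obtain B where "\<And>y. norm (f y) \<le> B" using bdd_supp_bound[OF assms] by metis
  then show ?thesis by (rule integrable_avker_mult[OF bdd_supp_measurable[OF assms]])
qed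

lemma avg_bound:
  assumes "\<And>y. norm (f y) \<le> B" "0 \<le> B"
  shows "norm (avg k f x) \<le> B"
proof (cases "integrable lborel (\<lambda>y. avker k x y *\<^sub>R f y)")
  case True
  have "norm (avg k f x) \<le> (LINT y|lborel. avker k x y *\<^sub>R B)"
    unfolding avg_def
    by (rule Bochner_Integration.integral_norm_bound_integral[OF True])
       (use assms in \<open>auto simp: integrable_avker intro!: mult_left_mono\<close>)
  also have "\<dots> = B" by (simp add: integrable_avker integral_avker)
  finally show ?thesis .
next
  \<comment> \<open>The Bochner integral of a non-integrable function is 0 by convention.\<close>
  case False
  then show ?thesis using assms(2) by (simp add: avg_def not_integrable_integral_eq)
qed

lemma avg_add:
  assumes "bdd_supp f" "bdd_supp g"
  shows "avg k (\<lambda>y. f y + g y) x = avg k f x + avg k g x"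
proof -
  note assms[THEN integrable_avker_bdd_supp, of k x]
  then show ?thesis by (simp add: avg_def scaleR_add_right)
qed

lemma avg_minus: "avg k (\<lambda>y. - f y) x = - avg k f x"
  by (simp add: avg_def)

lemma avg_diff:
  assumes "bdd_supp f" "bdd_supp g"
  shows "avg k (\<lambda>y. f y - g y) x = avg k f x - avg k g x"
  using avg_add[OF assms(1) bdd_supp_minus[OF assms(2)]] by (simp add: avg_minus)

text \<open>A factor constant on the cube of x can be taken out, as for conditional expectations;
  together with \<open>avg_avg\<close> this underlies the orthogonality arguments.\<close>

lemma avg_mult:
  fixes f g :: "real ^ 'd \<Rightarrow> 'b::{euclidean_space, real_normed_field}"
  assumes "\<And>y. same_cube k x y \<Longrightarrow> g y = g x"
  shows "avg k (\<lambda>y. g y * f y) x = g x * avg k f x"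
proof -
  have "avg k (\<lambda>y. g y * f y) x = (LINT y|lborel. g x * (avker k x y *\<^sub>R f y))"
    unfolding avg_def
  proof (intro Bochner_Integration.integral_cong refl)
    show "avker k x y *\<^sub>R (g y * f y) = g x * (avker k x y *\<^sub>R f y)" for y
      by (cases "same_cube k x y") (simp_all add: avker_def assms[of y])
  qed
  then show ?thesis unfolding avg_def by (simp only: Bochner_Integration.integral_mult_right_zero)
qed

lemma avg_eq_0:
  fixes x :: "real ^ 'd"
  assumes "\<And>y. R < norm y \<Longrightarrow> f y = 0" "R + real CARD('d) * 2 powi (-k) < norm x"
  shows "avg k f x = 0"
proof (rule avg_const)
  fix y assume "same_cube k x y"
  then have "norm x \<le> norm y + real CARD('d) * 2 powi (-k)"
    using same_cube_dist[of k x y] norm_triangle_sub[of x y] by linarith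
  then show "f y = 0" using assms by simp
qed

lemma bdd_supp_avg_param:
  fixes f :: "(real ^ 'd) \<times> 'z::euclidean_space \<Rightarrow> 'b::euclidean_space"
  assumes f: "bdd_supp f"
  shows "bdd_supp (\<lambda>p. avg k (\<lambda>y. f (y, snd p)) (fst p))"
proof -
  note [measurable] = bdd_supp_measurable[OF f]
  obtain B where B: "0 \<le> B" "\<And>x. norm (f x) \<le> B" "\<And>x. B < norm x \<Longrightarrow> f x = 0"
    using bdd_supp_bound[OF f] by metis
  \<comment> \<open>If the parameter has norm at most \<open>B\<close>, then a point of norm above
    \<open>R\<close> has a first component of norm above \<open>B\<close> plus the diameter bound of
    a cube, so its cube misses the support.\<close>
  define R where "R = 2 * B + real CARD('d) * 2 powi (-k)"
  show ?thesis
  proof (rule bdd_suppI[where B=B and R=R])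
    show "(\<lambda>p. avg k (\<lambda>y. f (y, snd p)) (fst p)) \<in> borel_measurable borel" by measurable
    show "norm (avg k (\<lambda>y. f (y, snd p)) (fst p)) \<le> B" for p
      by (intro avg_bound B)
    show "avg k (\<lambda>y. f (y, snd p)) (fst p) = 0" if "R < norm p" for p
    proof (cases "B < norm (snd p)")
      case True
      then have "f (y, snd p) = 0" for y
        by (intro B(3)) (auto intro: order.strict_trans2[OF _ norm_snd_le])
      then show ?thesis by (simp add: avg_def)
    next
      case False
      show ?thesis
      proof (rule avg_eq_0[where R=B])
        show "B < norm y \<Longrightarrow> f (y, snd p) = 0" for y
          by (intro B(3)) (auto intro: order.strict_trans2[OF _ norm_fst_le])
        show "B + real CARD('d) * 2 powi - k < norm (fst p)"
          using that False norm_Pair_le[of "fst p" "snd p"] by (simp add: R_def)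
      qed
    qed
  qed
qed

lemma bdd_supp_swap:
  fixes f :: "'a::euclidean_space \<times> 'b::euclidean_space \<Rightarrow> 'c::euclidean_space"
  assumes "bdd_supp f" shows "bdd_supp (\<lambda>p. f (snd p, fst p))"
proof -
  note [measurable] = bdd_supp_measurable[OF assms]
  obtain B where B: "0 \<le> B" "\<And>x. norm (f x) \<le> B" "\<And>x. B < norm x \<Longrightarrow> f x = 0"
    using bdd_supp_bound[OF assms] by metis
  show ?thesis
    by (rule bdd_suppI[where B=B and R=B])
       (auto simp: B norm_Pair add.commute intro!: B(3))
qed

lemma bdd_supp_avg_param2:
  fixes f :: "'z::euclidean_space \<times> (real ^ 'd) \<Rightarrow> 'b::euclidean_space"
  assumes f: "bdd_supp f"
  shows "bdd_supp (\<lambda>p. avg k (\<lambda>y. f (fst p, y)) (snd p))"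
  using bdd_supp_swap[OF bdd_supp_avg_param[OF bdd_supp_swap[OF f]]] by simp

lemma bdd_supp_avg:
  assumes f: "bdd_supp f" shows "bdd_supp (avg k f)"
proof -
  note [measurable] = bdd_supp_measurable[OF f]
  obtain B where B: "0 \<le> B" "\<And>x. norm (f x) \<le> B" "\<And>x. B < norm x \<Longrightarrow> f x = 0"
    using bdd_supp_bound[OF f] by metis
  show ?thesis
  proof (rule bdd_suppI[where B=B])
    show "avg k f \<in> borel_measurable borel" by measurable
  qed (auto intro!: avg_bound avg_eq_0[where R=B] B)
qed

text \<open>As x and y share a cube, both stay in a bounded set. This justifies Fubini in
  \<open>integral_avg\<close> and \<open>avg_avg\<close>.\<close>

lemma bdd_supp_avker:
  fixes f :: "real ^ 'd \<Rightarrow> 'b::euclidean_space"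
  assumes f: "bdd_supp f" shows "bdd_supp (\<lambda>(x, y). avker k x y *\<^sub>R f y)"
proof -
  note [measurable] = bdd_supp_measurable[OF f]
  obtain B where B: "0 \<le> B" "\<And>x. norm (f x) \<le> B" "\<And>x. B < norm x \<Longrightarrow> f x = 0"
    using bdd_supp_bound[OF f] by metis
  show ?thesis
  proof (rule bdd_suppI[where B="2 powi (k * int CARD('d)) * B" and R="2 * B + real CARD('d) * 2 powi (-k)"])
    show "norm (case p of (x, y) \<Rightarrow> avker k x y *\<^sub>R f y) \<le> 2 powi (k * int CARD('d)) * B" for p
      using B(1,2) by (auto simp: avker_def split: prod.split intro!: mult_left_mono)
    fix p :: "(real ^ 'd) \<times> (real ^ 'd)"
    assume p: "2 * B + real CARD('d) * 2 powi (-k) < norm p"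
    obtain x y where xy: "p = (x, y)" by fastforce
    have "norm p \<le> norm x + norm y" unfolding xy by (rule norm_Pair_le)
    moreover have "norm x \<le> norm y + real CARD('d) * 2 powi (-k)" if "same_cube k x y"
      using same_cube_dist[OF that] norm_triangle_sub[of x y] by linarith
    ultimately have "B < norm y" if "same_cube k x y" using that p by linarith
    then show "(case p of (x, y) \<Rightarrow> avker k x y *\<^sub>R f y) = 0"
      using B(3) by (auto simp: avker_def xy)
  qed measurable
qed

lemma lborel_Fubini:
  fixes f :: "'a::euclidean_space \<times> 'b::euclidean_space \<Rightarrow> 'c::{banach, second_countable_topology}"
  assumes "integrable lborel f"
  shows "(LINT x|lborel. LINT y|lborel. f (x, y)) = (LINT y|lborel. LINT x|lborel. f (x, y))"
  using assms by (intro lborel_pair.Fubini_integral[symmetric]) (simp add: lborel_prod)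

lemma integral_avg:
  assumes f: "bdd_supp f" shows "(LINT x|lborel. avg k f x) = (LINT x|lborel. f x)"
proof -
  have "(LINT x|lborel. avg k f x) = (LINT y|lborel. LINT x|lborel. avker k x y *\<^sub>R f y)"
    unfolding avg_def
    using lborel_Fubini[OF bdd_supp_integrable[OF bdd_supp_avker[OF f]]] by simp
  also have "\<dots> = (LINT y|lborel. f y)"
    by (subst avker_commute) (simp add: integrable_avker integral_avker)
  finally show ?thesis .
qed

text \<open>After Fubini, \<open>avker_tower\<close> frees the coarse kernel of the intermediate
  point, and the fine kernel then integrates to one.\<close>

lemma avg_avg:
  assumes f: "bdd_supp f" and "k \<le> l"
  shows "avg k (avg l f) x = avg k f x"
proof -
  note [measurable] = bdd_supp_measurable[OF f]
  have b: "bdd_supp (\<lambda>p. avker l (fst p) (snd p) *\<^sub>R f (snd p))"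
    using bdd_supp_avker[OF f, of l] by (simp add: case_prod_unfold)
  have "bdd_supp (\<lambda>p. avker k x (fst p) *\<^sub>R (avker l (fst p) (snd p) *\<^sub>R f (snd p)))"
    by (rule bdd_supp_mult_bounded[OF b, where C="2 powi (k * int CARD('a))"])
       (auto simp: avker_def)
  from lborel_Fubini[OF bdd_supp_integrable[OF this]]
  have "avg k (avg l f) x = (LINT z|lborel. LINT y|lborel. avker k x y *\<^sub>R (avker l y z *\<^sub>R f z))"
    by (simp add: avg_def del: scaleR_scaleR)
  also have "\<dots> = (LINT z|lborel. LINT y|lborel. (avker k x y * avker l y z) *\<^sub>R f z)"
    by simp
  also have "\<dots> = (LINT z|lborel. LINT y|lborel. avker l z y *\<^sub>R (avker k x z *\<^sub>R f z))"
    by (simp add: avker_tower[OF \<open>k \<le> l\<close>]) (simp add: mult.commute avker_commute[of l])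
  also have "\<dots> = avg k f x"
    by (simp add: integrable_avker integral_avker avg_def)
  finally show ?thesis .
qed

lemma avg_commute:
  fixes f :: "(real ^ 'd) \<times> (real ^ 'e) \<Rightarrow> 'b::euclidean_space"
  assumes f: "bdd_supp f"
  shows "avg k (\<lambda>y. avg l (\<lambda>z. f (y, z)) z0) y0 = avg l (\<lambda>z. avg k (\<lambda>y. f (y, z)) y0) z0"
proof -
  note [measurable] = bdd_supp_measurable[OF f]
  have "bdd_supp (\<lambda>p. avker k y0 (fst p) *\<^sub>R avker l z0 (snd p) *\<^sub>R f p)"
    by (rule bdd_supp_mult_bounded[OF f, where C="2 powi (k * int CARD('d)) * 2 powi (l * int CARD('e))"])
       (auto simp: avker_def)
  from lborel_Fubini[OF bdd_supp_integrable[OF this]]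
  have "avg k (\<lambda>y. avg l (\<lambda>z. f (y, z)) z0) y0
    = (LINT z|lborel. LINT y|lborel. avker k y0 y *\<^sub>R (avker l z0 z *\<^sub>R f (y, z)))"
    by (simp add: avg_def del: scaleR_scaleR)
  also have "\<dots> = (LINT z|lborel. LINT y|lborel. avker l z0 z *\<^sub>R (avker k y0 y *\<^sub>R f (y, z)))"
    by (simp add: mult.commute)
  also have "\<dots> = avg l (\<lambda>z. avg k (\<lambda>y. f (y, z)) y0) z0"
    by (simp add: avg_def del: scaleR_scaleR)
  finally show ?thesis .
qed

lemma bdd_supp_norm_power2:
  "bdd_supp f \<Longrightarrow> bdd_supp (\<lambda>x. (norm (f x))\<^sup>2)"
  for f :: "'a::euclidean_space \<Rightarrow> 'b::euclidean_space"
proof -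
  assume f: "bdd_supp f"
  note [measurable] = bdd_supp_measurable[OF f]
  obtain B where B: "0 \<le> B" "\<And>x. norm (f x) \<le> B" "\<And>x. B < norm x \<Longrightarrow> f x = 0"
    using bdd_supp_bound[OF f] by metis
  show "bdd_supp (\<lambda>x. (norm (f x))\<^sup>2)"
    by (rule bdd_supp_mult_bounded[OF f, where C=B])
       (use B in \<open>auto simp: power2_eq_square intro!: mult_right_mono\<close>)
qed

text \<open>Valued in \<open>ennreal\<close>, so that it makes sense for every function and bounds
  can be chained without integrability side conditions.\<close>

definition sqnorm :: "('a::euclidean_space \<Rightarrow> complex) \<Rightarrow> ennreal" where
  "sqnorm f = (\<integral>\<^sup>+x. ennreal ((norm (f x))\<^sup>2) \<partial>lborel)"

lemma sqnorm_eq_integral: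
  "bdd_supp f \<Longrightarrow> sqnorm f = ennreal (LINT x|lborel. (norm (f x))\<^sup>2)"
  unfolding sqnorm_def
  by (intro nn_integral_eq_integral bdd_supp_integrable bdd_supp_norm_power2) auto

text \<open>Pythagoras for conditional expectations: the coarse average is constant on coarse cubes
  and the increment has mean zero on each of them, so the cross term (\<open>h\<close> in the proof)
  integrates to zero.\<close>

lemma sqnorm_avg_orthogonal:
  assumes f: "bdd_supp f" and kl: "k \<le> l"
  shows "sqnorm (avg k f) + sqnorm (\<lambda>x. avg l f x - avg k f x) = sqnorm (avg l f)"
proof -
  let ?F = "avg k f" and ?G = "avg l f"
  have F: "bdd_supp ?F" and G: "bdd_supp ?G" using bdd_supp_avg[OF f] by auto
  note [measurable] = bdd_supp_measurable[OF f] bdd_supp_measurable[OF F] bdd_supp_measurable[OF G]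
  obtain B where B: "\<And>x. norm (?F x) \<le> B" using bdd_supp_bound[OF F] by metis
  have cF': "(\<lambda>x. cnj (?F x)) \<in> borel_measurable borel" "\<And>x. norm (cnj (?F x)) \<le> B"
    using B by (auto intro!: borel_measurable_continuous_on[where f=cnj] continuous_intros)
  have cG: "bdd_supp (\<lambda>x. cnj (?F x) * ?G x)" and cF: "bdd_supp (\<lambda>x. cnj (?F x) * ?F x)"
    by (rule bdd_supp_mult[OF G cF'], rule bdd_supp_mult[OF F cF'])
  have "avg k (\<lambda>x. cnj (?F x) * ?G x) x = cnj (?F x) * ?F x" for x
    by (subst avg_mult) (auto simp: avg_avg[OF f kl] intro!: avg_same_cube same_cube_sym)
  then have "(LINT x|lborel. cnj (?F x) * ?G x) = (LINT x|lborel. cnj (?F x) * ?F x)"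
    using integral_avg[OF cG, of k] by simp
  then have z: "(LINT x|lborel. cnj (?F x) * (?G x - ?F x)) = 0"
    using bdd_supp_integrable[OF cG] bdd_supp_integrable[OF cF] by (simp add: right_diff_distrib)
  have i: "integrable lborel (\<lambda>x. cnj (?F x) * (?G x - ?F x))"
    using bdd_supp_integrable[OF cG] bdd_supp_integrable[OF cF] by (simp add: right_diff_distrib)
  define h where "h x = Re (cnj (?F x) * (?G x - ?F x))" for x
  have ih: "integrable lborel h" and 0: "(LINT x|lborel. h x) = 0"
    using integral_Re[OF i] integrable_Re[OF i] z
    unfolding h_def by (simp_all only: zero_complex.simps)
  have "(norm (?G x))\<^sup>2 = (norm (?F x))\<^sup>2 + (norm (?G x - ?F x))\<^sup>2 + 2 * h x" for x
    unfolding cmod_power2 h_def by (simp add: power2_eq_square algebra_simps)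
  then have "(LINT x|lborel. (norm (?G x))\<^sup>2)
    = (LINT x|lborel. (norm (?F x))\<^sup>2) + (LINT x|lborel. (norm (?G x - ?F x))\<^sup>2)"
    using 0 bdd_supp_integrable[OF bdd_supp_norm_power2[OF F]] ih
      bdd_supp_integrable[OF bdd_supp_norm_power2[OF bdd_supp_diff[OF G F]]]
    by simp
  then show ?thesis
    by (simp add: sqnorm_eq_integral F G bdd_supp_diff flip: ennreal_plus)
qed

subsection \<open>Kernel integrals\<close>

lemma nn_integral_swap:
  fixes f :: "'a::euclidean_space \<Rightarrow> 'b::euclidean_space \<Rightarrow> ennreal"
  assumes "(\<lambda>(x, y). f x y) \<in> borel_measurable borel"
  shows "(\<integral>\<^sup>+x. \<integral>\<^sup>+y. f x y \<partial>lborel \<partial>lborel) = (\<integral>\<^sup>+y. \<integral>\<^sup>+x. f x y \<partial>lborel \<partial>lborel)"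
  using assms by (intro lborel_pair.Fubini'[symmetric]) (simp add: lborel_prod)

lemma measurable_uncurry:
  fixes g :: "'a::second_countable_topology \<Rightarrow> 'b::second_countable_topology \<Rightarrow> 'c::topological_space"
  assumes "(\<lambda>(x, y). g x y) \<in> borel_measurable borel" "f \<in> M \<rightarrow>\<^sub>M borel" "h \<in> M \<rightarrow>\<^sub>M borel"
  shows "(\<lambda>x. g (f x) (h x)) \<in> M \<rightarrow>\<^sub>M borel"
  using measurable_compose[OF borel_measurable_Pair[OF assms(2,3)] assms(1)] by simp

lemma nn_integral_pair:
  fixes f :: "'a::euclidean_space \<times> 'b::euclidean_space \<Rightarrow> ennreal"
  assumes "f \<in> borel_measurable borel"
  shows "(\<integral>\<^sup>+p. f p \<partial>lborel) = (\<integral>\<^sup>+x. \<integral>\<^sup>+y. f (x, y) \<partial>lborel \<partial>lborel)"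
  using assms lborel.nn_integral_fst[of f "lborel :: 'a measure"] by (simp add: lborel_prod)

section \<open>Integrals of the size kernel\<close>

lemma size_factor_nonneg [simp]: "0 \<le> size_factor \<alpha> t x y"
  by (simp add: size_factor_def)

lemma size_factor_pos: "0 < t \<Longrightarrow> 0 < size_factor \<alpha> t x y"
  by (simp add: size_factor_def add_pos_nonneg less_imp_neq[symmetric])

lemma size_factor_commute: "size_factor \<alpha> t x y = size_factor \<alpha> t y x"
  by (simp add: size_factor_def norm_minus_commute)

lemma size_factor_measurable [measurable (raw)]:
  assumes [measurable]: "f \<in> M \<rightarrow>\<^sub>M borel" "g \<in> M \<rightarrow>\<^sub>M borel" "h \<in> M \<rightarrow>\<^sub>M borel"
  shows "(\<lambda>x. size_factor \<alpha> (f x) (g x) (h x :: real ^ 'd)) \<in> borel_measurable M"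
  unfolding size_factor_def by measurable

lemma holder_factor_measurable [measurable (raw)]:
  assumes [measurable]: "f \<in> M \<rightarrow>\<^sub>M borel" "g \<in> M \<rightarrow>\<^sub>M borel" "h \<in> M \<rightarrow>\<^sub>M borel" "k \<in> M \<rightarrow>\<^sub>M borel"
  shows "(\<lambda>x. holder_factor \<alpha> (f x) (g x) (h x) (k x :: real ^ 'd)) \<in> borel_measurable M"
  unfolding holder_factor_def by measurable

lemma emeasure_ball_le:
  fixes x :: "real ^ 'd"
  assumes "0 < r" shows "emeasure lborel (ball x r) \<le> ennreal ((2 * r) ^ CARD('d))"
proof -
  have "ball x r \<subseteq> cube (\<chi> i. x $ i - r) (2 * r)"
  proof
    fix y assume "y \<in> ball x r"
    then have "\<bar>(y - x) $ i\<bar> < r" for i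
      using component_le_norm_cart[of "y - x" i] by (simp add: dist_norm norm_minus_commute)
    then show "y \<in> cube (\<chi> i. x $ i - r) (2 * r)"
      unfolding cube_def mem_Collect_eq vec_lambda_beta vector_minus_component
      by (smt (verit))
  qed
  then show ?thesis
    using emeasure_mono[of "ball x r" "cube (\<chi> i. x $ i - r) (2 * r)" lborel] assms
    by (simp add: emeasure_cube)
qed

text \<open>A geometric series over the balls of radius \<open>2 ^ i * t\<close>: the kernel on the
  i-th annulus times the measure bound of the ball is \<open>4 ^ d * 2 powr \<alpha>\<close> times
  the i-th power of \<open>2 powr (-\<alpha>)\<close>.\<close>

definition size_const :: "nat \<Rightarrow> real \<Rightarrow> real" where
  "size_const d \<alpha> = 4 ^ d * 2 powr \<alpha> / (1 - 2 powr (-\<alpha>))"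

lemma size_const_nonneg: "0 < \<alpha> \<Longrightarrow> 0 \<le> size_const d \<alpha>"
proof -
  assume "0 < \<alpha>"
  then have "(2::real) powr (-\<alpha>) \<le> 2 powr 0" by (intro powr_mono) auto
  then show ?thesis by (simp add: size_const_def)
qed

lemma nn_integral_size_factor:
  fixes x :: "real ^ 'd"
  assumes "0 < t" "0 < \<alpha>"
  shows "(\<integral>\<^sup>+y. ennreal (size_factor \<alpha> t x y) \<partial>lborel) \<le> ennreal (size_const CARD('d) \<alpha>)"
proof -
  let ?d = "real CARD('d)"
  define c where "c i = t powr \<alpha> * (2 ^ i * t / 2) powr - (?d + \<alpha>)" for i :: nat
  have c0: "0 \<le> c i" for i by (simp add: c_def)
  have "ennreal (size_factor \<alpha> t x y) \<le> (\<Sum>i. ennreal (c i) * indicator (ball x (2 ^ i * t)) y)" for y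
  proof -
    \<comment> \<open>The smallest ball containing y. Being outside the previous ball bounds
      \<open>t + norm (x - y)\<close> below by half the radius; for i = 0 the summand t does
      so.\<close>
    define i where "i = (LEAST i. norm (x - y) < 2 ^ i * t)"
    have "\<exists>i. norm (x - y) < 2 ^ i * t"
    proof -
      obtain n where "norm (x - y) / t < 2 ^ n" using real_arch_pow[of 2 "norm (x - y) / t"] by auto
      then show ?thesis using \<open>0 < t\<close> by (auto simp: field_simps)
    qed
    then have i: "norm (x - y) < 2 ^ i * t" unfolding i_def by (rule LeastI_ex)
    have "2 ^ i * t / 2 \<le> t + norm (x - y)"
    proof (cases i)
      case (Suc j)
      then have "\<not> norm (x - y) < 2 ^ j * t" unfolding i_def using not_less_Least by (metis lessI)
      then show ?thesis using Suc \<open>0 < t\<close> by simp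
    qed (use \<open>0 < t\<close> in \<open>simp add: add_pos_nonneg add_increasing2\<close>)
    then have "(t + norm (x - y)) powr - (?d + \<alpha>) \<le> (2 ^ i * t / 2) powr - (?d + \<alpha>)"
      using assms by (intro powr_mono2') auto
    then have "size_factor \<alpha> t x y \<le> c i"
      unfolding size_factor_def c_def powr_minus divide_inverse
      by (intro mult_left_mono) auto
    then have "ennreal (size_factor \<alpha> t x y) \<le> ennreal (c i) * indicator (ball x (2 ^ i * t)) y"
      using i by (simp add: dist_norm ennreal_leI)
    also have "\<dots> \<le> (\<Sum>i. ennreal (c i) * indicator (ball x (2 ^ i * t)) y)"
    proof -
      have le: "f i \<le> (\<Sum>i. f i)" for f :: "nat \<Rightarrow> ennreal"
        using sum_le_suminf[of f "{i}"] by simp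
      show ?thesis by (rule le)
    qed
    finally show ?thesis .
  qed
  then have "(\<integral>\<^sup>+y. ennreal (size_factor \<alpha> t x y) \<partial>lborel)
    \<le> (\<integral>\<^sup>+y. (\<Sum>i. ennreal (c i) * indicator (ball x (2 ^ i * t)) y) \<partial>lborel)"
    by (rule nn_integral_mono)
  also have "\<dots> = (\<Sum>i. ennreal (c i) * emeasure lborel (ball x (2 ^ i * t)))"
  proof -
    have [measurable]: "ball x r \<in> sets borel" for r by simp
    show ?thesis by (subst nn_integral_suminf) (simp_all add: nn_integral_cmult_indicator)
  qed
  also have "\<dots> \<le> (\<Sum>i. ennreal (4 ^ CARD('d) * 2 powr \<alpha> * (2 powr -\<alpha>) ^ i))"
  proof (intro suminf_le summableI)
    fix i
    have "ennreal (c i) * emeasure lborel (ball x (2 ^ i * t)) \<le> ennreal (c i) * ennreal ((2 * (2 ^ i * t)) ^ CARD('d))"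
      using assms by (intro mult_left_mono emeasure_ball_le) auto
    also have "\<dots> = ennreal (c i * (2 * (2 ^ i * t)) ^ CARD('d))" using c0 assms by (simp add: ennreal_mult)
    also have "c i * (2 * (2 ^ i * t)) ^ CARD('d) = 4 ^ CARD('d) * 2 powr \<alpha> * (2 powr -\<alpha>) ^ i"
    proof -
      \<comment> \<open>In terms of half the radius all powers of \<open>s\<close> cancel, as
        \<alpha> - (d + \<alpha>) + d = 0, and only the geometric factor in i is left.\<close>
      define s where "s = 2 ^ i * t / 2"
      have s: "0 < s" "2 * (2 ^ i * t) = 4 * s" using assms by (auto simp: s_def)
      have "t powr \<alpha> = (2 * s / 2 ^ i) powr \<alpha>" by (simp add: s_def)
      also have "\<dots> = 2 powr \<alpha> * s powr \<alpha> / (2 ^ i) powr \<alpha>"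
        using s by (simp add: powr_divide powr_mult)
      also have "((2::real) ^ i) powr \<alpha> = (2 powr \<alpha>) ^ i"
        by (simp add: powr_realpow[symmetric] powr_powr mult.commute)
      also have "2 powr \<alpha> * s powr \<alpha> / (2 powr \<alpha>) ^ i = 2 powr \<alpha> * s powr \<alpha> * (2 powr -\<alpha>) ^ i"
        by (simp add: powr_minus power_inverse divide_inverse)
      finally have t: "t powr \<alpha> = 2 powr \<alpha> * s powr \<alpha> * (2 powr -\<alpha>) ^ i" .
      have "s powr \<alpha> * s powr - (?d + \<alpha>) * s ^ CARD('d) = s powr (\<alpha> + - (?d + \<alpha>) + ?d)"
        using s by (simp only: powr_add powr_realpow)
      also have "\<dots> = 1" using s by simp
      finally have "s powr \<alpha> * s powr - (?d + \<alpha>) * s ^ CARD('d) = 1" .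
      then show ?thesis
        unfolding c_def s(2) s_def[symmetric] t power_mult_distrib by (simp add: mult_ac)
    qed
    finally show "ennreal (c i) * emeasure lborel (ball x (2 ^ i * t))
      \<le> ennreal (4 ^ CARD('d) * 2 powr \<alpha> * (2 powr -\<alpha>) ^ i)" .
  qed
  also have "\<dots> = ennreal (size_const CARD('d) \<alpha>)"
  proof -
    have "(2::real) powr (-\<alpha>) < 2 powr 0" using assms by (intro powr_less_mono) auto
    then have "(\<lambda>i. 4 ^ CARD('d) * 2 powr \<alpha> * (2 powr -\<alpha>) ^ i) sums size_const CARD('d) \<alpha>"
      unfolding size_const_def
      using sums_mult[OF geometric_sums[of "2 powr -\<alpha>"], of "4 ^ CARD('d) * 2 powr \<alpha>"] by simp
    then show ?thesis by (subst suminf_ennreal2) (auto simp: sums_iff)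
  qed
  finally show ?thesis .
qed

lemma integrable_size_factor:
  assumes "0 < t" "0 < \<alpha>"
  shows "integrable lborel (\<lambda>y. size_factor \<alpha> t (x :: real ^ 'd) y)"
proof (rule integrableI_bounded)
  have "(\<integral>\<^sup>+y. ennreal (size_factor \<alpha> t x y) \<partial>lborel) < \<infinity>"
    using nn_integral_size_factor[OF assms, of x] by (rule order.strict_trans1) simp
  then show "(\<integral>\<^sup>+y. ennreal (norm (size_factor \<alpha> t x y)) \<partial>lborel) < \<infinity>" by simp
qed measurable

text \<open>Part of the decay of the kernel is spent on absorbing a growing weight, which lowers the
  exponent from \<alpha> to \<alpha> - \<gamma>.\<close>

lemma size_factor_weight:
  assumes "0 < t" "0 \<le> \<gamma>" "\<gamma> \<le> \<alpha>"
  shows "size_factor \<alpha> t x y * (norm (x - y) / t) powr \<gamma> \<le> size_factor (\<alpha> - \<gamma>) t x (y :: real ^ 'd)"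
proof -
  let ?T = "t + norm (x - y)"
  have T: "0 < ?T" using assms by (simp add: add_pos_nonneg)
  have "(norm (x - y) / t) powr \<gamma> \<le> (?T / t) powr \<gamma>"
    using assms by (intro powr_mono2 divide_right_mono) auto
  then have "size_factor \<alpha> t x y * (norm (x - y) / t) powr \<gamma> \<le> size_factor \<alpha> t x y * (?T / t) powr \<gamma>"
    by (intro mult_left_mono) auto
  also have "\<dots> = size_factor (\<alpha> - \<gamma>) t x y"
    using T assms by (simp add: size_factor_def powr_divide powr_diff powr_add divide_simps)
  finally show ?thesis .
qed

text \<open>A point that the shift by u carries out of the cube leaves it through some face, so it
  lies in a slab along that face whose thickness is the corresponding component of u.\<close>

lemma emeasure_cube_shift:
  fixes u :: "real ^ 'd"
  assumes l: "0 < l"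
  shows "emeasure lborel {x \<in> cube a l. x + u \<notin> cube a l} \<le> ennreal (real CARD('d) * norm u * l ^ (CARD('d) - 1))"
proof -
  \<comment> \<open>The sign of the component decides whether the slab lies along the upper or the
    lower face. For a long shift the slab sticks out of the cube, which does not affect the
    bound.\<close>
  define A where "A i = (if 0 \<le> u $ i
     then hbox (\<chi> j. if j = i then a $ i + l - \<bar>u $ i\<bar> else a $ j) (\<chi> j. a $ j + l)
     else hbox a (\<chi> j. if j = i then a $ i + \<bar>u $ i\<bar> else a $ j + l))" for i
  have A_meas: "A i \<in> sets borel" for i by (simp add: A_def)
  have "emeasure lborel (A i) = ennreal (\<bar>u $ i\<bar> * l ^ (CARD('d) - 1))" for i
  proof -
    have "(\<Prod>j\<in>UNIV. if j = i then \<bar>u $ i\<bar> else l) = \<bar>u $ i\<bar> * l ^ (CARD('d) - 1)"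
      by (subst prod.remove[of _ i]) (auto simp: card_Diff_singleton)
    moreover have "(\<Prod>j\<in>UNIV. (\<chi> j. a $ j + l) $ j - (\<chi> j. if j = i then a $ i + l - \<bar>u $ i\<bar> else a $ j) $ j)
       = (\<Prod>j\<in>UNIV. if j = i then \<bar>u $ i\<bar> else l)"
      "(\<Prod>j\<in>UNIV. (\<chi> j. if j = i then a $ i + \<bar>u $ i\<bar> else a $ j + l) $ j - a $ j)
       = (\<Prod>j\<in>UNIV. if j = i then \<bar>u $ i\<bar> else l)"
      by (intro prod.cong; simp)+
    ultimately show ?thesis
      unfolding A_def using l by (auto simp: emeasure_hbox)
  qed
  note A = this
  have "{x \<in> cube a l. x + u \<notin> cube a l} \<subseteq> (\<Union>i. A i)"
  proof
    fix x assume x: "x \<in> {x \<in> cube a l. x + u \<notin> cube a l}"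
    then obtain i where i: "\<not> (a $ i \<le> x $ i + u $ i \<and> x $ i + u $ i < a $ i + l)"
      by (auto simp: cube_def)
    have "a $ j \<le> x $ j" "x $ j < a $ j + l" for j using x by (auto simp: cube_def)
    then have "x \<in> A i" using i by (auto simp: A_def hbox_def) (smt (verit))+
    then show "x \<in> (\<Union>i. A i)" by auto
  qed
  then have "emeasure lborel {x \<in> cube a l. x + u \<notin> cube a l} \<le> emeasure lborel (\<Union>i. A i)"
    using A_meas by (intro emeasure_mono) auto
  also have "\<dots> \<le> (\<Sum>i\<in>UNIV. emeasure lborel (A i))"
    using A_meas by (intro emeasure_subadditive_finite) auto
  also have "\<dots> = ennreal (\<Sum>i\<in>UNIV. \<bar>u $ i\<bar> * l ^ (CARD('d) - 1))"
    using l by (simp add: A)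
  also have "\<dots> \<le> ennreal (real CARD('d) * norm u * l ^ (CARD('d) - 1))"
  proof (intro ennreal_leI)
    have "(\<Sum>i\<in>UNIV. \<bar>u $ i\<bar>) \<le> (\<Sum>i\<in>(UNIV :: 'd set). norm u)"
      by (intro sum_mono component_le_norm_cart)
    then show "(\<Sum>i\<in>UNIV. \<bar>u $ i\<bar> * l ^ (CARD('d) - 1)) \<le> real CARD('d) * norm u * l ^ (CARD('d) - 1)"
      using l by (simp flip: sum_distrib_right add: mult_right_mono)
  qed
  finally show ?thesis .
qed

text \<open>For short shifts a number in [0,1] is at most its power with exponent \<gamma>; for long
  shifts the measure of the whole cube is a sufficient bound.\<close>

lemma emeasure_cube_shift_powr:
  fixes u :: "real ^ 'd"
  assumes l: "0 < l" and \<gamma>: "0 < \<gamma>" "\<gamma> \<le> 1"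
  shows "emeasure lborel {x \<in> cube a l. x + u \<notin> cube a l}
     \<le> ennreal (real CARD('d) * (norm u / l) powr \<gamma> * l ^ CARD('d))"
proof (cases "norm u \<le> l")
  case True
  define s where "s = norm u / l"
  have s: "0 \<le> s" "s \<le> 1" using True l by (auto simp: s_def)
  have "s \<le> s powr \<gamma>" using powr_mono'[of \<gamma> 1 s] s \<gamma> by simp
  have "norm u * l ^ (CARD('d) - 1) = s * l ^ CARD('d)"
    using l by (cases "CARD('d)") (auto simp: s_def)
  also have "\<dots> \<le> s powr \<gamma> * l ^ CARD('d)" using \<open>s \<le> s powr \<gamma>\<close> l by (intro mult_right_mono) auto
  finally have "real CARD('d) * norm u * l ^ (CARD('d) - 1) \<le> real CARD('d) * s powr \<gamma> * l ^ CARD('d)"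
    by (simp add: mult.assoc mult_left_mono)
  then show ?thesis
    using emeasure_cube_shift[OF l, of a u] unfolding s_def by (meson ennreal_leI order_trans)
next
  case False
  have "1 \<le> (norm u / l) powr \<gamma>" using False l \<gamma> by (intro ge_one_powr_ge_zero) auto
  then have "1 * 1 \<le> real CARD('d) * (norm u / l) powr \<gamma>" by (intro mult_mono) (auto simp: Suc_leI)
  then have "l ^ CARD('d) \<le> real CARD('d) * (norm u / l) powr \<gamma> * l ^ CARD('d)" using l by simp
  moreover have "emeasure lborel {x \<in> cube a l. x + u \<notin> cube a l} \<le> emeasure lborel (cube a l)"
    by (intro emeasure_mono) auto
  ultimately show ?thesis using l by (auto simp: emeasure_cube intro: order_trans ennreal_leI)
qed

lemma nn_integral_translate:
  fixes g :: "'a::euclidean_space \<Rightarrow> ennreal"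
  assumes [measurable]: "g \<in> borel_measurable borel"
  shows "(\<integral>\<^sup>+y. g y \<partial>lborel) = (\<integral>\<^sup>+u. g (x + u) \<partial>lborel)"
proof -
  have "(\<integral>\<^sup>+y. g y \<partial>lborel) = (\<integral>\<^sup>+y. g y \<partial>distr lborel borel ((+) x))"
    by (simp only: lborel_distr_plus)
  then show ?thesis by (simp add: nn_integral_distr)
qed

text \<open>The part of the size kernel joining different dyadic cubes. Where a function is constant
  on cubes, its difference to the value at x is seen only by this part.\<close>

definition offker :: "int \<Rightarrow> real \<Rightarrow> real \<Rightarrow> real ^ 'd \<Rightarrow> real ^ 'd \<Rightarrow> real" where
  "offker k \<alpha> t x y = (if same_cube k x y then 0 else size_factor \<alpha> t x y)"

lemma offker_nonneg [simp]: "0 \<le> offker k \<alpha> t x y"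
  and offker_le: "offker k \<alpha> t x y \<le> size_factor \<alpha> t x y"
  and offker_commute: "offker k \<alpha> t x y = offker k \<alpha> t y x"
  by (auto simp: offker_def size_factor_commute same_cube_commute)

lemma offker_measurable [measurable (raw)]:
  assumes [measurable]: "f \<in> M \<rightarrow>\<^sub>M borel" "g \<in> M \<rightarrow>\<^sub>M borel" "h \<in> M \<rightarrow>\<^sub>M borel"
  shows "(\<lambda>x. offker k \<alpha> (f x) (g x) (h x :: real ^ 'd)) \<in> borel_measurable M"
  unfolding offker_def by measurable

lemma nn_integral_offker_le:
  fixes x :: "real ^ 'd"
  assumes "0 < t" "0 < \<alpha>"
  shows "(\<integral>\<^sup>+y. ennreal (offker k \<alpha> t x y) \<partial>lborel) \<le> ennreal (size_const CARD('d) \<alpha>)"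
  by (rule order_trans[OF nn_integral_mono nn_integral_size_factor[OF assms, of x]])
     (intro ennreal_leI offker_le)

text \<open>By translation, the left-hand side averages \<open>|Q \ (Q - u)| / |Q| \<lesssim> (|u| / \<ell>(Q))\<^sup>\<gamma>\<close>
  against the size kernel.\<close>

lemma nn_integral_avker_offker:
  fixes x0 :: "real ^ 'd"
  assumes t: "0 < t" and \<gamma>: "0 < \<gamma>" "\<gamma> \<le> 1" "\<gamma> < \<alpha>"
  shows "(\<integral>\<^sup>+x. ennreal (avker k x0 x) * (\<integral>\<^sup>+y. ennreal (offker k \<alpha> t x y) \<partial>lborel) \<partial>lborel)
    \<le> ennreal (real CARD('d) * size_const CARD('d) (\<alpha> - \<gamma>) * (2 powi k * t) powr \<gamma>)"
proof -
  define l :: real where "l = 2 powi (-k)"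
  have l: "0 < l" by (simp add: l_def)
  let ?Q = "dcube k x0"
  have Qeq: "cube (corner k x0) l = ?Q" by (simp add: l_def)
  have "(\<integral>\<^sup>+x. ennreal (avker k x0 x) * (\<integral>\<^sup>+y. ennreal (offker k \<alpha> t x y) \<partial>lborel) \<partial>lborel)
     = (\<integral>\<^sup>+x. \<integral>\<^sup>+u. ennreal (avker k x0 x) * ennreal (offker k \<alpha> t x (x + u)) \<partial>lborel \<partial>lborel)"
  proof (intro nn_integral_cong)
    fix x
    show "ennreal (avker k x0 x) * (\<integral>\<^sup>+y. ennreal (offker k \<alpha> t x y) \<partial>lborel)
      = (\<integral>\<^sup>+u. ennreal (avker k x0 x) * ennreal (offker k \<alpha> t x (x + u)) \<partial>lborel)"
      using nn_integral_translate[of "\<lambda>y. ennreal (offker k \<alpha> t x y)" x]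
      by (simp add: nn_integral_cmult)
  qed
  also have "\<dots> = (\<integral>\<^sup>+u. \<integral>\<^sup>+x. ennreal (avker k x0 x) * ennreal (offker k \<alpha> t x (x + u)) \<partial>lborel \<partial>lborel)"
    by (rule nn_integral_swap) measurable
  \<comment> \<open>The size kernel depends on u alone. What is left in x is the indicator of the
    points which u moves out of the cube.\<close>
  also have "\<dots> = (\<integral>\<^sup>+u. \<integral>\<^sup>+x. ennreal (2 powi (k * int CARD('d)) * size_factor \<alpha> t 0 u) *
      indicator {x \<in> ?Q. x + u \<notin> ?Q} x \<partial>lborel \<partial>lborel)"
  proof (intro nn_integral_cong)
    fix u x :: "real ^ 'd"
    have "size_factor \<alpha> t x (x + u) = size_factor \<alpha> t 0 u" by (simp add: size_factor_def)
    moreover have "same_cube k x0 x \<Longrightarrow> same_cube k x (x + u) \<longleftrightarrow> same_cube k x0 (x + u)"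
      by (meson same_cube_trans same_cube_sym)
    ultimately show "ennreal (avker k x0 x) * ennreal (offker k \<alpha> t x (x + u))
        = ennreal (2 powi (k * int CARD('d)) * size_factor \<alpha> t 0 u) * indicator {x \<in> ?Q. x + u \<notin> ?Q} x"
      by (auto simp: avker_def offker_def mem_dcube ennreal_mult indicator_def)
  qed
  also have "\<dots> = (\<integral>\<^sup>+u. ennreal (2 powi (k * int CARD('d)) * size_factor \<alpha> t 0 u) *
      emeasure lborel {x \<in> ?Q. x + u \<notin> ?Q} \<partial>lborel)"
  proof (intro nn_integral_cong nn_integral_cmult_indicator)
    fix u
    have "{x \<in> space borel. x \<in> ?Q \<and> x + u \<notin> ?Q} \<in> sets borel" by measurable
    then show "{x \<in> ?Q. x + u \<notin> ?Q} \<in> sets lborel" by simp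
  qed
  \<comment> \<open>The power of the length of u given by \<open>emeasure_cube_shift_powr\<close> is
    absorbed by the kernel through \<open>size_factor_weight\<close>.\<close>
  also have "\<dots> \<le> (\<integral>\<^sup>+u. ennreal (real CARD('d) * (2 powi k * t) powr \<gamma>) * ennreal (size_factor (\<alpha> - \<gamma>) t 0 (u :: real ^ 'd)) \<partial>lborel)"
  proof (intro nn_integral_mono)
    fix u :: "real ^ 'd"
    have "ennreal (2 powi (k * int CARD('d)) * size_factor \<alpha> t 0 u) * emeasure lborel {x \<in> ?Q. x + u \<notin> ?Q}
      \<le> ennreal (2 powi (k * int CARD('d)) * size_factor \<alpha> t 0 u) * ennreal (real CARD('d) * (norm u / l) powr \<gamma> * l ^ CARD('d))"
      using emeasure_cube_shift_powr[OF l \<gamma>(1,2), of "corner k x0" u] unfolding Qeq by (intro mult_left_mono) auto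
    also have "\<dots> = ennreal (2 powi (k * int CARD('d)) * size_factor \<alpha> t 0 u * (real CARD('d) * (norm u / l) powr \<gamma> * l ^ CARD('d)))"
      using l by (intro ennreal_mult[symmetric]) auto
    also have "2 powi (k * int CARD('d)) * size_factor \<alpha> t 0 u * (real CARD('d) * (norm u / l) powr \<gamma> * l ^ CARD('d))
       = real CARD('d) * (2 powi k * t) powr \<gamma> * (size_factor \<alpha> t 0 u * (norm (0 - u) / t) powr \<gamma>)"
    proof -
      have 1: "2 powi (k * int CARD('d)) * l ^ CARD('d) = 1"
        by (simp add: l_def power_int_minus power_inverse power_int_mult)
      have eq: "norm u / l = (2 powi k * t) * (norm u / t)" using t by (simp add: l_def power_int_minus field_simps)
      have 2: "(norm u / l) powr \<gamma> = (2 powi k * t) powr \<gamma> * (norm u / t) powr \<gamma>"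
        by (subst eq, subst powr_mult) (use t in auto)
      have "2 powi (k * int CARD('d)) * size_factor \<alpha> t 0 u * (real CARD('d) * (norm u / l) powr \<gamma> * l ^ CARD('d))
         = (2 powi (k * int CARD('d)) * l ^ CARD('d)) * (size_factor \<alpha> t 0 u * (real CARD('d) * (norm u / l) powr \<gamma>))"
        by (simp only: mult_ac)
      then show ?thesis unfolding 1 2 by (simp add: mult_ac)
    qed
    also have "ennreal \<dots> \<le> ennreal (real CARD('d) * (2 powi k * t) powr \<gamma> * size_factor (\<alpha> - \<gamma>) t 0 u)"
      using t \<gamma> by (intro ennreal_leI mult_left_mono size_factor_weight) auto
    finally show "ennreal (2 powi (k * int CARD('d)) * size_factor \<alpha> t 0 u) * emeasure lborel {x \<in> ?Q. x + u \<notin> ?Q}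
      \<le> ennreal (real CARD('d) * (2 powi k * t) powr \<gamma>) * ennreal (size_factor (\<alpha> - \<gamma>) t 0 u)"
      by (simp add: ennreal_mult)
  qed
  also have "\<dots> \<le> ennreal (real CARD('d) * (2 powi k * t) powr \<gamma>) * ennreal (size_const CARD('d) (\<alpha> - \<gamma>))"
    using t \<gamma> by (subst nn_integral_cmult) (auto intro!: mult_left_mono nn_integral_size_factor)
  also have "\<dots> = ennreal (real CARD('d) * size_const CARD('d) (\<alpha> - \<gamma>) * (2 powi k * t) powr \<gamma>)"
    using \<gamma> by (simp add: size_const_nonneg mult_ac flip: ennreal_mult)
  finally show ?thesis .
qed

text \<open>In the non-integrable case the left side is 0 by convention.\<close>

lemma norm_integral_le_nn_integral:
  fixes f :: "'a \<Rightarrow> 'b::{banach, second_countable_topology}"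
  shows "ennreal (norm (LINT x|M. f x)) \<le> (\<integral>\<^sup>+x. ennreal (norm (f x)) \<partial>M)"
proof (cases "integrable M f")
  case True then show ?thesis by (rule integral_norm_bound_ennreal)
qed (simp add: not_integrable_integral_eq)

text \<open>Schur's test in the form used for operator-valued kernels: \<open>g y\<close> is thought of as an element
  of \<open>L\<^sup>2\<close> of norm at most \<open>\<omega> y * sqrt (N y)\<close>.\<close>

lemma weighted_Cauchy_Schwarz:
  fixes g :: "'y::euclidean_space \<Rightarrow> 'w::euclidean_space \<Rightarrow> complex"
  assumes g [measurable]: "(\<lambda>(y, w). g y w) \<in> borel_measurable borel"
    and \<omega> [measurable]: "\<omega> \<in> borel_measurable borel"
    and N [measurable]: "N \<in> borel_measurable borel"
    and \<omega>0: "\<And>y. 0 \<le> \<omega> y" and \<omega>g: "\<And>y w. \<omega> y = 0 \<Longrightarrow> g y w = 0"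
    and bd: "AE y in lborel. (\<integral>\<^sup>+w. ennreal ((norm (g y w))\<^sup>2) \<partial>lborel) \<le> ennreal ((\<omega> y)\<^sup>2) * N y"
  shows "(\<integral>\<^sup>+w. ennreal ((norm (LINT y|lborel. g y w))\<^sup>2) \<partial>lborel)
    \<le> (\<integral>\<^sup>+y. ennreal (\<omega> y) \<partial>lborel) * (\<integral>\<^sup>+y. ennreal (\<omega> y) * N y \<partial>lborel)"
proof -
  let ?W = "\<integral>\<^sup>+y. ennreal (\<omega> y) \<partial>lborel"
  note [measurable (raw)] = measurable_uncurry[OF g]
  have "(\<integral>\<^sup>+w. ennreal ((norm (LINT y|lborel. g y w))\<^sup>2) \<partial>lborel)
    \<le> (\<integral>\<^sup>+w. ?W * (\<integral>\<^sup>+y. ennreal ((norm (g y w))\<^sup>2 / \<omega> y) \<partial>lborel) \<partial>lborel)"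
  proof (intro nn_integral_mono)
    fix w
    \<comment> \<open>Splitting off the square root of the weight. Where the weight is 0, so is
      \<open>g\<close>, and the quotient is 0 by convention.\<close>
    have e: "ennreal (norm (g y w)) = ennreal (sqrt (\<omega> y)) * ennreal (norm (g y w) / sqrt (\<omega> y))" for y
      using \<omega>0[of y] \<omega>g[of y w] by (cases "\<omega> y = 0") (simp_all flip: ennreal_mult)
    have "ennreal ((norm (LINT y|lborel. g y w))\<^sup>2) \<le> (\<integral>\<^sup>+y. ennreal (norm (g y w)) \<partial>lborel)\<^sup>2"
      using norm_integral_le_nn_integral[of lborel "\<lambda>y. g y w"]
      by (simp add: ennreal_power[symmetric] power_mono)
    also have "\<dots> \<le> (\<integral>\<^sup>+y. (ennreal (sqrt (\<omega> y)))\<^sup>2 \<partial>lborel) * (\<integral>\<^sup>+y. (ennreal (norm (g y w) / sqrt (\<omega> y)))\<^sup>2 \<partial>lborel)"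
      unfolding e by (intro Cauchy_Schwarz_nn_integral) measurable
    also have "\<dots> = ?W * (\<integral>\<^sup>+y. ennreal ((norm (g y w))\<^sup>2 / \<omega> y) \<partial>lborel)"
      by (simp add: ennreal_power \<omega>0 power_divide)
    finally show "ennreal ((norm (LINT y|lborel. g y w))\<^sup>2) \<le> ?W * (\<integral>\<^sup>+y. ennreal ((norm (g y w))\<^sup>2 / \<omega> y) \<partial>lborel)" .
  qed
  also have "\<dots> = ?W * (\<integral>\<^sup>+w. \<integral>\<^sup>+y. ennreal ((norm (g y w))\<^sup>2 / \<omega> y) \<partial>lborel \<partial>lborel)"
    by (intro nn_integral_cmult) measurable
  also have "(\<integral>\<^sup>+w. \<integral>\<^sup>+y. ennreal ((norm (g y w))\<^sup>2 / \<omega> y) \<partial>lborel \<partial>lborel)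
     = (\<integral>\<^sup>+y. \<integral>\<^sup>+w. ennreal ((norm (g y w))\<^sup>2 / \<omega> y) \<partial>lborel \<partial>lborel)"
    by (rule nn_integral_swap) measurable
  also have "\<dots> \<le> (\<integral>\<^sup>+y. ennreal (\<omega> y) * N y \<partial>lborel)"
  proof (intro nn_integral_mono_AE, use bd in eventually_elim)
    fix y assume b: "(\<integral>\<^sup>+w. ennreal ((norm (g y w))\<^sup>2) \<partial>lborel) \<le> ennreal ((\<omega> y)\<^sup>2) * N y"
    have "(\<integral>\<^sup>+w. ennreal ((norm (g y w))\<^sup>2 / \<omega> y) \<partial>lborel) = ennreal (1 / \<omega> y) * (\<integral>\<^sup>+w. ennreal ((norm (g y w))\<^sup>2) \<partial>lborel)"
      using \<omega>0[of y] by (subst nn_integral_cmult[symmetric]) (auto simp flip: ennreal_mult intro!: nn_integral_cong)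
    also have "\<dots> \<le> ennreal (1 / \<omega> y) * (ennreal ((\<omega> y)\<^sup>2) * N y)" by (intro mult_left_mono b) simp
    also have "\<dots> = ennreal (\<omega> y) * N y"
      using \<omega>0[of y] by (simp add: mult.assoc[symmetric] power2_eq_square flip: ennreal_mult)
    finally show "(\<integral>\<^sup>+w. ennreal ((norm (g y w))\<^sup>2 / \<omega> y) \<partial>lborel) \<le> ennreal (\<omega> y) * N y" .
  qed
  finally show ?thesis by (simp add: mult_left_mono)
qed

subsection \<open>Operator-valued kernels with a cancellation condition\<close>

lemma lborel_integral_pair:
  fixes f :: "'a::euclidean_space \<times> 'b::euclidean_space \<Rightarrow> 'c::{banach, second_countable_topology}"
  assumes "integrable lborel f"
  shows "(LINT p|lborel. f p) = (LINT x|lborel. LINT y|lborel. f (x, y))"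
    and "AE x in lborel. integrable lborel (\<lambda>y. f (x, y))"
    and "integrable lborel (\<lambda>x. LINT y|lborel. f (x, y))"
  using lborel_pair.integral_fst'[of f] lborel_pair.AE_integrable_fst'[of f]
    lborel_pair.integrable_fst'[of f] assms
  by (simp_all add: lborel_prod)

lemma integrable_mult_bounded:
  fixes f g :: "'a::euclidean_space \<Rightarrow> complex"
  assumes "integrable lborel f" and [measurable]: "g \<in> borel_measurable borel" and "\<And>x. norm (g x) \<le> B"
  shows "integrable lborel (\<lambda>x. f x * g x)"
proof -
  note [measurable] = borel_measurable_integrable[OF assms(1)]
  have "norm (f x * g x) \<le> norm (\<bar>B\<bar> * norm (f x))" for x
    using mult_left_mono[OF order_trans[OF assms(3)[of x] abs_ge_self], of "norm (f x)"]
    by (simp add: norm_mult abs_mult mult.commute)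
  then show ?thesis
    using assms(1) by (intro Bochner_Integration.integrable_bound[where g="\<lambda>x. f x * g x" and f="\<lambda>x. \<bar>B\<bar> * norm (f x)"]) auto
qed

lemma AE_AE_mono:
  assumes "AE x in M. AE y in N. P x y" "\<And>x y. P x y \<Longrightarrow> Q x y"
  shows "AE x in M. AE y in N. Q x y"
  using assms by (auto elim!: eventually_mono)

lemma sqnorm_pair:
  fixes f :: "'a::euclidean_space \<times> 'b::euclidean_space \<Rightarrow> complex"
  assumes [measurable]: "f \<in> borel_measurable borel"
  shows "sqnorm f = (\<integral>\<^sup>+x. sqnorm (\<lambda>y. f (x, y)) \<partial>lborel)"
    and "sqnorm f = (\<integral>\<^sup>+y. sqnorm (\<lambda>x. f (x, y)) \<partial>lborel)"
    and "(\<lambda>x. sqnorm (\<lambda>y. f (x, y))) \<in> borel_measurable borel"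
proof -
  show 1: "sqnorm f = (\<integral>\<^sup>+x. sqnorm (\<lambda>y. f (x, y)) \<partial>lborel)"
    unfolding sqnorm_def by (rule nn_integral_pair) measurable
  show "sqnorm f = (\<integral>\<^sup>+y. sqnorm (\<lambda>x. f (x, y)) \<partial>lborel)"
    unfolding 1 unfolding sqnorm_def by (rule nn_integral_swap) measurable
  show "(\<lambda>x. sqnorm (\<lambda>y. f (x, y))) \<in> borel_measurable borel"
    unfolding sqnorm_def by measurable
qed

lemma norm_power2_diff_le: "(norm (a - b :: complex))\<^sup>2 \<le> 2 * (norm a)\<^sup>2 + 2 * (norm b)\<^sup>2"
proof -
  have "(norm (a - b))\<^sup>2 \<le> (norm a + norm b)\<^sup>2" by (intro power_mono norm_triangle_ineq4) auto
  also have "\<dots> \<le> 2 * (norm a)\<^sup>2 + 2 * (norm b)\<^sup>2"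
    using sum_squares_ge_zero[of "norm a - norm b" 0] by (simp add: power2_eq_square algebra_simps)
  finally show ?thesis .
qed

lemma sqnorm_diff_le:
  assumes [measurable]: "u \<in> borel_measurable borel" "v \<in> borel_measurable borel"
  shows "sqnorm (\<lambda>z. u z - v z) \<le> 2 * sqnorm u + 2 * sqnorm v"
proof -
  have "sqnorm (\<lambda>z. u z - v z) \<le> (\<integral>\<^sup>+z. 2 * ennreal ((norm (u z))\<^sup>2) + 2 * ennreal ((norm (v z))\<^sup>2) \<partial>lborel)"
    unfolding sqnorm_def
  proof (intro nn_integral_mono)
    fix z
    show "ennreal ((norm (u z - v z))\<^sup>2) \<le> 2 * ennreal ((norm (u z))\<^sup>2) + 2 * ennreal ((norm (v z))\<^sup>2)"
      using ennreal_leI[OF norm_power2_diff_le[of "u z" "v z"]] by (simp add: ennreal_mult)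
  qed
  also have "\<dots> = 2 * sqnorm u + 2 * sqnorm v"
    unfolding sqnorm_def by (simp add: nn_integral_add nn_integral_cmult)
  finally show ?thesis .
qed

text \<open>For fixed \<open>x, y\<close> the kernel \<open>\<kappa> x y w z\<close> represents an operator from functions of \<open>z\<close> to
  functions of \<open>w\<close>, and \<open>P\<close> is the class of functions on which its norm is controlled.\<close>

locale operator_kernel =
  fixes \<kappa> :: "real ^ 'd \<Rightarrow> real ^ 'd \<Rightarrow> 'w::euclidean_space \<Rightarrow> 'z::euclidean_space \<Rightarrow> complex"
    and P :: "('z \<Rightarrow> complex) \<Rightarrow> bool" and \<alpha> A t :: real
  assumes \<kappa>_meas: "(\<lambda>(x, y, w, z). \<kappa> x y w z) \<in> borel_measurable borel"
    and \<kappa>_int: "\<And>x w. integrable lborel (\<lambda>p. \<kappa> x (fst p) w (snd p))"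
    and size: "AE x in lborel. AE y in lborel. \<forall>v. P v \<longrightarrow>
      (\<integral>\<^sup>+w. ennreal ((norm (LINT z|lborel. \<kappa> x y w z * v z))\<^sup>2) \<partial>lborel)
        \<le> ennreal ((A * size_factor \<alpha> t x y)\<^sup>2) * sqnorm v"
    and holder: "AE x in lborel. AE y in lborel. AE y' in lborel. norm (y - y') < t / 2 \<longrightarrow> (\<forall>v. P v \<longrightarrow>
      (\<integral>\<^sup>+w. ennreal ((norm (LINT z|lborel. (\<kappa> x y w z - \<kappa> x y' w z) * v z))\<^sup>2) \<partial>lborel)
        \<le> ennreal ((A * holder_factor \<alpha> t x y y')\<^sup>2) * sqnorm v)"
    and P_diff: "\<And>u v. P u \<Longrightarrow> P v \<Longrightarrow> P (\<lambda>z. u z - v z)"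
    and A: "0 \<le> A" and \<alpha>: "0 < \<alpha>" and t: "0 < t"
begin

lemma \<kappa>_measurable [measurable (raw)]:
  assumes [measurable]: "a \<in> M \<rightarrow>\<^sub>M borel" "b \<in> M \<rightarrow>\<^sub>M borel" "c \<in> M \<rightarrow>\<^sub>M borel" "d \<in> M \<rightarrow>\<^sub>M borel"
  shows "(\<lambda>x. \<kappa> (a x) (b x) (c x) (d x)) \<in> borel_measurable M"
  using measurable_compose[of "\<lambda>x. (a x, b x, c x, d x)" M borel, OF _ \<kappa>_meas] by simp

abbreviation app :: "((real ^ 'd) \<times> 'z \<Rightarrow> complex) \<Rightarrow> real ^ 'd \<Rightarrow> 'w \<Rightarrow> complex" where
  "app D x w \<equiv> (LINT p|lborel. \<kappa> x (fst p) w (snd p) * D p)"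

lemma app_eq:
  assumes [measurable]: "D \<in> borel_measurable borel" and "\<And>p. norm (D p) \<le> B"
  shows "integrable lborel (\<lambda>p. \<kappa> x (fst p) w (snd p) * D p)"
    and "app D x w = (LINT y|lborel. LINT z|lborel. \<kappa> x y w z * D (y, z))"
proof -
  show 1: "integrable lborel (\<lambda>p. \<kappa> x (fst p) w (snd p) * D p)"
    by (rule integrable_mult_bounded[OF \<kappa>_int]) (use assms in auto)
  show "app D x w = (LINT y|lborel. LINT z|lborel. \<kappa> x y w z * D (y, z))"
    using lborel_integral_pair(1)[OF 1] by simp
qed

text \<open>For fixed x, Cauchy-Schwarz with the size kernel in y as weight; then the symmetric
  kernel is integrated in x. Each of the two integrations contributes one factor
  \<open>size_const\<close>.\<close>

lemma schur:
  fixes g :: "real ^ 'd \<Rightarrow> real ^ 'd \<Rightarrow> 'w \<Rightarrow> complex" and D :: "(real ^ 'd) \<times> 'z \<Rightarrow> complex"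
  assumes g: "(\<lambda>(x, y, w). g x y w) \<in> borel_measurable borel"
    and [measurable]: "D \<in> borel_measurable borel" and c: "0 \<le> c"
    and bd: "AE x in lborel. AE y in lborel. (\<integral>\<^sup>+w. ennreal ((norm (g x y w))\<^sup>2) \<partial>lborel)
        \<le> ennreal ((c * size_factor \<alpha> t x y)\<^sup>2) * sqnorm (\<lambda>z. D (y, z))"
  shows "(\<integral>\<^sup>+x. \<integral>\<^sup>+w. ennreal ((norm (LINT y|lborel. g x y w))\<^sup>2) \<partial>lborel \<partial>lborel)
     \<le> ennreal ((c * size_const CARD('d) \<alpha>)\<^sup>2) * sqnorm D"
proof -
  let ?S = "\<lambda>y. sqnorm (\<lambda>z. D (y, z))" and ?C = "size_const CARD('d) \<alpha>"
  note [measurable] = sqnorm_pair(3)[of D]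
  have gm: "(\<lambda>(y, w). g x y w) \<in> borel_measurable borel" for x
    using measurable_compose[of "\<lambda>q. (x, q)" borel borel, OF _ g] by (simp add: case_prod_unfold)
  have "(\<integral>\<^sup>+x. \<integral>\<^sup>+w. ennreal ((norm (LINT y|lborel. g x y w))\<^sup>2) \<partial>lborel \<partial>lborel)
    \<le> (\<integral>\<^sup>+x. ennreal ?C * (\<integral>\<^sup>+y. ennreal (size_factor \<alpha> t x y) * (ennreal (c\<^sup>2) * ?S y) \<partial>lborel) \<partial>lborel)"
  proof (intro nn_integral_mono_AE, use bd in eventually_elim)
    fix x assume b: "AE y in lborel. (\<integral>\<^sup>+w. ennreal ((norm (g x y w))\<^sup>2) \<partial>lborel)
        \<le> ennreal ((c * size_factor \<alpha> t x y)\<^sup>2) * ?S y"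
    have "(\<integral>\<^sup>+w. ennreal ((norm (LINT y|lborel. g x y w))\<^sup>2) \<partial>lborel)
      \<le> (\<integral>\<^sup>+y. ennreal (size_factor \<alpha> t x y) \<partial>lborel)
        * (\<integral>\<^sup>+y. ennreal (size_factor \<alpha> t x y) * (ennreal (c\<^sup>2) * ?S y) \<partial>lborel)"
    proof (rule weighted_Cauchy_Schwarz[OF gm])
      show "size_factor \<alpha> t x y = 0 \<Longrightarrow> g x y w = 0" for y w
        using size_factor_pos[OF t, of \<alpha> x y] by simp
      show "AE y in lborel. (\<integral>\<^sup>+w. ennreal ((norm (g x y w))\<^sup>2) \<partial>lborel)
        \<le> ennreal ((size_factor \<alpha> t x y)\<^sup>2) * (ennreal (c\<^sup>2) * ?S y)"
        using b by (simp add: power_mult_distrib ennreal_mult mult_ac)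
    qed auto
    also have "\<dots> \<le> ennreal ?C * (\<integral>\<^sup>+y. ennreal (size_factor \<alpha> t x y) * (ennreal (c\<^sup>2) * ?S y) \<partial>lborel)"
      by (intro mult_right_mono nn_integral_size_factor t \<alpha>) auto
    finally show "(\<integral>\<^sup>+w. ennreal ((norm (LINT y|lborel. g x y w))\<^sup>2) \<partial>lborel) \<le> \<dots>" .
  qed
  also have "\<dots> = ennreal ?C * (\<integral>\<^sup>+y. \<integral>\<^sup>+x. ennreal (size_factor \<alpha> t x y) * (ennreal (c\<^sup>2) * ?S y) \<partial>lborel \<partial>lborel)"
    by (subst nn_integral_swap[symmetric]) (auto intro!: nn_integral_cmult)
  also have "(\<integral>\<^sup>+y. \<integral>\<^sup>+x. ennreal (size_factor \<alpha> t x y) * (ennreal (c\<^sup>2) * ?S y) \<partial>lborel \<partial>lborel)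
      \<le> (\<integral>\<^sup>+y. ennreal ?C * (ennreal (c\<^sup>2) * ?S y) \<partial>lborel)"
  proof (intro nn_integral_mono)
    fix y
    have "(\<integral>\<^sup>+x. ennreal (size_factor \<alpha> t x y) * (ennreal (c\<^sup>2) * ?S y) \<partial>lborel)
      = (\<integral>\<^sup>+x. ennreal (size_factor \<alpha> t y x) \<partial>lborel) * (ennreal (c\<^sup>2) * ?S y)"
      by (subst size_factor_commute) (simp add: nn_integral_multc)
    also have "\<dots> \<le> ennreal ?C * (ennreal (c\<^sup>2) * ?S y)"
      by (intro mult_right_mono nn_integral_size_factor t \<alpha>) auto
    finally show "(\<integral>\<^sup>+x. ennreal (size_factor \<alpha> t x y) * (ennreal (c\<^sup>2) * ?S y) \<partial>lborel) \<le> ennreal ?C * (ennreal (c\<^sup>2) * ?S y)" .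
  qed
  also have "(\<integral>\<^sup>+y. ennreal ?C * (ennreal (c\<^sup>2) * ?S y) \<partial>lborel) = ennreal ?C * (ennreal (c\<^sup>2) * sqnorm D)"
    by (simp add: nn_integral_cmult sqnorm_pair(1)[of D])
  finally have "(\<integral>\<^sup>+x. \<integral>\<^sup>+w. ennreal ((norm (LINT y|lborel. g x y w))\<^sup>2) \<partial>lborel \<partial>lborel)
     \<le> ennreal ?C * (ennreal ?C * (ennreal (c\<^sup>2) * sqnorm D))" by (simp add: mult_left_mono)
  also have "\<dots> = ennreal ((c * ?C)\<^sup>2) * sqnorm D"
    using size_const_nonneg[OF \<alpha>] c by (simp add: power2_eq_square ennreal_mult mult_ac)
  finally show ?thesis .
qed

lemma app_bound:
  assumes [measurable]: "D \<in> borel_measurable borel" and B: "\<And>p. norm (D p) \<le> B"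
    and P: "\<And>y. P (\<lambda>z. D (y, z))"
  shows "(\<integral>\<^sup>+x. \<integral>\<^sup>+w. ennreal ((norm (app D x w))\<^sup>2) \<partial>lborel \<partial>lborel)
     \<le> ennreal ((A * size_const CARD('d) \<alpha>)\<^sup>2) * sqnorm D"
  unfolding app_eq(2)[of D, OF assms(1) B]
proof (rule schur)
  show "(\<lambda>(x, y, w). LINT z|lborel. \<kappa> x y w z * D (y, z)) \<in> borel_measurable borel"
    by measurable
  show "AE x in lborel. AE y in lborel. (\<integral>\<^sup>+w. ennreal ((norm (LINT z|lborel. \<kappa> x y w z * D (y, z)))\<^sup>2) \<partial>lborel)
        \<le> ennreal ((A * size_factor \<alpha> t x y)\<^sup>2) * sqnorm (\<lambda>z. D (y, z))"
    using size by eventually_elim (auto elim!: eventually_mono simp: P)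
qed (use A in auto)

text \<open>Because \<open>D\<close> has mean zero in y on every cube of generation
  \<open>k\<close>, the kernel may be replaced by its difference to its own average over the cube of
  y. This is the form to which the Hoelder estimate applies.\<close>

lemma app_cancel:
  assumes D [measurable]: "D \<in> borel_measurable borel" and B: "\<And>p. norm (D p) \<le> B"
    and canc: "\<And>y z. avg k (\<lambda>y. D (y, z)) y = 0"
  shows "app D x w = (LINT y|lborel. LINT y'|lborel. of_real (avker k y y') *
           (LINT z|lborel. (\<kappa> x y w z - \<kappa> x y' w z) * D (y, z)))"
proof -
  \<comment> \<open>The term to be subtracted. Integrated in y first, it contains the average of
    \<open>D\<close> over a cube, which is zero.\<close>
  define \<phi> where "\<phi> y p = of_real (avker k y (fst p)) * (\<kappa> x (fst p) w (snd p) * D (y, snd p))" for y p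
  have B0: "0 \<le> B" using B[of undefined] norm_ge_zero order_trans by blast
  have i\<phi>: "integrable lborel (\<lambda>q. \<phi> (fst q) (snd q))"
  proof (rule integrableI_bounded)
    show "(\<lambda>q. \<phi> (fst q) (snd q)) \<in> borel_measurable lborel" unfolding \<phi>_def by measurable
    have "(\<integral>\<^sup>+q. ennreal (norm (\<phi> (fst q) (snd q))) \<partial>lborel)
      \<le> (\<integral>\<^sup>+q. ennreal (avker k (fst q) (fst (snd q))) * ennreal (norm (\<kappa> x (fst (snd q)) w (snd (snd q))) * B) \<partial>lborel)"
    proof (intro nn_integral_mono)
      fix q :: "(real ^ 'd) \<times> (real ^ 'd) \<times> 'z"
      have "norm (\<phi> (fst q) (snd q)) \<le> avker k (fst q) (fst (snd q)) * (norm (\<kappa> x (fst (snd q)) w (snd (snd q))) * B)"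
        unfolding \<phi>_def norm_mult by (intro mult_mono) (auto simp: B)
      then show "ennreal (norm (\<phi> (fst q) (snd q))) \<le> ennreal (avker k (fst q) (fst (snd q))) * ennreal (norm (\<kappa> x (fst (snd q)) w (snd (snd q))) * B)"
        using B0 by (simp add: ennreal_leI flip: ennreal_mult)
    qed
    also have "\<dots> = (\<integral>\<^sup>+p. (\<integral>\<^sup>+y. ennreal (avker k (fst p) y) * ennreal (norm (\<kappa> x (fst p) w (snd p)) * B) \<partial>lborel) \<partial>lborel)"
      by (subst nn_integral_pair, measurable, subst nn_integral_swap, measurable) (simp add: avker_commute)
    also have "\<dots> = (\<integral>\<^sup>+p. ennreal (norm (\<kappa> x (fst p) w (snd p) * of_real B)) \<partial>lborel)"
      using B0 by (simp add: nn_integral_multc nn_integral_avker norm_mult)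
    also have "\<dots> < \<infinity>"
    proof -
      have "integrable lborel (\<lambda>p. \<kappa> x (fst p) w (snd p) * of_real B)" using \<kappa>_int by simp
      then show ?thesis by (simp add: integrable_iff_bounded)
    qed
    finally show "(\<integral>\<^sup>+q. ennreal (norm (\<phi> (fst q) (snd q))) \<partial>lborel) < \<infinity>" .
  qed
  have "(LINT y|lborel. LINT p|lborel. \<phi> y p) = (LINT p|lborel. LINT y|lborel. \<phi> y p)"
    using lborel_Fubini[OF i\<phi>] by simp
  also have "\<dots> = (LINT p|lborel. \<kappa> x (fst p) w (snd p) * avg k (\<lambda>y. D (y, snd p)) (fst p))"
  proof (intro Bochner_Integration.integral_cong refl)
    fix p
    have "(LINT y|lborel. \<phi> y p) = (LINT y|lborel. \<kappa> x (fst p) w (snd p) * (avker k (fst p) y *\<^sub>R D (y, snd p)))"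
      unfolding \<phi>_def by (intro Bochner_Integration.integral_cong refl) (simp add: scaleR_conv_of_real avker_commute)
    then show "(LINT y|lborel. \<phi> y p) = \<kappa> x (fst p) w (snd p) * avg k (\<lambda>y. D (y, snd p)) (fst p)"
      unfolding avg_def by (simp only: Bochner_Integration.integral_mult_right_zero)
  qed
  finally have \<phi>0: "(LINT y|lborel. LINT p|lborel. \<phi> y p) = 0" by (simp add: canc)
  note fst\<kappa> = lborel_integral_pair(2)[OF \<kappa>_int[of x w], simplified]
  \<comment> \<open>Integrability of the sections, needed to split the difference, is available for
    almost every y and y' only.\<close>
  have ae: "AE y in lborel. (LINT y'|lborel. of_real (avker k y y') * (LINT z|lborel. (\<kappa> x y w z - \<kappa> x y' w z) * D (y, z)))
      = (LINT z|lborel. \<kappa> x y w z * D (y, z)) - (LINT p|lborel. \<phi> y p)"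
    using fst\<kappa> lborel_integral_pair(2)[OF i\<phi>, simplified]
  proof eventually_elim
    case (elim y)
    have Dz: "(\<lambda>z. D (y, z)) \<in> borel_measurable borel" by measurable
    let ?a = "LINT z|lborel. \<kappa> x y w z * D (y, z)"
    have "AE y' in lborel. of_real (avker k y y') * (LINT z|lborel. (\<kappa> x y w z - \<kappa> x y' w z) * D (y, z))
      = of_real (avker k y y') * ?a - (LINT z|lborel. \<phi> y (y', z))"
      using fst\<kappa>
    proof eventually_elim
      case (elim y')
      have "integrable lborel (\<lambda>z. \<kappa> x y w z * D (y, z))" "integrable lborel (\<lambda>z. \<kappa> x y' w z * D (y, z))"
        using integrable_mult_bounded[OF \<open>integrable lborel (\<kappa> x y w)\<close> Dz B]
              integrable_mult_bounded[OF elim Dz B] by auto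
      then show ?case by (simp add: \<phi>_def left_diff_distrib right_diff_distrib)
    qed
    moreover have "integrable lborel (\<lambda>y'. of_real (avker k y y') * ?a)"
      by (intro integrable_mult_left integrable_of_real integrable_avker)
    moreover have "(LINT y'|lborel. of_real (avker k y y') * ?a) = ?a"
      by (simp add: integral_avker)
    moreover have "(\<lambda>y'. LINT z|lborel. \<phi> y (y', z)) \<in> borel_measurable lborel"
      unfolding \<phi>_def by measurable
    ultimately show ?case
      using lborel_integral_pair(1,3)[OF elim(2)]
      by (subst integral_cong_AE[where g="\<lambda>y'. of_real (avker k y y') * ?a - (LINT z|lborel. \<phi> y (y', z))"])
         simp_all
  qed
  have "app D x w = (LINT y|lborel. LINT z|lborel. \<kappa> x y w z * D (y, z)) - (LINT y|lborel. LINT p|lborel. \<phi> y p)"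
    using \<phi>0 app_eq(2)[OF D B] by simp
  also have "\<dots> = (LINT y|lborel. (LINT z|lborel. \<kappa> x y w z * D (y, z)) - (LINT p|lborel. \<phi> y p))"
    using lborel_integral_pair(3)[OF i\<phi>] lborel_integral_pair(3)[OF app_eq(1)[OF D B, of x w]] by simp
  also have "\<dots> = (LINT y|lborel. LINT y'|lborel. of_real (avker k y y') *
           (LINT z|lborel. (\<kappa> x y w z - \<kappa> x y' w z) * D (y, z)))"
    using ae by (intro integral_cong_AE) (auto simp: \<phi>_def)
  finally show ?thesis .
qed

text \<open>If the cubes on which \<open>D\<close> has mean zero are small against t, the Hoelder
  estimate gains the ratio of cube size and t to the power \<alpha>; if they are not, that ratio is
  no gain and the bound without cancellation suffices.\<close>

lemma app_fine:
  assumes D [measurable]: "D \<in> borel_measurable borel" and B: "\<And>p. norm (D p) \<le> B"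
    and P: "\<And>y. P (\<lambda>z. D (y, z))"
    and canc: "\<And>y z. avg k (\<lambda>y. D (y, z)) y = 0"
  shows "(\<integral>\<^sup>+x. \<integral>\<^sup>+w. ennreal ((norm (app D x w))\<^sup>2) \<partial>lborel \<partial>lborel)
     \<le> ennreal ((A * (2 * real CARD('d) * 2 powi (-k) / t) powr \<alpha> * size_const CARD('d) \<alpha>)\<^sup>2) * sqnorm D"
proof -
  let ?C = "size_const CARD('d) \<alpha>"
  define r where "r = real CARD('d) * 2 powi (-k)"
  \<comment> \<open>The factor 2 makes \<open>H\<close> at least 1 as soon as
    \<open>r < t / 2\<close> fails, that is, when the Hoelder estimate may be inapplicable.\<close>
  define H where "H = (2 * r / t) powr \<alpha>"
  have r: "0 < r" by (simp add: r_def)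
  show ?thesis
  proof (cases "r < t / 2")
    case False
    then have "1 \<le> H" unfolding H_def using t \<alpha> by (intro ge_one_powr_ge_zero) auto
    then have "(A * ?C)\<^sup>2 \<le> (A * H * ?C)\<^sup>2"
      using A size_const_nonneg[OF \<alpha>, of "CARD('d)"]
      by (intro power_mono mult_right_mono) (auto intro: mult_left_mono[of 1 H A, simplified])
    then have "(\<integral>\<^sup>+x. \<integral>\<^sup>+w. ennreal ((norm (app D x w))\<^sup>2) \<partial>lborel \<partial>lborel) \<le> ennreal ((A * H * ?C)\<^sup>2) * sqnorm D"
      by (intro order_trans[OF app_bound[OF D B P]] mult_right_mono ennreal_leI) auto
    then show ?thesis by (simp add: H_def r_def mult.assoc)
  next
    case True
    have hold: "holder_factor \<alpha> t x y y' \<le> H * size_factor \<alpha> t x y" if "same_cube k y y'" for x y y' :: "real ^ 'd"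
    proof -
      have "norm (y - y') \<le> 2 * r" using same_cube_dist[OF that] r unfolding r_def by linarith
      then have "norm (y - y') powr \<alpha> \<le> (2 * r) powr \<alpha>" using \<alpha> by (intro powr_mono2) auto
      also have "\<dots> = H * t powr \<alpha>" using r t by (simp add: H_def powr_divide)
      finally show ?thesis
        unfolding holder_factor_def size_factor_def times_divide_eq_right
        by (intro divide_right_mono) auto
    qed
    have "(\<integral>\<^sup>+x. \<integral>\<^sup>+w. ennreal ((norm (app D x w))\<^sup>2) \<partial>lborel \<partial>lborel) \<le> ennreal ((A * H * ?C)\<^sup>2) * sqnorm D"
      unfolding app_cancel[OF D B canc]
    proof (rule schur)
      show "(\<lambda>(x, y, w). LINT y'|lborel. complex_of_real (avker k y y') *
           (LINT z|lborel. (\<kappa> x y w z - \<kappa> x y' w z) * D (y, z))) \<in> borel_measurable borel"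
        by measurable
      show "AE x in lborel. AE y in lborel. (\<integral>\<^sup>+w. ennreal ((norm (LINT y'|lborel. complex_of_real (avker k y y') *
           (LINT z|lborel. (\<kappa> x y w z - \<kappa> x y' w z) * D (y, z))))\<^sup>2) \<partial>lborel)
        \<le> ennreal ((A * H * size_factor \<alpha> t x y)\<^sup>2) * sqnorm (\<lambda>z. D (y, z))"
      proof (rule AE_AE_mono[OF holder])
        fix x y assume ae: "AE y' in lborel. norm (y - y') < t / 2 \<longrightarrow> (\<forall>v. P v \<longrightarrow>
          (\<integral>\<^sup>+w. ennreal ((norm (LINT z|lborel. (\<kappa> x y w z - \<kappa> x y' w z) * v z))\<^sup>2) \<partial>lborel)
            \<le> ennreal ((A * holder_factor \<alpha> t x y y')\<^sup>2) * sqnorm v)"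
        let ?N = "ennreal ((A * H * size_factor \<alpha> t x y)\<^sup>2) * sqnorm (\<lambda>z. D (y, z))"
        \<comment> \<open>The inner average is estimated with the probability density
          \<open>avker k y\<close> as weight, and the bound \<open>?N\<close> is independent of y',
          so no constant is lost.\<close>
        have "(\<integral>\<^sup>+w. ennreal ((norm (LINT y'|lborel. complex_of_real (avker k y y') *
           (LINT z|lborel. (\<kappa> x y w z - \<kappa> x y' w z) * D (y, z))))\<^sup>2) \<partial>lborel)
          \<le> (\<integral>\<^sup>+y'. ennreal (avker k y y') \<partial>lborel) * (\<integral>\<^sup>+y'. ennreal (avker k y y') * ?N \<partial>lborel)"
        proof (rule weighted_Cauchy_Schwarz)
          show "AE y' in lborel. (\<integral>\<^sup>+w. ennreal ((norm (complex_of_real (avker k y y') *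
              (LINT z|lborel. (\<kappa> x y w z - \<kappa> x y' w z) * D (y, z))))\<^sup>2) \<partial>lborel) \<le> ennreal ((avker k y y')\<^sup>2) * ?N"
            using ae
          proof eventually_elim
            case (elim y')
            show ?case
            proof (cases "same_cube k y y'")
              case same: True
              then have "norm (y - y') < t / 2" using same_cube_dist[OF same] True by (simp add: r_def)
              then have "(\<integral>\<^sup>+w. ennreal ((norm (LINT z|lborel. (\<kappa> x y w z - \<kappa> x y' w z) * D (y, z)))\<^sup>2) \<partial>lborel)
                \<le> ennreal ((A * holder_factor \<alpha> t x y y')\<^sup>2) * sqnorm (\<lambda>z. D (y, z))"
                using elim P by blast
              also have "\<dots> \<le> ?N"
                using mult_left_mono[OF hold[OF same, of x] A] A
                by (intro mult_right_mono ennreal_leI power_mono)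
                   (auto simp: mult.assoc holder_factor_def)
              finally have le: "(\<integral>\<^sup>+w. ennreal ((norm (LINT z|lborel. (\<kappa> x y w z - \<kappa> x y' w z) * D (y, z)))\<^sup>2) \<partial>lborel) \<le> ?N" .
              have "(\<integral>\<^sup>+w. ennreal ((norm (complex_of_real (avker k y y') *
                  (LINT z|lborel. (\<kappa> x y w z - \<kappa> x y' w z) * D (y, z))))\<^sup>2) \<partial>lborel)
                = ennreal ((avker k y y')\<^sup>2) * (\<integral>\<^sup>+w. ennreal ((norm (LINT z|lborel. (\<kappa> x y w z - \<kappa> x y' w z) * D (y, z)))\<^sup>2) \<partial>lborel)"
                by (subst nn_integral_cmult[symmetric], measurable)
                   (simp add: norm_mult power_mult_distrib ennreal_mult)
              then show ?thesis using le by (simp add: mult_left_mono)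
            qed (simp add: avker_def)
          qed
          show "(\<lambda>(y', w). complex_of_real (avker k y y') *
              (LINT z|lborel. (\<kappa> x y w z - \<kappa> x y' w z) * D (y, z))) \<in> borel_measurable borel"
            unfolding case_prod_unfold by measurable
        qed auto
        also have "\<dots> = ?N" by (simp add: nn_integral_avker nn_integral_multc)
        finally show "(\<integral>\<^sup>+w. ennreal ((norm (LINT y'|lborel. complex_of_real (avker k y y') *
           (LINT z|lborel. (\<kappa> x y w z - \<kappa> x y' w z) * D (y, z))))\<^sup>2) \<partial>lborel) \<le> ?N" .
      qed
    qed (use A in \<open>auto simp: H_def\<close>)
    then show ?thesis by (simp add: H_def r_def mult.assoc)
  qed
qed

text \<open>The differences of \<open>D\<close> between points of one cube vanish, so only
  \<open>offker\<close> enters. Its mass at a single point x need not be small; the hypothesis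
  bounds its averages over cubes, which is enough since the norm of the section of \<open>D\<close>
  is constant on each cube. The constant is 4 = 2 * 2: a square of a difference, and two equal
  integrals.\<close>

lemma app_coarse:
  assumes D [measurable]: "D \<in> borel_measurable borel" and B: "\<And>p. norm (D p) \<le> B"
    and P: "\<And>y. P (\<lambda>z. D (y, z))"
    and const: "\<And>y y' z. same_cube l y y' \<Longrightarrow> D (y, z) = D (y', z)"
    and M: "\<And>x0 :: real ^ 'd. (\<integral>\<^sup>+x. ennreal (avker l x0 x) * (\<integral>\<^sup>+y. ennreal (offker l \<alpha> t x y) \<partial>lborel) \<partial>lborel) \<le> ennreal M"
      "0 \<le> M"
  shows "(\<integral>\<^sup>+x. \<integral>\<^sup>+w. ennreal ((norm (app (\<lambda>p. D p - D (x, snd p)) x w))\<^sup>2) \<partial>lborel \<partial>lborel)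
     \<le> ennreal (4 * A\<^sup>2 * size_const CARD('d) \<alpha> * M) * sqnorm D"
proof -
  let ?C = "size_const CARD('d) \<alpha>" and ?S = "\<lambda>y. sqnorm (\<lambda>z. D (y, z))"
  let ?k = "\<lambda>x y :: real ^ 'd. ennreal (offker l \<alpha> t x y)"
  define W where "W x = (\<integral>\<^sup>+y. ?k x y \<partial>lborel)" for x
  note [measurable] = sqnorm_pair(3)[of D]
  have [measurable]: "W \<in> borel_measurable borel" unfolding W_def by measurable
  have "(\<integral>\<^sup>+x. \<integral>\<^sup>+w. ennreal ((norm (app (\<lambda>p. D p - D (x, snd p)) x w))\<^sup>2) \<partial>lborel \<partial>lborel)
    \<le> (\<integral>\<^sup>+x. ennreal ?C * (\<integral>\<^sup>+y. ?k x y * (ennreal (2 * A\<^sup>2) * (?S y + ?S x)) \<partial>lborel) \<partial>lborel)"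
  proof (intro nn_integral_mono_AE, use size in eventually_elim)
    fix x assume ae: "AE y in lborel. \<forall>v. P v \<longrightarrow>
      (\<integral>\<^sup>+w. ennreal ((norm (LINT z|lborel. \<kappa> x y w z * v z))\<^sup>2) \<partial>lborel)
        \<le> ennreal ((A * size_factor \<alpha> t x y)\<^sup>2) * sqnorm v"
    have eq: "app (\<lambda>p. D p - D (x, snd p)) x w = (LINT y|lborel. LINT z|lborel. \<kappa> x y w z * (D (y, z) - D (x, z)))" for w
      by (subst app_eq(2)[where B="B + B"]) (auto simp del: mult_2 intro: order_trans[OF norm_triangle_ineq4 add_mono[OF B B], simplified])
    have "(\<integral>\<^sup>+w. ennreal ((norm (app (\<lambda>p. D p - D (x, snd p)) x w))\<^sup>2) \<partial>lborel)
      \<le> (\<integral>\<^sup>+y. ?k x y \<partial>lborel) * (\<integral>\<^sup>+y. ?k x y * (ennreal (2 * A\<^sup>2) * (?S y + ?S x)) \<partial>lborel)"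
      unfolding eq
    proof (rule weighted_Cauchy_Schwarz)
      show "(LINT z|lborel. \<kappa> x y w z * (D (y, z) - D (x, z))) = 0" if "offker l \<alpha> t x y = 0" for y w
      proof -
        have "same_cube l x y" using that size_factor_pos[OF t, of \<alpha> x y] by (auto simp: offker_def split: if_splits)
        then show ?thesis by (simp add: const)
      qed
      show "AE y in lborel. (\<integral>\<^sup>+w. ennreal ((norm (LINT z|lborel. \<kappa> x y w z * (D (y, z) - D (x, z))))\<^sup>2) \<partial>lborel)
        \<le> ennreal ((offker l \<alpha> t x y)\<^sup>2) * (ennreal (2 * A\<^sup>2) * (?S y + ?S x))"
        using ae
      proof eventually_elim
        case (elim y)
        show ?case
        proof (cases "same_cube l x y")
          case True then show ?thesis by (simp add: const)
        next
          case False
          have "(\<integral>\<^sup>+w. ennreal ((norm (LINT z|lborel. \<kappa> x y w z * (D (y, z) - D (x, z))))\<^sup>2) \<partial>lborel)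
             \<le> ennreal ((A * size_factor \<alpha> t x y)\<^sup>2) * sqnorm (\<lambda>z. D (y, z) - D (x, z))"
            \<comment> \<open>The operator bound is applied to a difference of two sections; for
              this the class \<open>P\<close> has to be closed under differences.\<close>
            using elim P P_diff by blast
          also have "\<dots> \<le> ennreal ((A * size_factor \<alpha> t x y)\<^sup>2) * (2 * ?S y + 2 * ?S x)"
            by (intro mult_left_mono sqnorm_diff_le) auto
          also have "\<dots> = ennreal ((offker l \<alpha> t x y)\<^sup>2) * (ennreal (2 * A\<^sup>2) * (?S y + ?S x))"
            using False by (simp add: offker_def power_mult_distrib ennreal_mult distrib_left mult_ac)
          finally show ?thesis .
        qed
      qed
      show "(\<lambda>(y, w). LINT z|lborel. \<kappa> x y w z * (D (y, z) - D (x, z))) \<in> borel_measurable borel"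
        unfolding case_prod_unfold by measurable
    qed auto
    also have "\<dots> \<le> ennreal ?C * (\<integral>\<^sup>+y. ?k x y * (ennreal (2 * A\<^sup>2) * (?S y + ?S x)) \<partial>lborel)"
      by (intro mult_right_mono nn_integral_offker_le t \<alpha>) auto
    finally show "(\<integral>\<^sup>+w. ennreal ((norm (app (\<lambda>p. D p - D (x, snd p)) x w))\<^sup>2) \<partial>lborel) \<le> \<dots>" .
  qed
  also have "\<dots> = ennreal ?C * (ennreal (2 * A\<^sup>2) * ((\<integral>\<^sup>+x. \<integral>\<^sup>+y. ?k x y * ?S y \<partial>lborel \<partial>lborel) + (\<integral>\<^sup>+x. \<integral>\<^sup>+y. ?k x y * ?S x \<partial>lborel \<partial>lborel)))"
  proof -
    have "?k x y * (ennreal (2 * A\<^sup>2) * (?S y + ?S x)) = ennreal (2 * A\<^sup>2) * (?k x y * ?S y + ?k x y * ?S x)" for x y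
      by (simp add: distrib_left mult_ac)
    then show ?thesis by (simp add: nn_integral_cmult nn_integral_add)
  qed
  also have "(\<integral>\<^sup>+x. \<integral>\<^sup>+y. ?k x y * ?S y \<partial>lborel \<partial>lborel) = (\<integral>\<^sup>+x. W x * ?S x \<partial>lborel)"
    by (subst nn_integral_swap, measurable) (subst offker_commute, simp add: W_def nn_integral_multc)
  also have "(\<integral>\<^sup>+x. \<integral>\<^sup>+y. ?k x y * ?S x \<partial>lborel \<partial>lborel) = (\<integral>\<^sup>+x. W x * ?S x \<partial>lborel)"
    by (simp add: W_def nn_integral_multc)
  \<comment> \<open>A probability average is inserted and its base point moved: \<open>?S\<close>
    takes equal values at both points, so \<open>W\<close> is met only through its averages.\<close>
  also have "(\<integral>\<^sup>+x. W x * ?S x \<partial>lborel) \<le> ennreal M * sqnorm D"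
  proof -
    have "(\<integral>\<^sup>+x. W x * ?S x \<partial>lborel) = (\<integral>\<^sup>+x. \<integral>\<^sup>+x0. ennreal (avker l x x0) * (W x * ?S x) \<partial>lborel \<partial>lborel)"
      by (simp add: nn_integral_multc nn_integral_avker)
    also have "\<dots> = (\<integral>\<^sup>+x0. \<integral>\<^sup>+x. ennreal (avker l x x0) * (W x * ?S x) \<partial>lborel \<partial>lborel)"
      by (rule nn_integral_swap) measurable
    also have "\<dots> = (\<integral>\<^sup>+x0. \<integral>\<^sup>+x. ennreal (avker l x0 x) * W x * ?S x0 \<partial>lborel \<partial>lborel)"
    proof (intro nn_integral_cong)
      fix x x0
      have "same_cube l x x0 \<Longrightarrow> ?S x = ?S x0" by (simp only: const)
      then show "ennreal (avker l x x0) * (W x * ?S x) = ennreal (avker l x0 x) * W x * ?S x0"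
        by (auto simp: avker_def same_cube_commute mult_ac)
    qed
    also have "\<dots> = (\<integral>\<^sup>+x0. (\<integral>\<^sup>+x. ennreal (avker l x0 x) * W x \<partial>lborel) * ?S x0 \<partial>lborel)"
      by (simp add: nn_integral_multc)
    also have "\<dots> \<le> (\<integral>\<^sup>+x0. ennreal M * ?S x0 \<partial>lborel)"
      using M(1) unfolding W_def by (intro nn_integral_mono mult_right_mono) auto
    finally show ?thesis by (simp add: nn_integral_cmult sqnorm_pair(1)[of D])
  qed
  finally have "(\<integral>\<^sup>+x. \<integral>\<^sup>+w. ennreal ((norm (app (\<lambda>p. D p - D (x, snd p)) x w))\<^sup>2) \<partial>lborel \<partial>lborel)
     \<le> ennreal ?C * (ennreal (2 * A\<^sup>2) * (ennreal M * sqnorm D + ennreal M * sqnorm D))"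
    by (simp add: mult_left_mono add_mono)
  also have "\<dots> = ennreal (4 * A\<^sup>2 * ?C * M) * sqnorm D"
  proof -
    have "ennreal (4 * A\<^sup>2 * ?C * M) = ennreal ?C * (ennreal (2 * A\<^sup>2) * (ennreal M + ennreal M))"
      using M(2) size_const_nonneg[OF \<alpha>, of "CARD('d)"]
      by (simp flip: ennreal_mult ennreal_plus add: mult_ac)
    then show ?thesis by (simp add: distrib_right mult.assoc)
  qed
  finally show ?thesis .
qed

end

subsection \<open>Martingale differences\<close>

definition pavg :: "int \<Rightarrow> ((real ^ 'd) \<times> 'z::euclidean_space \<Rightarrow> complex) \<Rightarrow> (real ^ 'd) \<times> 'z \<Rightarrow> complex" where
  "pavg k f p = avg k (\<lambda>y. f (y, snd p)) (fst p)"

lemma bdd_supp_pavg: "bdd_supp f \<Longrightarrow> bdd_supp (pavg k f)"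
  unfolding pavg_def[abs_def] by (rule bdd_supp_avg_param)

lemma pavg_same_cube: "same_cube k y y' \<Longrightarrow> pavg k f (y, z) = pavg k f (y', z)"
  by (simp add: pavg_def avg_same_cube)

lemma sqnorm_pavg_orthogonal:
  assumes f: "bdd_supp f" and "k \<le> l"
  shows "sqnorm (pavg k f) + sqnorm (\<lambda>p. pavg l f p - pavg k f p) = sqnorm (pavg l f)"
proof -
  note [measurable] = bdd_supp_measurable[OF f] bdd_supp_measurable[OF bdd_supp_pavg[OF f]]
  have "sqnorm (pavg k f) + sqnorm (\<lambda>p. pavg l f p - pavg k f p)
    = (\<integral>\<^sup>+z. sqnorm (avg k (\<lambda>y. f (y, z))) + sqnorm (\<lambda>y. avg l (\<lambda>y. f (y, z)) y - avg k (\<lambda>y. f (y, z)) y) \<partial>lborel)"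
    unfolding sqnorm_pair(2)[of "pavg k f", OF bdd_supp_measurable[OF bdd_supp_pavg[OF f]]]
    by (subst sqnorm_pair(2), measurable, subst nn_integral_add[symmetric])
       (auto simp: pavg_def sqnorm_def bdd_supp_measurable[OF f])
  also have "\<dots> = (\<integral>\<^sup>+z. sqnorm (avg l (\<lambda>y. f (y, z))) \<partial>lborel)"
    using assms by (intro nn_integral_cong sqnorm_avg_orthogonal bdd_supp_section)
  also have "\<dots> = sqnorm (pavg l f)"
    by (subst sqnorm_pair(2)) (auto simp: pavg_def intro: arg_cong2[where f=nn_integral])
  finally show ?thesis .
qed

text \<open>Index 0 is the average of the starting generation itself, so that partial sums telescope
  to \<open>pavg\<close> without remainder. Index \<open>Suc m\<close> has mean zero on cubes of
  generation \<open>k + int m\<close> and is constant on those of generation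
  \<open>k + int (Suc m)\<close>.\<close>

definition mdiff :: "int \<Rightarrow> ((real ^ 'd) \<times> 'z::euclidean_space \<Rightarrow> complex) \<Rightarrow> nat \<Rightarrow> (real ^ 'd) \<times> 'z \<Rightarrow> complex" where
  "mdiff k f i p = (case i of 0 \<Rightarrow> pavg k f p | Suc m \<Rightarrow> pavg (k + int i) f p - pavg (k + int m) f p)"

lemma sum_mdiff: "(\<Sum>i\<le>n. mdiff k f i p) = pavg (k + int n) f p"
  by (induction n) (simp_all add: mdiff_def)

lemma bdd_supp_mdiff: "bdd_supp f \<Longrightarrow> bdd_supp (mdiff k f i)"
  by (cases i) (simp_all add: mdiff_def[abs_def] bdd_supp_pavg bdd_supp_diff)

lemma sum_sqnorm_mdiff:
  assumes "bdd_supp f" shows "(\<Sum>i\<le>n. sqnorm (mdiff k f i)) = sqnorm (pavg (k + int n) f)"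
proof (induction n)
  case (Suc n)
  then show ?case using sqnorm_pavg_orthogonal[OF assms, of "k + int n" "k + int (Suc n)"]
    by (simp add: mdiff_def[abs_def])
qed (simp add: mdiff_def[abs_def])

lemma mdiff_same_cube:
  assumes "same_cube (k + int i) y y'" shows "mdiff k f i (y, z) = mdiff k f i (y', z)"
proof (cases i)
  case 0 then show ?thesis using assms by (simp add: mdiff_def pavg_same_cube)
next
  case (Suc m)
  have "same_cube (k + int m) y y'" by (rule same_cube_mono[OF _ assms]) (simp add: Suc)
  then show ?thesis using assms unfolding mdiff_def Suc by (simp add: pavg_same_cube)
qed

lemma avg_mdiff:
  assumes f: "bdd_supp f" shows "avg (k + int m) (\<lambda>y. mdiff k f (Suc m) (y, z)) y0 = 0"
proof -
  let ?f = "\<lambda>y. f (y, z)"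
  have f': "bdd_supp ?f" using bdd_supp_section[OF f] by simp
  have "avg (k + int m) (\<lambda>y. mdiff k f (Suc m) (y, z)) y0
    = avg (k + int m) (\<lambda>y. avg (k + int (Suc m)) ?f y - avg (k + int m) ?f y) y0"
    by (simp add: mdiff_def pavg_def)
  also have "\<dots> = 0"
    using avg_diff[OF bdd_supp_avg[OF f'] bdd_supp_avg[OF f']] by (simp add: avg_avg[OF f'])
  finally show ?thesis .
qed

text \<open>For such functions the martingale stops at generation \<open>K\<close>: finer averages
  reproduce the function, so no convergence question arises.\<close>

definition stepfun :: "int \<Rightarrow> ((real ^ 'd) \<times> 'z \<Rightarrow> 'b) \<Rightarrow> bool" where
  "stepfun K f \<longleftrightarrow> (\<forall>y y' z. same_cube K y y' \<longrightarrow> f (y, z) = f (y', z))"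

lemma pavg_stepfun: "stepfun K f \<Longrightarrow> K \<le> k \<Longrightarrow> pavg k f p = f p"
  unfolding pavg_def stepfun_def
  by (rule avg_const) (metis prod.collapse same_cube_mono same_cube_sym)

text \<open>Comparison with generation \<open>max k K\<close>, where averaging no longer changes
  \<open>f\<close>.\<close>

lemma sqnorm_pavg_le:
  assumes f: "bdd_supp f" and "stepfun K f" shows "sqnorm (pavg k f) \<le> sqnorm f"
proof -
  have eq: "pavg (max k K) f = f" using pavg_stepfun[OF assms(2)] by auto
  have "sqnorm (pavg k f) \<le> sqnorm (pavg (max k K) f)"
    using sqnorm_pavg_orthogonal[OF f, of k "max k K"] by (metis le_iff_add max.cobounded1)
  then show ?thesis by (simp only: eq)
qed

text \<open>Bessel's inequality for the martingale differences, uniformly in the starting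
  generation.\<close>

lemma suminf_sqnorm_mdiff:
  assumes f: "bdd_supp f" and "stepfun K f" shows "(\<Sum>i. sqnorm (mdiff k f i)) \<le> sqnorm f"
proof (rule suminf_le_const)
  show "(\<Sum>i<n. sqnorm (mdiff k f i)) \<le> sqnorm f" for n
  proof (cases n)
    case (Suc m)
    then show ?thesis
      using sum_sqnorm_mdiff[OF f, of k m] sqnorm_pavg_le[OF assms] by (simp add: lessThan_Suc_atMost)
  qed simp
qed simp

text \<open>Twice a one-sided geometric series, a bound for the sum of
  \<open>2 powr (- \<delta> * \<bar>i - J\<bar>)\<close> over i that does not depend on J.\<close>

definition geo_const :: "real \<Rightarrow> real" where "geo_const \<delta> = 2 / (1 - 2 powr (-\<delta>))"

lemma geo_const_nonneg: "0 < \<delta> \<Longrightarrow> 0 \<le> geo_const \<delta>"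
  using powr_mono[of "-\<delta>" 0 2] by (simp add: geo_const_def)

lemma sum_geo:
  assumes \<delta>: "0 < \<delta>"
  shows "(\<Sum>i<n. 2 powr (- \<delta> * \<bar>real i - real J\<bar>)) \<le> geo_const \<delta>"
proof -
  define q :: real where "q = 2 powr (-\<delta>)"
  have q: "0 < q" "q < 1" using \<delta> powr_less_mono[of "-\<delta>" 0 2] by (auto simp: q_def)
  have e: "2 powr (- \<delta> * \<bar>real i - real J\<bar>) = q ^ (if i < J then J - i else i - J)" for i
    by (auto simp: q_def powr_power of_nat_diff mult.commute)
  have geo: "(\<Sum>i\<in>S. q ^ i) \<le> 1 / (1 - q)" if "finite S" for S
    using sum_le_suminf[of "\<lambda>i. q ^ i" S] that q summable_geometric[of q] suminf_geometric[of q] by simp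
  have "(\<Sum>i<n. 2 powr (- \<delta> * \<bar>real i - real J\<bar>))
     = (\<Sum>i\<in>{..<n} \<inter> {..<J}. q ^ (J - i)) + (\<Sum>i\<in>{..<n} - {..<J}. q ^ (i - J))"
    unfolding e by (subst sum.Int_Diff[of _ _ "{..<J}"]) (auto intro!: arg_cong2[where f="(+)"] sum.cong)
  also have "(\<Sum>i\<in>{..<n} \<inter> {..<J}. q ^ (J - i)) = (\<Sum>i\<in>(\<lambda>i. J - i) ` ({..<n} \<inter> {..<J}). q ^ i)"
    by (subst sum.reindex) (auto simp: inj_on_def)
  also have "\<dots> \<le> 1 / (1 - q)" by (intro geo) auto
  also have "(\<Sum>i\<in>{..<n} - {..<J}. q ^ (i - J)) = (\<Sum>i\<in>(\<lambda>i. i - J) ` ({..<n} - {..<J}). q ^ i)"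
    by (subst sum.reindex) (auto simp: inj_on_def)
  also have "\<dots> \<le> 1 / (1 - q)" by (intro geo) auto
  finally show ?thesis by (simp add: geo_const_def q_def)
qed

lemma suminf_geo:
  assumes "0 < \<delta>"
  shows "(\<Sum>i. ennreal (2 powr (- \<delta> * \<bar>real i - real J\<bar>))) \<le> ennreal (geo_const \<delta>)"
  by (rule suminf_le_const) (use sum_geo[OF assms] in \<open>auto intro: ennreal_leI\<close>)

text \<open>The generation whose cubes have side comparable to t: t is more than half the side and
  at most the side. Thus t belongs to the Whitney region of the cube unless it equals the
  side.\<close>

definition gen :: "real \<Rightarrow> int" where "gen t = \<lfloor>- log 2 t\<rfloor>"

lemma powi_eq_powr: "(2::real) powi k = 2 powr real_of_int k"
  by (simp add: powr_real_of_int')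

lemma gen_bounds:
  assumes "0 < t" shows "2 powi (- gen t) / 2 < t" "t \<le> 2 powi (- gen t)"
proof -
  have g: "real_of_int (gen t) \<le> - log 2 t" "- log 2 t < real_of_int (gen t) + 1"
    unfolding gen_def by linarith+
  have t: "t = 2 powr (log 2 t)" using assms by simp
  have p: "(2::real) powi (- gen t) = 2 powr (- real_of_int (gen t))"
    by (simp add: powi_eq_powr)
  have "2 powi (- gen t) / 2 = (2::real) powr (- real_of_int (gen t) - 1)"
    unfolding p by (simp add: powr_diff)
  also have "\<dots> < 2 powr (log 2 t)" using g by (intro powr_less_mono) auto
  finally show "2 powi (- gen t) / 2 < t" using t by simp
  show "t \<le> 2 powi (- gen t)" unfolding p by (subst t, rule powr_mono) (use g in auto)
qed

text \<open>The sum of the constants for coarse and fine differences, from \<open>app_coarse\<close>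
  with \<open>nn_integral_avker_offker\<close> and from \<open>app_fine\<close>.\<close>

definition fine_coarse_const :: "nat \<Rightarrow> real \<Rightarrow> real \<Rightarrow> real" where
  "fine_coarse_const d \<alpha> \<gamma> = 4 * size_const d \<alpha> * (real d * size_const d (\<alpha> - \<gamma>))
     + ((8 * real d) powr \<alpha> * size_const d \<alpha>)\<^sup>2"

lemma fine_coarse_const_nonneg: "0 < \<gamma> \<Longrightarrow> \<gamma> < \<alpha> \<Longrightarrow> 0 \<le> fine_coarse_const d \<alpha> \<gamma>"
  by (simp add: fine_coarse_const_def size_const_nonneg)

context operator_kernel
begin

text \<open>Generation \<open>k + int J\<close> is the scale of t. Differences up to index J are
  compared with their value at x, and the boundary effect decays with the ratio of t to the cube;
  later ones are small through the mean zero property one generation earlier. Both give decay in the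
  distance of i and J.\<close>

lemma app_mdiff:
  fixes f :: "(real ^ 'd) \<times> 'z \<Rightarrow> complex"
  assumes f: "bdd_supp f" and P: "\<And>k y. P (\<lambda>z. pavg k f (y, z))"
    and \<gamma>: "0 < \<gamma>" "\<gamma> \<le> 1" "\<gamma> < \<alpha>" and k: "gen t = k + int J"
  shows "(\<integral>\<^sup>+x. \<integral>\<^sup>+w. ennreal ((norm (app (\<lambda>p. mdiff k f i p - (if i \<le> J then mdiff k f i (x, snd p) else 0)) x w))\<^sup>2) \<partial>lborel \<partial>lborel)
     \<le> ennreal (fine_coarse_const CARD('d) \<alpha> \<gamma> * A\<^sup>2 * 2 powr (- \<gamma> * \<bar>real i - real J\<bar>)) * sqnorm (mdiff k f i)"
proof -
  let ?D = "mdiff k f i" and ?C = "size_const CARD('d) \<alpha>" and ?d = "real CARD('d)"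
  have D: "bdd_supp ?D" using f by (rule bdd_supp_mdiff)
  note [measurable] = bdd_supp_measurable[OF D]
  obtain B where B: "\<And>p. norm (?D p) \<le> B" using bdd_supp_bound[OF D] by metis
  have P': "P (\<lambda>z. ?D (y, z))" for y
    by (cases i) (auto simp: mdiff_def intro!: P P_diff)
  have C: "0 \<le> ?C" "0 \<le> size_const CARD('d) (\<alpha> - \<gamma>)" using \<alpha> \<gamma> by (auto intro: size_const_nonneg)
  show ?thesis
  proof (cases "i \<le> J")
    case True
    let ?l = "k + int i"
    define M where "M = ?d * size_const CARD('d) (\<alpha> - \<gamma>) * (2 powi ?l * t) powr \<gamma>"
    have "(\<integral>\<^sup>+x. \<integral>\<^sup>+w. ennreal ((norm (app (\<lambda>p. ?D p - ?D (x, snd p)) x w))\<^sup>2) \<partial>lborel \<partial>lborel)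
      \<le> ennreal (4 * A\<^sup>2 * ?C * M) * sqnorm ?D"
      unfolding M_def
      by (rule app_coarse[OF _ B P' mdiff_same_cube nn_integral_avker_offker[OF t \<gamma>]]) (use C in auto)
    also have "\<dots> \<le> ennreal (fine_coarse_const CARD('d) \<alpha> \<gamma> * A\<^sup>2 * 2 powr (- \<gamma> * \<bar>real i - real J\<bar>)) * sqnorm ?D"
    proof (intro mult_right_mono ennreal_leI)
      have "2 powi ?l * t \<le> 2 powi ?l * 2 powi (- gen t)"
        using gen_bounds[OF t] by (intro mult_left_mono) auto
      also have "\<dots> = 2 powr (- \<bar>real i - real J\<bar>)"
        using True by (simp add: k powi_eq_powr flip: powr_add)
      finally have "(2 powi ?l * t) powr \<gamma> \<le> (2 powr (- \<bar>real i - real J\<bar>)) powr \<gamma>"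
        using \<gamma> t by (intro powr_mono2) auto
      also have "\<dots> = 2 powr (- \<gamma> * \<bar>real i - real J\<bar>)" by (simp add: powr_powr mult.commute)
      finally have "4 * A\<^sup>2 * ?C * M \<le> 4 * A\<^sup>2 * ?C * (?d * size_const CARD('d) (\<alpha> - \<gamma>) * 2 powr (- \<gamma> * \<bar>real i - real J\<bar>))"
        using C unfolding M_def by (intro mult_left_mono) auto
      also have "\<dots> \<le> fine_coarse_const CARD('d) \<alpha> \<gamma> * A\<^sup>2 * 2 powr (- \<gamma> * \<bar>real i - real J\<bar>)"
        by (simp add: fine_coarse_const_def algebra_simps)
      finally show "4 * A\<^sup>2 * ?C * M \<le> fine_coarse_const CARD('d) \<alpha> \<gamma> * A\<^sup>2 * 2 powr (- \<gamma> * \<bar>real i - real J\<bar>)" .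
    qed auto
    finally show ?thesis using True by simp
  next
    case False
    then obtain m where m: "i = Suc m" "J \<le> m" by (cases i) auto
    have "(\<integral>\<^sup>+x. \<integral>\<^sup>+w. ennreal ((norm (app ?D x w))\<^sup>2) \<partial>lborel \<partial>lborel)
      \<le> ennreal ((A * (2 * ?d * 2 powi (- (k + int m)) / t) powr \<alpha> * ?C)\<^sup>2) * sqnorm ?D"
    proof (rule app_fine[OF _ B P'])
      show "avg (k + int m) (\<lambda>y. ?D (y, z)) y = 0" for y z using avg_mdiff[OF f] m by simp
    qed measurable
    also have "\<dots> \<le> ennreal (fine_coarse_const CARD('d) \<alpha> \<gamma> * A\<^sup>2 * 2 powr (- \<gamma> * \<bar>real i - real J\<bar>)) * sqnorm ?D"
    proof (intro mult_right_mono ennreal_leI)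
      let ?e = "\<bar>real i - real J\<bar>"
      have "2 powi (- (k + int m)) / t \<le> 2 powi (- (k + int m)) / (2 powi (- gen t) / 2)"
        using gen_bounds[OF t] t by (intro divide_left_mono) auto
      \<comment> \<open>One factor 2 because t is only known to exceed half the side, another
        because the mean is zero on the parent cubes. With the 2 of \<open>app_fine\<close> this is
        the 8 in \<open>fine_coarse_const\<close>.\<close>
      also have "\<dots> = 4 * 2 powr (- ?e)"
      proof -
        have "2 powi (- (k + int m)) / (2 powi (- gen t) / 2)
          = 2 * ((2::real) powr (- real_of_int (k + int m)) / 2 powr (- real_of_int (k + int J)))"
          by (simp add: k powi_eq_powr)
        also have "\<dots> = 2 * 2 powr (1 - ?e)" using m by (simp flip: powr_diff)
        also have "\<dots> = 4 * 2 powr (- ?e)" by (simp add: powr_diff powr_minus divide_inverse)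
        finally show ?thesis .
      qed
      finally have "2 * ?d * (2 powi (- (k + int m)) / t) \<le> 2 * ?d * (4 * 2 powr (- ?e))"
        by (intro mult_left_mono) auto
      then have "(2 * ?d * 2 powi (- (k + int m)) / t) powr \<alpha> \<le> ((8 * ?d) * 2 powr (- ?e)) powr \<alpha>"
        using \<alpha> t by (intro powr_mono2) auto
      also have "\<dots> = (8 * ?d) powr \<alpha> * 2 powr (- \<alpha> * ?e)"
        by (subst powr_mult) (auto simp: powr_powr mult.commute)
      finally have "(A * (2 * ?d * 2 powi (- (k + int m)) / t) powr \<alpha> * ?C)\<^sup>2 \<le> (A * ((8 * ?d) powr \<alpha> * 2 powr (- \<alpha> * ?e)) * ?C)\<^sup>2"
        using A C by (intro power_mono mult_right_mono mult_left_mono) auto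
      also have "\<dots> = ((8 * ?d) powr \<alpha> * ?C)\<^sup>2 * A\<^sup>2 * (2 powr (- \<alpha> * ?e))\<^sup>2"
        by (simp add: power_mult_distrib mult_ac)
      also have "\<dots> \<le> ((8 * ?d) powr \<alpha> * ?C)\<^sup>2 * A\<^sup>2 * 2 powr (- \<gamma> * ?e)"
      proof (intro mult_left_mono)
        \<comment> \<open>The fine differences decay faster than the coarse ones; the common rate
          \<gamma> is kept.\<close>
        have "(2 powr (- \<alpha> * ?e))\<^sup>2 = (2::real) powr (- (2 * \<alpha>) * ?e)"
          by (simp add: powr_power mult_ac)
        also have "\<dots> \<le> 2 powr (- \<gamma> * ?e)"
          using \<gamma> \<alpha> by (intro powr_mono mult_right_mono) auto
        finally show "(2 powr (- \<alpha> * ?e))\<^sup>2 \<le> (2::real) powr (- \<gamma> * ?e)" .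
      qed auto
      also have "\<dots> \<le> fine_coarse_const CARD('d) \<alpha> \<gamma> * A\<^sup>2 * 2 powr (- \<gamma> * ?e)"
        using C by (intro mult_right_mono) (auto simp: fine_coarse_const_def)
      finally show "(A * (2 * ?d * 2 powi (- (k + int m)) / t) powr \<alpha> * ?C)\<^sup>2 \<le> \<dots>" .
    qed auto
    finally show ?thesis using False by simp
  qed
qed

text \<open>Summing the differences, where those up to the scale of t are recentred at x, gives
  exactly f minus its average at x. A weighted Cauchy-Schwarz inequality spends half of the decay on
  summing over i and leaves the exponent \<gamma> / 2.\<close>

lemma app_cancelled_bound:
  fixes f :: "(real ^ 'd) \<times> 'z \<Rightarrow> complex"
  assumes f: "bdd_supp f" "stepfun K f" and P: "\<And>k y. P (\<lambda>z. pavg k f (y, z))"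
    and \<gamma>: "0 < \<gamma>" "\<gamma> \<le> 1" "\<gamma> < \<alpha>" and k: "gen t = k + int J"
  defines "c \<equiv> geo_const (\<gamma> / 2) * fine_coarse_const CARD('d) \<alpha> \<gamma> * A\<^sup>2"
  shows "(\<integral>\<^sup>+x. \<integral>\<^sup>+w. ennreal ((norm (app (\<lambda>p. f p - pavg (gen t) f (x, snd p)) x w))\<^sup>2) \<partial>lborel \<partial>lborel)
     \<le> (\<Sum>i. ennreal (c * 2 powr (- (\<gamma> / 2) * \<bar>real i - real J\<bar>)) * sqnorm (mdiff k f i))"
proof -
  \<comment> \<open>Late enough to include the scale of t and to reach the generation where
    \<open>f\<close> equals its average.\<close>
  define n where "n = max J (nat (K - k))"
  have n: "J \<le> n" "K \<le> k + int n" by (auto simp: n_def)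
  define \<delta> where "\<delta> = \<gamma> / 2"
  have \<delta>: "0 < \<delta>" "\<gamma> = 2 * \<delta>" using \<gamma> by (auto simp: \<delta>_def)
  let ?D = "mdiff k f" and ?F = "fine_coarse_const CARD('d) \<alpha> \<gamma>" and ?e = "\<lambda>i. \<bar>real i - real J\<bar>"
  note [measurable] = bdd_supp_measurable[OF bdd_supp_mdiff[OF f(1)]]
  define h where "h i x p = ?D i p - (if i \<le> J then ?D i (x, snd p) else 0)" for i x p
  define r where "r i x w = app (h i x) x w" for i x w
  have [measurable]: "(\<lambda>w. r i x w) \<in> borel_measurable borel" "(\<lambda>(x, w). r i x w) \<in> borel_measurable borel" for i x
    unfolding r_def h_def by measurable
  note [measurable (raw)] = measurable_uncurry[OF this(2)]
  have F0: "0 \<le> ?F" using \<gamma> by (intro fine_coarse_const_nonneg)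
  have R: "app (\<lambda>p. f p - pavg (gen t) f (x, snd p)) x w = (\<Sum>i\<le>n. r i x w)" for x w
  proof -
    have eq: "f p - pavg (gen t) f (x, snd p) = (\<Sum>i\<le>n. h i x p)" for p
    proof -
      have "(\<Sum>i\<le>n. h i x p) = (\<Sum>i\<le>n. ?D i p) - (\<Sum>i\<le>n. if i \<le> J then ?D i (x, snd p) else 0)"
        by (simp add: h_def sum_subtractf)
      also have "(\<Sum>i\<le>n. if i \<le> J then ?D i (x, snd p) else 0) = (\<Sum>i\<le>J. ?D i (x, snd p))"
        using n(1) by (intro sum.mono_neutral_cong_right) auto
      finally show ?thesis
        using pavg_stepfun[OF f(2) n(2)] by (simp add: sum_mdiff k)
    qed
    have "integrable lborel (\<lambda>p. \<kappa> x (fst p) w (snd p) * h i x p)" for i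
    proof -
      obtain B where B: "0 \<le> B" "\<And>p. norm (?D i p) \<le> B" using bdd_supp_bound[OF bdd_supp_mdiff[OF f(1)]] by metis
      have "norm (h i x p) \<le> B + B" for p
        unfolding h_def using B(1) B(2)[of p] B(2)[of "(x, snd p)"]
        by (intro order_trans[OF norm_triangle_ineq4 add_mono]) auto
      then show ?thesis by (rule app_eq(1)[rotated]) (simp add: h_def)
    qed
    then show ?thesis unfolding r_def eq by (simp add: sum_distrib_left integral_sum)
  qed
  have pw: "ennreal ((norm (\<Sum>i\<le>n. r i x w))\<^sup>2)
     \<le> (\<Sum>i\<le>n. ennreal (geo_const \<delta> * 2 powr (\<delta> * ?e i)) * ennreal ((norm (r i x w))\<^sup>2))" for x w
  proof -
    have "(norm (\<Sum>i\<le>n. r i x w))\<^sup>2 \<le> (\<Sum>i\<le>n. norm (r i x w))\<^sup>2"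
      by (intro power_mono norm_sum) auto
    \<comment> \<open>The weights are reciprocal powers with exponent \<delta> / 2; after squaring,
      one sum is geometric with rate \<delta> and the other costs growth of rate \<delta>, half of
      the available \<gamma>.\<close>
    also have "\<dots> = (\<Sum>i\<le>n. 2 powr (- (\<delta> / 2) * ?e i) * (2 powr (\<delta> / 2 * ?e i) * norm (r i x w)))\<^sup>2"
      by (simp flip: mult.assoc powr_add)
    also have "\<dots> \<le> (\<Sum>i\<le>n. (2 powr (- (\<delta> / 2) * ?e i))\<^sup>2) * (\<Sum>i\<le>n. (2 powr (\<delta> / 2 * ?e i) * norm (r i x w))\<^sup>2)"
      by (rule Cauchy_Schwarz_ineq_sum)
    also have "\<dots> = (\<Sum>i\<le>n. 2 powr (- \<delta> * ?e i)) * (\<Sum>i\<le>n. 2 powr (\<delta> * ?e i) * (norm (r i x w))\<^sup>2)"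
    proof -
      have e: "(2 powr (\<delta> / 2 * ?e i))\<^sup>2 = (2::real) powr (\<delta> * ?e i)"
        "(2 powr (- (\<delta> / 2) * ?e i))\<^sup>2 = (2::real) powr (- \<delta> * ?e i)" for i
        by (simp_all add: powr_power)
      show ?thesis
        by (rule arg_cong2[where f="(*)"]; rule sum.cong[OF refl]) (simp_all only: e power_mult_distrib)
    qed
    also have "\<dots> \<le> geo_const \<delta> * (\<Sum>i\<le>n. 2 powr (\<delta> * ?e i) * (norm (r i x w))\<^sup>2)"
      using sum_geo[OF \<delta>(1), of J "Suc n"] by (intro mult_right_mono) (auto simp: lessThan_Suc_atMost intro: sum_nonneg)
    finally have "(norm (\<Sum>i\<le>n. r i x w))\<^sup>2 \<le> (\<Sum>i\<le>n. geo_const \<delta> * 2 powr (\<delta> * ?e i) * (norm (r i x w))\<^sup>2)"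
      by (simp add: sum_distrib_left mult.assoc)
    from ennreal_leI[OF this] show ?thesis
      using geo_const_nonneg[OF \<delta>(1)] by (simp add: ennreal_mult flip: sum_ennreal)
  qed
  have "(\<integral>\<^sup>+x. \<integral>\<^sup>+w. ennreal ((norm (app (\<lambda>p. f p - pavg (gen t) f (x, snd p)) x w))\<^sup>2) \<partial>lborel \<partial>lborel)
    \<le> (\<integral>\<^sup>+x. \<integral>\<^sup>+w. (\<Sum>i\<le>n. ennreal (geo_const \<delta> * 2 powr (\<delta> * ?e i)) * ennreal ((norm (r i x w))\<^sup>2)) \<partial>lborel \<partial>lborel)"
    unfolding R by (intro nn_integral_mono pw)
  also have "\<dots> = (\<Sum>i\<le>n. ennreal (geo_const \<delta> * 2 powr (\<delta> * ?e i)) * (\<integral>\<^sup>+x. \<integral>\<^sup>+w. ennreal ((norm (r i x w))\<^sup>2) \<partial>lborel \<partial>lborel))"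
    by (simp add: nn_integral_sum nn_integral_cmult)
  also have "\<dots> \<le> (\<Sum>i\<le>n. ennreal (geo_const \<delta> * 2 powr (\<delta> * ?e i)) * (ennreal (?F * A\<^sup>2 * 2 powr (- \<gamma> * ?e i)) * sqnorm (?D i)))"
    unfolding r_def h_def by (intro sum_mono mult_left_mono app_mdiff f P \<gamma> k) auto
  also have "\<dots> = (\<Sum>i\<le>n. ennreal (c * 2 powr (- \<delta> * ?e i)) * sqnorm (?D i))"
  proof (intro sum.cong refl)
    fix i
    have "2 powr (\<delta> * ?e i) * 2 powr (- \<gamma> * ?e i) = (2::real) powr (\<delta> * ?e i + - \<gamma> * ?e i)"
      by (rule powr_add[symmetric])
    also have "\<delta> * ?e i + - \<gamma> * ?e i = - \<delta> * ?e i" by (simp add: \<delta>(2))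
    finally have p: "2 powr (\<delta> * ?e i) * 2 powr (- \<gamma> * ?e i) = (2::real) powr (- \<delta> * ?e i)" .
    have "g * X * (F * a * Y) = g * F * a * (X * Y)" for g X F a Y :: real by simp
    from this[of "geo_const \<delta>" "2 powr (\<delta> * ?e i)" ?F "A\<^sup>2" "2 powr (- \<gamma> * ?e i)"]
    have "geo_const \<delta> * 2 powr (\<delta> * ?e i) * (?F * A\<^sup>2 * 2 powr (- \<gamma> * ?e i)) = c * 2 powr (- \<delta> * ?e i)"
      unfolding p by (simp only: c_def \<delta>_def)
    then show "ennreal (geo_const \<delta> * 2 powr (\<delta> * ?e i)) * (ennreal (?F * A\<^sup>2 * 2 powr (- \<gamma> * ?e i)) * sqnorm (?D i))
       = ennreal (c * 2 powr (- \<delta> * ?e i)) * sqnorm (?D i)"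
      using F0 geo_const_nonneg[OF \<delta>(1)] by (simp add: mult.assoc[symmetric] flip: ennreal_mult)
  qed
  also have "\<dots> \<le> (\<Sum>i. ennreal (c * 2 powr (- \<delta> * ?e i)) * sqnorm (?D i))"
    by (intro sum_le_suminf) auto
  finally show ?thesis by (simp add: \<delta>_def)
qed

end

subsection \<open>Square functions of operator-valued kernels\<close>

lemma gen_measurable [measurable]: "gen \<in> borel \<rightarrow>\<^sub>M count_space UNIV"
  unfolding gen_def[abs_def] by measurable

lemma gen_measurable_compose:
  assumes "\<tau> \<in> M \<rightarrow>\<^sub>M borel" and "\<And>k. F k \<in> M \<rightarrow>\<^sub>M N"
  shows "(\<lambda>x. F (gen (\<tau> x)) x) \<in> M \<rightarrow>\<^sub>M N"
  by (rule measurable_compose_countable[where f=F, OF assms(2) measurable_compose[OF assms(1) gen_measurable]])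

lemma avker_gen_measurable [measurable (raw)]:
  assumes "\<tau> \<in> M \<rightarrow>\<^sub>M borel" "f \<in> M \<rightarrow>\<^sub>M borel" "g \<in> M \<rightarrow>\<^sub>M borel"
  shows "(\<lambda>x. avker (gen (\<tau> x)) (f x) (g x :: real ^ 'd)) \<in> borel_measurable M"
  by (rule gen_measurable_compose[where F="\<lambda>k x. avker k (f x) (g x)", OF assms(1) avker_measurable[OF assms(2,3)]])

lemma pavg_gen_measurable:
  assumes "bdd_supp f" and [measurable]: "\<tau> \<in> M \<rightarrow>\<^sub>M borel" "g \<in> M \<rightarrow>\<^sub>M borel"
  shows "(\<lambda>x. pavg (gen (\<tau> x)) f (g x)) \<in> borel_measurable M"
proof (rule gen_measurable_compose[where F="\<lambda>k x. pavg k f (g x)"])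
  show "(\<lambda>x. pavg k f (g x)) \<in> borel_measurable M" for k
    by (rule measurable_compose[OF _ bdd_supp_measurable[OF bdd_supp_pavg[OF assms(1)]]]) fact
qed fact

text \<open>The density of dt/t as a weight on the whole line, zero for nonpositive t, so that half
  space integrals become integrals over \<open>lborel\<close>.\<close>

definition dtt :: "real \<Rightarrow> ennreal" where "dtt t = ennreal (1 / t) * indicator {0<..} t"

lemma dtt_measurable [measurable]: "dtt \<in> borel_measurable borel"
  unfolding dtt_def[abs_def] by measurable

lemma dtt_nonpos: "t \<le> 0 \<Longrightarrow> dtt t = 0"
  by (simp add: dtt_def)

text \<open>On an interval of length r / 2 the density is at most 2 / r.\<close>

lemma nn_integral_dtt_gen: "(\<integral>\<^sup>+t. dtt t * indicator {t. gen t = j} t \<partial>lborel) \<le> 1"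
proof -
  let ?r = "2 powi (-j) :: real"
  have r: "0 < ?r" by simp
  have "(\<integral>\<^sup>+t. dtt t * indicator {t. gen t = j} t \<partial>lborel) \<le> (\<integral>\<^sup>+t. ennreal (2 / ?r) * indicator {?r / 2..?r} t \<partial>lborel)"
  proof (intro nn_integral_mono)
    fix t :: real
    show "dtt t * indicator {t. gen t = j} t \<le> ennreal (2 / ?r) * indicator {?r / 2..?r} t"
    proof (cases "0 < t \<and> gen t = j")
      case True
      then have "?r / 2 < t" "t \<le> ?r" using gen_bounds[of t] by auto
      moreover have "1 / t \<le> 1 / (?r / 2)" using \<open>?r / 2 < t\<close> r True by (intro divide_left_mono) auto
      ultimately show ?thesis using True by (simp add: dtt_def ennreal_leI)
    qed (auto simp: dtt_def)
  qed
  also have "\<dots> = ennreal (2 / ?r) * ennreal (?r / 2)"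
    using r by (subst nn_integral_cmult_indicator) auto
  also have "\<dots> = 1" using r by (simp flip: ennreal_mult)
  finally show ?thesis .
qed

lemma ennreal_suminf_swap: "(\<Sum>j. \<Sum>i. a j i) = (\<Sum>i. \<Sum>j. a j i :: ennreal)"
proof -
  have "(\<Sum>j. \<Sum>i. a j i) = (\<integral>\<^sup>+j. (\<Sum>i. a j i) \<partial>count_space UNIV)"
    by (simp add: nn_integral_count_space_nat)
  also have "\<dots> = (\<Sum>i. \<integral>\<^sup>+j. a j i \<partial>count_space UNIV)" by (rule nn_integral_suminf) simp
  finally show ?thesis by (simp add: nn_integral_count_space_nat)
qed

lemma ennreal_le_suminf: "f i \<le> (\<Sum>i. f i :: ennreal)"
  using sum_le_suminf[of f "{i}"] by simp

text \<open>Monotone convergence removes the restriction to generations at least -N. The restriction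
  gives every martingale a first generation.\<close>

lemma nn_integral_dtt_le:
  assumes \<Phi> [measurable]: "\<Phi> \<in> borel_measurable borel"
    and le: "\<And>N :: nat. (\<integral>\<^sup>+t. dtt t * indicator {t. - int N \<le> gen t} t * \<Phi> t \<partial>lborel) \<le> C"
  shows "(\<integral>\<^sup>+t. dtt t * \<Phi> t \<partial>lborel) \<le> C"
proof -
  have m: "(\<lambda>t. indicator {t. - int N \<le> gen t} t :: ennreal) \<in> borel_measurable borel" for N
    by measurable
  note [measurable] = m
  have "dtt t * \<Phi> t = (SUP N::nat. dtt t * indicator {t. - int N \<le> gen t} t * \<Phi> t)" for t
  proof (rule antisym)
    show "dtt t * \<Phi> t \<le> (SUP N::nat. dtt t * indicator {t. - int N \<le> gen t} t * \<Phi> t)"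
      by (rule order_trans[OF _ SUP_upper[OF UNIV_I, of _ "nat (- gen t)"]]) simp
    show "(SUP N::nat. dtt t * indicator {t. - int N \<le> gen t} t * \<Phi> t) \<le> dtt t * \<Phi> t"
      by (intro SUP_least) (auto simp: indicator_def)
  qed
  then have "(\<integral>\<^sup>+t. dtt t * \<Phi> t \<partial>lborel) = (\<integral>\<^sup>+t. (SUP N::nat. dtt t * indicator {t. - int N \<le> gen t} t * \<Phi> t) \<partial>lborel)"
    by simp
  also have "\<dots> = (SUP N::nat. \<integral>\<^sup>+t. dtt t * indicator {t. - int N \<le> gen t} t * \<Phi> t \<partial>lborel)"
  proof (intro nn_integral_monotone_convergence_SUP)
    show "incseq (\<lambda>N t. dtt t * indicator {t. - int N \<le> gen t} t * \<Phi> t)"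
      by (auto simp: incseq_def le_fun_def indicator_def)
  qed measurable
  also have "\<dots> \<le> C" by (intro SUP_least le)
  finally show ?thesis .
qed

text \<open>The exponent \<gamma> must be at most 1 for the shift of cubes and below \<alpha> for a
  positive remaining exponent. \<open>geo_const\<close> is squared: once for Cauchy-Schwarz over the
  differences, once for the sum over the generations of t.\<close>

definition square_const :: "nat \<Rightarrow> real \<Rightarrow> real" where
  "square_const d \<alpha> = (let \<gamma> = min \<alpha> 1 / 2 in (geo_const (\<gamma> / 2))\<^sup>2 * fine_coarse_const d \<alpha> \<gamma>)"

lemma square_const_nonneg: "0 < \<alpha> \<Longrightarrow> 0 \<le> square_const d \<alpha>"
  unfolding square_const_def Let_def by (intro mult_nonneg_nonneg fine_coarse_const_nonneg) auto

text \<open>Each generation of t has mass at most 1 for dt/t, so the square function is at most the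
  sum over J of the bounds of \<open>app_cancelled_bound\<close>. The decay in the distance of i and
  J makes that sum a multiple of the sum of the squared norms of the differences, and Bessel's
  inequality concludes.\<close>

theorem operator_square_function:
  fixes \<kappa> :: "real \<Rightarrow> real ^ 'd \<Rightarrow> real ^ 'd \<Rightarrow> 'w::euclidean_space \<Rightarrow> 'z::euclidean_space \<Rightarrow> complex"
    and f :: "(real ^ 'd) \<times> 'z \<Rightarrow> complex"
  assumes \<kappa>: "(\<lambda>(t, x, y, w, z). \<kappa> t x y w z) \<in> borel_measurable borel"
    and ok: "AE t in lborel. 0 < t \<longrightarrow> operator_kernel (\<kappa> t) P \<alpha> A t"
    and f: "bdd_supp f" "stepfun K f" and P: "\<And>k y. P (\<lambda>z. pavg k f (y, z))"
    and \<alpha>: "0 < \<alpha>"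
  shows "(\<integral>\<^sup>+t. dtt t * (\<integral>\<^sup>+x. \<integral>\<^sup>+w. ennreal ((norm (LINT p|lborel.
      \<kappa> t x (fst p) w (snd p) * (f p - pavg (gen t) f (x, snd p))))\<^sup>2) \<partial>lborel \<partial>lborel) \<partial>lborel)
     \<le> ennreal (square_const CARD('d) \<alpha> * A\<^sup>2) * sqnorm f"
proof -
  define \<gamma> where "\<gamma> = min \<alpha> 1 / 2"
  have \<gamma>: "0 < \<gamma>" "\<gamma> \<le> 1" "\<gamma> < \<alpha>" using \<alpha> by (auto simp: \<gamma>_def)
  have [measurable (raw)]: "(\<lambda>x. \<kappa> (e x) (a x) (b x) (c x) (d x)) \<in> borel_measurable M"
    if [measurable]: "e \<in> M \<rightarrow>\<^sub>M borel" "a \<in> M \<rightarrow>\<^sub>M borel" "b \<in> M \<rightarrow>\<^sub>M borel" "c \<in> M \<rightarrow>\<^sub>M borel" "d \<in> M \<rightarrow>\<^sub>M borel"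
    for a b c d e and M :: "'m measure"
    using measurable_compose[of "\<lambda>x. (e x, a x, b x, c x, d x)" M borel, OF _ \<kappa>] by simp
  note [measurable] = bdd_supp_measurable[OF f(1)]
  note [measurable (raw)] = pavg_gen_measurable[OF f(1)]
  define \<Phi> where "\<Phi> t = (\<integral>\<^sup>+x. \<integral>\<^sup>+w. ennreal ((norm (LINT p|lborel.
      \<kappa> t x (fst p) w (snd p) * (f p - pavg (gen t) f (x, snd p))))\<^sup>2) \<partial>lborel \<partial>lborel)" for t
  have [measurable]: "\<Phi> \<in> borel_measurable borel" unfolding \<Phi>_def by measurable
  define c where "c = geo_const (\<gamma> / 2) * fine_coarse_const CARD('d) \<alpha> \<gamma> * A\<^sup>2"
  have c0: "0 \<le> c" unfolding c_def using \<gamma> by (intro mult_nonneg_nonneg geo_const_nonneg fine_coarse_const_nonneg) auto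
  have "(\<integral>\<^sup>+t. dtt t * \<Phi> t \<partial>lborel) \<le> ennreal (geo_const (\<gamma> / 2) * c) * sqnorm f"
  proof (rule nn_integral_dtt_le)
    fix N :: nat
    let ?k = "- int N"
    define b where "b J = (\<Sum>i. ennreal (c * 2 powr (- (\<gamma> / 2) * \<bar>real i - real J\<bar>)) * sqnorm (mdiff ?k f i))" for J
    have "(\<integral>\<^sup>+t. dtt t * indicator {t. ?k \<le> gen t} t * \<Phi> t \<partial>lborel)
      \<le> (\<integral>\<^sup>+t. (\<Sum>J. dtt t * indicator {t. gen t = ?k + int J} t * b J) \<partial>lborel)"
    proof (intro nn_integral_mono_AE, use ok in eventually_elim)
      fix t :: real assume ok: "0 < t \<longrightarrow> operator_kernel (\<kappa> t) P \<alpha> A t"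
      show "dtt t * indicator {t. ?k \<le> gen t} t * \<Phi> t \<le> (\<Sum>J. dtt t * indicator {t. gen t = ?k + int J} t * b J)"
      proof (cases "0 < t \<and> ?k \<le> gen t")
        case True
        define J where "J = nat (gen t + int N)"
        have J: "gen t = ?k + int J" using True by (simp add: J_def)
        interpret operator_kernel "\<kappa> t" P \<alpha> A t using ok True by simp
        have "\<Phi> t \<le> b J"
          unfolding \<Phi>_def b_def c_def by (rule app_cancelled_bound[OF f P \<gamma> J])
        then have "dtt t * indicator {t. ?k \<le> gen t} t * \<Phi> t \<le> dtt t * indicator {t. gen t = ?k + int J} t * b J"
          using J by (auto intro: mult_left_mono)
        also have "\<dots> \<le> (\<Sum>J. dtt t * indicator {t. gen t = ?k + int J} t * b J)" by (rule ennreal_le_suminf)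
        finally show ?thesis .
      qed (auto simp: dtt_def)
    qed
    also have "\<dots> = (\<Sum>J. (\<integral>\<^sup>+t. dtt t * indicator {t. gen t = ?k + int J} t \<partial>lborel) * b J)"
      by (subst nn_integral_suminf) (auto simp: nn_integral_multc)
    also have "\<dots> \<le> (\<Sum>J. 1 * b J)"
      by (intro suminf_le summableI mult_right_mono nn_integral_dtt_gen) auto
    \<comment> \<open>With the sums exchanged, the difference i is fixed and the decay is summed
      over the generations of t.\<close>
    also have "\<dots> = (\<Sum>i. \<Sum>J. ennreal (c * 2 powr (- (\<gamma> / 2) * \<bar>real i - real J\<bar>)) * sqnorm (mdiff ?k f i))"
      unfolding b_def mult_1 by (rule ennreal_suminf_swap)
    also have "\<dots> \<le> (\<Sum>i. ennreal (geo_const (\<gamma> / 2) * c) * sqnorm (mdiff ?k f i))"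
    proof (intro suminf_le summableI)
      fix i
      have "(\<Sum>J. ennreal (c * 2 powr (- (\<gamma> / 2) * \<bar>real i - real J\<bar>)) * sqnorm (mdiff ?k f i))
        = ennreal c * (\<Sum>J. ennreal (2 powr (- (\<gamma> / 2) * \<bar>real J - real i\<bar>))) * sqnorm (mdiff ?k f i)"
        using c0 by (simp add: ennreal_mult abs_minus_commute)
      also have "\<dots> \<le> ennreal c * ennreal (geo_const (\<gamma> / 2)) * sqnorm (mdiff ?k f i)"
        using \<gamma> by (intro mult_right_mono mult_left_mono suminf_geo) auto
      finally show "(\<Sum>J. ennreal (c * 2 powr (- (\<gamma> / 2) * \<bar>real i - real J\<bar>)) * sqnorm (mdiff ?k f i))
        \<le> ennreal (geo_const (\<gamma> / 2) * c) * sqnorm (mdiff ?k f i)"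
        using c0 \<gamma> by (simp add: ennreal_mult geo_const_nonneg mult.commute)
    qed
    also have "\<dots> \<le> ennreal (geo_const (\<gamma> / 2) * c) * sqnorm f"
      by (simp add: mult_left_mono suminf_sqnorm_mdiff[OF f])
    finally show "(\<integral>\<^sup>+t. dtt t * indicator {t. ?k \<le> gen t} t * \<Phi> t \<partial>lborel) \<le> ennreal (geo_const (\<gamma> / 2) * c) * sqnorm f" .
  qed measurable
  also have "geo_const (\<gamma> / 2) * c = square_const CARD('d) \<alpha> * A\<^sup>2"
    by (simp add: square_const_def c_def power2_eq_square Let_def flip: \<gamma>_def)
  finally show ?thesis unfolding \<Phi>_def .
qed

subsection \<open>The dyadic maximal function and Carleson's embedding\<close>

text \<open>Only finitely many generations enter, so the maximum is itself constant on the cubes of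
  the finest of them.\<close>

fun dmax :: "int \<Rightarrow> (real ^ 'd \<Rightarrow> real) \<Rightarrow> nat \<Rightarrow> real ^ 'd \<Rightarrow> real" where
  "dmax k F 0 x = avg k F x"
| "dmax k F (Suc n) x = max (dmax k F n x) (avg (k + int (Suc n)) F x)"

lemma avg_nonneg:
  fixes F :: "real ^ 'd \<Rightarrow> real"
  shows "(\<And>y. 0 \<le> F y) \<Longrightarrow> 0 \<le> avg k F x"
  unfolding avg_def by (intro Bochner_Integration.integral_nonneg) auto

lemma dmax_nonneg: "(\<And>y. 0 \<le> F y) \<Longrightarrow> 0 \<le> dmax k F n x"
  by (induction n) (auto simp: avg_nonneg le_max_iff_disj)

lemma dmax_mono: "m \<le> n \<Longrightarrow> dmax k F m x \<le> dmax k F n x"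
  by (rule lift_Suc_mono_le[of "\<lambda>n. dmax k F n x"]) auto

lemma avg_le_dmax: "i \<le> n \<Longrightarrow> avg (k + int i) F x \<le> dmax k F n x"
  by (rule order_trans[OF _ dmax_mono[of i n]]) (cases i; simp)

lemma dmax_same_cube:
  "same_cube (k + int n) x y \<Longrightarrow> dmax k F n x = dmax k F n y"
proof (induction n)
  case (Suc n)
  have "same_cube (k + int n) x y" by (rule same_cube_mono[OF _ Suc.prems]) simp
  then have "dmax k F n x = dmax k F n y" by (rule Suc.IH)
  moreover have "avg (k + int (Suc n)) F x = avg (k + int (Suc n)) F y" by (rule avg_same_cube[OF Suc.prems])
  ultimately show ?case by (simp only: dmax.simps)
qed (simp add: avg_same_cube)

lemma bdd_supp_max:
  fixes f g :: "'a::euclidean_space \<Rightarrow> real"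
  assumes "bdd_supp f" "bdd_supp g" shows "bdd_supp (\<lambda>x. max (f x) (g x))"
proof -
  obtain B where B: "0 \<le> B" "\<And>x. norm (f x) \<le> B" "\<And>x. B < norm x \<Longrightarrow> f x = 0"
    using bdd_supp_bound[OF assms(1)] by metis
  obtain C where C: "0 \<le> C" "\<And>x. norm (g x) \<le> C" "\<And>x. C < norm x \<Longrightarrow> g x = 0"
    using bdd_supp_bound[OF assms(2)] by metis
  note [measurable] = assms[THEN bdd_supp_measurable]
  show ?thesis
  proof (rule bdd_suppI[where B="B + C" and R="max B C"])
    show "norm (max (f x) (g x)) \<le> B + C" for x
      using B(1) C(1) B(2)[of x] C(2)[of x] by (auto simp: max_def)
  qed (use B C in auto)
qed

lemma bdd_supp_dmax: "bdd_supp F \<Longrightarrow> bdd_supp (dmax k F n)"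
proof (induction n)
  case 0
  have "dmax k F 0 = avg k F" by (rule ext) simp
  then show ?case using 0 by (simp add: bdd_supp_avg del: dmax.simps)
next
  case (Suc n)
  have "dmax k F (Suc n) = (\<lambda>x. max (dmax k F n x) (avg (k + int (Suc n)) F x))"
    by (rule ext) simp
  then show ?case using Suc by (simp only: bdd_supp_max bdd_supp_avg)
qed

text \<open>A pathwise form of Doob's \<open>L\<^sup>2\<close> inequality; the sum on the left integrates to zero.\<close>

lemma dmax_pathwise:
  "(\<Sum>i<n. dmax k F i x * (avg (k + int (Suc i)) F x - avg (k + int i) F x))
     \<le> dmax k F n x * avg (k + int n) F x - (dmax k F n x)\<^sup>2 / 2"
proof (induction n)
  case 0 then show ?case by (simp add: power2_eq_square)
next
  case (Suc n)
  let ?M = "dmax k F n x" and ?a = "avg (k + int n) F x" and ?b = "avg (k + int (Suc n)) F x"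
  \<comment> \<open>If the maximum rises to \<open>?b\<close>, the two sides differ by half the
    square of \<open>?b - ?M\<close>; otherwise they are equal.\<close>
  have "?M * ?a - ?M\<^sup>2 / 2 + ?M * (?b - ?a) \<le> max ?M ?b * ?b - (max ?M ?b)\<^sup>2 / 2"
  proof (cases "?M \<le> ?b")
    case True
    have "0 \<le> (?b - ?M)\<^sup>2" by simp
    then show ?thesis using True by (simp add: max_def power2_eq_square algebra_simps)
  qed (simp add: max_def algebra_simps)
  then show ?case using Suc by simp
qed

text \<open>Doob's inequality by integrating \<open>dmax_pathwise\<close>: at a generation where the
  average equals F it leaves the integral of M * F - M^2 / 2 nonnegative, and completing the square
  bounds this by F^2 - M^2 / 4, whence the constant 4.\<close>

lemma integral_dmax:
  fixes F :: "real ^ 'd \<Rightarrow> real"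
  assumes F: "bdd_supp F" and nn: "\<And>y. 0 \<le> F y" and K: "\<And>x y. same_cube K x y \<Longrightarrow> F x = F y"
  shows "(\<integral>\<^sup>+x. ennreal ((dmax k F n x)\<^sup>2) \<partial>lborel) \<le> 4 * (\<integral>\<^sup>+x. ennreal ((F x)\<^sup>2) \<partial>lborel)"
proof -
  \<comment> \<open>The maximum is extended to generations where the average of \<open>F\<close> is
    \<open>F\<close> itself; this only increases it.\<close>
  define n' where "n' = max n (nat (K - k))"
  have n': "n \<le> n'" "K \<le> k + int n'" by (auto simp: n'_def)
  let ?M = "dmax k F"
  have M: "bdd_supp (?M i)" for i using F by (rule bdd_supp_dmax)
  have A: "bdd_supp (avg j F)" for j using F by (rule bdd_supp_avg)
  note [measurable] = bdd_supp_measurable[OF M] bdd_supp_measurable[OF A] bdd_supp_measurable[OF F]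
  have prod: "bdd_supp (\<lambda>x. ?M i x * g x)" if "bdd_supp g" for i and g :: "real ^ 'd \<Rightarrow> real"
  proof -
    obtain B where "\<And>x. norm (?M i x) \<le> B" using bdd_supp_bound[OF M] by metis
    then show ?thesis by (intro bdd_supp_mult that) auto
  qed
  have sq: "bdd_supp (\<lambda>x. (?M n' x)\<^sup>2)" "bdd_supp (\<lambda>x. (F x)\<^sup>2)"
    using bdd_supp_norm_power2[OF M[of n']] bdd_supp_norm_power2[OF F] by simp_all
  have top: "avg (k + int n') F x = F x" for x
    by (rule avg_const) (metis K n'(2) same_cube_mono same_cube_sym)
  \<comment> \<open>A martingale increment has mean zero on the cubes of generation
    \<open>k + int i\<close>, and the maximum up to i is constant on them.\<close>
  have zero: "(LINT x|lborel. ?M i x * (avg (k + int (Suc i)) F x - avg (k + int i) F x)) = 0" for i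
  proof -
    let ?g = "\<lambda>x. avg (k + int (Suc i)) F x - avg (k + int i) F x"
    have g: "bdd_supp ?g" by (intro bdd_supp_diff A)
    have "(LINT x|lborel. ?M i x * ?g x) = (LINT x|lborel. avg (k + int i) (\<lambda>x. ?M i x * ?g x) x)"
      by (rule integral_avg[symmetric, OF prod[OF g]])
    also have "\<dots> = (LINT x|lborel. ?M i x * avg (k + int i) ?g x)"
    proof (intro Bochner_Integration.integral_cong refl avg_mult)
      show "?M i y = ?M i x" if "same_cube (k + int i) x y" for x y
        using dmax_same_cube[OF that] by simp
    qed
    also have "\<dots> = 0" using avg_diff[OF A A] by (simp add: avg_avg[OF F])
    finally show ?thesis .
  qed
  have "0 = (LINT x|lborel. (\<Sum>i<n'. ?M i x * (avg (k + int (Suc i)) F x - avg (k + int i) F x)))"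
    using bdd_supp_integrable[OF prod[OF bdd_supp_diff[OF A A]]] by (subst Bochner_Integration.integral_sum) (simp_all add: zero del: of_nat_Suc)
  also have "\<dots> \<le> (LINT x|lborel. ?M n' x * F x - (?M n' x)\<^sup>2 / 2)"
  proof (rule integral_mono)
    show "integrable lborel (\<lambda>x. \<Sum>i<n'. ?M i x * (avg (k + int (Suc i)) F x - avg (k + int i) F x))"
      by (intro Bochner_Integration.integrable_sum bdd_supp_integrable prod bdd_supp_diff A)
    show "integrable lborel (\<lambda>x. ?M n' x * F x - (?M n' x)\<^sup>2 / 2)"
      using bdd_supp_integrable[OF prod[OF F]] bdd_supp_integrable[OF sq(1)] by simp
  qed (use dmax_pathwise[of k F _ n'] top in auto)
  also have "\<dots> \<le> (LINT x|lborel. (F x)\<^sup>2 - (?M n' x)\<^sup>2 / 4)"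
  proof (rule integral_mono)
    show "integrable lborel (\<lambda>x. ?M n' x * F x - (?M n' x)\<^sup>2 / 2)"
      using bdd_supp_integrable[OF prod[OF F]] bdd_supp_integrable[OF sq(1)] by simp
    show "integrable lborel (\<lambda>x. (F x)\<^sup>2 - (?M n' x)\<^sup>2 / 4)"
      using bdd_supp_integrable[OF sq(1)] bdd_supp_integrable[OF sq(2)] by simp
    fix x
    have "0 \<le> (F x - ?M n' x / 2)\<^sup>2" by simp
    then show "?M n' x * F x - (?M n' x)\<^sup>2 / 2 \<le> (F x)\<^sup>2 - (?M n' x)\<^sup>2 / 4"
      by (simp add: power2_eq_square algebra_simps)
  qed
  also have "\<dots> = (LINT x|lborel. (F x)\<^sup>2) - (LINT x|lborel. (?M n' x)\<^sup>2) / 4"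
    using bdd_supp_integrable[OF sq(1)] bdd_supp_integrable[OF sq(2)] by simp
  finally have le: "(LINT x|lborel. (?M n' x)\<^sup>2) \<le> 4 * (LINT x|lborel. (F x)\<^sup>2)" by simp
  have "(\<integral>\<^sup>+x. ennreal ((?M n x)\<^sup>2) \<partial>lborel) \<le> (\<integral>\<^sup>+x. ennreal ((?M n' x)\<^sup>2) \<partial>lborel)"
    by (intro nn_integral_mono ennreal_leI power_mono dmax_mono n' dmax_nonneg nn)
  also have "\<dots> = ennreal (LINT x|lborel. (?M n' x)\<^sup>2)"
    by (intro nn_integral_eq_integral bdd_supp_integrable sq) auto
  also have "\<dots> \<le> ennreal (4 * (LINT x|lborel. (F x)\<^sup>2))" by (intro ennreal_leI le)
  also have "\<dots> = 4 * ennreal (LINT x|lborel. (F x)\<^sup>2)" by (simp add: ennreal_mult)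
  also have "ennreal (LINT x|lborel. (F x)\<^sup>2) = (\<integral>\<^sup>+x. ennreal ((F x)\<^sup>2) \<partial>lborel)"
    by (intro nn_integral_eq_integral[symmetric] bdd_supp_integrable sq) auto
  finally show ?thesis .
qed

lemma norm_avg_le:
  assumes v: "bdd_supp v" shows "norm (avg k v x) \<le> avg k (\<lambda>y. norm (v y)) x"
proof -
  have n: "bdd_supp (\<lambda>y. norm (v y))"
    by (rule bdd_supp_mult_bounded[OF v, where C=1]) (use v in \<open>auto simp: bdd_supp_measurable\<close>)
  show ?thesis
    unfolding avg_def
    by (rule Bochner_Integration.integral_norm_bound_integral)
       (use integrable_avker_bdd_supp[OF v] integrable_avker_bdd_supp[OF n] in auto)
qed

text \<open>A function constant on cubes sees of the weight \<open>W\<close> only its averages over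
  these cubes.\<close>

lemma nn_integral_step_avg:
  fixes W S :: "real ^ 'd \<Rightarrow> ennreal"
  assumes [measurable]: "W \<in> borel_measurable borel" "S \<in> borel_measurable borel"
    and S: "\<And>x y. same_cube l x y \<Longrightarrow> S x = S y"
    and W: "\<And>x0. (\<integral>\<^sup>+x. ennreal (avker l x0 x) * W x \<partial>lborel) \<le> M"
  shows "(\<integral>\<^sup>+x. W x * S x \<partial>lborel) \<le> M * (\<integral>\<^sup>+x. S x \<partial>lborel)"
proof -
  have "(\<integral>\<^sup>+x. W x * S x \<partial>lborel) = (\<integral>\<^sup>+x. \<integral>\<^sup>+x0. ennreal (avker l x x0) * (W x * S x) \<partial>lborel \<partial>lborel)"
    by (simp add: nn_integral_multc nn_integral_avker)
  also have "\<dots> = (\<integral>\<^sup>+x0. \<integral>\<^sup>+x. ennreal (avker l x x0) * (W x * S x) \<partial>lborel \<partial>lborel)"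
    by (rule nn_integral_swap) measurable
  also have "\<dots> = (\<integral>\<^sup>+x0. \<integral>\<^sup>+x. ennreal (avker l x0 x) * W x * S x0 \<partial>lborel \<partial>lborel)"
  proof (intro nn_integral_cong)
    fix x x0
    have "same_cube l x x0 \<Longrightarrow> S x = S x0" by (rule S)
    then show "ennreal (avker l x x0) * (W x * S x) = ennreal (avker l x0 x) * W x * S x0"
      by (auto simp: avker_def same_cube_commute mult_ac)
  qed
  also have "\<dots> = (\<integral>\<^sup>+x0. (\<integral>\<^sup>+x. ennreal (avker l x0 x) * W x \<partial>lborel) * S x0 \<partial>lborel)"
    by (simp add: nn_integral_multc)
  also have "\<dots> \<le> (\<integral>\<^sup>+x0. M * S x0 \<partial>lborel)"
    by (intro nn_integral_mono mult_right_mono W) auto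
  finally show ?thesis by (simp add: nn_integral_cmult)
qed

text \<open>The increments of the squared maximal function turn the embedding into a summation by parts:
  no stopping cubes are needed.\<close>

theorem Carleson_embedding:
  fixes c :: "real \<Rightarrow> real ^ 'd \<Rightarrow> ennreal"
  assumes c: "(\<lambda>(t, x). c t x) \<in> borel_measurable borel"
    and box: "\<And>k x0. (\<integral>\<^sup>+x. ennreal (avker k x0 x) *
        (\<integral>\<^sup>+t. dtt t * indicator {t. k \<le> gen t} t * c t x \<partial>lborel) \<partial>lborel) \<le> B"
    and v: "bdd_supp v" and K: "\<And>x y. same_cube K x y \<Longrightarrow> v x = v y"
  shows "(\<integral>\<^sup>+t. dtt t * (\<integral>\<^sup>+x. c t x * ennreal ((norm (avg (gen t) v x))\<^sup>2) \<partial>lborel) \<partial>lborel) \<le> 4 * B * sqnorm v"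
proof (rule nn_integral_dtt_le)
  note [measurable (raw)] = measurable_uncurry[OF c]
  note [measurable] = bdd_supp_measurable[OF v]
  have mavg [measurable (raw)]: "(\<lambda>q. avg (gen (\<tau> q)) v (h q)) \<in> borel_measurable M"
    if [measurable]: "\<tau> \<in> M \<rightarrow>\<^sub>M borel" "h \<in> M \<rightarrow>\<^sub>M borel" for \<tau> h and M :: "'m measure"
    by (rule gen_measurable_compose[where F="\<lambda>k q. avg k v (h q)"]) measurable
  show "(\<lambda>t. \<integral>\<^sup>+x. c t x * ennreal ((norm (avg (gen t) v x))\<^sup>2) \<partial>lborel) \<in> borel_measurable borel"
    by measurable
  fix N :: nat
  let ?k = "- int N"
  define F where "F y = norm (v y)" for y
  have F: "bdd_supp F" unfolding F_def[abs_def]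
    by (rule bdd_supp_mult_bounded[OF v, where C=1]) auto
  have Fn: "0 \<le> F y" for y by (simp add: F_def)
  have FK: "same_cube K x y \<Longrightarrow> F x = F y" for x y using K by (simp add: F_def)
  let ?M = "dmax ?k F"
  note [measurable] = bdd_supp_measurable[OF bdd_supp_dmax[OF F]]
  \<comment> \<open>The increments of the squared maximal function: nonnegative, constant on cubes
    of generation \<open>?k + int i\<close>, with partial sums the squared maximal
    functions.\<close>
  define m where "m i x = (case i of 0 \<Rightarrow> (?M 0 x)\<^sup>2 | Suc j \<Rightarrow> (?M i x)\<^sup>2 - (?M j x)\<^sup>2)" for i x
  have [measurable]: "m i \<in> borel_measurable borel" for i
    unfolding m_def by (cases i) (simp_all del: dmax.simps)
  have m0: "0 \<le> m i x" for i x
    by (cases i) (auto simp: m_def intro!: power_mono dmax_nonneg Fn)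
  have sum_m: "(\<Sum>i\<le>n. m i x) = (?M n x)\<^sup>2" for n x
    by (induction n) (simp_all add: m_def)
  have m_same: "m i x = m i y" if "same_cube (?k + int i) x y" for i x y
  proof (cases i)
    case (Suc j)
    have "same_cube (?k + int j) x y" by (rule same_cube_mono[OF _ that]) (simp add: Suc)
    then show ?thesis using dmax_same_cube[OF that, of F] dmax_same_cube[of ?k j x y F] by (simp add: m_def Suc)
  qed (use that in \<open>simp add: m_def avg_same_cube\<close>)
  \<comment> \<open>The mass of \<open>c\<close> above x and below the scale of generation
    \<open>?k + int i\<close>. Its average over a cube of that generation is the normalized mass of
    the Carleson box bounded by \<open>box\<close>.\<close>
  define A where "A i x = (\<integral>\<^sup>+t. dtt t * indicator {t. ?k + int i \<le> gen t} t * c t x \<partial>lborel)" for i x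
  have ind: "(\<lambda>t. indicator {t. j \<le> gen t} t :: ennreal) \<in> borel_measurable borel" for j
    by measurable
  note [measurable (raw)] = measurable_compose[OF _ ind]
  have [measurable]: "A i \<in> borel_measurable borel" for i unfolding A_def by measurable
  have "(\<integral>\<^sup>+t. dtt t * indicator {t. ?k \<le> gen t} t * (\<integral>\<^sup>+x. c t x * ennreal ((norm (avg (gen t) v x))\<^sup>2) \<partial>lborel) \<partial>lborel)
    \<le> (\<integral>\<^sup>+t. \<integral>\<^sup>+x. (\<Sum>i. dtt t * indicator {t. ?k + int i \<le> gen t} t * c t x * ennreal (m i x)) \<partial>lborel \<partial>lborel)"
  proof (intro nn_integral_mono)
    fix t :: real
    show "dtt t * indicator {t. ?k \<le> gen t} t * (\<integral>\<^sup>+x. c t x * ennreal ((norm (avg (gen t) v x))\<^sup>2) \<partial>lborel)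
       \<le> (\<integral>\<^sup>+x. (\<Sum>i. dtt t * indicator {t. ?k + int i \<le> gen t} t * c t x * ennreal (m i x)) \<partial>lborel)"
    proof (cases "?k \<le> gen t")
      case True
      define J where "J = nat (gen t + int N)"
      have J: "gen t = ?k + int J" using True by (simp add: J_def)
      \<comment> \<open>The average at the scale of t is at most the maximal function at index
        \<open>J\<close>, whose square is a sum of increments. The range i at most J is the
        condition on \<open>gen t\<close> in the indicator, which then passes into the
        t-integral.\<close>
      have "ennreal ((norm (avg (gen t) v x))\<^sup>2) \<le> (\<Sum>i. indicator {t. ?k + int i \<le> gen t} t * ennreal (m i x))" for x
      proof -
        have "norm (avg (gen t) v x) \<le> ?M J x"
          unfolding J F_def[abs_def] by (rule order_trans[OF norm_avg_le[OF v] avg_le_dmax]) simp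
        then have "(norm (avg (gen t) v x))\<^sup>2 \<le> (\<Sum>i\<le>J. m i x)" unfolding sum_m by (intro power_mono) auto
        then have "ennreal ((norm (avg (gen t) v x))\<^sup>2) \<le> (\<Sum>i\<le>J. ennreal (m i x))"
          by (simp add: sum_ennreal m0 ennreal_leI)
        also have "\<dots> = (\<Sum>i\<le>J. indicator {t. ?k + int i \<le> gen t} t * ennreal (m i x))"
          by (intro sum.cong) (auto simp: J)
        also have "\<dots> \<le> (\<Sum>i. indicator {t. ?k + int i \<le> gen t} t * ennreal (m i x))"
          by (intro sum_le_suminf) auto
        finally show ?thesis .
      qed
      note le = this
      have "dtt t * (c t x * ennreal ((norm (avg (gen t) v x))\<^sup>2))
         \<le> (\<Sum>i. dtt t * indicator {t. ?k + int i \<le> gen t} t * c t x * ennreal (m i x))" for x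
      proof -
        have "dtt t * (c t x * ennreal ((norm (avg (gen t) v x))\<^sup>2))
           \<le> dtt t * (c t x * (\<Sum>i. indicator {t. ?k + int i \<le> gen t} t * ennreal (m i x)))"
          by (intro mult_left_mono le) auto
        also have "\<dots> = (\<Sum>i. dtt t * (c t x * (indicator {t. ?k + int i \<le> gen t} t * ennreal (m i x))))"
          by (simp only: ennreal_suminf_cmult)
        also have "\<dots> = (\<Sum>i. dtt t * indicator {t. ?k + int i \<le> gen t} t * c t x * ennreal (m i x))"
          by (simp only: mult_ac)
        finally show ?thesis .
      qed
      then show ?thesis using True by (simp add: nn_integral_cmult[symmetric] nn_integral_mono)
    qed simp
  qed
  also have "\<dots> = (\<Sum>i. \<integral>\<^sup>+t. \<integral>\<^sup>+x. dtt t * indicator {t. ?k + int i \<le> gen t} t * c t x * ennreal (m i x) \<partial>lborel \<partial>lborel)"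
    by (simp add: nn_integral_suminf)
  also have "\<dots> = (\<Sum>i. \<integral>\<^sup>+x. A i x * ennreal (m i x) \<partial>lborel)"
  proof (intro suminf_cong)
    fix i
    have "(\<integral>\<^sup>+t. \<integral>\<^sup>+x. dtt t * indicator {t. ?k + int i \<le> gen t} t * c t x * ennreal (m i x) \<partial>lborel \<partial>lborel)
      = (\<integral>\<^sup>+x. \<integral>\<^sup>+t. dtt t * indicator {t. ?k + int i \<le> gen t} t * c t x * ennreal (m i x) \<partial>lborel \<partial>lborel)"
      by (rule nn_integral_swap) measurable
    then show "(\<integral>\<^sup>+t. \<integral>\<^sup>+x. dtt t * indicator {t. ?k + int i \<le> gen t} t * c t x * ennreal (m i x) \<partial>lborel \<partial>lborel)
      = (\<integral>\<^sup>+x. A i x * ennreal (m i x) \<partial>lborel)"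
      unfolding A_def by (simp add: nn_integral_multc)
  qed
  also have "\<dots> \<le> (\<Sum>i. B * (\<integral>\<^sup>+x. ennreal (m i x) \<partial>lborel))"
  proof (intro suminf_le summableI nn_integral_step_avg)
    show "same_cube (?k + int i) x y \<Longrightarrow> ennreal (m i x) = ennreal (m i y)" for i x y
      by (simp only: m_same)
    show "(\<integral>\<^sup>+x. ennreal (avker (?k + int i) x0 x) * A i x \<partial>lborel) \<le> B" for i x0
      unfolding A_def by (rule box)
  qed measurable
  also have "\<dots> = B * (\<Sum>i. \<integral>\<^sup>+x. ennreal (m i x) \<partial>lborel)" by simp
  also have "\<dots> \<le> B * (4 * (\<integral>\<^sup>+x. ennreal ((F x)\<^sup>2) \<partial>lborel))"
  proof (intro mult_left_mono suminf_le_const)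
    fix n
    have "(\<Sum>i\<in>{..<n}. \<integral>\<^sup>+x. ennreal (m i x) \<partial>lborel) \<le> (\<Sum>i\<le>n. \<integral>\<^sup>+x. ennreal (m i x) \<partial>lborel)"
      by (intro sum_mono2) auto
    also have "\<dots> = (\<integral>\<^sup>+x. ennreal ((?M n x)\<^sup>2) \<partial>lborel)"
      by (simp add: nn_integral_sum[symmetric] sum_ennreal m0 sum_m)
    also have "\<dots> \<le> 4 * (\<integral>\<^sup>+x. ennreal ((F x)\<^sup>2) \<partial>lborel)" by (rule integral_dmax[OF F Fn FK])
    finally show "(\<Sum>i\<in>{..<n}. \<integral>\<^sup>+x. ennreal (m i x) \<partial>lborel) \<le> 4 * (\<integral>\<^sup>+x. ennreal ((F x)\<^sup>2) \<partial>lborel)" .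
  qed auto
  also have "\<dots> = 4 * B * sqnorm v" by (simp add: sqnorm_def F_def mult_ac)
  finally show "(\<integral>\<^sup>+t. dtt t * indicator {t. ?k \<le> gen t} t * (\<integral>\<^sup>+x. c t x * ennreal ((norm (avg (gen t) v x))\<^sup>2) \<partial>lborel) \<partial>lborel)
    \<le> 4 * B * sqnorm v" .
qed

subsection \<open>The one-parameter theorem\<close>

text \<open>On the i-th generation below j the power is at most
  \<open>2 powr (- \<gamma> * i)\<close>, and each generation has mass at most 1.\<close>

lemma nn_integral_dtt_powr:
  assumes "0 < \<gamma>"
  shows "(\<integral>\<^sup>+t. dtt t * indicator {t. j \<le> gen t} t * ennreal ((2 powi j * t) powr \<gamma>) \<partial>lborel) \<le> ennreal (geo_const \<gamma>)"
proof -
  have "(\<integral>\<^sup>+t. dtt t * indicator {t. j \<le> gen t} t * ennreal ((2 powi j * t) powr \<gamma>) \<partial>lborel)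
    \<le> (\<integral>\<^sup>+t. (\<Sum>i. dtt t * indicator {t. gen t = j + int i} t * ennreal (2 powr (- \<gamma> * \<bar>real i - real 0\<bar>))) \<partial>lborel)"
  proof (intro nn_integral_mono)
    fix t :: real
    show "dtt t * indicator {t. j \<le> gen t} t * ennreal ((2 powi j * t) powr \<gamma>)
      \<le> (\<Sum>i. dtt t * indicator {t. gen t = j + int i} t * ennreal (2 powr (- \<gamma> * \<bar>real i - real 0\<bar>)))"
    proof (cases "0 < t \<and> j \<le> gen t")
      case True
      define i where "i = nat (gen t - j)"
      have i: "gen t = j + int i" using True by (simp add: i_def)
      have "2 powi j * t \<le> 2 powi j * 2 powi (- gen t)" using gen_bounds[of t] True by (intro mult_left_mono) auto
      also have "\<dots> = 2 powr (- real i)" by (simp add: i powi_eq_powr flip: powr_add)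
      finally have "(2 powi j * t) powr \<gamma> \<le> (2 powr (- real i)) powr \<gamma>"
        using assms True by (intro powr_mono2) auto
      also have "\<dots> = 2 powr (- \<gamma> * \<bar>real i - real 0\<bar>)" by (simp add: powr_powr mult.commute)
      finally have "dtt t * indicator {t. j \<le> gen t} t * ennreal ((2 powi j * t) powr \<gamma>)
         \<le> dtt t * indicator {t. gen t = j + int i} t * ennreal (2 powr (- \<gamma> * \<bar>real i - real 0\<bar>))"
        using True i by (intro mult_mono ennreal_leI) auto
      also have "\<dots> \<le> (\<Sum>i. dtt t * indicator {t. gen t = j + int i} t * ennreal (2 powr (- \<gamma> * \<bar>real i - real 0\<bar>)))"
        by (rule ennreal_le_suminf)
      finally show ?thesis .
    qed (auto simp: dtt_def)
  qed
  also have "\<dots> = (\<Sum>i. (\<integral>\<^sup>+t. dtt t * indicator {t. gen t = j + int i} t \<partial>lborel) * ennreal (2 powr (- \<gamma> * \<bar>real i - real 0\<bar>)))"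
    by (subst nn_integral_suminf) (auto simp: nn_integral_multc)
  also have "\<dots> \<le> (\<Sum>i. 1 * ennreal (2 powr (- \<gamma> * \<bar>real i - real 0\<bar>)))"
    by (intro suminf_le summableI mult_right_mono nn_integral_dtt_gen) auto
  also have "\<dots> \<le> ennreal (geo_const \<gamma>)" unfolding mult_1 by (rule suminf_geo[OF assms])
  finally show ?thesis .
qed

text \<open>The two factors 2 come from the square of a sum: the box hypothesis itself, and the
  error made by extending the integral beyond the cube.\<close>

definition carleson_const :: "nat \<Rightarrow> real \<Rightarrow> real" where
  "carleson_const d \<alpha> = (let \<gamma> = min \<alpha> 1 / 2 in
     2 + 2 * (size_const d \<alpha> * (real d * size_const d (\<alpha> - \<gamma>)) * geo_const \<gamma>))"

lemma carleson_const_nonneg: "0 < \<alpha> \<Longrightarrow> 0 \<le> carleson_const d \<alpha>"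
  unfolding carleson_const_def Let_def
  by (intro add_nonneg_nonneg mult_nonneg_nonneg size_const_nonneg geo_const_nonneg) auto

lemma norm_power2_add_le: "(norm (a + b :: complex))\<^sup>2 \<le> 2 * (norm a)\<^sup>2 + 2 * (norm b)\<^sup>2"
  using norm_power2_diff_le[of a "- b"] by simp

text \<open>The box condition in normalized form for dyadic cubes, with the kernel integrated over
  the cube. One constant \<open>A\<close> serves for size and box, as the slices of the bi-parameter
  kernel produce both with the same factor. Continuity in y is added only in
  \<open>t1_kernel\<close>.\<close>

locale carleson_kernel =
  fixes k :: "real \<Rightarrow> real ^ 'd \<Rightarrow> real ^ 'd \<Rightarrow> complex" and \<alpha> A :: real
  assumes k_meas: "(\<lambda>(t, x, y). k t x y) \<in> borel_measurable borel"
    and k_int: "\<And>t x. 0 < t \<Longrightarrow> integrable lborel (k t x)"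
    and k_size: "AE t in lborel. 0 < t \<longrightarrow> (AE x in lborel. AE y in lborel.
      norm (k t x y) \<le> A * size_factor \<alpha> t x y)"
    and k_box: "\<And>j x0. (\<integral>\<^sup>+x. ennreal (avker j x0 x) * (\<integral>\<^sup>+t. dtt t * indicator {t. j \<le> gen t} t *
        ennreal ((norm (LINT y|lborel. indicator (dcube j x0) y * k t x y))\<^sup>2) \<partial>lborel) \<partial>lborel) \<le> ennreal (A\<^sup>2)"
    and A: "0 \<le> A" and \<alpha>: "0 < \<alpha>"
begin

lemma k_measurable [measurable (raw)]:
  assumes [measurable]: "a \<in> M \<rightarrow>\<^sub>M borel" "b \<in> M \<rightarrow>\<^sub>M borel" "c \<in> M \<rightarrow>\<^sub>M borel"
  shows "(\<lambda>x. k (a x) (b x) (c x)) \<in> borel_measurable M"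
  using measurable_compose[of "\<lambda>x. (a x, b x, c x)" M borel, OF _ k_meas] by simp

text \<open>What the integral over the cube of x misses is the part of the kernel that leaves the
  cube.\<close>

lemma k_offdiag:
  assumes "0 < t" and ae: "AE y in lborel. norm (k t x y) \<le> A * size_factor \<alpha> t x y"
  shows "norm ((LINT y|lborel. k t x y) - (LINT y|lborel. indicator (dcube j x) y * k t x y))
    \<le> A * (LINT y|lborel. offker j \<alpha> t x y)"
    and "integrable lborel (offker j \<alpha> t x)"
proof -
  show i: "integrable lborel (offker j \<alpha> t x)"
    by (rule Bochner_Integration.integrable_bound[OF integrable_size_factor[OF \<open>0 < t\<close> \<alpha>, of x]])
       (auto simp: offker_le)
  have ik: "integrable lborel (\<lambda>y. indicator (dcube j x) y * k t x y)"
    by (rule Bochner_Integration.integrable_bound[OF k_int[OF \<open>0 < t\<close>, of x]])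
       (auto simp: indicator_def)
  have "(LINT y|lborel. k t x y) - (LINT y|lborel. indicator (dcube j x) y * k t x y)
    = (LINT y|lborel. k t x y - indicator (dcube j x) y * k t x y)"
    using k_int[OF \<open>0 < t\<close>] ik by simp
  also have "norm \<dots> \<le> (LINT y|lborel. norm (k t x y - indicator (dcube j x) y * k t x y))"
    by (rule integral_norm_bound)
  also have "\<dots> \<le> (LINT y|lborel. A * offker j \<alpha> t x y)"
  proof (rule integral_mono_AE)
    show "AE y in lborel. norm (k t x y - indicator (dcube j x) y * k t x y) \<le> A * offker j \<alpha> t x y"
      using ae by eventually_elim (auto simp: indicator_def offker_def mem_dcube A)
  qed (use k_int[OF \<open>0 < t\<close>] ik i in auto)
  finally show "norm ((LINT y|lborel. k t x y) - (LINT y|lborel. indicator (dcube j x) y * k t x y))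
    \<le> A * (LINT y|lborel. offker j \<alpha> t x y)" by simp
qed

text \<open>Passes from the integral over the cube to the integral over the whole space. The error
  at x is the off-cube mass of the kernel, which decays with t after averaging over the cube and is
  then integrable for dt/t.\<close>

lemma k_carleson:
  "(\<integral>\<^sup>+x. ennreal (avker j x0 x) * (\<integral>\<^sup>+t. dtt t * indicator {t. j \<le> gen t} t *
      ennreal ((norm (LINT y|lborel. k t x y))\<^sup>2) \<partial>lborel) \<partial>lborel) \<le> ennreal (carleson_const CARD('d) \<alpha> * A\<^sup>2)"
proof -
  define \<gamma> where "\<gamma> = min \<alpha> 1 / 2"
  have \<gamma>: "0 < \<gamma>" "\<gamma> \<le> 1" "\<gamma> < \<alpha>" using \<alpha> by (auto simp: \<gamma>_def)
  let ?C = "size_const CARD('d) \<alpha>" and ?M = "real CARD('d) * size_const CARD('d) (\<alpha> - \<gamma>)"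
  have C0: "0 \<le> ?C" "0 \<le> ?M" "0 \<le> geo_const \<gamma>" using \<alpha> \<gamma> by (auto simp: size_const_nonneg geo_const_nonneg)
  let ?w = "\<lambda>t. dtt t * indicator {t. j \<le> gen t} t"
  have ind: "(\<lambda>t. indicator {t. j \<le> gen t} t :: ennreal) \<in> borel_measurable borel" by measurable
  note [measurable (raw)] = measurable_compose[OF _ ind]
  define b where "b t x = ennreal ((norm (LINT y|lborel. indicator (dcube j x0) y * k t x y))\<^sup>2)" for t x
  define e where "e t x = ennreal ((norm ((LINT y|lborel. k t x y) - (LINT y|lborel. indicator (dcube j x0) y * k t x y)))\<^sup>2)" for t x
  have [measurable]: "(\<lambda>x. b (f x) (g x)) \<in> borel_measurable M" "(\<lambda>x. e (f x) (g x)) \<in> borel_measurable M"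
    if [measurable]: "f \<in> M \<rightarrow>\<^sub>M borel" "g \<in> M \<rightarrow>\<^sub>M borel" for f g and M :: "'m measure"
    unfolding b_def e_def by measurable
  have pw: "ennreal ((norm (LINT y|lborel. k t x y))\<^sup>2) \<le> 2 * b t x + 2 * e t x" for t x
  proof -
    let ?a = "LINT y|lborel. indicator (dcube j x0) y * k t x y"
    have "(norm (LINT y|lborel. k t x y))\<^sup>2 \<le> 2 * (norm ?a)\<^sup>2 + 2 * (norm ((LINT y|lborel. k t x y) - ?a))\<^sup>2"
      using norm_power2_add_le[of ?a "(LINT y|lborel. k t x y) - ?a"] by simp
    from ennreal_leI[OF this] show ?thesis by (simp add: b_def e_def ennreal_mult)
  qed
  have "(\<integral>\<^sup>+x. ennreal (avker j x0 x) * (\<integral>\<^sup>+t. ?w t * ennreal ((norm (LINT y|lborel. k t x y))\<^sup>2) \<partial>lborel) \<partial>lborel)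
    \<le> (\<integral>\<^sup>+x. ennreal (avker j x0 x) * (\<integral>\<^sup>+t. ?w t * (2 * b t x + 2 * e t x) \<partial>lborel) \<partial>lborel)"
    by (intro nn_integral_mono mult_left_mono pw) auto
  also have "\<dots> = 2 * (\<integral>\<^sup>+x. ennreal (avker j x0 x) * (\<integral>\<^sup>+t. ?w t * b t x \<partial>lborel) \<partial>lborel)
    + 2 * (\<integral>\<^sup>+x. ennreal (avker j x0 x) * (\<integral>\<^sup>+t. ?w t * e t x \<partial>lborel) \<partial>lborel)"
  proof -
    have "?w t * (2 * b t x + 2 * e t x) = 2 * (?w t * b t x) + 2 * (?w t * e t x)" for t x
      by (simp add: distrib_left mult_ac)
    moreover have "ennreal a * (2 * p + 2 * q) = 2 * (ennreal a * p) + 2 * (ennreal a * q)" for a p q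
      by (simp add: distrib_left mult_ac)
    ultimately show ?thesis by (simp add: nn_integral_add nn_integral_cmult)
  qed
  also have "(\<integral>\<^sup>+x. ennreal (avker j x0 x) * (\<integral>\<^sup>+t. ?w t * b t x \<partial>lborel) \<partial>lborel) \<le> ennreal (A\<^sup>2)"
    unfolding b_def by (rule k_box)
  also have "(\<integral>\<^sup>+x. ennreal (avker j x0 x) * (\<integral>\<^sup>+t. ?w t * e t x \<partial>lborel) \<partial>lborel)
      = (\<integral>\<^sup>+t. ?w t * (\<integral>\<^sup>+x. ennreal (avker j x0 x) * e t x \<partial>lborel) \<partial>lborel)"
  proof -
    have "(\<integral>\<^sup>+x. ennreal (avker j x0 x) * (\<integral>\<^sup>+t. ?w t * e t x \<partial>lborel) \<partial>lborel)
      = (\<integral>\<^sup>+x. \<integral>\<^sup>+t. ?w t * (ennreal (avker j x0 x) * e t x) \<partial>lborel \<partial>lborel)"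
      by (simp add: nn_integral_cmult[symmetric] mult_ac)
    also have "\<dots> = (\<integral>\<^sup>+t. \<integral>\<^sup>+x. ?w t * (ennreal (avker j x0 x) * e t x) \<partial>lborel \<partial>lborel)"
      by (rule nn_integral_swap) measurable
    finally show ?thesis by (simp add: nn_integral_cmult)
  qed
  also have "\<dots> \<le> (\<integral>\<^sup>+t. ennreal (A\<^sup>2 * ?C * ?M) * (?w t * ennreal ((2 powi j * t) powr \<gamma>)) \<partial>lborel)"
  proof (intro nn_integral_mono_AE, use k_size in eventually_elim)
    fix t :: real assume ae: "0 < t \<longrightarrow> (AE x in lborel. AE y in lborel. norm (k t x y) \<le> A * size_factor \<alpha> t x y)"
    show "?w t * (\<integral>\<^sup>+x. ennreal (avker j x0 x) * e t x \<partial>lborel) \<le> ennreal (A\<^sup>2 * ?C * ?M) * (?w t * ennreal ((2 powi j * t) powr \<gamma>))"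
    proof (cases "0 < t")
      case t: True
      define W :: "real ^ 'd \<Rightarrow> ennreal" where "W x = (\<integral>\<^sup>+y. ennreal (offker j \<alpha> t x y) \<partial>lborel)" for x
      have "(\<integral>\<^sup>+x. ennreal (avker j x0 x) * e t x \<partial>lborel) \<le> (\<integral>\<^sup>+x. ennreal (A\<^sup>2 * ?C) * (ennreal (avker j x0 x) * W x) \<partial>lborel)"
      proof (intro nn_integral_mono_AE, use ae[rule_format, OF t] in eventually_elim)
        fix x assume ae: "AE y in lborel. norm (k t x y) \<le> A * size_factor \<alpha> t x y"
        show "ennreal (avker j x0 x) * e t x \<le> ennreal (A\<^sup>2 * ?C) * (ennreal (avker j x0 x) * W x)"
        proof (cases "same_cube j x0 x")
          case True
          have "same_cube j x0 y \<longleftrightarrow> same_cube j x y" for y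
            using True by (meson same_cube_sym same_cube_trans)
          then have Q: "dcube j x0 = dcube j x" by (simp add: dcube_eq)
          define r where "r = (LINT y|lborel. offker j \<alpha> t x y)"
          have r: "0 \<le> r" unfolding r_def by (intro Bochner_Integration.integral_nonneg) auto
          have W: "W x = ennreal r"
            unfolding W_def r_def by (rule nn_integral_eq_integral[OF k_offdiag(2)[OF t ae]]) simp
          have "ennreal r \<le> ennreal ?C" unfolding W[symmetric] W_def by (rule nn_integral_offker_le[OF t \<alpha>])
          then have rC: "r \<le> ?C" using C0 by simp
          have "(norm ((LINT y|lborel. k t x y) - (LINT y|lborel. indicator (dcube j x0) y * k t x y)))\<^sup>2 \<le> (A * r)\<^sup>2"
            unfolding Q r_def by (intro power_mono k_offdiag[OF t ae]) auto
          also have "\<dots> = A\<^sup>2 * (r * r)" by (simp add: power2_eq_square)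
          \<comment> \<open>One of the two factors \<open>r\<close> is bounded by a constant,
            because the averaged decay estimate is linear in the off-cube mass.\<close>
          also have "\<dots> \<le> A\<^sup>2 * (?C * r)" by (intro mult_left_mono mult_right_mono rC r) auto
          finally have "e t x \<le> ennreal (A\<^sup>2 * ?C * r)" unfolding e_def by (intro ennreal_leI) (simp add: mult.assoc)
          then have "e t x \<le> ennreal (A\<^sup>2 * ?C) * W x" using C0 r by (simp add: W ennreal_mult)
          then have "ennreal (avker j x0 x) * e t x \<le> ennreal (avker j x0 x) * (ennreal (A\<^sup>2 * ?C) * W x)"
            by (intro mult_left_mono) auto
          then show ?thesis by (simp add: mult_ac)
        qed (simp add: avker_def)
      qed
      also have "\<dots> = ennreal (A\<^sup>2 * ?C) * (\<integral>\<^sup>+x. ennreal (avker j x0 x) * W x \<partial>lborel)"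
        unfolding W_def by (rule nn_integral_cmult) measurable
      also have "\<dots> \<le> ennreal (A\<^sup>2 * ?C) * ennreal (?M * (2 powi j * t) powr \<gamma>)"
        unfolding W_def by (intro mult_left_mono nn_integral_avker_offker t \<gamma>) auto
      also have "\<dots> = ennreal (A\<^sup>2 * ?C * ?M) * ennreal ((2 powi j * t) powr \<gamma>)"
      proof -
        have "ennreal a * ennreal (m * p) = ennreal (a * m) * ennreal p" if "0 \<le> a" "0 \<le> m" "0 \<le> p" for a m p
          using that by (simp add: ennreal_mult mult_ac)
        from this[of "A\<^sup>2 * ?C" ?M "(2 powi j * t) powr \<gamma>"] show ?thesis using C0 by simp
      qed
      finally have "?w t * (\<integral>\<^sup>+x. ennreal (avker j x0 x) * e t x \<partial>lborel) \<le> ?w t * (ennreal (A\<^sup>2 * ?C * ?M) * ennreal ((2 powi j * t) powr \<gamma>))"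
        by (rule mult_left_mono) simp
      then show ?thesis by (simp only: mult_ac)
    qed (simp add: dtt_def)
  qed
  also have "\<dots> = ennreal (A\<^sup>2 * ?C * ?M) * (\<integral>\<^sup>+t. ?w t * ennreal ((2 powi j * t) powr \<gamma>) \<partial>lborel)"
    by (rule nn_integral_cmult) measurable
  also have "\<dots> \<le> ennreal (A\<^sup>2 * ?C * ?M) * ennreal (geo_const \<gamma>)"
    by (intro mult_left_mono nn_integral_dtt_powr \<gamma>) auto
  also have "2 * ennreal (A\<^sup>2) + 2 * (ennreal (A\<^sup>2 * ?C * ?M) * ennreal (geo_const \<gamma>))
     = ennreal (carleson_const CARD('d) \<alpha> * A\<^sup>2)"
  proof -
    have "2 * ennreal (A\<^sup>2) + 2 * (ennreal (A\<^sup>2 * ?C * ?M) * ennreal (geo_const \<gamma>))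
      = ennreal (2 * A\<^sup>2 + 2 * (A\<^sup>2 * ?C * ?M * geo_const \<gamma>))"
      using C0 by (simp add: ennreal_mult ennreal_plus)
    also have "2 * A\<^sup>2 + 2 * (A\<^sup>2 * ?C * ?M * geo_const \<gamma>) = carleson_const CARD('d) \<alpha> * A\<^sup>2"
      unfolding carleson_const_def Let_def \<gamma>_def[symmetric] by (simp add: algebra_simps)
    finally show ?thesis .
  qed
  finally show ?thesis by (simp add: add_mono mult_left_mono)
qed

theorem k_embedding:
  assumes v: "bdd_supp v" and K: "\<And>x y. same_cube K x y \<Longrightarrow> v x = v y"
  shows "(\<integral>\<^sup>+t. dtt t * (\<integral>\<^sup>+x. ennreal ((norm ((LINT y|lborel. k t x y) * avg (gen t) v x))\<^sup>2) \<partial>lborel) \<partial>lborel)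
     \<le> ennreal (4 * carleson_const CARD('d) \<alpha> * A\<^sup>2) * sqnorm v"
proof -
  have "(\<integral>\<^sup>+t. dtt t * (\<integral>\<^sup>+x. ennreal ((norm (LINT y|lborel. k t x y))\<^sup>2) * ennreal ((norm (avg (gen t) v x))\<^sup>2) \<partial>lborel) \<partial>lborel)
    \<le> 4 * ennreal (carleson_const CARD('d) \<alpha> * A\<^sup>2) * sqnorm v"
  proof (rule Carleson_embedding[OF _ k_carleson v K])
    show "(\<lambda>(t, x). ennreal ((norm (LINT y|lborel. k t x y))\<^sup>2)) \<in> borel_measurable borel"
      unfolding case_prod_unfold by measurable
  qed
  then show ?thesis
    using carleson_const_nonneg[OF \<alpha>, of "CARD('d)"]
    by (simp add: norm_mult power_mult_distrib ennreal_mult mult_ac)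
qed

end

lemma integral_unit_indicator: "(LINT z|lborel. indicat_real {0..1::real} z) = 1"
  by simp

text \<open>The slices in the first parameter are of this kind: there the full theorem is applied
  and not just the embedding.\<close>

locale t1_kernel = carleson_kernel +
  assumes k_holder: "AE t in lborel. 0 < t \<longrightarrow> (AE x in lborel. AE y in lborel. AE y' in lborel.
      norm (y - y') < t / 2 \<longrightarrow> norm (k t x y - k t x y') \<le> A * holder_factor \<alpha> t x y y')"
begin

text \<open>The scalar kernel is made operator-valued by tensoring with the projection onto the
  indicator of [0,1] in an auxiliary real variable. \<open>operator_square_function\<close> controls
  the part acting on v minus its average, \<open>k_embedding\<close> the rest; 8 is 2 times the 4 of
  the latter.\<close>

theorem square_function:
  assumes v: "bdd_supp v" and K: "\<And>x y. same_cube K x y \<Longrightarrow> v x = v y"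
  shows "(\<integral>\<^sup>+t. dtt t * (\<integral>\<^sup>+x. ennreal ((norm (LINT y|lborel. k t x y * v y))\<^sup>2) \<partial>lborel) \<partial>lborel)
     \<le> ennreal ((2 * square_const CARD('a) \<alpha> + 8 * carleson_const CARD('a) \<alpha>) * A\<^sup>2) * sqnorm v"
proof -
  let ?i = "\<lambda>z :: real. indicator {0..1} z :: complex"
  have ii: "?i z * ?i z = ?i z" for z by (simp add: indicator_def)
  have int_i: "integrable lborel ?i" "(LINT z|lborel. ?i z) = 1"
  proof -
    have *: "?i = (\<lambda>z. of_real (indicator {0..1} z))" by (auto simp: indicator_def fun_eq_iff)
    show "integrable lborel ?i" unfolding * by (intro integrable_of_real integrable_real_indicator) auto
    show "(LINT z|lborel. ?i z) = 1" unfolding * integral_of_real integral_unit_indicator by simp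
  qed
  have sq_i: "(\<integral>\<^sup>+w. ennreal ((norm (c * ?i w))\<^sup>2) \<partial>lborel) = ennreal ((norm c)\<^sup>2)" for c
  proof -
    have "(\<integral>\<^sup>+w. ennreal ((norm (c * ?i w))\<^sup>2) \<partial>lborel) = (\<integral>\<^sup>+w. ennreal ((norm c)\<^sup>2) * indicator {0..1::real} w \<partial>lborel)"
      by (intro nn_integral_cong) (simp add: indicator_def)
    then show ?thesis by (simp add: nn_integral_cmult_indicator)
  qed
  define \<kappa> where "\<kappa> t x y w z = (k t x y * ?i w) * ?i z" for t x y w z
  \<comment> \<open>Multiples of the indicator, the range of the projection. On them the operator
    norm is the absolute value of the scalar kernel.\<close>
  define P where "P u \<longleftrightarrow> (\<exists>c. u = (\<lambda>z. c * ?i z))" for u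
  define f where "f p = v (fst p) * ?i (snd p)" for p
  note [measurable] = bdd_supp_measurable[OF v]
  obtain B where B: "0 \<le> B" "\<And>x. norm (v x) \<le> B" "\<And>x. B < norm x \<Longrightarrow> v x = 0"
    using bdd_supp_bound[OF v] by metis
  have f: "bdd_supp f"
  proof (rule bdd_suppI[where B=B and R="B + 1"])
    show "f \<in> borel_measurable borel" unfolding f_def[abs_def] by measurable
    show "norm (f p) \<le> B" for p using B(1) B(2)[of "fst p"] by (simp add: f_def indicator_def)
    fix p :: "(real ^ 'a) \<times> real" assume p: "B + 1 < norm p"
    have "norm p \<le> norm (fst p) + norm (snd p)" using norm_Pair_le[of "fst p" "snd p"] by simp
    then show "f p = 0" using p B(3)[of "fst p"] by (cases "snd p \<in> {0..1}") (auto simp: f_def)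
  qed
  have pavg_f: "pavg j f (y, z) = avg j v y * ?i z" for j y z
    using avg_mult[of j y "\<lambda>_. ?i z" v] by (simp add: pavg_def f_def mult.commute[of _ "?i z"])
  have int_k: "(LINT z|lborel. (c * ?i z) * (d * ?i z)) = c * d" for c d
  proof -
    have eq: "(\<lambda>z. (c * ?i z) * (d * ?i z)) = (\<lambda>z. (c * d) * ?i z)"
      by (auto simp: indicator_def fun_eq_iff)
    show ?thesis unfolding eq using int_i by simp
  qed
  have kk: "integrable lborel (\<lambda>p. \<kappa> t x (fst p) w (snd p))" if "0 < t" for t x w
  proof (rule integrableI_bounded)
    show "(\<lambda>p. \<kappa> t x (fst p) w (snd p)) \<in> borel_measurable lborel" unfolding \<kappa>_def by measurable
    have "(\<integral>\<^sup>+p. ennreal (norm (\<kappa> t x (fst p) w (snd p))) \<partial>lborel)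
      \<le> (\<integral>\<^sup>+p. ennreal (norm (k t x (fst p))) * indicator {0..1::real} (snd p) \<partial>lborel)"
      by (intro nn_integral_mono) (auto simp: \<kappa>_def indicator_def)
    also have "\<dots> = (\<integral>\<^sup>+y. ennreal (norm (k t x y)) \<partial>lborel)"
      by (subst nn_integral_pair, measurable) (simp add: nn_integral_cmult_indicator)
    also have "\<dots> < \<infinity>" using k_int[OF that, of x] by (simp add: integrable_iff_bounded)
    finally show "(\<integral>\<^sup>+p. ennreal (norm (\<kappa> t x (fst p) w (snd p))) \<partial>lborel) < \<infinity>" .
  qed
  have sqP: "sqnorm (\<lambda>z. c * ?i z) = ennreal ((norm c)\<^sup>2)" for c
    unfolding sqnorm_def by (rule sq_i)
  have ok: "AE t in lborel. 0 < t \<longrightarrow> operator_kernel (\<kappa> t) P \<alpha> A t"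
    using k_size k_holder
  proof eventually_elim
    case (elim t)
    show ?case
    proof
      assume t: "0 < t"
      have bound: "(\<integral>\<^sup>+w. ennreal ((norm (LINT z|lborel. (c * ?i w) * ?i z * (d * ?i z)))\<^sup>2) \<partial>lborel)
          \<le> ennreal (q\<^sup>2) * ennreal ((norm d)\<^sup>2)" if "norm c \<le> q" for c d q
      proof -
        have "(\<integral>\<^sup>+w. ennreal ((norm (LINT z|lborel. (c * ?i w) * ?i z * (d * ?i z)))\<^sup>2) \<partial>lborel)
          = (\<integral>\<^sup>+w. ennreal ((norm ((c * d) * ?i w))\<^sup>2) \<partial>lborel)"
          by (simp only: int_k) (simp add: mult_ac)
        also have "\<dots> = ennreal ((norm c)\<^sup>2) * ennreal ((norm d)\<^sup>2)"
          unfolding sq_i by (simp add: norm_mult power_mult_distrib ennreal_mult)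
        also have "\<dots> \<le> ennreal (q\<^sup>2) * ennreal ((norm d)\<^sup>2)"
          using that by (intro mult_right_mono ennreal_leI power_mono) auto
        finally show ?thesis .
      qed
      show "operator_kernel (\<kappa> t) P \<alpha> A t"
      proof
        show "(\<lambda>(x, y, w, z). \<kappa> t x y w z) \<in> borel_measurable borel"
          unfolding \<kappa>_def case_prod_unfold by measurable
        show "integrable lborel (\<lambda>p. \<kappa> t x (fst p) w (snd p))" for x w by (rule kk[OF t])
        show "AE x in lborel. AE y in lborel. \<forall>v. P v \<longrightarrow>
          (\<integral>\<^sup>+w. ennreal ((norm (LINT z|lborel. \<kappa> t x y w z * v z))\<^sup>2) \<partial>lborel)
            \<le> ennreal ((A * size_factor \<alpha> t x y)\<^sup>2) * sqnorm v"
          by (rule AE_AE_mono[OF elim(1)[rule_format, OF t]]) (auto simp: P_def \<kappa>_def sqP intro!: bound)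
        show "AE x in lborel. AE y in lborel. AE y' in lborel. norm (y - y') < t / 2 \<longrightarrow> (\<forall>v. P v \<longrightarrow>
          (\<integral>\<^sup>+w. ennreal ((norm (LINT z|lborel. (\<kappa> t x y w z - \<kappa> t x y' w z) * v z))\<^sup>2) \<partial>lborel)
            \<le> ennreal ((A * holder_factor \<alpha> t x y y')\<^sup>2) * sqnorm v)"
        proof (rule AE_AE_mono[OF elim(2)[rule_format, OF t]], erule eventually_mono, intro impI allI)
          fix x y y' v
          assume h: "norm (y - y') < t / 2 \<longrightarrow> norm (k t x y - k t x y') \<le> A * holder_factor \<alpha> t x y y'"
            "norm (y - y') < t / 2" and "P v"
          then obtain d where d: "v = (\<lambda>z. d * ?i z)" by (auto simp: P_def)
          have eq: "\<kappa> t x y w z - \<kappa> t x y' w z = ((k t x y - k t x y') * ?i w) * ?i z" for w z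
            by (simp add: \<kappa>_def left_diff_distrib)
          show "(\<integral>\<^sup>+w. ennreal ((norm (LINT z|lborel. (\<kappa> t x y w z - \<kappa> t x y' w z) * v z))\<^sup>2) \<partial>lborel)
            \<le> ennreal ((A * holder_factor \<alpha> t x y y')\<^sup>2) * sqnorm v"
            unfolding eq d sqP using h by (intro bound) auto
        qed
        show "P (\<lambda>z. u z - v z)" if Puv: "P u" "P v" for u v
        proof -
          obtain c d where "u = (\<lambda>z. c * ?i z)" "v = (\<lambda>z. d * ?i z)" using Puv by (auto simp: P_def)
          then have "(\<lambda>z. u z - v z) = (\<lambda>z. (c - d) * ?i z)" by (simp add: left_diff_distrib)
          then show ?thesis unfolding P_def by blast
        qed
      qed (use A \<alpha> t in auto)
    qed
  qed
  \<comment> \<open>Undoes the tensor product: the auxiliary integral is 1, and the value of the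
    average at x leaves the y-integral.\<close>
  have app: "(LINT p|lborel. \<kappa> t x (fst p) w (snd p) * (f p - pavg (gen t) f (x, snd p)))
     = ((LINT y|lborel. k t x y * v y) - (LINT y|lborel. k t x y) * avg (gen t) v x) * ?i w"
    if t: "0 < t" for t x w
  proof -
    have "norm (f p - pavg (gen t) f (x, snd p)) \<le> B + B" for p
    proof -
      have "norm (avg (gen t) v x) \<le> B" by (intro avg_bound B)
      then show ?thesis
        unfolding f_def pavg_f using B(1) B(2)[of "fst p"] norm_triangle_ineq4[of "v (fst p)" "avg (gen t) v x"]
        by (cases "snd p \<in> {0..1}") auto
    qed
    note bnd = this
    have i: "integrable lborel (\<lambda>p. \<kappa> t x (fst p) w (snd p) * (f p - pavg (gen t) f (x, snd p)))"
      by (rule integrable_mult_bounded[OF kk[OF t] _ bnd]) (simp add: pavg_f f_def)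
    have iv: "integrable lborel (\<lambda>y. k t x y * v y)"
      by (rule integrable_mult_bounded[OF k_int[OF t] _ B(2)]) measurable
    have "(LINT p|lborel. \<kappa> t x (fst p) w (snd p) * (f p - pavg (gen t) f (x, snd p)))
      = (LINT y|lborel. LINT z|lborel. (k t x y * ?i w) * ?i z * ((v y - avg (gen t) v x) * ?i z))"
      by (subst lborel_integral_pair(1)[OF i]) (simp add: \<kappa>_def f_def pavg_f left_diff_distrib)
    also have "\<dots> = (LINT y|lborel. (k t x y * v y - k t x y * avg (gen t) v x) * ?i w)"
      unfolding int_k by (simp add: right_diff_distrib mult_ac)
    also have "\<dots> = ((LINT y|lborel. k t x y * v y) - (LINT y|lborel. k t x y) * avg (gen t) v x) * ?i w"
      using iv k_int[OF t] by simp
    finally show ?thesis .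
  qed
  have sqf: "sqnorm f = sqnorm v"
    by (subst sqnorm_pair(1)[OF bdd_supp_measurable[OF f]]) (simp add: f_def sqP, simp add: sqnorm_def)
  have \<kappa>m: "(\<lambda>(t, x, y, w, z). \<kappa> t x y w z) \<in> borel_measurable borel"
    unfolding \<kappa>_def case_prod_unfold by measurable
  have "(\<integral>\<^sup>+t. dtt t * (\<integral>\<^sup>+x. \<integral>\<^sup>+w. ennreal ((norm (LINT p|lborel.
      \<kappa> t x (fst p) w (snd p) * (f p - pavg (gen t) f (x, snd p))))\<^sup>2) \<partial>lborel \<partial>lborel) \<partial>lborel)
     \<le> ennreal (square_const CARD('a) \<alpha> * A\<^sup>2) * sqnorm f"
  proof (rule operator_square_function[OF \<kappa>m ok f _ _ \<alpha>])
    show "stepfun K f" unfolding stepfun_def f_def by (auto dest: K)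
    show "P (\<lambda>z. pavg j f (y, z))" for j y unfolding P_def pavg_f by blast
  qed
  also have "(\<integral>\<^sup>+t. dtt t * (\<integral>\<^sup>+x. \<integral>\<^sup>+w. ennreal ((norm (LINT p|lborel.
      \<kappa> t x (fst p) w (snd p) * (f p - pavg (gen t) f (x, snd p))))\<^sup>2) \<partial>lborel \<partial>lborel) \<partial>lborel)
    = (\<integral>\<^sup>+t. dtt t * (\<integral>\<^sup>+x. ennreal ((norm ((LINT y|lborel. k t x y * v y) - (LINT y|lborel. k t x y) * avg (gen t) v x))\<^sup>2) \<partial>lborel) \<partial>lborel)"
    (is "_ = (\<integral>\<^sup>+t. dtt t * ?a t \<partial>lborel)")
  proof (intro nn_integral_cong)
    fix t :: real
    show "dtt t * (\<integral>\<^sup>+x. \<integral>\<^sup>+w. ennreal ((norm (LINT p|lborel.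
      \<kappa> t x (fst p) w (snd p) * (f p - pavg (gen t) f (x, snd p))))\<^sup>2) \<partial>lborel \<partial>lborel) = dtt t * ?a t"
      by (cases "0 < t") (simp_all only: app sq_i, simp add: dtt_def)
  qed
  finally have a: "(\<integral>\<^sup>+t. dtt t * ?a t \<partial>lborel) \<le> ennreal (square_const CARD('a) \<alpha> * A\<^sup>2) * sqnorm v"
    unfolding sqf .
  let ?b = "\<lambda>t. \<integral>\<^sup>+x. ennreal ((norm ((LINT y|lborel. k t x y) * avg (gen t) v x))\<^sup>2) \<partial>lborel"
  have mavg [measurable (raw)]: "(\<lambda>q. avg (gen (\<tau> q)) v (h q)) \<in> borel_measurable M"
    if [measurable]: "\<tau> \<in> M \<rightarrow>\<^sub>M borel" "h \<in> M \<rightarrow>\<^sub>M borel" for \<tau> h and M :: "'m measure"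
    by (rule gen_measurable_compose[where F="\<lambda>k q. avg k v (h q)"]) measurable
  have "(\<integral>\<^sup>+t. dtt t * (\<integral>\<^sup>+x. ennreal ((norm (LINT y|lborel. k t x y * v y))\<^sup>2) \<partial>lborel) \<partial>lborel)
    \<le> (\<integral>\<^sup>+t. dtt t * (\<integral>\<^sup>+x. 2 * ennreal ((norm ((LINT y|lborel. k t x y * v y) - (LINT y|lborel. k t x y) * avg (gen t) v x))\<^sup>2)
       + 2 * ennreal ((norm ((LINT y|lborel. k t x y) * avg (gen t) v x))\<^sup>2) \<partial>lborel) \<partial>lborel)"
  proof (intro nn_integral_mono mult_left_mono)
    fix t x
    let ?u = "LINT y|lborel. k t x y * v y" and ?w = "(LINT y|lborel. k t x y) * avg (gen t) v x"
    have "(norm ?u)\<^sup>2 \<le> 2 * (norm (?u - ?w))\<^sup>2 + 2 * (norm ?w)\<^sup>2"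
      using norm_power2_add_le[of "?u - ?w" ?w] by simp
    from ennreal_leI[OF this] show "ennreal ((norm ?u)\<^sup>2) \<le> 2 * ennreal ((norm (?u - ?w))\<^sup>2) + 2 * ennreal ((norm ?w)\<^sup>2)"
      by (simp add: ennreal_mult)
  qed simp
  also have "\<dots> = (\<integral>\<^sup>+t. 2 * (dtt t * ?a t) + 2 * (dtt t * ?b t) \<partial>lborel)"
    by (intro nn_integral_cong, subst nn_integral_add) (simp_all add: nn_integral_cmult distrib_left mult_ac)
  also have "\<dots> = 2 * (\<integral>\<^sup>+t. dtt t * ?a t \<partial>lborel) + 2 * (\<integral>\<^sup>+t. dtt t * ?b t \<partial>lborel)"
    by (subst nn_integral_add) (simp_all add: nn_integral_cmult)
  also have "\<dots> \<le> 2 * (ennreal (square_const CARD('a) \<alpha> * A\<^sup>2) * sqnorm v) + 2 * (ennreal (4 * carleson_const CARD('a) \<alpha> * A\<^sup>2) * sqnorm v)"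
    by (intro add_mono mult_left_mono a k_embedding[OF v K]) auto
  also have "\<dots> = ennreal ((2 * square_const CARD('a) \<alpha> + 8 * carleson_const CARD('a) \<alpha>) * A\<^sup>2) * sqnorm v"
  proof -
    have "ennreal ((2 * square_const CARD('a) \<alpha> + 8 * carleson_const CARD('a) \<alpha>) * A\<^sup>2)
      = 2 * ennreal (square_const CARD('a) \<alpha> * A\<^sup>2) + 2 * ennreal (4 * carleson_const CARD('a) \<alpha> * A\<^sup>2)"
      using carleson_const_nonneg[OF \<alpha>, of "CARD('a)"] square_const_nonneg[OF \<alpha>, of "CARD('a)"]
      by (simp add: distrib_right distrib_left ennreal_plus ennreal_mult mult_ac)
    then show ?thesis by (simp add: distrib_right mult.assoc)
  qed
  finally show ?thesis .
qed

end

subsection \<open>The bi-parameter Carleson embedding\<close>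

lemma layer_cake:
  assumes "0 \<le> a"
  shows "ennreal (a\<^sup>2) = (\<integral>\<^sup>+r. ennreal (2 * r) * indicator {0..a} r \<partial>lborel)"
proof -
  have "(\<integral>\<^sup>+r. ennreal (2 * r) * indicator {0..a} r \<partial>lborel) = ennreal (a\<^sup>2 - 0\<^sup>2)"
    by (rule nn_integral_FTC_Icc[where F="\<lambda>x. x\<^sup>2"])
       (use assms in \<open>auto intro!: derivative_eq_intros\<close>)
  then show ?thesis by simp
qed

section \<open>The strong dyadic maximal function\<close>

lemma avg_mono:
  fixes F G :: "real ^ 'd \<Rightarrow> real"
  assumes "bdd_supp F" "bdd_supp G" "\<And>y. F y \<le> G y"
  shows "avg k F x \<le> avg k G x"
  unfolding avg_def
  by (rule integral_mono)
     (use assms(1,2)[THEN integrable_avker_bdd_supp] assms(3) in \<open>auto intro: mult_left_mono\<close>)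

lemma bdd_supp_norm: "bdd_supp f \<Longrightarrow> bdd_supp (\<lambda>x. norm (f x))"
  for f :: "'a::euclidean_space \<Rightarrow> 'b::euclidean_space"
  by (rule bdd_supp_mult_bounded[where C=1]) (auto simp: bdd_supp_measurable)

lemma bdd_supp_dmax_param:
  fixes f :: "(real ^ 'd) \<times> 'z::euclidean_space \<Rightarrow> real"
  assumes "bdd_supp f" shows "bdd_supp (\<lambda>p. dmax k (\<lambda>y. f (y, snd p)) n (fst p))"
  by (induction n) (simp_all add: assms bdd_supp_max bdd_supp_avg_param)

lemma bdd_supp_dmax_param2:
  fixes f :: "'z::euclidean_space \<times> (real ^ 'd) \<Rightarrow> real"
  assumes "bdd_supp f" shows "bdd_supp (\<lambda>p. dmax k (\<lambda>y. f (fst p, y)) n (snd p))"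
  by (induction n) (simp_all add: assms bdd_supp_max bdd_supp_avg_param2)

definition stepfun2 :: "int \<Rightarrow> ((real ^ 'n) \<times> (real ^ 'm) \<Rightarrow> 'b) \<Rightarrow> bool" where
  "stepfun2 K f \<longleftrightarrow> (\<forall>y1 y1' y2 y2'. same_cube K y1 y1' \<longrightarrow> same_cube K y2 y2' \<longrightarrow> f (y1, y2) = f (y1', y2'))"

definition avg2 :: "int \<Rightarrow> int \<Rightarrow> ((real ^ 'n) \<times> (real ^ 'm) \<Rightarrow> complex) \<Rightarrow> real ^ 'n \<Rightarrow> real ^ 'm \<Rightarrow> complex" where
  "avg2 k l f x1 x2 = avg k (\<lambda>y1. avg l (\<lambda>y2. f (y1, y2)) x2) x1"

lemma avg_high:
  fixes f :: "real ^ 'd \<Rightarrow> 'b::euclidean_space"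
  assumes "\<And>y y'. same_cube K y y' \<Longrightarrow> f y = f y'" "K \<le> k"
  shows "avg k f x = f x"
proof (rule avg_const)
  fix y assume "same_cube k x y"
  then have "same_cube K x y" by (rule same_cube_mono[OF assms(2)])
  then show "f y = f x" using assms(1) by metis
qed

text \<open>Iterated one-parameter maximal functions, second variable first, dominate all
  rectangular averages; Doob's inequality in each variable gives 16 = 4 * 4. Local constancy on
  dyadic rectangles is recorded because it makes the level sets admissible in the Carleson
  condition.\<close>

theorem strong_maximal_function:
  fixes f :: "(real ^ 'n) \<times> (real ^ 'm) \<Rightarrow> complex"
  assumes f: "bdd_supp f" and K: "stepfun2 K f"
  obtains M where "bdd_supp M" "\<And>p. 0 \<le> M p"
    "\<And>k l x1 x2. - int N \<le> k \<Longrightarrow> - int N \<le> l \<Longrightarrow> norm (avg2 k l f x1 x2) \<le> M (x1, x2)"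
    "\<And>p. \<exists>k l. \<forall>y1 y2. same_cube k (fst p) y1 \<longrightarrow> same_cube l (snd p) y2 \<longrightarrow> M (y1, y2) = M p"
    "(\<integral>\<^sup>+p. ennreal ((M p)\<^sup>2) \<partial>lborel) \<le> 16 * sqnorm f"
proof -
  let ?k = "- int N"
  \<comment> \<open>From generation \<open>?k + int n\<close> on, averaging does not change
    \<open>f\<close>, so the finite maximum controls all finer generations too.\<close>
  define n where "n = nat (K + int N)"
  have n: "K \<le> ?k + int n" by (simp add: n_def)
  define F where "F p = norm (f p)" for p
  have F: "bdd_supp F" unfolding F_def[abs_def] by (rule bdd_supp_norm[OF f])
  have F0: "0 \<le> F p" for p by (simp add: F_def)
  have FK: "same_cube K y1 y1' \<Longrightarrow> same_cube K y2 y2' \<Longrightarrow> F (y1, y2) = F (y1', y2')" for y1 y1' y2 y2'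
    using K unfolding stepfun2_def F_def by metis
  define g where "g p = dmax ?k (\<lambda>y. F (fst p, y)) n (snd p)" for p
  have g: "bdd_supp g" unfolding g_def[abs_def] by (rule bdd_supp_dmax_param2[OF F])
  have g0: "0 \<le> g p" for p unfolding g_def by (rule dmax_nonneg[OF F0])
  have gK: "g (y1, x2) = g (y1', x2)" if "same_cube K y1 y1'" for y1 y1' x2
  proof -
    have "(\<lambda>y. F (y1, y)) = (\<lambda>y. F (y1', y))" using FK[OF that] by auto
    then show ?thesis by (simp add: g_def)
  qed
  define M where "M p = dmax ?k (\<lambda>y. g (y, snd p)) n (fst p)" for p
  have M: "bdd_supp M" unfolding M_def[abs_def] by (rule bdd_supp_dmax_param[OF g])
  note [measurable] = bdd_supp_measurable[OF f] bdd_supp_measurable[OF F] bdd_supp_measurable[OF g] bdd_supp_measurable[OF M]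
  have M0: "0 \<le> M p" for p unfolding M_def by (rule dmax_nonneg[OF g0])
  have le: "norm (avg2 k l f x1 x2) \<le> M (x1, x2)" if "?k \<le> k" "?k \<le> l" for k l x1 x2
  proof -
    have g1: "norm (avg l (\<lambda>y2. f (y1, y2)) x2) \<le> g (y1, x2)" for y1
    proof -
      \<comment> \<open>Generations beyond the range of the maximum are cut back to its last one,
        without changing the average of the step function.\<close>
      define l' where "l' = min l (?k + int n)"
      have fs: "bdd_supp (\<lambda>y2. f (y1, y2))" by (rule bdd_supp_section(2)[OF f])
      have "avg l (\<lambda>y2. f (y1, y2)) x2 = avg l' (\<lambda>y2. f (y1, y2)) x2"
      proof (cases "l \<le> ?k + int n")
        case False
        have s: "same_cube K y y' \<Longrightarrow> f (y1, y) = f (y1, y')" for y y'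
          using K unfolding stepfun2_def by (metis same_cube_refl)
        show ?thesis using False n by (simp add: l'_def avg_high[of K, OF s])
      qed (simp add: l'_def)
      also have "norm \<dots> \<le> avg l' (\<lambda>y. F (y1, y)) x2" unfolding F_def by (rule norm_avg_le[OF fs])
      also have "\<dots> = avg (?k + int (nat (l' + int N))) (\<lambda>y. F (y1, y)) x2"
      proof -
        have "?k + int (nat (l' + int N)) = l'" using that by (auto simp: l'_def)
        then show ?thesis by simp
      qed
      also have "\<dots> \<le> g (y1, x2)" unfolding g_def fst_conv snd_conv
        by (rule avg_le_dmax) (simp add: l'_def)
      finally show ?thesis .
    qed
    define k' where "k' = min k (?k + int n)"
    let ?h = "\<lambda>y1. avg l (\<lambda>y2. f (y1, y2)) x2"
    have h: "bdd_supp ?h" using bdd_supp_section(1)[OF bdd_supp_avg_param2[OF f, of l], of x2] by simp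
    have hs: "same_cube K y y' \<Longrightarrow> ?h y = ?h y'" for y y'
    proof -
      assume "same_cube K y y'"
      then have "(\<lambda>y2. f (y, y2)) = (\<lambda>y2. f (y', y2))"
        using K unfolding stepfun2_def by (metis same_cube_refl)
      then show "?h y = ?h y'" by simp
    qed
    have "avg2 k l f x1 x2 = avg k' ?h x1"
    proof (cases "k \<le> ?k + int n")
      case False
      show ?thesis unfolding avg2_def using False n by (simp add: k'_def avg_high[of K, OF hs])
    qed (simp add: k'_def avg2_def)
    also have "norm \<dots> \<le> avg k' (\<lambda>y. norm (?h y)) x1" by (rule norm_avg_le[OF h])
    also have "\<dots> \<le> avg k' (\<lambda>y. g (y, x2)) x1"
      by (rule avg_mono[OF bdd_supp_norm[OF h] bdd_supp_section(1)[OF g] g1])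
    also have "\<dots> = avg (?k + int (nat (k' + int N))) (\<lambda>y. g (y, x2)) x1"
    proof -
      have "?k + int (nat (k' + int N)) = k'" using that by (auto simp: k'_def)
      then show ?thesis by simp
    qed
    also have "\<dots> \<le> M (x1, x2)" unfolding M_def fst_conv snd_conv
      by (rule avg_le_dmax) (simp add: k'_def)
    finally show ?thesis .
  qed
  have step: "\<exists>k l. \<forall>y1 y2. same_cube k (fst p) y1 \<longrightarrow> same_cube l (snd p) y2 \<longrightarrow> M (y1, y2) = M p" for p
  proof (intro exI allI impI)
    fix y1 y2 assume s: "same_cube (?k + int n) (fst p) y1" "same_cube (?k + int n) (snd p) y2"
    have "g (y, y2) = g (y, snd p)" for y
      unfolding g_def using dmax_same_cube[OF s(2)] by simp
    then show "M (y1, y2) = M p" unfolding M_def using dmax_same_cube[OF s(1)] by simp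
  qed
  have "(\<integral>\<^sup>+p. ennreal ((M p)\<^sup>2) \<partial>lborel) = (\<integral>\<^sup>+x2. \<integral>\<^sup>+x1. ennreal ((M (x1, x2))\<^sup>2) \<partial>lborel \<partial>lborel)"
    by (subst nn_integral_pair, measurable, rule nn_integral_swap) measurable
  also have "\<dots> \<le> (\<integral>\<^sup>+x2. 4 * (\<integral>\<^sup>+x1. ennreal ((g (x1, x2))\<^sup>2) \<partial>lborel) \<partial>lborel)"
    unfolding M_def fst_conv snd_conv
    by (intro nn_integral_mono integral_dmax[where K=K] bdd_supp_section(1)[OF g] g0 gK)
  also have "\<dots> = 4 * (\<integral>\<^sup>+x1. \<integral>\<^sup>+x2. ennreal ((g (x1, x2))\<^sup>2) \<partial>lborel \<partial>lborel)"
    by (subst nn_integral_swap, measurable, simp add: nn_integral_cmult)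
  also have "\<dots> \<le> 4 * (\<integral>\<^sup>+x1. 4 * (\<integral>\<^sup>+x2. ennreal ((F (x1, x2))\<^sup>2) \<partial>lborel) \<partial>lborel)"
    unfolding g_def fst_conv snd_conv
    by (intro mult_left_mono nn_integral_mono integral_dmax[where K=K] bdd_supp_section(2)[OF F] F0 FK) auto
  also have "\<dots> = 16 * sqnorm f"
    unfolding sqnorm_def by (subst nn_integral_pair) (simp_all add: nn_integral_cmult F_def mult.assoc[symmetric])
  finally have "(\<integral>\<^sup>+p. ennreal ((M p)\<^sup>2) \<partial>lborel) \<le> 16 * sqnorm f" .
  then show thesis using that[OF M M0 le step] by blast
qed

text \<open>Here the parameter t precedes the point, opposite to the order in the Whitney regions;
  \<open>nn_integral_half_spaces\<close> converts.\<close>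

type_synonym ('n, 'm) half_spaces = "(real \<times> (real ^ 'n)) \<times> (real \<times> (real ^ 'm))"

text \<open>Layer cake: the weight of the set where the rectangular average is at least r is bounded
  through the level set of the strong maximal function at height r, as that level set contains the
  rectangles concerned. Integrating 2r dr turns the measures of the level sets into the squared norm
  of the maximal function.\<close>

theorem biparameter_Carleson_embedding:
  fixes c :: "('n::finite, 'm::finite) half_spaces \<Rightarrow> ennreal"
  assumes c [measurable]: "c \<in> borel_measurable borel"
    and f: "bdd_supp f" and K: "stepfun2 K f"
    and C: "\<And>G \<Omega>. G \<in> sets borel \<Longrightarrow> \<Omega> \<in> sets borel \<Longrightarrow> emeasure lborel \<Omega> < \<infinity> \<Longrightarrow>
       (\<And>x. x \<in> \<Omega> \<Longrightarrow> \<exists>k l. dcube k (fst x) \<times> dcube l (snd x) \<subseteq> \<Omega>) \<Longrightarrow>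
       (\<And>t1 x1 t2 x2. ((t1, x1), (t2, x2)) \<in> G \<Longrightarrow> dcube (gen t1) x1 \<times> dcube (gen t2) x2 \<subseteq> \<Omega>) \<Longrightarrow>
       (\<integral>\<^sup>+p. dtt (fst (fst p)) * dtt (fst (snd p)) * c p * indicator G p \<partial>lborel) \<le> B * emeasure lborel \<Omega>"
  shows "(\<integral>\<^sup>+p. dtt (fst (fst p)) * dtt (fst (snd p)) * c p *
      ennreal ((norm (avg2 (gen (fst (fst p))) (gen (fst (snd p))) f (snd (fst p)) (snd (snd p))))\<^sup>2) \<partial>lborel)
     \<le> 16 * B * sqnorm f"
proof -
  note [measurable] = bdd_supp_measurable[OF f]
  define w where "w p = dtt (fst (fst p)) * dtt (fst (snd p)) * c p" for p
  define a where "a p = norm (avg2 (gen (fst (fst p))) (gen (fst (snd p))) f (snd (fst p)) (snd (snd p)))" for p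
  have [measurable]: "w \<in> borel_measurable borel" unfolding w_def by measurable
  have [measurable]: "a \<in> borel_measurable borel"
  proof -
    have "(\<lambda>p :: ('n, 'm) half_spaces. avg2 k (gen (fst (snd p))) f (snd (fst p)) (snd (snd p))) \<in> borel_measurable borel" for k
      by (rule gen_measurable_compose[where F="\<lambda>l p. avg2 k l f (snd (fst p)) (snd (snd p))"])
         (measurable, unfold avg2_def, measurable)
    from gen_measurable_compose[where F="\<lambda>k p. avg2 k (gen (fst (snd p))) f (snd (fst p)) (snd (snd p))", OF _ this, of "\<lambda>p. fst (fst p)"]
    show ?thesis unfolding a_def by measurable
  qed
  \<comment> \<open>The maximal function depends on its coarsest generation -N. The estimate is
    proved on \<open>U N\<close> with a bound free of N, and then N tends to infinity.\<close>
  define U :: "nat \<Rightarrow> ('n, 'm) half_spaces set" where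
    "U N = {p. - int N \<le> gen (fst (fst p)) \<and> - int N \<le> gen (fst (snd p))}" for N
  have [measurable]: "U N \<in> sets borel" for N
  proof -
    have "{p \<in> space borel. - int N \<le> gen (fst (fst p)) \<and> - int N \<le> gen (fst (snd p))} \<in> sets (borel :: ('n, 'm) half_spaces measure)"
      by measurable
    then show ?thesis by (simp add: U_def)
  qed
  have trunc: "(\<integral>\<^sup>+p. w p * ennreal ((a p)\<^sup>2) * indicator (U N) p \<partial>lborel) \<le> 16 * B * sqnorm f" for N
  proof -
    obtain M where M: "bdd_supp M" "\<And>p. 0 \<le> M p"
      "\<And>k l x1 x2. - int N \<le> k \<Longrightarrow> - int N \<le> l \<Longrightarrow> norm (avg2 k l f x1 x2) \<le> M (x1, x2)"
      "\<And>p. \<exists>k l. \<forall>y1 y2. same_cube k (fst p) y1 \<longrightarrow> same_cube l (snd p) y2 \<longrightarrow> M (y1, y2) = M p"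
      "(\<integral>\<^sup>+p. ennreal ((M p)\<^sup>2) \<partial>lborel) \<le> 16 * sqnorm f"
      using strong_maximal_function[OF f K, of N] by blast
    note [measurable] = bdd_supp_measurable[OF M(1)]
    define G where "G r = {p. r \<le> a p} \<inter> U N" for r
    define \<Omega> where "\<Omega> r = {x. r \<le> M x}" for r
    have level: "(\<integral>\<^sup>+p. w p * indicator (G r) p \<partial>lborel) \<le> B * emeasure lborel (\<Omega> r)" if r: "0 < r" for r
      unfolding w_def
    proof (rule C)
      have "{p \<in> space borel. r \<le> a p} \<in> sets borel" "{p \<in> space borel. r \<le> M p} \<in> sets borel" by measurable
      then show "G r \<in> sets borel" "\<Omega> r \<in> sets borel" by (simp_all add: G_def \<Omega>_def)
      \<comment> \<open>At a positive height the level set lies in the bounded support of the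
        maximal function, hence has finite measure.\<close>
      obtain R where "\<And>x. R < norm x \<Longrightarrow> M x = 0" using bdd_supp_bound[OF M(1)] by metis
      then have "\<Omega> r \<subseteq> cball 0 R" using r by (force simp: \<Omega>_def not_le[symmetric])
      then show "emeasure lborel (\<Omega> r) < \<infinity>"
        by (intro emeasure_bounded_finite) (rule bounded_subset[OF bounded_cball])
      show "\<exists>k l. dcube k (fst x) \<times> dcube l (snd x) \<subseteq> \<Omega> r" if x: "x \<in> \<Omega> r" for x
      proof -
        obtain k l where kl: "\<And>y1 y2. same_cube k (fst x) y1 \<Longrightarrow> same_cube l (snd x) y2 \<Longrightarrow> M (y1, y2) = M x"
          using M(4)[of x] by blast
        have "dcube k (fst x) \<times> dcube l (snd x) \<subseteq> \<Omega> r"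
          using x kl by (auto simp: \<Omega>_def mem_dcube)
        then show ?thesis by blast
      qed
      show "dcube (gen t1) x1 \<times> dcube (gen t2) x2 \<subseteq> \<Omega> r" if p: "((t1, x1), (t2, x2)) \<in> G r" for t1 x1 t2 x2
      proof safe
        fix y1 y2 assume y: "y1 \<in> dcube (gen t1) x1" "y2 \<in> dcube (gen t2) x2"
        \<comment> \<open>The rectangular average has one value on the whole rectangle, so each of
          its points lies in the level set.\<close>
        have "avg2 (gen t1) (gen t2) f x1 x2 = avg2 (gen t1) (gen t2) f y1 y2"
          unfolding avg2_def avg_same_cube[OF y(1)[unfolded mem_dcube]] avg_same_cube[OF y(2)[unfolded mem_dcube]] ..
        then have "r \<le> norm (avg2 (gen t1) (gen t2) f y1 y2)" using p by (simp add: G_def a_def)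
        also have "\<dots> \<le> M (y1, y2)" using p by (intro M(3)) (auto simp: G_def U_def)
        finally show "(y1, y2) \<in> \<Omega> r" by (simp add: \<Omega>_def)
      qed
    qed
    have a0: "0 \<le> a p" for p by (simp add: a_def)
    have "(\<integral>\<^sup>+p. w p * ennreal ((a p)\<^sup>2) * indicator (U N) p \<partial>lborel)
      = (\<integral>\<^sup>+p. \<integral>\<^sup>+r. w p * indicator (U N) p * (ennreal (2 * r) * indicator {0..a p} r) \<partial>lborel \<partial>lborel)"
      by (simp add: layer_cake[OF a0] nn_integral_cmult mult_ac)
    \<comment> \<open>The indicator becomes a condition on r and p jointly, in which form the
      measurability needed for the exchange is visible.\<close>
    also have "\<dots> = (\<integral>\<^sup>+p. \<integral>\<^sup>+r. w p * indicator (U N) p * (ennreal (2 * r) * (if 0 \<le> r \<and> r \<le> a p then 1 else 0)) \<partial>lborel \<partial>lborel)"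
      by (simp add: indicator_def of_bool_def cong: if_cong)
    also have "\<dots> = (\<integral>\<^sup>+r. \<integral>\<^sup>+p. w p * indicator (U N) p * (ennreal (2 * r) * (if 0 \<le> r \<and> r \<le> a p then 1 else 0)) \<partial>lborel \<partial>lborel)"
      by (rule nn_integral_swap) measurable
    also have "\<dots> \<le> (\<integral>\<^sup>+r. B * (\<integral>\<^sup>+x. ennreal (2 * r) * (if 0 \<le> r \<and> r \<le> M x then 1 else 0) \<partial>lborel) \<partial>lborel)"
    proof (intro nn_integral_mono)
      fix r :: real
      show "(\<integral>\<^sup>+p. w p * indicator (U N) p * (ennreal (2 * r) * (if 0 \<le> r \<and> r \<le> a p then 1 else 0)) \<partial>lborel)
        \<le> B * (\<integral>\<^sup>+x. ennreal (2 * r) * (if 0 \<le> r \<and> r \<le> M x then 1 else 0) \<partial>lborel)"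
      proof (cases "0 < r")
        case True
        have Gm: "G r \<in> sets borel" "\<Omega> r \<in> sets borel"
        proof -
          have "{p \<in> space borel. r \<le> a p} \<in> sets borel" "{p \<in> space borel. r \<le> M p} \<in> sets borel" by measurable
          then show "G r \<in> sets borel" "\<Omega> r \<in> sets borel" by (simp_all add: G_def \<Omega>_def)
        qed
        note [measurable] = Gm
        have "(\<integral>\<^sup>+p. w p * indicator (U N) p * (ennreal (2 * r) * (if 0 \<le> r \<and> r \<le> a p then 1 else 0)) \<partial>lborel)
          = (\<integral>\<^sup>+p. ennreal (2 * r) * (w p * indicator (G r) p) \<partial>lborel)"
          using True by (intro nn_integral_cong) (auto simp: G_def indicator_def mult_ac)
        also have "\<dots> = ennreal (2 * r) * (\<integral>\<^sup>+p. w p * indicator (G r) p \<partial>lborel)"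
          by (intro nn_integral_cmult) measurable
        also have "\<dots> \<le> ennreal (2 * r) * (B * emeasure lborel (\<Omega> r))"
          by (intro mult_left_mono level True) auto
        also have "emeasure lborel (\<Omega> r) = (\<integral>\<^sup>+x. (if 0 \<le> r \<and> r \<le> M x then 1 else 0) \<partial>lborel)"
        proof -
          have "emeasure lborel (\<Omega> r) = (\<integral>\<^sup>+x. indicator (\<Omega> r) x \<partial>lborel)"
            using Gm(2) by simp
          also have "\<dots> = (\<integral>\<^sup>+x. (if 0 \<le> r \<and> r \<le> M x then 1 else 0) \<partial>lborel)"
            using True by (intro nn_integral_cong) (auto simp: \<Omega>_def indicator_def)
          finally show ?thesis .
        qed
        also have "ennreal (2 * r) * (B * (\<integral>\<^sup>+x. (if 0 \<le> r \<and> r \<le> M x then 1 else 0) \<partial>lborel))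
          = B * (\<integral>\<^sup>+x. ennreal (2 * r) * (if 0 \<le> r \<and> r \<le> M x then 1 else 0) \<partial>lborel)"
          by (subst nn_integral_cmult) (measurable, simp add: mult_ac)
        finally show ?thesis .
      qed (simp add: ennreal_neg)
    qed
    also have "\<dots> = B * (\<integral>\<^sup>+r. \<integral>\<^sup>+x. ennreal (2 * r) * (if 0 \<le> r \<and> r \<le> M x then 1 else 0) \<partial>lborel \<partial>lborel)"
      by (rule nn_integral_cmult) measurable
    also have "(\<integral>\<^sup>+r. \<integral>\<^sup>+x. ennreal (2 * r) * (if 0 \<le> r \<and> r \<le> M x then 1 else 0) \<partial>lborel \<partial>lborel)
      = (\<integral>\<^sup>+x. \<integral>\<^sup>+r. ennreal (2 * r) * (if 0 \<le> r \<and> r \<le> M x then 1 else 0) \<partial>lborel \<partial>lborel)"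
      by (rule nn_integral_swap) measurable
    also have "\<dots> = (\<integral>\<^sup>+x. ennreal ((M x)\<^sup>2) \<partial>lborel)"
      by (simp add: layer_cake[OF M(2)] indicator_def of_bool_def cong: if_cong)
    also have "B * \<dots> \<le> B * (16 * sqnorm f)" by (intro mult_left_mono M) auto
    finally show ?thesis by (simp add: mult_ac)
  qed
  have "w p * ennreal ((a p)\<^sup>2) = (SUP N. w p * ennreal ((a p)\<^sup>2) * indicator (U N) p)" for p
  proof (rule antisym)
    have "p \<in> U (nat (max (- gen (fst (fst p))) (- gen (fst (snd p)))))" by (auto simp: U_def)
    then show "w p * ennreal ((a p)\<^sup>2) \<le> (SUP N. w p * ennreal ((a p)\<^sup>2) * indicator (U N) p)"
      by (intro order_trans[OF _ SUP_upper[OF UNIV_I, of _ "nat (max (- gen (fst (fst p))) (- gen (fst (snd p))))"]]) simp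
  qed (auto intro!: SUP_least simp: indicator_def)
  then have "(\<integral>\<^sup>+p. w p * ennreal ((a p)\<^sup>2) \<partial>lborel) = (\<integral>\<^sup>+p. (SUP N. w p * ennreal ((a p)\<^sup>2) * indicator (U N) p) \<partial>lborel)"
    by simp
  also have "\<dots> = (SUP N. \<integral>\<^sup>+p. w p * ennreal ((a p)\<^sup>2) * indicator (U N) p \<partial>lborel)"
  proof (intro nn_integral_monotone_convergence_SUP)
    show "incseq (\<lambda>N p. w p * ennreal ((a p)\<^sup>2) * indicator (U N) p)"
      by (auto simp: incseq_def le_fun_def indicator_def U_def)
  qed measurable
  also have "\<dots> \<le> 16 * B * sqnorm f" by (intro SUP_least trunc)
  finally show ?thesis unfolding w_def a_def .
qed

subsection \<open>From the Carleson condition over dyadic rectangles to level sets\<close>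

lemma AE_lborel_fst:
  assumes "AE x in lborel. P (x :: 'a::euclidean_space)"
  shows "AE p in (lborel :: ('a \<times> 'b::euclidean_space) measure). P (fst p)"
proof -
  obtain N where N: "N \<in> null_sets lborel" "{x. \<not> P x} \<subseteq> N" using assms unfolding eventually_ae_filter by auto
  have "emeasure (lborel \<Otimes>\<^sub>M lborel) (N \<times> (UNIV :: 'b set)) = 0"
    using N(1) by (subst lborel.emeasure_pair_measure_Times) auto
  then have "N \<times> UNIV \<in> null_sets (lborel :: ('a \<times> 'b) measure)"
    using N(1) by (auto simp: null_sets_def lborel_prod[symmetric])
  then show ?thesis by (rule AE_I') (use N(2) in auto)
qed

lemma AE_lborel_snd:
  assumes "AE x in lborel. P (x :: 'b::euclidean_space)"
  shows "AE p in (lborel :: ('a::euclidean_space \<times> 'b) measure). P (snd p)"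
proof -
  obtain N where N: "N \<in> null_sets lborel" "{x. \<not> P x} \<subseteq> N" using assms unfolding eventually_ae_filter by auto
  have "emeasure (lborel \<Otimes>\<^sub>M lborel) ((UNIV :: 'a set) \<times> N) = 0"
    using N(1) by (subst lborel.emeasure_pair_measure_Times) auto
  then have "UNIV \<times> N \<in> null_sets (lborel :: ('a \<times> 'b) measure)"
    using N(1) by (auto simp: null_sets_def lborel_prod[symmetric])
  then show ?thesis by (rule AE_I') (use N(2) in auto)
qed

text \<open>Whitney regions and Carleson boxes exclude t equal to the sidelength while
  \<open>gen\<close> includes it; these values form a null set.\<close>

lemma AE_not_power: "AE t in lborel. \<forall>k. t \<noteq> (2::real) powi k"
proof -
  have "countable (range (\<lambda>k::int. (2::real) powi k))" by simp
  then have "range (\<lambda>k::int. (2::real) powi k) \<in> null_sets lborel"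
    by (rule countable_imp_null_set_lborel)
  then show ?thesis by (rule AE_I') auto
qed

lemma dcube_in_grid: "dcube k x \<in> standard_dyadic_grid"
  unfolding standard_dyadic_grid_def corner_def
  by (intro CollectI exI[of _ k] exI[of _ "\<chi> i. \<lfloor>2 powi k * x $ i\<rfloor>"]) simp

lemma sidelength_dcube: "sidelength (dcube k x) = 2 powi (-k)"
  by (rule sidelength_cube) simp

lemma is_cube_dcube: "is_cube (dcube k x)"
  unfolding is_cube_def by (rule exI, rule exI[of _ "2 powi (-k)"]) simp

lemma countable_grid: "countable (standard_dyadic_grid :: (real ^ 'd) set set)"
proof -
  have *: "(standard_dyadic_grid :: (real ^ 'd) set set)
     = (\<lambda>(k, j). cube (\<chi> i. 2 powi (-k) * real_of_int (j $ i)) (2 powi (-k))) ` UNIV"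
    unfolding standard_dyadic_grid_def by (auto simp: image_def)
  show ?thesis unfolding * by (rule countable_image) (rule countableI_type)
qed

lemma dyadic_grid_standard: "dyadic_grid (standard_dyadic_grid :: (real ^ 'd) set set)"
  unfolding dyadic_grid_def shifted_dyadic_grid_def
  by (rule exI[of _ "\<lambda>_. 0"]) auto

lemma grid_borel: "I \<in> standard_dyadic_grid \<Longrightarrow> I \<in> sets borel"
  unfolding standard_dyadic_grid_def by auto

lemma grid_sidelength_pos: "I \<in> standard_dyadic_grid \<Longrightarrow> 0 < sidelength I"
  unfolding standard_dyadic_grid_def by (auto simp: sidelength_cube)

text \<open>Turns the unordered sum of the Carleson condition into an integral for counting measure,
  which can be exchanged with Lebesgue integrals.\<close>

lemma nn_integral_count_space_le_infsum:
  fixes f :: "'a \<Rightarrow> ennreal"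
  assumes "countable S"
  shows "(\<integral>\<^sup>+i. f i \<partial>count_space S) \<le> infsum f S"
proof -
  have fin: "sum f F \<le> infsum f S" if "finite F" "F \<subseteq> S" for F
    using that by (subst nonneg_infsum_complete) (auto intro: SUP_upper)
  show ?thesis
  proof (cases "finite S")
    case True
    then show ?thesis using fin[of S] by (simp add: nn_integral_count_space_finite)
  next
    case False
    let ?e = "from_nat_into S"
    have bij: "bij_betw ?e UNIV S" by (rule bij_betw_from_nat_into[OF assms False])
    have "(\<integral>\<^sup>+i. f i \<partial>count_space S) = (\<Sum>n. f (?e n))"
      by (simp add: nn_integral_bij_count_space[OF bij, symmetric] nn_integral_count_space_nat)
    also have "\<dots> \<le> infsum f S"
    proof (rule suminf_le_const)
      fix n
      have "(\<Sum>i<n. f (?e i)) = sum f (?e ` {..<n})"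
        using bij by (subst sum.reindex) (auto simp: bij_betw_def inj_on_def)
      also have "\<dots> \<le> infsum f S" using bij by (intro fin) (auto simp: bij_betw_def)
      finally show "(\<Sum>i<n. f (?e i)) \<le> infsum f S" .
    qed simp
    finally show ?thesis .
  qed
qed

text \<open>The Whitney region with its coordinates in the order of
  \<open>half_spaces\<close>.\<close>

definition wset :: "(real ^ 'd) set \<Rightarrow> (real \<times> (real ^ 'd)) set" where
  "wset I = {(t, x). x \<in> I \<and> sidelength I / 2 < t \<and> t < sidelength I}"

lemma wset_borel: "I \<in> sets borel \<Longrightarrow> wset I \<in> sets borel"
proof -
  assume [measurable]: "I \<in> sets borel"
  have "{p \<in> space borel. snd p \<in> I \<and> sidelength I / 2 < fst p \<and> fst p < sidelength I} \<in> sets borel"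
    by measurable
  then show ?thesis by (simp add: wset_def case_prod_unfold)
qed

lemma nn_integral_pair_flip:
  fixes f :: "'a::euclidean_space \<times> 'b::euclidean_space \<Rightarrow> ennreal"
  assumes [measurable]: "f \<in> borel_measurable borel"
  shows "(\<integral>\<^sup>+p. f p \<partial>lborel) = (\<integral>\<^sup>+p. f (snd p, fst p) \<partial>lborel)"
  by (subst nn_integral_pair, measurable, subst nn_integral_swap, measurable, subst nn_integral_pair) simp_all

lemma nn_integral_half_spaces:
  fixes F :: "('n::finite, 'm::finite) half_spaces \<Rightarrow> ennreal"
  assumes [measurable]: "F \<in> borel_measurable borel"
  shows "(\<integral>\<^sup>+q. \<integral>\<^sup>+p. F ((snd p, fst p), (snd q, fst q)) \<partial>lborel \<partial>lborel) = (\<integral>\<^sup>+p. F p \<partial>lborel)"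
proof -
  have inner: "(\<integral>\<^sup>+p. F ((snd p, fst p), b) \<partial>lborel) = (\<integral>\<^sup>+a. F (a, b) \<partial>lborel)" for b
    by (rule nn_integral_pair_flip[of "\<lambda>a. F (a, b)", symmetric]) measurable
  have "(\<integral>\<^sup>+q. (\<integral>\<^sup>+a. F (a, (snd q, fst q)) \<partial>lborel) \<partial>lborel) = (\<integral>\<^sup>+b. \<integral>\<^sup>+a. F (a, b) \<partial>lborel \<partial>lborel)"
    by (rule nn_integral_pair_flip[of "\<lambda>b. \<integral>\<^sup>+a. F (a, b) \<partial>lborel", symmetric]) measurable
  also have "\<dots> = (\<integral>\<^sup>+a. \<integral>\<^sup>+b. F (a, b) \<partial>lborel \<partial>lborel)"
    by (rule nn_integral_swap) measurable
  also have "\<dots> = (\<integral>\<^sup>+p. F p \<partial>lborel)"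
    by (rule nn_integral_pair[of F, symmetric]) measurable
  finally show ?thesis unfolding inner .
qed

text \<open>The Carleson numbers are defined with the original kernel, while \<open>c\<close> comes
  from its Borel version; the two agree almost everywhere in the iterated sense, which is what
  iterated integrals see.\<close>

lemma carleson_number_eq:
  fixes c :: "('n::finite, 'm::finite) half_spaces \<Rightarrow> ennreal"
  assumes [measurable]: "c \<in> borel_measurable borel"
    and I: "I \<in> standard_dyadic_grid" and J: "J \<in> standard_dyadic_grid"
    and ae: "AE q in lborel. AE p in lborel. 0 < snd p \<longrightarrow> 0 < snd q \<longrightarrow>
      c ((snd p, fst p), (snd q, fst q)) = ennreal ((norm (theta s (snd p) (snd q) (\<lambda>_. 1) (fst p, fst q)))\<^sup>2)"
  shows "carleson_number s I J = (\<integral>\<^sup>+p. dtt (fst (fst p)) * dtt (fst (snd p)) * c p *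
      (indicator (wset I) (fst p) * indicator (wset J) (snd p)) \<partial>lborel)"
proof -
  note [measurable] = wset_borel[OF grid_borel[OF I]] wset_borel[OF grid_borel[OF J]]
  let ?F = "\<lambda>p :: ('n, 'm) half_spaces. dtt (fst (fst p)) * dtt (fst (snd p)) * c p *
      (indicator (wset I) (fst p) * indicator (wset J) (snd p))"
  have "carleson_number s I J = (\<integral>\<^sup>+q. \<integral>\<^sup>+p. ?F ((snd p, fst p), (snd q, fst q)) \<partial>lborel \<partial>lborel)"
    unfolding carleson_number_def nn_integral_completion
  proof (intro nn_integral_cong_AE, use ae in eventually_elim)
    fix q :: "(real ^ 'm) \<times> real"
    assume ae: "AE p in lborel. 0 < snd p \<longrightarrow> 0 < snd q \<longrightarrow>
      c ((snd p, fst p), (snd q, fst q)) = ennreal ((norm (theta s (snd p) (snd q) (\<lambda>_. 1) (fst p, fst q)))\<^sup>2)"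
    obtain x2 t2 where q: "q = (x2, t2)" by fastforce
    let ?G = "\<lambda>p. (case p of (x1, t1) \<Rightarrow> ennreal ((norm (theta s t1 t2 (\<lambda>_. 1) (x1, x2)))\<^sup>2 / t1 / t2)) * indicator (whitney_region I) p"
    show "(case q of (x2, t2) \<Rightarrow> (\<integral>\<^sup>+p. (case p of (x1, t1) \<Rightarrow> ennreal ((norm (theta s t1 t2 (\<lambda>_. 1) (x1, x2)))\<^sup>2 / t1 / t2)) * indicator (whitney_region I) p \<partial>lborel))
        * indicator (whitney_region J) q = (\<integral>\<^sup>+p. ?F ((snd p, fst p), (snd q, fst q)) \<partial>lborel)"
    proof (cases "q \<in> whitney_region J")
      case True
      then have t2: "0 < t2" and J': "(t2, x2) \<in> wset J"
        using grid_sidelength_pos[OF J] by (auto simp: q whitney_region_def wset_def)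
      have "(\<integral>\<^sup>+p. ?G p \<partial>lborel) = (\<integral>\<^sup>+p. ?F ((snd p, fst p), (snd q, fst q)) \<partial>lborel)"
      proof (intro nn_integral_cong_AE, use ae in eventually_elim)
        fix p :: "(real ^ 'n) \<times> real"
        assume h: "0 < snd p \<longrightarrow> 0 < snd q \<longrightarrow>
          c ((snd p, fst p), (snd q, fst q)) = ennreal ((norm (theta s (snd p) (snd q) (\<lambda>_. 1) (fst p, fst q)))\<^sup>2)"
        obtain x1 t1 where p: "p = (x1, t1)" by fastforce
        show "?G p = ?F ((snd p, fst p), (snd q, fst q))"
        proof (cases "p \<in> whitney_region I")
          case True
          then have t1: "0 < t1" and I': "(t1, x1) \<in> wset I"
            using grid_sidelength_pos[OF I] by (auto simp: p whitney_region_def wset_def)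
          have "ennreal (r / t1 / t2) = ennreal (1 / t1) * ennreal (1 / t2) * ennreal r" if "0 \<le> r" for r
            using t1 t2 that by (simp flip: ennreal_mult)
          then show ?thesis using True h t1 t2 I' J' by (simp add: p q dtt_def)
        next
          case False
          then have "(t1, x1) \<notin> wset I" by (auto simp: p whitney_region_def wset_def)
          then show ?thesis using False by (simp add: p)
        qed
      qed
      then show ?thesis using True by (simp add: q)
    next
      case False
      then have "(t2, x2) \<notin> wset J" by (auto simp: q whitney_region_def wset_def)
      then show ?thesis using False by (simp add: q)
    qed
  qed
  also have "\<dots> = (\<integral>\<^sup>+p. ?F p \<partial>lborel)"
    by (rule nn_integral_half_spaces) measurable
  finally show ?thesis .
qed

text \<open>Apart from a null set, every point of \<open>G\<close> with positive parameters lies in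
  the product of the Whitney regions of its own rectangle, a grid rectangle contained in \<Omega>.
  So the integral over \<open>G\<close> is at most the sum of the Carleson numbers of the rectangles
  in \<Omega>.\<close>

lemma carleson_condition_level_set:
  fixes c :: "('n::finite, 'm::finite) half_spaces \<Rightarrow> ennreal"
  assumes c [measurable]: "c \<in> borel_measurable borel"
    and ae: "AE q in lborel. AE p in lborel. 0 < snd p \<longrightarrow> 0 < snd q \<longrightarrow>
      c ((snd p, fst p), (snd q, fst q)) = ennreal ((norm (theta s (snd p) (snd q) (\<lambda>_. 1) (fst p, fst q)))\<^sup>2)"
    and bc: "biparameter_carleson_condition K s"
    and G [measurable]: "G \<in> sets borel" and \<Omega>: "\<Omega> \<in> sets borel" "emeasure lborel \<Omega> < \<infinity>"
    and open_\<Omega>: "\<And>x. x \<in> \<Omega> \<Longrightarrow> \<exists>k l. dcube k (fst x) \<times> dcube l (snd x) \<subseteq> \<Omega>"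
    and G\<Omega>: "\<And>t1 x1 t2 x2. ((t1, x1), (t2, x2)) \<in> G \<Longrightarrow> dcube (gen t1) x1 \<times> dcube (gen t2) x2 \<subseteq> \<Omega>"
  shows "(\<integral>\<^sup>+p. dtt (fst (fst p)) * dtt (fst (snd p)) * c p * indicator G p \<partial>lborel) \<le> ennreal K * emeasure lborel \<Omega>"
proof -
  define S where "S = {(I, J). I \<in> standard_dyadic_grid \<and> J \<in> standard_dyadic_grid \<and> I \<times> J \<subseteq> \<Omega>}"
  have "countable S"
    by (rule countable_subset[of _ "standard_dyadic_grid \<times> standard_dyadic_grid"])
       (auto simp: S_def countable_grid)
  let ?w = "\<lambda>p :: ('n, 'm) half_spaces. dtt (fst (fst p)) * dtt (fst (snd p)) * c p"
  let ?W = "\<lambda>IJ p. ?w p * (indicator (wset (fst IJ)) (fst p) * indicator (wset (snd IJ)) (snd p))"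
  have W_meas: "?W IJ \<in> borel_measurable lborel" if "IJ \<in> S" for IJ
  proof -
    have [measurable]: "wset (fst IJ) \<in> sets borel" "wset (snd IJ) \<in> sets borel"
      using that by (auto simp: S_def intro!: wset_borel grid_borel)
    show ?thesis by measurable
  qed
  have ae1: "AE p in (lborel :: ('n, 'm) half_spaces measure). \<forall>k. fst (fst p) \<noteq> 2 powi k"
    using AE_lborel_fst[OF AE_lborel_fst[OF AE_not_power]] .
  have ae2: "AE p in (lborel :: ('n, 'm) half_spaces measure). \<forall>k. fst (snd p) \<noteq> 2 powi k"
    using AE_lborel_snd[OF AE_lborel_fst[OF AE_not_power]] .
  have "(\<integral>\<^sup>+p. ?w p * indicator G p \<partial>lborel) \<le> (\<integral>\<^sup>+p. \<integral>\<^sup>+IJ. ?W IJ p \<partial>count_space S \<partial>lborel)"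
  proof (intro nn_integral_mono_AE, use ae1 ae2 in eventually_elim)
    fix p :: "('n, 'm) half_spaces"
    assume np: "\<forall>k. fst (fst p) \<noteq> 2 powi k" "\<forall>k. fst (snd p) \<noteq> 2 powi k"
    obtain t1 x1 t2 x2 where p: "p = ((t1, x1), (t2, x2))" by (cases p; cases "fst p"; cases "snd p") auto
    show "?w p * indicator G p \<le> (\<integral>\<^sup>+IJ. ?W IJ p \<partial>count_space S)"
    proof (cases "p \<in> G \<and> 0 < t1 \<and> 0 < t2")
      case True
      \<comment> \<open>The rectangle at the scales of t1 and t2. A single term of the sum already
        dominates the integrand.\<close>
      define IJ where "IJ = (dcube (gen t1) x1, dcube (gen t2) x2)"
      have IJ: "IJ \<in> S" using G\<Omega> True unfolding IJ_def S_def p by (simp add: dcube_in_grid)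
      have w1: "t1 \<le> 2 powi (- gen t1)" "2 powi (- gen t1) / 2 < t1" "t2 \<le> 2 powi (- gen t2)" "2 powi (- gen t2) / 2 < t2"
        using gen_bounds[of t1] gen_bounds[of t2] True by auto
      have "t1 < 2 powi (- gen t1)" "t2 < 2 powi (- gen t2)"
        using np[THEN spec, of "- gen t1"] np[THEN spec, of "- gen t2"] w1 by (auto simp: p)
      then have "?W IJ p = ?w p"
        using w1 by (simp add: IJ_def p wset_def sidelength_dcube mem_dcube)
      then have "?w p * indicator G p \<le> ?W IJ p" by (simp add: indicator_def)
      also have "\<dots> = (\<integral>\<^sup>+i. ?W i p * indicator {IJ} i \<partial>count_space S)"
        using IJ by (subst nn_integral_indicator_singleton) auto
      also have "\<dots> \<le> (\<integral>\<^sup>+i. ?W i p \<partial>count_space S)"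
        by (intro nn_integral_mono) (simp add: indicator_def)
      finally show ?thesis .
    qed (auto simp: p dtt_def)
  qed
  also have "\<dots> = (\<integral>\<^sup>+IJ. \<integral>\<^sup>+p. ?W IJ p \<partial>lborel \<partial>count_space S)"
    by (rule nn_integral_count_space_nn_integral[OF \<open>countable S\<close> W_meas])
  also have "\<dots> = (\<integral>\<^sup>+IJ. (case IJ of (I, J) \<Rightarrow> carleson_number s I J) \<partial>count_space S)"
    by (intro nn_integral_cong) (auto simp: S_def carleson_number_eq[OF c _ _ ae])
  also have "\<dots> \<le> (\<Sum>\<^sub>\<infinity>(I, J)\<in>S. carleson_number s I J)"
    by (rule nn_integral_count_space_le_infsum[OF \<open>countable S\<close>])
  also have "\<dots> \<le> ennreal K * emeasure lebesgue \<Omega>"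
  proof -
    have "\<forall>x\<in>\<Omega>. \<exists>I\<in>standard_dyadic_grid. \<exists>J\<in>standard_dyadic_grid. x \<in> I \<times> J \<and> I \<times> J \<subseteq> \<Omega>"
    proof
      fix x assume "x \<in> \<Omega>"
      then obtain k l where "dcube k (fst x) \<times> dcube l (snd x) \<subseteq> \<Omega>" using open_\<Omega> by blast
      then show "\<exists>I\<in>standard_dyadic_grid. \<exists>J\<in>standard_dyadic_grid. x \<in> I \<times> J \<and> I \<times> J \<subseteq> \<Omega>"
        by (intro bexI[of _ "dcube k (fst x)"] bexI[of _ "dcube l (snd x)"]) (auto simp: dcube_in_grid mem_dcube mem_Times_iff)
    qed
    moreover have "emeasure lebesgue \<Omega> < \<infinity>" using \<Omega> by simp
    ultimately show ?thesis
      using bc dyadic_grid_standard[where 'd='n] dyadic_grid_standard[where 'd='m]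
      unfolding biparameter_carleson_condition_def S_def by blast
  qed
  also have "emeasure lebesgue \<Omega> = emeasure lborel \<Omega>" using \<Omega>(1) by simp
  finally show ?thesis .
qed

subsection \<open>The bi-parameter theorem for step functions\<close>

lemma integrable_tensor:
  fixes f :: "'a::euclidean_space \<Rightarrow> complex" and g :: "'b::euclidean_space \<Rightarrow> complex"
  assumes "integrable lborel f" "integrable lborel g"
  shows "integrable lborel (\<lambda>p. f (fst p) * g (snd p))"
proof (rule integrableI_bounded)
  have [measurable]: "f \<in> borel_measurable borel" "g \<in> borel_measurable borel"
    using assms[THEN borel_measurable_integrable] by simp_all
  show "(\<lambda>p. f (fst p) * g (snd p)) \<in> borel_measurable lborel" by measurable
  have "(\<integral>\<^sup>+p. ennreal (norm (f (fst p) * g (snd p))) \<partial>lborel)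
    = (\<integral>\<^sup>+x. ennreal (norm (f x)) \<partial>lborel) * (\<integral>\<^sup>+y. ennreal (norm (g y)) \<partial>lborel)"
    by (subst nn_integral_pair, measurable)
       (simp add: norm_mult ennreal_mult nn_integral_cmult nn_integral_multc)
  also have "\<dots> < \<infinity>" using assms by (auto simp: integrable_iff_bounded ennreal_mult_less_top)
  finally show "(\<integral>\<^sup>+p. ennreal (norm (f (fst p) * g (snd p))) \<partial>lborel) < \<infinity>" .
qed

lemma nn_integral_dtt_pair:
  fixes \<Phi> :: "real \<times> 'a::euclidean_space \<Rightarrow> ennreal"
  assumes [measurable]: "\<Phi> \<in> borel_measurable borel"
  shows "(\<integral>\<^sup>+v. dtt (fst v) * \<Phi> v \<partial>lborel) = (\<integral>\<^sup>+t. dtt t * (\<integral>\<^sup>+x. \<Phi> (t, x) \<partial>lborel) \<partial>lborel)"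
  by (subst nn_integral_pair) (simp_all add: nn_integral_cmult)

text \<open>Multiplying a kernel by this factor puts dt/t inside the square, so that the square
  function becomes an unweighted L2 norm, as required of the target of an operator-valued
  kernel.\<close>

definition rsqrt :: "real \<Rightarrow> real" where "rsqrt t = (if 0 < t then 1 / sqrt t else 0)"

lemma rsqrt_measurable [measurable]: "rsqrt \<in> borel_measurable borel"
  unfolding rsqrt_def[abs_def] by measurable

lemma rsqrt_power2: "ennreal ((norm (complex_of_real (rsqrt t) * z))\<^sup>2) = dtt t * ennreal ((norm z)\<^sup>2)"
  by (auto simp: rsqrt_def dtt_def norm_mult power_mult_distrib power_divide simp flip: ennreal_mult)

definition t1_const :: "nat \<Rightarrow> real \<Rightarrow> real" where
  "t1_const d \<alpha> = 2 * square_const d \<alpha> + 8 * carleson_const d \<alpha>"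

lemma t1_const_nonneg: "0 < \<alpha> \<Longrightarrow> 0 \<le> t1_const d \<alpha>"
  unfolding t1_const_def by (intro add_nonneg_nonneg mult_nonneg_nonneg square_const_nonneg carleson_const_nonneg) auto

text \<open>The conditions as seen from slices: with the pair of points of one parameter frozen, the
  kernel in the other parameter satisfies one-parameter hypotheses whose constant decays like a size
  or Hoelder factor. Slices in the second parameter need to serve only the embedding, hence
  \<open>carleson_kernel\<close> there. The size bound holds everywhere, (C) enters in its level set
  form.\<close>

locale biparam_kernel =
  fixes q :: "real \<Rightarrow> real \<Rightarrow> real ^ 'n \<Rightarrow> real ^ 'm \<Rightarrow> real ^ 'n \<Rightarrow> real ^ 'm \<Rightarrow> complex"
    and \<alpha> \<beta> K B :: real
  assumes q_meas: "(\<lambda>(t1, t2, x1, x2, y1, y2). q t1 t2 x1 x2 y1 y2) \<in> borel_measurable borel"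
    and q_size: "\<And>t1 t2 x1 x2 y1 y2. 0 < t1 \<Longrightarrow> 0 < t2 \<Longrightarrow>
      norm (q t1 t2 x1 x2 y1 y2) \<le> K * size_factor \<alpha> t1 x1 y1 * size_factor \<beta> t2 x2 y2"
    and kernel2: "AE t2 in lborel. 0 < t2 \<longrightarrow> (AE x2 in lborel. AE y2 in lborel.
      t1_kernel (\<lambda>t1 x1 y1. q t1 t2 x1 x2 y1 y2) \<alpha> (K * size_factor \<beta> t2 x2 y2))"
    and kernel2_diff: "AE t2 in lborel. 0 < t2 \<longrightarrow> (AE x2 in lborel. AE y2 in lborel. AE z2 in lborel.
      norm (y2 - z2) < t2 / 2 \<longrightarrow>
      t1_kernel (\<lambda>t1 x1 y1. q t1 t2 x1 x2 y1 y2 - q t1 t2 x1 x2 y1 z2) \<alpha> (K * holder_factor \<beta> t2 x2 y2 z2))"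
    and kernel1: "AE t1 in lborel. 0 < t1 \<longrightarrow> (AE x1 in lborel. AE y1 in lborel.
      carleson_kernel (\<lambda>t2 x2 y2. q t1 t2 x1 x2 y1 y2) \<beta> (K * size_factor \<alpha> t1 x1 y1))"
    and kernel1_diff: "AE t1 in lborel. 0 < t1 \<longrightarrow> (AE x1 in lborel. AE y1 in lborel. AE z1 in lborel.
      norm (y1 - z1) < t1 / 2 \<longrightarrow>
      carleson_kernel (\<lambda>t2 x2 y2. q t1 t2 x1 x2 y1 y2 - q t1 t2 x1 x2 z1 y2) \<beta> (K * holder_factor \<alpha> t1 x1 y1 z1))"
    and level_set: "\<And>G \<Omega>. G \<in> sets borel \<Longrightarrow> \<Omega> \<in> sets borel \<Longrightarrow> emeasure lborel \<Omega> < \<infinity> \<Longrightarrow>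
       (\<And>x. x \<in> \<Omega> \<Longrightarrow> \<exists>k l. dcube k (fst x) \<times> dcube l (snd x) \<subseteq> \<Omega>) \<Longrightarrow>
       (\<And>t1 x1 t2 x2. ((t1, x1), (t2, x2)) \<in> G \<Longrightarrow> dcube (gen t1) x1 \<times> dcube (gen t2) x2 \<subseteq> \<Omega>) \<Longrightarrow>
       (\<integral>\<^sup>+p. dtt (fst (fst p)) * dtt (fst (snd p)) *
          ennreal ((norm (LINT y1|lborel. LINT y2|lborel. q (fst (fst p)) (fst (snd p)) (snd (fst p)) (snd (snd p)) y1 y2))\<^sup>2)
          * indicator G p \<partial>lborel) \<le> ennreal B * emeasure lborel \<Omega>"
    and \<alpha>: "0 < \<alpha>" and \<beta>: "0 < \<beta>" and K: "0 \<le> K" and B: "0 \<le> B"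
begin

lemma q_measurable [measurable (raw)]:
  assumes [measurable]: "a \<in> M \<rightarrow>\<^sub>M borel" "b \<in> M \<rightarrow>\<^sub>M borel" "c \<in> M \<rightarrow>\<^sub>M borel" "d \<in> M \<rightarrow>\<^sub>M borel"
    "e \<in> M \<rightarrow>\<^sub>M borel" "f \<in> M \<rightarrow>\<^sub>M borel"
  shows "(\<lambda>x. q (a x) (b x) (c x) (d x) (e x) (f x)) \<in> borel_measurable M"
  using measurable_compose[of "\<lambda>x. (a x, b x, c x, d x, e x, f x)" M borel, OF _ q_meas] by simp

lemma q_int:
  assumes t: "0 < t1" "0 < t2"
  shows "integrable lborel (\<lambda>p. q t1 t2 x1 x2 (fst p) (snd p))"
    and "integrable lborel (\<lambda>p. q t1 t2 x1 x2 (snd p) (fst p))"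
    and "integrable lborel (\<lambda>y2. q t1 t2 x1 x2 y1 y2)"
proof -
  have s1: "integrable lborel (\<lambda>y. complex_of_real (size_factor \<alpha> t1 x1 y))"
    and s2: "integrable lborel (\<lambda>y. complex_of_real (size_factor \<beta> t2 x2 y))"
    by (intro integrable_of_real integrable_size_factor t \<alpha> \<beta>)+
  have "integrable lborel (\<lambda>p. complex_of_real K * (complex_of_real (size_factor \<alpha> t1 x1 (fst p)) * complex_of_real (size_factor \<beta> t2 x2 (snd p))))"
    by (intro integrable_mult_right integrable_tensor s1 s2)
  then show "integrable lborel (\<lambda>p. q t1 t2 x1 x2 (fst p) (snd p))"
    by (rule Bochner_Integration.integrable_bound)
       (use q_size[OF t] K in \<open>auto simp: norm_mult mult.assoc intro!: AE_I2\<close>)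
  have "integrable lborel (\<lambda>p. complex_of_real K * (complex_of_real (size_factor \<beta> t2 x2 (fst p)) * complex_of_real (size_factor \<alpha> t1 x1 (snd p))))"
    by (intro integrable_mult_right integrable_tensor s1 s2)
  then show "integrable lborel (\<lambda>p. q t1 t2 x1 x2 (snd p) (fst p))"
    by (rule Bochner_Integration.integrable_bound)
       (use q_size[OF t] K in \<open>auto simp: norm_mult mult.commute mult.left_commute intro!: AE_I2\<close>)
  have "integrable lborel (\<lambda>y2. complex_of_real (K * size_factor \<alpha> t1 x1 y1) * complex_of_real (size_factor \<beta> t2 x2 y2))"
    by (intro integrable_mult_right s2)
  then show "integrable lborel (\<lambda>y2. q t1 t2 x1 x2 y1 y2)"
    by (rule Bochner_Integration.integrable_bound)
       (use q_size[OF t] K in \<open>auto simp: norm_mult mult.assoc intro!: AE_I2\<close>)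
qed

definition \<sigma> :: "real \<Rightarrow> real \<Rightarrow> real ^ 'n \<Rightarrow> real ^ 'm \<Rightarrow> real ^ 'n \<Rightarrow> complex" where
  "\<sigma> t1 t2 x1 x2 y1 = (LINT y2|lborel. q t1 t2 x1 x2 y1 y2)"

lemma \<sigma>_measurable [measurable (raw)]:
  assumes [measurable]: "a \<in> M \<rightarrow>\<^sub>M borel" "b \<in> M \<rightarrow>\<^sub>M borel" "c \<in> M \<rightarrow>\<^sub>M borel" "d \<in> M \<rightarrow>\<^sub>M borel"
    "e \<in> M \<rightarrow>\<^sub>M borel"
  shows "(\<lambda>x. \<sigma> (a x) (b x) (c x) (d x) (e x)) \<in> borel_measurable M"
  unfolding \<sigma>_def by measurable

lemma \<sigma>_int: "0 < t1 \<Longrightarrow> 0 < t2 \<Longrightarrow> integrable lborel (\<sigma> t1 t2 x1 x2)"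
  unfolding \<sigma>_def[abs_def] using lborel_integral_pair(3)[OF q_int(1)] by simp

text \<open>The three terms of the decomposition. In \<open>\<Theta>2\<close> the function is
  averaged in the second variable at x2, so the average leaves the y2-integral and only
  \<open>\<sigma>\<close> remains; in \<open>\<Theta>12\<close> both averages have left the
  integrals.\<close>

definition \<Theta> :: "((real ^ 'n) \<times> (real ^ 'm) \<Rightarrow> complex) \<Rightarrow> real \<times> (real ^ 'n) \<Rightarrow> real \<times> (real ^ 'm) \<Rightarrow> complex" where
  "\<Theta> f u v = (LINT p|lborel. q (fst u) (fst v) (snd u) (snd v) (fst p) (snd p) * f p)"

definition \<Theta>2 :: "((real ^ 'n) \<times> (real ^ 'm) \<Rightarrow> complex) \<Rightarrow> real \<times> (real ^ 'n) \<Rightarrow> real \<times> (real ^ 'm) \<Rightarrow> complex" where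
  "\<Theta>2 f u v = (LINT y|lborel. \<sigma> (fst u) (fst v) (snd u) (snd v) y * avg (gen (fst v)) (\<lambda>z. f (y, z)) (snd v))"

definition \<Theta>12 :: "((real ^ 'n) \<times> (real ^ 'm) \<Rightarrow> complex) \<Rightarrow> real \<times> (real ^ 'n) \<Rightarrow> real \<times> (real ^ 'm) \<Rightarrow> complex" where
  "\<Theta>12 f u v = (LINT y|lborel. \<sigma> (fst u) (fst v) (snd u) (snd v) y) * avg2 (gen (fst u)) (gen (fst v)) f (snd u) (snd v)"

context
  fixes f :: "(real ^ 'n) \<times> (real ^ 'm) \<Rightarrow> complex" and k :: int
  assumes f: "bdd_supp f" and k: "stepfun2 k f"
begin

lemma f_measurable [measurable]: "f \<in> borel_measurable borel"
  by (rule bdd_supp_measurable[OF f])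

lemma f_bound: obtains R where "0 \<le> R" "\<And>p. norm (f p) \<le> R"
  using bdd_supp_bound[OF f] by metis

lemma avg_gen_f_measurable [measurable (raw)]:
  assumes [measurable]: "a \<in> M \<rightarrow>\<^sub>M borel" "b \<in> M \<rightarrow>\<^sub>M borel" "c \<in> M \<rightarrow>\<^sub>M borel"
  shows "(\<lambda>x. avg (gen (a x)) (\<lambda>z. f (b x, z)) (c x)) \<in> borel_measurable M"
  by (rule gen_measurable_compose[where F="\<lambda>k x. avg k (\<lambda>z. f (b x, z)) (c x)"]) measurable

lemma avg2_gen_f_measurable [measurable (raw)]:
  assumes a: "a \<in> M \<rightarrow>\<^sub>M borel" and b: "b \<in> M \<rightarrow>\<^sub>M borel"
    and [measurable]: "c \<in> M \<rightarrow>\<^sub>M borel" "d \<in> M \<rightarrow>\<^sub>M borel"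
  shows "(\<lambda>x. avg2 (gen (a x)) (gen (b x)) f (c x) (d x)) \<in> borel_measurable M"
proof -
  have "(\<lambda>x. avg2 k (gen (b x)) f (c x) (d x)) \<in> borel_measurable M" for k
    by (rule gen_measurable_compose[where F="\<lambda>l x. avg2 k l f (c x) (d x)", OF b])
       (unfold avg2_def, measurable)
  from gen_measurable_compose[where F="\<lambda>k x. avg2 k (gen (b x)) f (c x) (d x)", OF a this]
  show ?thesis .
qed

lemma \<Theta>_measurable [measurable (raw)]:
  assumes [measurable]: "a \<in> M \<rightarrow>\<^sub>M borel" "b \<in> M \<rightarrow>\<^sub>M borel"
  shows "(\<lambda>x. \<Theta> f (a x) (b x)) \<in> borel_measurable M" "(\<lambda>x. \<Theta>2 f (a x) (b x)) \<in> borel_measurable M"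
    "(\<lambda>x. \<Theta>12 f (a x) (b x)) \<in> borel_measurable M"
  unfolding \<Theta>_def \<Theta>2_def \<Theta>12_def by measurable

abbreviation (input) nice :: "(real ^ 'a \<Rightarrow> complex) \<Rightarrow> bool" where
  "nice u \<equiv> bdd_supp u \<and> (\<forall>y y'. same_cube k y y' \<longrightarrow> u y = u y')"

text \<open>The cancelled part in the second parameter, where the kernel acts on \<open>L\<^sup>2\<close> in the first
  variables and its norm is controlled by the one-parameter theorem.\<close>

lemma square_\<Theta>_diff:
  "(\<integral>\<^sup>+v. dtt (fst v) * (\<integral>\<^sup>+u. dtt (fst u) * ennreal ((norm (\<Theta> f u v - \<Theta>2 f u v))\<^sup>2) \<partial>lborel) \<partial>lborel)
     \<le> ennreal (square_const CARD('m) \<beta> * (t1_const CARD('n) \<alpha> * K\<^sup>2)) * sqnorm f"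
proof -
  let ?T = "t1_const CARD('n) \<alpha>"
  \<comment> \<open>\<open>operator_kernel\<close> has its constant inside the square; the root
    makes the constant of \<open>square_function\<close> come out linearly.\<close>
  define A where "A = sqrt ?T * K"
  have T0: "0 \<le> ?T" by (rule t1_const_nonneg[OF \<alpha>])
  have A0: "0 \<le> A" using T0 K by (simp add: A_def)
  have A2: "(A * r)\<^sup>2 = ?T * (K * r)\<^sup>2" for r using T0 by (simp add: A_def power_mult_distrib mult.assoc)
  \<comment> \<open>The base variables are x2 and y2; the operator takes functions of y1 to
    functions of u, the pair of t1 and x1.\<close>
  define \<kappa> where "\<kappa> t2 x2 y2 u y1 = complex_of_real (rsqrt (fst u)) * q (fst u) t2 (snd u) x2 y1 y2"
    for t2 x2 y2 y1 and u :: "real \<times> (real ^ 'n)"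
  \<comment> \<open>The one-parameter theorem averages in the first component, so the variables are
    exchanged.\<close>
  define g where "g p = f (snd p, fst p)" for p
  have g: "bdd_supp g" unfolding g_def[abs_def] by (rule bdd_supp_swap[OF f])
  note [measurable] = bdd_supp_measurable[OF g]
  have \<kappa>_meas: "(\<lambda>(t, x, y, w, z). \<kappa> t x y w z) \<in> borel_measurable borel"
    unfolding \<kappa>_def case_prod_unfold by measurable
  have \<kappa>_int: "integrable lborel (\<lambda>p. \<kappa> t2 x2 (fst p) u (snd p))" if "0 < t2" for t2 x2 u
    using q_int(2)[OF _ that, of "fst u"] by (cases "0 < fst u") (auto simp: \<kappa>_def rsqrt_def)
  have norm_eq: "(\<integral>\<^sup>+u. ennreal ((norm (LINT z|lborel. complex_of_real (rsqrt (fst u)) * h (fst u) (snd u) z * v z))\<^sup>2) \<partial>lborel)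
    = (\<integral>\<^sup>+t. dtt t * (\<integral>\<^sup>+x. ennreal ((norm (LINT z|lborel. h t x z * v z))\<^sup>2) \<partial>lborel) \<partial>lborel)"
    if h: "(\<lambda>(t, x, z). h t x z) \<in> borel_measurable borel" and v: "v \<in> borel_measurable borel"
    for h :: "real \<Rightarrow> real ^ 'n \<Rightarrow> real ^ 'n \<Rightarrow> complex" and v :: "real ^ 'n \<Rightarrow> complex"
  proof -
    note [measurable] = v
    have [measurable (raw)]: "(\<lambda>x. h (a x) (b x) (c x)) \<in> borel_measurable M"
      if "a \<in> M \<rightarrow>\<^sub>M borel" "b \<in> M \<rightarrow>\<^sub>M borel" "c \<in> M \<rightarrow>\<^sub>M borel" for a b c and M :: "'x measure"
      using measurable_compose[of "\<lambda>x. (a x, b x, c x)" M borel, OF _ h] that by simp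
    have "(\<integral>\<^sup>+u. ennreal ((norm (LINT z|lborel. complex_of_real (rsqrt (fst u)) * h (fst u) (snd u) z * v z))\<^sup>2) \<partial>lborel)
      = (\<integral>\<^sup>+u. dtt (fst u) * ennreal ((norm (LINT z|lborel. h (fst u) (snd u) z * v z))\<^sup>2) \<partial>lborel)"
      by (simp only: mult.assoc Bochner_Integration.integral_mult_right_zero rsqrt_power2)
    then show ?thesis by (subst (asm) (2) nn_integral_pair) (simp_all add: nn_integral_cmult)
  qed
  have ok: "AE t2 in lborel. 0 < t2 \<longrightarrow> operator_kernel (\<kappa> t2) nice \<beta> A t2"
    using kernel2 kernel2_diff
  proof eventually_elim
    case (elim t2)
    show ?case
    proof
      assume t2: "0 < t2"
      show "operator_kernel (\<kappa> t2) nice \<beta> A t2"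
      proof
        show "(\<lambda>(x, y, w, z). \<kappa> t2 x y w z) \<in> borel_measurable borel"
          unfolding \<kappa>_def case_prod_unfold by measurable
        show "integrable lborel (\<lambda>p. \<kappa> t2 x2 (fst p) u (snd p))" for x2 u by (rule \<kappa>_int[OF t2])
        show "AE x in lborel. AE y in lborel. \<forall>v. nice v \<longrightarrow>
          (\<integral>\<^sup>+w. ennreal ((norm (LINT z|lborel. \<kappa> t2 x y w z * v z))\<^sup>2) \<partial>lborel)
            \<le> ennreal ((A * size_factor \<beta> t2 x y)\<^sup>2) * sqnorm v"
        proof (rule AE_AE_mono[OF elim(1)[rule_format, OF t2]], intro allI impI)
          fix x y and v :: "real ^ 'n \<Rightarrow> complex" assume "t1_kernel (\<lambda>t1 x1 y1. q t1 t2 x1 x y1 y) \<alpha> (K * size_factor \<beta> t2 x y)" and v: "nice v"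
          then interpret t1_kernel "\<lambda>t1 x1 y1. q t1 t2 x1 x y1 y" \<alpha> "K * size_factor \<beta> t2 x y" by simp
          show "(\<integral>\<^sup>+w. ennreal ((norm (LINT z|lborel. \<kappa> t2 x y w z * v z))\<^sup>2) \<partial>lborel)
            \<le> ennreal ((A * size_factor \<beta> t2 x y)\<^sup>2) * sqnorm v"
            using square_function[of v k] v
            by (simp add: \<kappa>_def norm_eq[OF k_meas bdd_supp_measurable] A2 t1_const_def)
        qed
        show "AE x in lborel. AE y in lborel. AE y' in lborel. norm (y - y') < t2 / 2 \<longrightarrow> (\<forall>v. nice v \<longrightarrow>
          (\<integral>\<^sup>+w. ennreal ((norm (LINT z|lborel. (\<kappa> t2 x y w z - \<kappa> t2 x y' w z) * v z))\<^sup>2) \<partial>lborel)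
            \<le> ennreal ((A * holder_factor \<beta> t2 x y y')\<^sup>2) * sqnorm v)"
        proof (rule AE_AE_mono[OF elim(2)[rule_format, OF t2]], erule eventually_mono, intro allI impI)
          fix x y y' and v :: "real ^ 'n \<Rightarrow> complex"
          assume "norm (y - y') < t2 / 2 \<longrightarrow> t1_kernel (\<lambda>t1 x1 y1. q t1 t2 x1 x y1 y - q t1 t2 x1 x y1 y') \<alpha> (K * holder_factor \<beta> t2 x y y')"
            "norm (y - y') < t2 / 2" and v: "nice v"
          then interpret t1_kernel "\<lambda>t1 x1 y1. q t1 t2 x1 x y1 y - q t1 t2 x1 x y1 y'" \<alpha> "K * holder_factor \<beta> t2 x y y'" by simp
          have eq: "\<kappa> t2 x y w z - \<kappa> t2 x y' w z = complex_of_real (rsqrt (fst w)) * (q (fst w) t2 (snd w) x z y - q (fst w) t2 (snd w) x z y')" for w z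
            by (simp add: \<kappa>_def right_diff_distrib)
          show "(\<integral>\<^sup>+w. ennreal ((norm (LINT z|lborel. (\<kappa> t2 x y w z - \<kappa> t2 x y' w z) * v z))\<^sup>2) \<partial>lborel)
            \<le> ennreal ((A * holder_factor \<beta> t2 x y y')\<^sup>2) * sqnorm v"
            using square_function[of v k] v
            by (simp add: eq norm_eq[OF k_meas bdd_supp_measurable] A2 t1_const_def)
        qed
        show "nice (\<lambda>z. u z - v z)" if "nice u" "nice v" for u v :: "real ^ 'n \<Rightarrow> complex"
          using that by (auto intro: bdd_supp_diff)
      qed (use A0 \<beta> t2 in auto)
    qed
  qed
  have "(\<integral>\<^sup>+t2. dtt t2 * (\<integral>\<^sup>+x2. \<integral>\<^sup>+u. ennreal ((norm (LINT p|lborel.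
      \<kappa> t2 x2 (fst p) u (snd p) * (g p - pavg (gen t2) g (x2, snd p))))\<^sup>2) \<partial>lborel \<partial>lborel) \<partial>lborel)
     \<le> ennreal (square_const CARD('m) \<beta> * A\<^sup>2) * sqnorm g"
  proof (rule operator_square_function[OF \<kappa>_meas ok g _ _ \<beta>])
    show "stepfun k g" using k unfolding stepfun_def stepfun2_def g_def by auto
    show "nice (\<lambda>z. pavg j g (y, z))" for j y
    proof (intro conjI allI impI)
      show "bdd_supp (\<lambda>z. pavg j g (y, z))" by (rule bdd_supp_section(2)[OF bdd_supp_pavg[OF g]])
      fix z z' :: "real ^ 'n" assume "same_cube k z z'"
      then have "(\<lambda>y. g (y, z)) = (\<lambda>y. g (y, z'))" using k unfolding stepfun2_def g_def by auto
      then show "pavg j g (y, z) = pavg j g (y, z')" by (simp add: pavg_def)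
    qed
  qed
  also have "sqnorm g = sqnorm f"
    unfolding sqnorm_def g_def by (rule nn_integral_pair_flip[of "\<lambda>p. ennreal ((norm (f p))\<^sup>2)", symmetric]) measurable
  also have "A\<^sup>2 = ?T * K\<^sup>2" using A2[of 1] by simp
  also have "(\<integral>\<^sup>+t2. dtt t2 * (\<integral>\<^sup>+x2. \<integral>\<^sup>+u. ennreal ((norm (LINT p|lborel.
      \<kappa> t2 x2 (fst p) u (snd p) * (g p - pavg (gen t2) g (x2, snd p))))\<^sup>2) \<partial>lborel \<partial>lborel) \<partial>lborel)
     = (\<integral>\<^sup>+t2. dtt t2 * (\<integral>\<^sup>+x2. \<integral>\<^sup>+u. dtt (fst u) * ennreal ((norm (\<Theta> f u (t2, x2) - \<Theta>2 f u (t2, x2)))\<^sup>2) \<partial>lborel \<partial>lborel) \<partial>lborel)"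
  proof (intro nn_integral_cong)
    fix t2 :: real
    have "ennreal ((norm (LINT p|lborel. \<kappa> t2 x2 (fst p) u (snd p) * (g p - pavg (gen t2) g (x2, snd p))))\<^sup>2)
      = dtt (fst u) * ennreal ((norm (\<Theta> f u (t2, x2) - \<Theta>2 f u (t2, x2)))\<^sup>2)" if t2: "0 < t2" for x2 u
    proof (cases "0 < fst u")
      case t1: True
      let ?q = "\<lambda>p. q (fst u) t2 (snd u) x2 (snd p) (fst p)"
      obtain R where R: "0 \<le> R" "\<And>p. norm (f p) \<le> R" using f_bound by metis
      have pav: "pavg (gen t2) g (x2, y) = avg (gen t2) (\<lambda>z. f (y, z)) x2" for y
        by (simp add: pavg_def g_def)
      have ig: "integrable lborel (\<lambda>p. ?q p * g p)"
        by (rule integrable_mult_bounded[OF q_int(2)[OF t1 t2] _ R(2)[of "(snd p, fst p)" for p, folded g_def]]) measurable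
      have ip: "integrable lborel (\<lambda>p. ?q p * avg (gen t2) (\<lambda>z. f (snd p, z)) x2)"
        by (rule integrable_mult_bounded[OF q_int(2)[OF t1 t2] _ avg_bound[OF R(2) R(1)]]) measurable
      have flip: "(LINT p|lborel. h (snd p, fst p)) = (LINT p|lborel. h p)"
        if "integrable lborel (\<lambda>p. h (snd p, fst p))" "integrable lborel h" for h :: "(real ^ 'n) \<times> (real ^ 'm) \<Rightarrow> complex"
        using lborel_integral_pair(1)[OF that(1)] lborel_integral_pair(1)[OF that(2)] lborel_Fubini[OF that(2)] by simp
      have if': "integrable lborel (\<lambda>p. q (fst u) t2 (snd u) x2 (fst p) (snd p) * f p)"
        by (rule integrable_mult_bounded[OF q_int(1)[OF t1 t2] _ R(2)]) measurable
      have ip': "integrable lborel (\<lambda>p. q (fst u) t2 (snd u) x2 (fst p) (snd p) * avg (gen t2) (\<lambda>z. f (fst p, z)) x2)"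
        by (rule integrable_mult_bounded[OF q_int(1)[OF t1 t2] _ avg_bound[OF R(2) R(1)]]) measurable
      have 1: "(LINT p|lborel. ?q p * g p) = \<Theta> f u (t2, x2)"
        using flip[of "\<lambda>p. q (fst u) t2 (snd u) x2 (fst p) (snd p) * f p"] ig if' by (simp add: \<Theta>_def g_def)
      have "(LINT p|lborel. ?q p * avg (gen t2) (\<lambda>z. f (snd p, z)) x2)
        = (LINT p|lborel. q (fst u) t2 (snd u) x2 (fst p) (snd p) * avg (gen t2) (\<lambda>z. f (fst p, z)) x2)"
        using flip[of "\<lambda>p. q (fst u) t2 (snd u) x2 (fst p) (snd p) * avg (gen t2) (\<lambda>z. f (fst p, z)) x2"] ip ip' by simp
      also have "\<dots> = \<Theta>2 f u (t2, x2)"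
        using lborel_integral_pair(1)[OF ip'] by (simp add: \<Theta>2_def \<sigma>_def)
      finally have 2: "(LINT p|lborel. ?q p * avg (gen t2) (\<lambda>z. f (snd p, z)) x2) = \<Theta>2 f u (t2, x2)" .
      have "(LINT p|lborel. \<kappa> t2 x2 (fst p) u (snd p) * (g p - pavg (gen t2) g (x2, snd p)))
        = (LINT p|lborel. complex_of_real (rsqrt (fst u)) * (?q p * g p - ?q p * avg (gen t2) (\<lambda>z. f (snd p, z)) x2))"
        by (simp add: \<kappa>_def pav right_diff_distrib mult.assoc)
      also have "\<dots> = complex_of_real (rsqrt (fst u)) * (\<Theta> f u (t2, x2) - \<Theta>2 f u (t2, x2))"
        using ig ip by (simp add: 1 2)
      finally show ?thesis by (simp only: rsqrt_power2)
    qed (simp add: \<kappa>_def rsqrt_def dtt_def)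
    then show "dtt t2 * (\<integral>\<^sup>+x2. \<integral>\<^sup>+u. ennreal ((norm (LINT p|lborel.
      \<kappa> t2 x2 (fst p) u (snd p) * (g p - pavg (gen t2) g (x2, snd p))))\<^sup>2) \<partial>lborel \<partial>lborel)
      = dtt t2 * (\<integral>\<^sup>+x2. \<integral>\<^sup>+u. dtt (fst u) * ennreal ((norm (\<Theta> f u (t2, x2) - \<Theta>2 f u (t2, x2)))\<^sup>2) \<partial>lborel \<partial>lborel)"
      by (cases "0 < t2") (simp_all add: dtt_nonpos)
  qed
  also have "\<dots> = (\<integral>\<^sup>+v. dtt (fst v) * (\<integral>\<^sup>+u. dtt (fst u) * ennreal ((norm (\<Theta> f u v - \<Theta>2 f u v))\<^sup>2) \<partial>lborel) \<partial>lborel)"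
    by (rule nn_integral_dtt_pair[symmetric]) measurable
  finally show ?thesis .
qed

text \<open>Now x1 and y1 are the base variables. The operator sends a function of the second
  variable to \<open>\<sigma>\<close> times its average at the scale of t2, weighted by
  \<open>rsqrt\<close>, and its norm is what \<open>k_embedding\<close> bounds; hence
  \<open>4 * carleson_const\<close>.\<close>

lemma square_\<Theta>2_diff:
  "(\<integral>\<^sup>+u. dtt (fst u) * (\<integral>\<^sup>+v. dtt (fst v) * ennreal ((norm (\<Theta>2 f u v - \<Theta>12 f u v))\<^sup>2) \<partial>lborel) \<partial>lborel)
     \<le> ennreal (square_const CARD('n) \<alpha> * (4 * carleson_const CARD('m) \<beta> * K\<^sup>2)) * sqnorm f"
proof -
  let ?T = "4 * carleson_const CARD('m) \<beta>"
  define A where "A = sqrt ?T * K"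
  have T0: "0 \<le> ?T" using carleson_const_nonneg[OF \<beta>] by simp
  have A0: "0 \<le> A" using T0 K by (simp add: A_def)
  have A2: "(A * r)\<^sup>2 = ?T * (K * r)\<^sup>2" for r using T0 by (simp add: A_def power_mult_distrib mult.assoc)
  \<comment> \<open>The averaging kernel is built into the operator, so that applying it to
    \<open>f\<close> gives \<open>\<Theta>2\<close> and applying it to the average of
    \<open>f\<close> gives \<open>\<Theta>12\<close>.\<close>
  define \<kappa> where "\<kappa> t1 x1 y1 v z = complex_of_real (rsqrt (fst v)) * \<sigma> t1 (fst v) x1 (snd v) y1 * complex_of_real (avker (gen (fst v)) (snd v) z)"
    for t1 x1 y1 z and v :: "real \<times> (real ^ 'm)"
  have \<kappa>_meas: "(\<lambda>(t, x, y, w, z). \<kappa> t x y w z) \<in> borel_measurable borel"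
    unfolding \<kappa>_def case_prod_unfold by measurable
  have \<kappa>_int: "integrable lborel (\<lambda>p. \<kappa> t1 x1 (fst p) v (snd p))" if t1: "0 < t1" for t1 x1 v
  proof (cases "0 < fst v")
    case True
    show ?thesis unfolding \<kappa>_def
      by (intro integrable_tensor integrable_mult_right \<sigma>_int t1 True integrable_of_real integrable_avker)
  qed (simp add: \<kappa>_def rsqrt_def)
  have avg_eq: "(LINT z|lborel. c * complex_of_real (avker j x z) * w z) = c * avg j w x"
    for c j w and x :: "real ^ 'm"
  proof -
    have "(LINT z|lborel. c * complex_of_real (avker j x z) * w z) = (LINT z|lborel. c * (avker j x z *\<^sub>R w z))"
      by (simp add: scaleR_conv_of_real mult.assoc)
    then show ?thesis unfolding avg_def by (simp only: Bochner_Integration.integral_mult_right_zero)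
  qed
  have norm_eq: "(\<integral>\<^sup>+v. ennreal ((norm (LINT z|lborel. complex_of_real (rsqrt (fst v)) * h (fst v) (snd v) * complex_of_real (avker (gen (fst v)) (snd v) z) * w z))\<^sup>2) \<partial>lborel)
    = (\<integral>\<^sup>+t. dtt t * (\<integral>\<^sup>+x. ennreal ((norm (h t x * avg (gen t) w x))\<^sup>2) \<partial>lborel) \<partial>lborel)"
    if h: "(\<lambda>(t, x). h t x) \<in> borel_measurable borel" and w: "w \<in> borel_measurable borel"
    for h :: "real \<Rightarrow> real ^ 'm \<Rightarrow> complex" and w :: "real ^ 'm \<Rightarrow> complex"
  proof -
    note [measurable] = w
    note [measurable (raw)] = measurable_uncurry[OF h]
    have [measurable (raw)]: "(\<lambda>q. avg (gen (a q)) w (b q)) \<in> borel_measurable M"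
      if [measurable]: "a \<in> M \<rightarrow>\<^sub>M borel" "b \<in> M \<rightarrow>\<^sub>M borel" for a b and M :: "'x measure"
      by (rule gen_measurable_compose[where F="\<lambda>k q. avg k w (b q)"]) measurable
    have "(\<integral>\<^sup>+v. ennreal ((norm (LINT z|lborel. complex_of_real (rsqrt (fst v)) * h (fst v) (snd v) * complex_of_real (avker (gen (fst v)) (snd v) z) * w z))\<^sup>2) \<partial>lborel)
      = (\<integral>\<^sup>+v. dtt (fst v) * ennreal ((norm (h (fst v) (snd v) * avg (gen (fst v)) w (snd v)))\<^sup>2) \<partial>lborel)"
      unfolding avg_eq by (simp only: mult.assoc rsqrt_power2)
    then show ?thesis by (subst (asm) (2) nn_integral_pair) (simp_all add: nn_integral_cmult)
  qed
  have h_meas: "(\<lambda>(t, x). LINT y|lborel. kk t x y) \<in> borel_measurable borel"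
    if kk: "(\<lambda>(t, x, y). kk t x y) \<in> borel_measurable borel" for kk :: "real \<Rightarrow> real ^ 'm \<Rightarrow> real ^ 'm \<Rightarrow> complex"
  proof -
    have [measurable (raw)]: "(\<lambda>x. kk (a x) (b x) (c x)) \<in> borel_measurable M"
      if "a \<in> M \<rightarrow>\<^sub>M borel" "b \<in> M \<rightarrow>\<^sub>M borel" "c \<in> M \<rightarrow>\<^sub>M borel" for a b c and M :: "'x measure"
      using measurable_compose[of "\<lambda>x. (a x, b x, c x)" M borel, OF _ kk] that by simp
    show ?thesis unfolding case_prod_unfold by measurable
  qed
  have ok: "AE t1 in lborel. 0 < t1 \<longrightarrow> operator_kernel (\<kappa> t1) nice \<alpha> A t1"
    using kernel1 kernel1_diff
  proof eventually_elim
    case (elim t1)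
    show ?case
    proof
      assume t1: "0 < t1"
      show "operator_kernel (\<kappa> t1) nice \<alpha> A t1"
      proof
        show "(\<lambda>(x, y, w, z). \<kappa> t1 x y w z) \<in> borel_measurable borel"
          unfolding \<kappa>_def case_prod_unfold by measurable
        show "integrable lborel (\<lambda>p. \<kappa> t1 x1 (fst p) u (snd p))" for x1 u by (rule \<kappa>_int[OF t1])
        show "AE x in lborel. AE y in lborel. \<forall>v. nice v \<longrightarrow>
          (\<integral>\<^sup>+w. ennreal ((norm (LINT z|lborel. \<kappa> t1 x y w z * v z))\<^sup>2) \<partial>lborel)
            \<le> ennreal ((A * size_factor \<alpha> t1 x y)\<^sup>2) * sqnorm v"
        proof (rule AE_AE_mono[OF elim(1)[rule_format, OF t1]], intro allI impI)
          fix x y and v :: "real ^ 'm \<Rightarrow> complex"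
          assume "carleson_kernel (\<lambda>t2 x2 y2. q t1 t2 x x2 y y2) \<beta> (K * size_factor \<alpha> t1 x y)" and v: "nice v"
          then interpret carleson_kernel "\<lambda>t2 x2 y2. q t1 t2 x x2 y y2" \<beta> "K * size_factor \<alpha> t1 x y" by simp
          show "(\<integral>\<^sup>+w. ennreal ((norm (LINT z|lborel. \<kappa> t1 x y w z * v z))\<^sup>2) \<partial>lborel)
            \<le> ennreal ((A * size_factor \<alpha> t1 x y)\<^sup>2) * sqnorm v"
            using k_embedding[of v k] v
            by (simp add: \<kappa>_def \<sigma>_def norm_eq[OF h_meas[OF k_meas] bdd_supp_measurable] A2)
        qed
        show "AE x in lborel. AE y in lborel. AE y' in lborel. norm (y - y') < t1 / 2 \<longrightarrow> (\<forall>v. nice v \<longrightarrow>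
          (\<integral>\<^sup>+w. ennreal ((norm (LINT z|lborel. (\<kappa> t1 x y w z - \<kappa> t1 x y' w z) * v z))\<^sup>2) \<partial>lborel)
            \<le> ennreal ((A * holder_factor \<alpha> t1 x y y')\<^sup>2) * sqnorm v)"
        proof (rule AE_AE_mono[OF elim(2)[rule_format, OF t1]], erule eventually_mono, intro allI impI)
          fix x y y' and v :: "real ^ 'm \<Rightarrow> complex"
          assume "norm (y - y') < t1 / 2 \<longrightarrow> carleson_kernel (\<lambda>t2 x2 y2. q t1 t2 x x2 y y2 - q t1 t2 x x2 y' y2) \<beta> (K * holder_factor \<alpha> t1 x y y')"
            "norm (y - y') < t1 / 2" and v: "nice v"
          then interpret carleson_kernel "\<lambda>t2 x2 y2. q t1 t2 x x2 y y2 - q t1 t2 x x2 y' y2" \<beta> "K * holder_factor \<alpha> t1 x y y'" by simp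
          \<comment> \<open>For nonpositive t2 the factor \<open>rsqrt\<close> makes both sides
            vanish; otherwise the integrals defining \<open>\<sigma>\<close> converge and can be
            subtracted.\<close>
          have eq: "\<kappa> t1 x y w z - \<kappa> t1 x y' w z = complex_of_real (rsqrt (fst w)) *
              (LINT y2|lborel. q t1 (fst w) x (snd w) y y2 - q t1 (fst w) x (snd w) y' y2)
              * complex_of_real (avker (gen (fst w)) (snd w) z)" for w z
          proof (cases "0 < fst w")
            case True
            then show ?thesis
              using q_int(3)[OF t1 True] by (simp add: \<kappa>_def \<sigma>_def left_diff_distrib right_diff_distrib)
          qed (simp add: \<kappa>_def rsqrt_def)
          show "(\<integral>\<^sup>+w. ennreal ((norm (LINT z|lborel. (\<kappa> t1 x y w z - \<kappa> t1 x y' w z) * v z))\<^sup>2) \<partial>lborel)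
            \<le> ennreal ((A * holder_factor \<alpha> t1 x y y')\<^sup>2) * sqnorm v"
            unfolding eq using k_embedding[of v k] v
            by (simp only: norm_eq[OF h_meas[OF k_meas] bdd_supp_measurable] A2)
        qed
        show "nice (\<lambda>z. u z - v z)" if "nice u" "nice v" for u v :: "real ^ 'm \<Rightarrow> complex"
          using that by (auto intro: bdd_supp_diff)
      qed (use A0 \<alpha> t1 in auto)
    qed
  qed
  have "(\<integral>\<^sup>+t1. dtt t1 * (\<integral>\<^sup>+x1. \<integral>\<^sup>+v. ennreal ((norm (LINT p|lborel.
      \<kappa> t1 x1 (fst p) v (snd p) * (f p - pavg (gen t1) f (x1, snd p))))\<^sup>2) \<partial>lborel \<partial>lborel) \<partial>lborel)
     \<le> ennreal (square_const CARD('n) \<alpha> * A\<^sup>2) * sqnorm f"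
  proof (rule operator_square_function[OF \<kappa>_meas ok f _ _ \<alpha>])
    show "stepfun k f" using k unfolding stepfun_def stepfun2_def by auto
    show "nice (\<lambda>z. pavg j f (y, z))" for j y
    proof (intro conjI allI impI)
      show "bdd_supp (\<lambda>z. pavg j f (y, z))" by (rule bdd_supp_section(2)[OF bdd_supp_pavg[OF f]])
      fix z z' :: "real ^ 'm" assume "same_cube k z z'"
      then have "(\<lambda>y. f (y, z)) = (\<lambda>y. f (y, z'))" using k unfolding stepfun2_def by auto
      then show "pavg j f (y, z) = pavg j f (y, z')" by (simp add: pavg_def)
    qed
  qed
  also have "A\<^sup>2 = ?T * K\<^sup>2" using A2[of 1] by simp
  also have "(\<integral>\<^sup>+t1. dtt t1 * (\<integral>\<^sup>+x1. \<integral>\<^sup>+v. ennreal ((norm (LINT p|lborel.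
      \<kappa> t1 x1 (fst p) v (snd p) * (f p - pavg (gen t1) f (x1, snd p))))\<^sup>2) \<partial>lborel \<partial>lborel) \<partial>lborel)
     = (\<integral>\<^sup>+t1. dtt t1 * (\<integral>\<^sup>+x1. \<integral>\<^sup>+v. dtt (fst v) * ennreal ((norm (\<Theta>2 f (t1, x1) v - \<Theta>12 f (t1, x1) v))\<^sup>2) \<partial>lborel \<partial>lborel) \<partial>lborel)"
  proof (intro nn_integral_cong)
    fix t1 :: real
    have "ennreal ((norm (LINT p|lborel. \<kappa> t1 x1 (fst p) v (snd p) * (f p - pavg (gen t1) f (x1, snd p))))\<^sup>2)
      = dtt (fst v) * ennreal ((norm (\<Theta>2 f (t1, x1) v - \<Theta>12 f (t1, x1) v))\<^sup>2)" if t1: "0 < t1" for x1 v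
    proof (cases "0 < fst v")
      case t2: True
      let ?s = "\<sigma> t1 (fst v) x1 (snd v)" and ?a = "\<lambda>z. complex_of_real (avker (gen (fst v)) (snd v) z)"
      let ?r = "complex_of_real (rsqrt (fst v))"
      obtain R where R: "0 \<le> R" "\<And>p. norm (f p) \<le> R" using f_bound by metis
      have pb: "norm (pavg (gen t1) f (x1, z)) \<le> R" for z unfolding pavg_def by (rule avg_bound[OF R(2) R(1)])
      have [measurable]: "pavg j f \<in> borel_measurable borel" for j by (rule bdd_supp_measurable[OF bdd_supp_pavg[OF f]])
      have i1: "integrable lborel (\<lambda>p. \<kappa> t1 x1 (fst p) v (snd p) * f p)"
        by (rule integrable_mult_bounded[OF \<kappa>_int[OF t1] _ R(2)]) measurable
      have i2: "integrable lborel (\<lambda>p. \<kappa> t1 x1 (fst p) v (snd p) * pavg (gen t1) f (x1, snd p))"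
        by (rule integrable_mult_bounded[OF \<kappa>_int[OF t1] _ pb]) measurable
      have "(LINT p|lborel. \<kappa> t1 x1 (fst p) v (snd p) * f p) = (LINT y|lborel. ?r * ?s y * avg (gen (fst v)) (\<lambda>z. f (y, z)) (snd v))"
        using lborel_integral_pair(1)[OF i1] by (simp add: \<kappa>_def avg_eq)
      also have "\<dots> = ?r * \<Theta>2 f (t1, x1) v"
        by (simp only: \<Theta>2_def mult.assoc Bochner_Integration.integral_mult_right_zero fst_conv snd_conv)
      finally have 1: "(LINT p|lborel. \<kappa> t1 x1 (fst p) v (snd p) * f p) = ?r * \<Theta>2 f (t1, x1) v" .
      have "(LINT p|lborel. \<kappa> t1 x1 (fst p) v (snd p) * pavg (gen t1) f (x1, snd p))
        = (LINT y|lborel. ?r * ?s y * avg (gen (fst v)) (\<lambda>z. avg (gen t1) (\<lambda>y. f (y, z)) x1) (snd v))"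
        using lborel_integral_pair(1)[OF i2] by (simp add: \<kappa>_def avg_eq pavg_def)
      \<comment> \<open>The operator averages in the second variable after the first one, in the
        reverse order of \<open>avg2\<close>.\<close>
      also have "avg (gen (fst v)) (\<lambda>z. avg (gen t1) (\<lambda>y. f (y, z)) x1) (snd v) = avg2 (gen t1) (gen (fst v)) f x1 (snd v)"
        unfolding avg2_def by (rule avg_commute[OF f, symmetric])
      also have "(LINT y|lborel. ?r * ?s y * avg2 (gen t1) (gen (fst v)) f x1 (snd v)) = ?r * \<Theta>12 f (t1, x1) v"
        by (simp only: \<Theta>12_def mult.assoc Bochner_Integration.integral_mult_right_zero Bochner_Integration.integral_mult_left_zero fst_conv snd_conv)
      finally have 2: "(LINT p|lborel. \<kappa> t1 x1 (fst p) v (snd p) * pavg (gen t1) f (x1, snd p)) = ?r * \<Theta>12 f (t1, x1) v" .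
      have "(LINT p|lborel. \<kappa> t1 x1 (fst p) v (snd p) * (f p - pavg (gen t1) f (x1, snd p))) = ?r * (\<Theta>2 f (t1, x1) v - \<Theta>12 f (t1, x1) v)"
        using i1 i2 1 2 by (simp add: right_diff_distrib)
      then show ?thesis by (simp only: rsqrt_power2)
    qed (simp add: \<kappa>_def rsqrt_def dtt_def)
    then show "dtt t1 * (\<integral>\<^sup>+x1. \<integral>\<^sup>+v. ennreal ((norm (LINT p|lborel.
      \<kappa> t1 x1 (fst p) v (snd p) * (f p - pavg (gen t1) f (x1, snd p))))\<^sup>2) \<partial>lborel \<partial>lborel)
      = dtt t1 * (\<integral>\<^sup>+x1. \<integral>\<^sup>+v. dtt (fst v) * ennreal ((norm (\<Theta>2 f (t1, x1) v - \<Theta>12 f (t1, x1) v))\<^sup>2) \<partial>lborel \<partial>lborel)"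
      by (cases "0 < t1") (simp_all add: dtt_nonpos)
  qed
  also have "\<dots> = (\<integral>\<^sup>+u. dtt (fst u) * (\<integral>\<^sup>+v. dtt (fst v) * ennreal ((norm (\<Theta>2 f u v - \<Theta>12 f u v))\<^sup>2) \<partial>lborel) \<partial>lborel)"
    by (rule nn_integral_dtt_pair[symmetric]) measurable
  finally show ?thesis .
qed

text \<open>\<open>\<Theta>12\<close> is the image of the constant one times the rectangular
  average: exactly the product treated by the bi-parameter embedding.\<close>

lemma square_\<Theta>12:
  "(\<integral>\<^sup>+p. dtt (fst (fst p)) * dtt (fst (snd p)) * ennreal ((norm (\<Theta>12 f (fst p) (snd p)))\<^sup>2) \<partial>lborel)
     \<le> ennreal (16 * B) * sqnorm f"
proof -
  define c where "c p = ennreal ((norm (LINT y1|lborel. LINT y2|lborel. q (fst (fst p)) (fst (snd p)) (snd (fst p)) (snd (snd p)) y1 y2))\<^sup>2)"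
    for p :: "('n, 'm) half_spaces"
  have "(\<integral>\<^sup>+p. dtt (fst (fst p)) * dtt (fst (snd p)) * c p *
      ennreal ((norm (avg2 (gen (fst (fst p))) (gen (fst (snd p))) f (snd (fst p)) (snd (snd p))))\<^sup>2) \<partial>lborel)
     \<le> 16 * ennreal B * sqnorm f"
  proof (rule biparameter_Carleson_embedding[OF _ f k])
    show "c \<in> borel_measurable borel" unfolding c_def by measurable
  qed (unfold c_def, rule level_set)
  then show ?thesis
    using B by (simp add: c_def \<Theta>12_def \<sigma>_def norm_mult power_mult_distrib ennreal_mult mult.assoc)
qed

lemma square_\<Theta>:
  "(\<integral>\<^sup>+p. dtt (fst (fst p)) * dtt (fst (snd p)) * ennreal ((norm (\<Theta> f (fst p) (snd p)))\<^sup>2) \<partial>lborel)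
     \<le> ennreal (3 * (square_const CARD('m) \<beta> * (t1_const CARD('n) \<alpha> * K\<^sup>2))
        + 3 * (square_const CARD('n) \<alpha> * (4 * carleson_const CARD('m) \<beta> * K\<^sup>2)) + 3 * (16 * B)) * sqnorm f"
proof -
  let ?w = "\<lambda>p :: ('n, 'm) half_spaces. dtt (fst (fst p)) * dtt (fst (snd p))"
  let ?a = "\<lambda>p. ennreal ((norm (\<Theta> f (fst p) (snd p) - \<Theta>2 f (fst p) (snd p)))\<^sup>2)"
  let ?b = "\<lambda>p. ennreal ((norm (\<Theta>2 f (fst p) (snd p) - \<Theta>12 f (fst p) (snd p)))\<^sup>2)"
  let ?c = "\<lambda>p. ennreal ((norm (\<Theta>12 f (fst p) (snd p)))\<^sup>2)"
  have a: "(\<integral>\<^sup>+p. ?w p * ?a p \<partial>lborel) \<le> ennreal (square_const CARD('m) \<beta> * (t1_const CARD('n) \<alpha> * K\<^sup>2)) * sqnorm f"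
  proof -
    have "(\<integral>\<^sup>+p. ?w p * ?a p \<partial>lborel) = (\<integral>\<^sup>+v. \<integral>\<^sup>+u. dtt (fst v) * (dtt (fst u) * ennreal ((norm (\<Theta> f u v - \<Theta>2 f u v))\<^sup>2)) \<partial>lborel \<partial>lborel)"
      by (subst nn_integral_pair, measurable, subst nn_integral_swap, measurable) (simp add: mult_ac)
    then show ?thesis using square_\<Theta>_diff by (simp add: nn_integral_cmult)
  qed
  have b: "(\<integral>\<^sup>+p. ?w p * ?b p \<partial>lborel) \<le> ennreal (square_const CARD('n) \<alpha> * (4 * carleson_const CARD('m) \<beta> * K\<^sup>2)) * sqnorm f"
  proof -
    have "(\<integral>\<^sup>+p. ?w p * ?b p \<partial>lborel) = (\<integral>\<^sup>+u. \<integral>\<^sup>+v. dtt (fst u) * (dtt (fst v) * ennreal ((norm (\<Theta>2 f u v - \<Theta>12 f u v))\<^sup>2)) \<partial>lborel \<partial>lborel)"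
      by (subst nn_integral_pair, measurable) (simp add: mult_ac)
    then show ?thesis using square_\<Theta>2_diff by (simp add: nn_integral_cmult)
  qed
  have "(\<integral>\<^sup>+p. ?w p * ennreal ((norm (\<Theta> f (fst p) (snd p)))\<^sup>2) \<partial>lborel)
    \<le> (\<integral>\<^sup>+p. 3 * (?w p * ?a p) + 3 * (?w p * ?b p) + 3 * (?w p * ?c p) \<partial>lborel)"
  proof (intro nn_integral_mono)
    fix p :: "('n, 'm) half_spaces"
    let ?x = "\<Theta> f (fst p) (snd p) - \<Theta>2 f (fst p) (snd p)" and ?y = "\<Theta>2 f (fst p) (snd p) - \<Theta>12 f (fst p) (snd p)"
      and ?z = "\<Theta>12 f (fst p) (snd p)"
    have "norm (?x + ?y + ?z) \<le> norm ?x + norm ?y + norm ?z" by (rule norm_triangle_le[OF add_right_mono[OF norm_triangle_ineq]])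
    then have "(norm (\<Theta> f (fst p) (snd p)))\<^sup>2 \<le> (norm ?x + norm ?y + norm ?z)\<^sup>2" by (intro power_mono) auto
    also have "\<dots> \<le> 3 * (norm ?x)\<^sup>2 + 3 * (norm ?y)\<^sup>2 + 3 * (norm ?z)\<^sup>2"
      using sum_squares_ge_zero[of "norm ?x - norm ?y" "norm ?y - norm ?z"] zero_le_power2[of "norm ?x - norm ?z"]
      by (simp add: power2_eq_square algebra_simps)
    finally have "ennreal ((norm (\<Theta> f (fst p) (snd p)))\<^sup>2) \<le> 3 * ?a p + 3 * ?b p + 3 * ?c p"
      by (drule_tac ennreal_leI) (simp add: ennreal_mult ennreal_plus)
    then have "?w p * ennreal ((norm (\<Theta> f (fst p) (snd p)))\<^sup>2) \<le> ?w p * (3 * ?a p + 3 * ?b p + 3 * ?c p)"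
      by (rule mult_left_mono) simp
    then show "?w p * ennreal ((norm (\<Theta> f (fst p) (snd p)))\<^sup>2) \<le> 3 * (?w p * ?a p) + 3 * (?w p * ?b p) + 3 * (?w p * ?c p)"
      by (simp add: distrib_left mult_ac)
  qed
  also have "\<dots> = 3 * (\<integral>\<^sup>+p. ?w p * ?a p \<partial>lborel) + 3 * (\<integral>\<^sup>+p. ?w p * ?b p \<partial>lborel) + 3 * (\<integral>\<^sup>+p. ?w p * ?c p \<partial>lborel)"
    by (simp add: nn_integral_add nn_integral_cmult)
  also have "\<dots> \<le> 3 * (ennreal (square_const CARD('m) \<beta> * (t1_const CARD('n) \<alpha> * K\<^sup>2)) * sqnorm f)
     + 3 * (ennreal (square_const CARD('n) \<alpha> * (4 * carleson_const CARD('m) \<beta> * K\<^sup>2)) * sqnorm f) + 3 * (ennreal (16 * B) * sqnorm f)"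
    by (intro add_mono mult_left_mono a b square_\<Theta>12) auto
  also have "\<dots> = ennreal (3 * (square_const CARD('m) \<beta> * (t1_const CARD('n) \<alpha> * K\<^sup>2))
        + 3 * (square_const CARD('n) \<alpha> * (4 * carleson_const CARD('m) \<beta> * K\<^sup>2)) + 3 * (16 * B)) * sqnorm f"
  proof -
    have e: "ennreal (3 * a + 3 * b + 3 * c) * s = 3 * (ennreal a * s) + 3 * (ennreal b * s) + 3 * (ennreal c * s)"
      if "0 \<le> a" "0 \<le> b" "0 \<le> c" for a b c s
      using that by (simp add: ennreal_plus ennreal_mult distrib_right mult.assoc)
    show ?thesis
      by (rule e[symmetric])
         (use B square_const_nonneg[OF \<alpha>] square_const_nonneg[OF \<beta>] t1_const_nonneg[OF \<alpha>] carleson_const_nonneg[OF \<beta>] in auto)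
  qed
  finally show ?thesis .
qed

end

end

subsection \<open>Density of step functions\<close>

text \<open>The L2 closure of the step functions, within Borel functions. The generation
  \<open>k\<close> may depend on the accuracy, as no bound above involves it.\<close>

definition step_approx :: "((real ^ 'n) \<times> (real ^ 'm) \<Rightarrow> complex) \<Rightarrow> bool" where
  "step_approx f \<longleftrightarrow> f \<in> borel_measurable borel \<and>
     (\<forall>e>0. \<exists>g k. bdd_supp g \<and> stepfun2 k g \<and> sqnorm (\<lambda>p. f p - g p) \<le> ennreal e)"

lemma stepfun2_mono: "stepfun2 k f \<Longrightarrow> k \<le> l \<Longrightarrow> stepfun2 l f"
  unfolding stepfun2_def by (meson same_cube_mono)

lemma sqnorm_add_le:
  assumes [measurable]: "u \<in> borel_measurable borel" "v \<in> borel_measurable borel"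
  shows "sqnorm (\<lambda>z. u z + v z) \<le> 2 * sqnorm u + 2 * sqnorm v"
proof -
  have "sqnorm (\<lambda>z. - v z) = sqnorm v" by (simp add: sqnorm_def)
  then show ?thesis using sqnorm_diff_le[of u "\<lambda>z. - v z"] by simp
qed

lemma step_approx_limit:
  assumes [measurable]: "f \<in> borel_measurable borel"
    and lim: "\<And>e. 0 < e \<Longrightarrow> \<exists>h. step_approx h \<and> sqnorm (\<lambda>p. f p - h p) \<le> ennreal e"
  shows "step_approx f"
  unfolding step_approx_def
proof (intro conjI allI impI)
  fix e :: real assume "0 < e"
  \<comment> \<open>The squared norm of a sum costs a factor 2 for each of the two terms.\<close>
  then have e: "0 < e / 4" by simp
  obtain h where h: "step_approx h" "sqnorm (\<lambda>p. f p - h p) \<le> ennreal (e / 4)"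
    using lim[OF e] by blast
  then obtain g k where g: "bdd_supp g" "stepfun2 k g" "sqnorm (\<lambda>p. h p - g p) \<le> ennreal (e / 4)"
    using e unfolding step_approx_def by blast
  note [measurable] = bdd_supp_measurable[OF g(1)]
  have [measurable]: "h \<in> borel_measurable borel" using h by (simp add: step_approx_def)
  have "sqnorm (\<lambda>p. f p - g p) = sqnorm (\<lambda>p. (f p - h p) + (h p - g p))" by simp
  also have "\<dots> \<le> 2 * sqnorm (\<lambda>p. f p - h p) + 2 * sqnorm (\<lambda>p. h p - g p)"
    by (rule sqnorm_add_le) measurable
  also have "\<dots> \<le> 2 * ennreal (e / 4) + 2 * ennreal (e / 4)"
    by (intro add_mono mult_left_mono h g) auto
  also have "\<dots> = ennreal (2 * (e / 4) + 2 * (e / 4))"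
    using e by (simp only: ennreal_plus ennreal_mult) (simp add: ennreal_mult)
  finally show "\<exists>g k. bdd_supp g \<and> stepfun2 k g \<and> sqnorm (\<lambda>p. f p - g p) \<le> ennreal e"
    using g by auto
qed fact

lemma step_approx_add:
  assumes "step_approx f1" "step_approx f2" shows "step_approx (\<lambda>p. f1 p + f2 p)"
  unfolding step_approx_def
proof (intro conjI allI impI)
  have [measurable]: "f1 \<in> borel_measurable borel" "f2 \<in> borel_measurable borel"
    using assms by (simp_all add: step_approx_def)
  show "(\<lambda>p. f1 p + f2 p) \<in> borel_measurable borel" by measurable
  fix e :: real assume "0 < e"
  then have e: "0 < e / 4" by simp
  obtain g1 k1 g2 k2 where g: "bdd_supp g1" "stepfun2 k1 g1" "sqnorm (\<lambda>p. f1 p - g1 p) \<le> ennreal (e / 4)"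
     "bdd_supp g2" "stepfun2 k2 g2" "sqnorm (\<lambda>p. f2 p - g2 p) \<le> ennreal (e / 4)"
    using e assms unfolding step_approx_def by blast
  note [measurable] = bdd_supp_measurable[OF g(1)] bdd_supp_measurable[OF g(4)]
  have "sqnorm (\<lambda>p. (f1 p + f2 p) - (g1 p + g2 p)) = sqnorm (\<lambda>p. (f1 p - g1 p) + (f2 p - g2 p))"
    by (simp add: algebra_simps)
  also have "\<dots> \<le> 2 * sqnorm (\<lambda>p. f1 p - g1 p) + 2 * sqnorm (\<lambda>p. f2 p - g2 p)"
    by (rule sqnorm_add_le) measurable
  also have "\<dots> \<le> 2 * ennreal (e / 4) + 2 * ennreal (e / 4)"
    by (intro add_mono mult_left_mono g) auto
  also have "\<dots> = ennreal (2 * (e / 4) + 2 * (e / 4))"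
    using e by (simp only: ennreal_plus ennreal_mult) (simp add: ennreal_mult)
  finally have "sqnorm (\<lambda>p. (f1 p + f2 p) - (g1 p + g2 p)) \<le> ennreal e" by simp
  moreover have "stepfun2 (max k1 k2) (\<lambda>p. g1 p + g2 p)"
    using stepfun2_mono[OF g(2), of "max k1 k2"] stepfun2_mono[OF g(5), of "max k1 k2"]
    by (auto simp: stepfun2_def)
  ultimately show "\<exists>g k. bdd_supp g \<and> stepfun2 k g \<and> sqnorm (\<lambda>p. (f1 p + f2 p) - g p) \<le> ennreal e"
    using bdd_supp_add[OF g(1,4)] by blast
qed

lemma step_approx_0: "step_approx (\<lambda>_. 0)"
  unfolding step_approx_def
proof (intro conjI allI impI)
  fix e :: real assume "0 < e"
  have "bdd_supp (\<lambda>_ :: (real ^ 'a) \<times> (real ^ 'b). 0 :: complex)" by (rule bdd_suppI[where B=0 and R=0]) auto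
  then show "\<exists>g k. bdd_supp g \<and> stepfun2 k g \<and> sqnorm (\<lambda>p :: (real ^ 'a) \<times> (real ^ 'b). 0 - g p) \<le> ennreal e"
    by (intro exI[of _ "\<lambda>_. 0"] exI[of _ 0]) (auto simp: stepfun2_def sqnorm_def)
qed simp

lemma step_approx_sum: "finite I \<Longrightarrow> (\<And>i. i \<in> I \<Longrightarrow> step_approx (f i)) \<Longrightarrow> step_approx (\<lambda>p. \<Sum>i\<in>I. f i p)"
  by (induction I rule: finite_induct) (simp_all add: step_approx_0 step_approx_add)

lemma sqnorm_cmult: "f \<in> borel_measurable borel \<Longrightarrow> sqnorm (\<lambda>p. c * f p) = ennreal ((norm c)\<^sup>2) * sqnorm f"
  unfolding sqnorm_def
  by (subst nn_integral_cmult[symmetric]) (auto simp: norm_mult power_mult_distrib ennreal_mult)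

lemma step_approx_cmult:
  assumes "step_approx f" shows "step_approx (\<lambda>p. c * f p)"
  unfolding step_approx_def
proof (intro conjI allI impI)
  have [measurable]: "f \<in> borel_measurable borel" using assms by (simp add: step_approx_def)
  show "(\<lambda>p. c * f p) \<in> borel_measurable borel" by measurable
  fix e :: real assume e: "0 < e"
  \<comment> \<open>The summand 1 covers c = 0.\<close>
  define d where "d = e / ((norm c)\<^sup>2 + 1)"
  have c: "0 < (norm c)\<^sup>2 + 1" by (simp add: add_nonneg_pos)
  have d: "0 < d" using e c by (simp add: d_def)
  obtain g k where g: "bdd_supp g" "stepfun2 k g" "sqnorm (\<lambda>p. f p - g p) \<le> ennreal d"
    using d assms unfolding step_approx_def by blast
  note [measurable] = bdd_supp_measurable[OF g(1)]
  have "sqnorm (\<lambda>p. c * f p - c * g p) = ennreal ((norm c)\<^sup>2) * sqnorm (\<lambda>p. f p - g p)"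
    by (simp add: sqnorm_cmult flip: right_diff_distrib)
  also have "\<dots> \<le> ennreal ((norm c)\<^sup>2) * ennreal d" by (intro mult_left_mono g) auto
  also have "\<dots> = ennreal ((norm c)\<^sup>2 * d)" using d by (simp add: ennreal_mult)
  also have "\<dots> \<le> ennreal e"
  proof (rule ennreal_leI)
    have "(norm c)\<^sup>2 * d \<le> ((norm c)\<^sup>2 + 1) * d" using d by (intro mult_right_mono) auto
    then show "(norm c)\<^sup>2 * d \<le> e" using c by (simp add: d_def)
  qed
  finally have "sqnorm (\<lambda>p. c * f p - c * g p) \<le> ennreal e" .
  moreover have "bdd_supp (\<lambda>p. c * g p)" by (rule bdd_supp_mult[OF g(1)]) auto
  moreover have "stepfun2 k (\<lambda>p. c * g p)" using g(2) unfolding stepfun2_def by metis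
  ultimately show "\<exists>g k. bdd_supp g \<and> stepfun2 k g \<and> sqnorm (\<lambda>p. c * f p - g p) \<le> ennreal e" by blast
qed

text \<open>Outer regularity replaces \<open>A\<close> by an open set, which is exhausted from
  inside by unions of dyadic rectangles of one generation; the indicators of these unions are step
  functions.\<close>

lemma step_approx_indicator:
  fixes A :: "((real ^ 'n) \<times> (real ^ 'm)) set"
  assumes A: "A \<in> sets borel" "emeasure lborel A < \<infinity>"
  shows "step_approx (indicator A)"
  unfolding step_approx_def
proof (intro conjI allI impI)
  show "indicator A \<in> borel_measurable borel" using A by measurable
  fix e :: real assume "0 < e"
  then have e: "0 < e / 2" by simp
  obtain U where U: "open U" "A \<subseteq> U" "emeasure lborel (U - A) < ennreal (e / 2)"
    using outer_regular_lborel[OF A(1) e] by blast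
  let ?R = "\<lambda>N x. dcube (int N) (fst x) \<times> dcube (int N) (snd x)"
  \<comment> \<open>The ball keeps the union bounded. Generation and radius grow together, so these
    sets increase to \<open>U\<close>.\<close>
  define V where "V N = {x. ?R N x \<subseteq> U \<inter> cball 0 (real N)}" for N
  have V_sub: "V N \<subseteq> U" "V N \<subseteq> cball 0 (real N)" for N
    by (auto simp: V_def mem_dcube dest: subsetD[where c="(_, _)"])
  have V_step: "x \<in> V N \<longleftrightarrow> y \<in> V N" if "same_cube (int N) (fst x) (fst y)" "same_cube (int N) (snd x) (snd y)" for x y N
  proof -
    have "same_cube (int N) (fst x) z \<longleftrightarrow> same_cube (int N) (fst y) z" for z
      using that(1) by (meson same_cube_sym same_cube_trans)
    moreover have "same_cube (int N) (snd x) z \<longleftrightarrow> same_cube (int N) (snd y) z" for z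
      using that(2) by (meson same_cube_sym same_cube_trans)
    ultimately have "dcube (int N) (fst x) = dcube (int N) (fst y)" "dcube (int N) (snd x) = dcube (int N) (snd y)"
      unfolding dcube_eq by auto
    then show ?thesis by (simp add: V_def)
  qed
  have V_borel [measurable]: "V N \<in> sets borel" for N
  proof -
    have eq: "V N = \<Union> (?R N ` V N)"
    proof (intro antisym subsetI)
      show "x \<in> \<Union> (?R N ` V N)" if "x \<in> V N" for x
        using that by (intro UN_I[of x]) (auto simp: mem_dcube mem_Times_iff)
      show "x \<in> V N" if x: "x \<in> \<Union> (?R N ` V N)" for x
      proof -
        obtain y where "y \<in> V N" "x \<in> ?R N y" using x by blast
        then show ?thesis using V_step[of N y x] by (simp add: mem_dcube mem_Times_iff)
      qed
    qed
    have "?R N ` V N \<subseteq> (\<lambda>(I, J). I \<times> J) ` (standard_dyadic_grid \<times> standard_dyadic_grid)"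
    proof (rule image_subsetI)
      show "?R N x \<in> (\<lambda>(I, J). I \<times> J) ` (standard_dyadic_grid \<times> standard_dyadic_grid)" for x
        by (rule image_eqI[of _ _ "(dcube (int N) (fst x), dcube (int N) (snd x))"]) (simp_all add: dcube_in_grid)
    qed
    then have "countable (?R N ` V N)"
      by (rule countable_subset) (intro countable_image countable_SIGMA countable_grid)
    then show ?thesis
      by (subst eq, intro sets.countable_Union) (auto intro: borel_Times)
  qed
  have V_mono: "incseq V"
  proof (intro incseq_SucI subsetI)
    fix N x assume x: "x \<in> V N"
    have "same_cube (int N) u v" if "same_cube (int (Suc N)) u v" for u v :: "real ^ 'n"
      by (rule same_cube_mono[OF _ that]) simp
    moreover have "same_cube (int N) u v" if "same_cube (int (Suc N)) u v" for u v :: "real ^ 'm"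
      by (rule same_cube_mono[OF _ that]) simp
    ultimately have "?R (Suc N) x \<subseteq> ?R N x"
      by (auto simp: mem_dcube simp del: of_nat_Suc)
    moreover have "cball 0 (real N) \<subseteq> (cball 0 (real (Suc N)) :: ((real ^ 'n) \<times> (real ^ 'm)) set)" by auto
    ultimately show "x \<in> V (Suc N)" using x unfolding V_def by blast
  qed
  have V_UN: "(\<Union>N. V N) = U"
  proof (intro antisym subsetI)
    fix x assume "x \<in> U"
    then obtain \<delta> where \<delta>: "0 < \<delta>" "ball x \<delta> \<subseteq> U" using U(1) by (meson open_contains_ball)
    \<comment> \<open>A rectangle of generation N has diameter at most
      \<open>c * 2 powi (- int N)\<close>.\<close>
    define c where "c = real CARD('n) + real CARD('m)"
    have "0 < c" by (simp add: c_def add_pos_pos)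
    obtain N1 where N1: "c / \<delta> < 2 ^ N1" using real_arch_pow[of 2 "c / \<delta>"] by auto
    obtain N2 :: nat where N2: "norm x + \<delta> < real N2" using reals_Archimedean2 by blast
    define N where "N = max N1 N2"
    have "(2::real) ^ N1 \<le> 2 ^ N" by (intro power_increasing) (auto simp: N_def)
    with N1 have "c / \<delta> < 2 ^ N" by (rule order.strict_trans2)
    then have cN: "c * 2 powi (- int N) < \<delta>"
      using \<delta> by (simp add: power_int_minus field_simps)
    have "?R N x \<subseteq> ball x \<delta>"
    proof safe
      fix y1 y2 assume "y1 \<in> dcube (int N) (fst x)" "y2 \<in> dcube (int N) (snd x)"
      then have d: "norm (fst x - y1) \<le> real CARD('n) * 2 powi (- int N)" "norm (snd x - y2) \<le> real CARD('m) * 2 powi (- int N)"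
        using same_cube_dist by (auto simp: mem_dcube)
      have "norm (x - (y1, y2)) \<le> norm (fst x - y1) + norm (snd x - y2)"
        using norm_Pair_le[of "fst x - y1" "snd x - y2"] by (simp add: minus_prod_def)
      then show "(y1, y2) \<in> ball x \<delta>" using d cN by (simp add: c_def dist_norm distrib_right)
    qed
    moreover have "ball x \<delta> \<subseteq> cball 0 (real N)"
    proof
      fix y assume "y \<in> ball x \<delta>"
      then have "norm y \<le> norm x + \<delta>" using norm_triangle_ineq2[of y x] by (simp add: dist_norm norm_minus_commute)
      then show "y \<in> cball 0 (real N)" using N2 by (simp add: N_def)
    qed
    ultimately show "x \<in> (\<Union>N. V N)" using \<delta> by (auto simp: V_def)
  qed (use V_sub in auto)
  have U_fin: "emeasure lborel U < \<infinity>"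
  proof -
    have "emeasure lborel U \<le> emeasure lborel A + emeasure lborel (U - A)"
    proof -
      have eq: "A \<union> U = U" using U(2) by auto
      show ?thesis using emeasure_subadditive[of A lborel "U - A"] A U(1) by (simp add: eq)
    qed
    also have "\<dots> < \<infinity>" using A U(3) by (auto simp: less_top[symmetric])
    finally show ?thesis .
  qed
  have "(\<lambda>N. emeasure lborel (U - V N)) \<longlonglongrightarrow> emeasure lborel (\<Inter>N. U - V N)"
  proof (rule Lim_emeasure_decseq)
    show "decseq (\<lambda>N. U - V N)" using V_mono by (auto simp: decseq_def incseq_def)
    show "emeasure lborel (U - V i) \<noteq> \<infinity>" for i
      using emeasure_mono[of "U - V i" U lborel] U U_fin by (auto simp: top_unique)
  qed (use U in auto)
  moreover have empty: "(\<Inter>N. U - V N) = {}" using V_UN by auto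
  ultimately have "(\<lambda>N. emeasure lborel (U - V N)) \<longlonglongrightarrow> 0" unfolding empty emeasure_empty by blast
  then have "\<forall>\<^sub>F N in sequentially. emeasure lborel (U - V N) < ennreal (e / 2)"
    using e by (intro order_tendstoD) auto
  then obtain N where N: "emeasure lborel (U - V N) < ennreal (e / 2)"
    by (auto simp: eventually_sequentially)
  have "sqnorm (\<lambda>p. indicator A p - indicator (V N) p) \<le> (\<integral>\<^sup>+p. indicator (U - A) p + indicator (U - V N) p \<partial>lborel)"
    unfolding sqnorm_def
    by (intro nn_integral_mono) (use U(2) V_sub(1)[of N] in \<open>auto simp: indicator_def\<close>)
  also have "\<dots> = emeasure lborel (U - A) + emeasure lborel (U - V N)"
  proof -
    have [measurable]: "U \<in> sets borel" "A \<in> sets borel" using U A by auto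
    show ?thesis by (simp add: nn_integral_add)
  qed
  also have "\<dots> \<le> ennreal (e / 2) + ennreal (e / 2)" using N U(3) by (intro add_mono) auto
  also have "\<dots> = ennreal e" using e by (simp flip: ennreal_plus)
  finally have "sqnorm (\<lambda>p. indicator A p - indicator (V N) p) \<le> ennreal e" .
  moreover have "bdd_supp (indicator (V N) :: _ \<Rightarrow> complex)"
    by (rule bdd_suppI[where B=1 and R="real N"]) (use V_sub(2)[of N] in \<open>auto simp: indicator_def\<close>)
  moreover have "stepfun2 (int N) (indicator (V N) :: _ \<Rightarrow> complex)"
    using V_step[of N "(_, _)" "(_, _)"] by (auto simp: stepfun2_def indicator_def)
  ultimately show "\<exists>g k. bdd_supp g \<and> stepfun2 k g \<and> sqnorm (\<lambda>p. indicator A p - g p) \<le> ennreal e"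
    by blast
qed

text \<open>Simple functions dominated by \<open>f\<close> converge in L2, and each is a finite
  combination of indicators of sets of finite measure.\<close>

theorem step_approx_L2:
  fixes f :: "(real ^ 'n) \<times> (real ^ 'm) \<Rightarrow> complex"
  assumes f [measurable]: "f \<in> borel_measurable borel" and fin: "sqnorm f < \<infinity>"
  shows "step_approx f"
proof (rule step_approx_limit[OF f])
  fix e :: real assume e: "0 < e"
  obtain s where s: "\<And>i. simple_function lborel (s i)" "\<And>x. (\<lambda>i. s i x) \<longlonglongrightarrow> f x"
      "\<And>i x. dist (s i x) 0 \<le> 2 * dist (f x) 0"
    using borel_measurable_implies_sequence_metric[of f lborel 0] f by auto
  have [measurable]: "s i \<in> borel_measurable borel" for i
    using borel_measurable_simple_function[OF s(1)] by simp
  \<comment> \<open>The library gives simple functions of norm at most twice that of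
    \<open>f\<close>, so differences are at most 3 times \<open>f\<close>; squared, this is
    9.\<close>
  have bd: "(norm (f x - s i x))\<^sup>2 \<le> 9 * (norm (f x))\<^sup>2" for i x
  proof -
    have "norm (f x - s i x) \<le> 3 * norm (f x)" using s(3)[of i x] norm_triangle_ineq4[of "f x" "s i x"] by simp
    then have "(norm (f x - s i x))\<^sup>2 \<le> (3 * norm (f x))\<^sup>2" by (intro power_mono) auto
    then show ?thesis by (simp add: power_mult_distrib)
  qed
  have "(\<lambda>i. sqnorm (\<lambda>x. f x - s i x)) \<longlonglongrightarrow> (\<integral>\<^sup>+x. 0 \<partial>(lborel :: ((real ^ 'n) \<times> (real ^ 'm)) measure))"
    unfolding sqnorm_def
  proof (rule nn_integral_dominated_convergence[where w="\<lambda>x. 9 * ennreal ((norm (f x))\<^sup>2)"])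
    show "AE x in lborel. ennreal ((norm (f x - s j x))\<^sup>2) \<le> 9 * ennreal ((norm (f x))\<^sup>2)" for j
    proof (rule AE_I2)
      fix x show "ennreal ((norm (f x - s j x))\<^sup>2) \<le> 9 * ennreal ((norm (f x))\<^sup>2)"
        using ennreal_leI[OF bd[of x j]] by (simp add: ennreal_mult)
    qed
    show "(\<integral>\<^sup>+x. 9 * ennreal ((norm (f x))\<^sup>2) \<partial>lborel) < \<infinity>"
      using fin by (simp add: nn_integral_cmult sqnorm_def ennreal_mult_less_top)
    show "AE x in lborel. (\<lambda>i. ennreal ((norm (f x - s i x))\<^sup>2)) \<longlonglongrightarrow> 0"
    proof (rule AE_I2)
      fix x
      have "(\<lambda>i. ennreal ((norm (f x - s i x))\<^sup>2)) \<longlonglongrightarrow> ennreal ((norm (f x - f x))\<^sup>2)"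
        by (intro tendsto_intros tendsto_ennrealI s)
      then show "(\<lambda>i. ennreal ((norm (f x - s i x))\<^sup>2)) \<longlonglongrightarrow> 0" by simp
    qed
  qed measurable
  then have "\<forall>\<^sub>F i in sequentially. sqnorm (\<lambda>x. f x - s i x) < ennreal e"
    using e by (intro order_tendstoD) auto
  then obtain i where i: "sqnorm (\<lambda>x. f x - s i x) < ennreal e" by (auto simp: eventually_sequentially)
  have fin_range: "finite (range (s i))" using s(1)[of i] by (simp add: simple_function_def)
  define L where "L c = {x. s i x = c}" for c
  have L [measurable]: "L c \<in> sets borel" for c
  proof -
    have "{x \<in> space borel. s i x = c} \<in> sets borel" by measurable
    then show ?thesis by (simp add: L_def)
  qed
  have s_fin: "sqnorm (s i) < \<infinity>"
  proof -
    have "sqnorm (s i) = sqnorm (\<lambda>x. f x - (f x - s i x))" by simp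
    also have "\<dots> \<le> 2 * sqnorm f + 2 * sqnorm (\<lambda>x. f x - s i x)" by (rule sqnorm_diff_le) measurable
    also have "\<dots> < \<infinity>" using fin i by (auto simp: ennreal_mult_less_top intro: less_trans)
    finally show ?thesis .
  qed
  \<comment> \<open>The level set of 0 may have infinite measure, but its term vanishes; for other
    values Chebyshev's inequality gives finite measure.\<close>
  have "step_approx (\<lambda>p. c * indicator (L c) p)" for c
  proof (cases "c = 0")
    case False
    have "ennreal ((norm c)\<^sup>2) * emeasure lborel (L c) = (\<integral>\<^sup>+x. ennreal ((norm c)\<^sup>2) * indicator (L c) x \<partial>lborel)"
      by (simp add: nn_integral_cmult_indicator)
    also have "\<dots> \<le> sqnorm (s i)"
      unfolding sqnorm_def by (intro nn_integral_mono) (auto simp: L_def indicator_def)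
    finally have "ennreal ((norm c)\<^sup>2) * emeasure lborel (L c) < \<infinity>" using s_fin by (rule order.strict_trans1)
    then have "emeasure lborel (L c) < \<infinity>"
      using False by (auto simp: ennreal_mult_less_top)
    then show ?thesis by (intro step_approx_cmult step_approx_indicator L)
  qed (simp add: step_approx_0)
  then have "step_approx (\<lambda>p. \<Sum>c\<in>range (s i). c * indicator (L c) p)"
    by (intro step_approx_sum fin_range)
  moreover have "(\<Sum>c\<in>range (s i). c * indicator (L c) p) = s i p" for p
  proof -
    have "(\<Sum>c\<in>range (s i). c * indicator (L c) p) = (\<Sum>c\<in>range (s i). if c = s i p then c else 0)"
      by (intro sum.cong) (auto simp: L_def indicator_def)
    then show ?thesis using fin_range by simp
  qed
  ultimately have "step_approx (s i)" by simp
  then show "\<exists>h. step_approx h \<and> sqnorm (\<lambda>p. f p - h p) \<le> ennreal e" using i by (auto intro: less_imp_le)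
qed

subsection \<open>Passage from step functions to \<open>L\<^sup>2\<close>\<close>

lemma size_factor_bounded:
  assumes "0 < t" "0 < \<alpha>"
  shows "size_factor \<alpha> t x (y :: real ^ 'd) \<le> t powr (- real CARD('d))"
proof -
  have "(t + norm (x - y)) powr (- (real CARD('d) + \<alpha>)) \<le> t powr (- (real CARD('d) + \<alpha>))"
    using assms by (intro powr_mono2') auto
  then have "t powr \<alpha> * (t + norm (x - y)) powr (- (real CARD('d) + \<alpha>)) \<le> t powr \<alpha> * t powr (- (real CARD('d) + \<alpha>))"
    by (intro mult_left_mono) auto
  also have "t powr \<alpha> * t powr (- (real CARD('d) + \<alpha>)) = t powr (- real CARD('d))"
    by (simp flip: powr_add)
  finally show ?thesis by (simp only: size_factor_def powr_minus divide_inverse)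
qed

text \<open>A section of the kernel is bounded and integrable, hence square integrable. By duality
  \<open>\<Theta>\<close> at a fixed point is continuous on L2.\<close>

lemma nn_integral_square_tensor_size:
  assumes t: "0 < t1" "0 < t2" "0 < \<alpha>" "0 < \<beta>"
    and q: "\<And>p. norm (q p) \<le> K * size_factor \<alpha> t1 x1 (fst p) * size_factor \<beta> t2 x2 (snd p)"
    and K: "0 \<le> K"
  shows "(\<integral>\<^sup>+p. ennreal ((norm (q p :: complex))\<^sup>2) \<partial>(lborel :: ((real ^ 'n) \<times> (real ^ 'm)) measure)) < \<infinity>"
proof -
  define c where "c = K * t1 powr (- real CARD('n)) * t2 powr (- real CARD('m)) * K"
  have c0: "0 \<le> c" using K by (simp add: c_def)
  let ?a = "\<lambda>y. size_factor \<alpha> t1 x1 y" and ?b = "\<lambda>y. size_factor \<beta> t2 x2 y"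
  have "(\<integral>\<^sup>+p. ennreal ((norm (q p))\<^sup>2) \<partial>lborel) \<le> (\<integral>\<^sup>+p. ennreal c * (ennreal (?a (fst p)) * ennreal (?b (snd p))) \<partial>lborel)"
  proof (intro nn_integral_mono)
    fix p
    have "(norm (q p))\<^sup>2 \<le> (K * ?a (fst p) * ?b (snd p))\<^sup>2" by (intro power_mono q) simp
    also have "\<dots> = (K * ?a (fst p) * ?b (snd p) * K) * (?a (fst p) * ?b (snd p))" by (simp add: power2_eq_square)
    also have "\<dots> \<le> c * (?a (fst p) * ?b (snd p))"
      unfolding c_def using K t by (intro mult_right_mono mult_mono size_factor_bounded) auto
    finally have "ennreal ((norm (q p))\<^sup>2) \<le> ennreal (c * (?a (fst p) * ?b (snd p)))" by (rule ennreal_leI)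
    then show "ennreal ((norm (q p))\<^sup>2) \<le> ennreal c * (ennreal (?a (fst p)) * ennreal (?b (snd p)))"
      using c0 by (simp add: ennreal_mult)
  qed
  also have "\<dots> = ennreal c * ((\<integral>\<^sup>+y. ennreal (?a y) \<partial>lborel) * (\<integral>\<^sup>+y. ennreal (?b y) \<partial>lborel))"
    by (subst nn_integral_cmult, measurable, subst nn_integral_pair, measurable) (simp add: nn_integral_cmult nn_integral_multc)
  also have "\<dots> \<le> ennreal c * (ennreal (size_const CARD('n) \<alpha>) * ennreal (size_const CARD('m) \<beta>))"
    by (intro mult_left_mono mult_mono nn_integral_size_factor t) auto
  also have "\<dots> < \<infinity>" by (auto simp: ennreal_mult_less_top)
  finally show ?thesis .
qed

definition biparam_const :: "nat \<Rightarrow> nat \<Rightarrow> real \<Rightarrow> real \<Rightarrow> real \<Rightarrow> real \<Rightarrow> real" where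
  "biparam_const n m \<alpha> \<beta> K B = 3 * (square_const m \<beta> * (t1_const n \<alpha> * K\<^sup>2))
        + 3 * (square_const n \<alpha> * (4 * carleson_const m \<beta> * K\<^sup>2)) + 3 * (16 * B)"

lemma biparam_const_nonneg: "0 < \<alpha> \<Longrightarrow> 0 < \<beta> \<Longrightarrow> 0 \<le> B \<Longrightarrow> 0 \<le> biparam_const n m \<alpha> \<beta> K B"
  unfolding biparam_const_def
  by (intro add_nonneg_nonneg mult_nonneg_nonneg square_const_nonneg t1_const_nonneg carleson_const_nonneg) auto

context biparam_kernel
begin

text \<open>Fatou's lemma along approximating step functions, with pointwise convergence of
  \<open>\<Theta>\<close> for positive parameters.\<close>

lemma square_L2:
  fixes f :: "(real ^ 'n) \<times> (real ^ 'm) \<Rightarrow> complex"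
  assumes f [measurable]: "f \<in> borel_measurable borel" and fin: "sqnorm f < \<infinity>"
  shows "(\<integral>\<^sup>+p. dtt (fst (fst p)) * dtt (fst (snd p)) * ennreal ((norm (\<Theta> f (fst p) (snd p)))\<^sup>2) \<partial>lborel)
     \<le> ennreal (2 * biparam_const CARD('n) CARD('m) \<alpha> \<beta> K B) * sqnorm f"
proof -
  let ?C = "biparam_const CARD('n) CARD('m) \<alpha> \<beta> K B"
  have C0: "0 \<le> ?C" using \<alpha> \<beta> B by (rule biparam_const_nonneg)
  have "\<forall>i. \<exists>g k. bdd_supp g \<and> stepfun2 k g \<and> sqnorm (\<lambda>p. f p - g p) \<le> ennreal (1 / real (Suc i))"
  proof
    fix i
    have "0 < 1 / real (Suc i)" by simp
    then show "\<exists>g k. bdd_supp g \<and> stepfun2 k g \<and> sqnorm (\<lambda>p. f p - g p) \<le> ennreal (1 / real (Suc i))"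
      using step_approx_L2[OF f fin] unfolding step_approx_def by blast
  qed
  then obtain g k where g: "\<And>i. bdd_supp (g i)" "\<And>i. stepfun2 (k i) (g i)"
    "\<And>i. sqnorm (\<lambda>p. f p - g i p) \<le> ennreal (1 / real (Suc i))" by metis
  note [measurable] = bdd_supp_measurable[OF g(1)]
  define u where "u i p = dtt (fst (fst p)) * dtt (fst (snd p)) * ennreal ((norm (\<Theta> (g i) (fst p) (snd p)))\<^sup>2)"
    for i and p :: "('n, 'm) half_spaces"
  have [measurable]: "u i \<in> borel_measurable borel" for i
    unfolding u_def \<Theta>_def by measurable
  define S where "S = enn2real (sqnorm f)"
  have S: "sqnorm f = ennreal S" "0 \<le> S" using fin by (auto simp: S_def less_top)
  have lim: "(\<lambda>i. \<Theta> (g i) v w) \<longlonglongrightarrow> \<Theta> f v w" if t: "0 < fst v" "0 < fst w" for v w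
  proof -
    let ?q = "\<lambda>p. q (fst v) (fst w) (snd v) (snd w) (fst p) (snd p)"
    define Q where "Q = (\<integral>\<^sup>+p. ennreal ((norm (?q p))\<^sup>2) \<partial>lborel)"
    have Qfin: "Q < \<infinity>" unfolding Q_def
      by (rule nn_integral_square_tensor_size[OF t \<alpha> \<beta> _ K]) (rule q_size[OF t])
    have int: "integrable lborel (\<lambda>p. ?q p * h p)" if [measurable]: "h \<in> borel_measurable borel" and "sqnorm h < \<infinity>"
      for h :: "(real ^ 'n) \<times> (real ^ 'm) \<Rightarrow> complex"
    proof (rule integrableI_bounded)
      have "(\<integral>\<^sup>+p. ennreal (norm (?q p * h p)) \<partial>lborel) \<le> (\<integral>\<^sup>+p. ennreal ((norm (?q p))\<^sup>2) + ennreal ((norm (h p))\<^sup>2) \<partial>lborel)"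
      proof (intro nn_integral_mono)
        fix p
        have "norm (?q p) * norm (h p) \<le> (norm (?q p))\<^sup>2 + (norm (h p))\<^sup>2"
          using sum_squares_bound[of "norm (?q p)" "norm (h p)"] mult_nonneg_nonneg[OF norm_ge_zero[of "?q p"] norm_ge_zero[of "h p"]]
          by linarith
        from ennreal_leI[OF this] show "ennreal (norm (?q p * h p)) \<le> ennreal ((norm (?q p))\<^sup>2) + ennreal ((norm (h p))\<^sup>2)"
          by (simp add: norm_mult ennreal_plus)
      qed
      also have "\<dots> = Q + sqnorm h" unfolding Q_def sqnorm_def by (rule nn_integral_add) measurable
      also have "\<dots> < \<infinity>" using Qfin that(2) by simp
      finally show "(\<integral>\<^sup>+p. ennreal (norm (?q p * h p)) \<partial>lborel) < \<infinity>" .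
    qed measurable
    have gfin: "sqnorm (g i) < \<infinity>" for i by (simp add: sqnorm_eq_integral[OF g(1)])
    have le: "ennreal ((norm (\<Theta> f v w - \<Theta> (g i) v w))\<^sup>2) \<le> Q * ennreal (1 / real (Suc i))" for i
    proof -
      have "\<Theta> f v w - \<Theta> (g i) v w = (LINT p|lborel. ?q p * (f p - g i p))"
        unfolding \<Theta>_def using int[OF f fin] int[OF _ gfin[of i]] by (simp add: right_diff_distrib)
      then have "ennreal ((norm (\<Theta> f v w - \<Theta> (g i) v w))\<^sup>2) \<le> (\<integral>\<^sup>+p. ennreal (norm (?q p)) * ennreal (norm (f p - g i p)) \<partial>lborel)\<^sup>2"
        using norm_integral_le_nn_integral[of lborel "\<lambda>p. ?q p * (f p - g i p)"]
        by (simp add: ennreal_power[symmetric] power_mono norm_mult ennreal_mult)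
      also have "\<dots> \<le> (\<integral>\<^sup>+p. (ennreal (norm (?q p)))\<^sup>2 \<partial>lborel) * (\<integral>\<^sup>+p. (ennreal (norm (f p - g i p)))\<^sup>2 \<partial>lborel)"
        by (rule Cauchy_Schwarz_nn_integral) measurable
      also have "\<dots> = Q * sqnorm (\<lambda>p. f p - g i p)" by (simp add: Q_def sqnorm_def ennreal_power)
      also have "\<dots> \<le> Q * ennreal (1 / real (Suc i))" by (intro mult_left_mono g) simp
      finally show ?thesis .
    qed
    obtain r where r: "Q = ennreal r" "0 \<le> r" using Qfin by (cases Q) auto
    have le': "(norm (\<Theta> (g i) v w - \<Theta> f v w))\<^sup>2 \<le> r * (1 / real (Suc i))" for i
    proof -
      have "ennreal ((norm (\<Theta> f v w - \<Theta> (g i) v w))\<^sup>2) \<le> ennreal (r * (1 / real (Suc i)))"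
        using le[of i] r by (simp only: ennreal_mult'[symmetric])
      then show ?thesis using r(2) by (simp add: norm_minus_commute del: of_nat_Suc)
    qed
    have "(\<lambda>i. (norm (\<Theta> (g i) v w - \<Theta> f v w))\<^sup>2) \<longlonglongrightarrow> 0"
    proof (rule Lim_null_comparison[where g="\<lambda>i. r * (1 / real (Suc i))"])
      have "(\<lambda>i. r * (1 / real (Suc i))) \<longlonglongrightarrow> r * 0"
        by (rule tendsto_mult[OF tendsto_const LIMSEQ_Suc[OF lim_1_over_n]])
      then show "(\<lambda>i. r * (1 / real (Suc i))) \<longlonglongrightarrow> 0" by simp
    qed (use le' in \<open>auto intro!: always_eventually simp del: of_nat_Suc\<close>)
    then have "(\<lambda>i. sqrt ((norm (\<Theta> (g i) v w - \<Theta> f v w))\<^sup>2)) \<longlonglongrightarrow> sqrt 0" by (rule tendsto_real_sqrt)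
    then have "(\<lambda>i. norm (\<Theta> (g i) v w - \<Theta> f v w)) \<longlonglongrightarrow> 0" by simp
    then show ?thesis by (simp add: tendsto_norm_zero_iff LIM_zero_iff)
  qed
  have "dtt (fst (fst p)) * dtt (fst (snd p)) * ennreal ((norm (\<Theta> f (fst p) (snd p)))\<^sup>2) \<le> liminf (\<lambda>i. u i p)" for p
  proof (cases "0 < fst (fst p) \<and> 0 < fst (snd p)")
    case True
    define r where "r = 1 / fst (fst p) * (1 / fst (snd p))"
    have r: "0 \<le> r" "dtt (fst (fst p)) * dtt (fst (snd p)) = ennreal r"
      using True by (auto simp: r_def dtt_def simp flip: ennreal_mult)
    have "(\<lambda>i. ennreal (r * (norm (\<Theta> (g i) (fst p) (snd p)))\<^sup>2)) \<longlonglongrightarrow> ennreal (r * (norm (\<Theta> f (fst p) (snd p)))\<^sup>2)"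
      using True by (intro tendsto_ennrealI tendsto_intros lim) auto
    then have "(\<lambda>i. u i p) \<longlonglongrightarrow> dtt (fst (fst p)) * dtt (fst (snd p)) * ennreal ((norm (\<Theta> f (fst p) (snd p)))\<^sup>2)"
      by (simp add: u_def r ennreal_mult)
    then show ?thesis by (simp add: lim_imp_Liminf)
  qed (auto simp: dtt_def)
  then have "(\<integral>\<^sup>+p. dtt (fst (fst p)) * dtt (fst (snd p)) * ennreal ((norm (\<Theta> f (fst p) (snd p)))\<^sup>2) \<partial>lborel)
    \<le> (\<integral>\<^sup>+p. liminf (\<lambda>i. u i p) \<partial>lborel)" by (rule nn_integral_mono)
  also have "\<dots> \<le> liminf (\<lambda>i. \<integral>\<^sup>+p. u i p \<partial>lborel)" by (rule nn_integral_liminf) measurable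
  also have "\<dots> \<le> liminf (\<lambda>i. ennreal (?C * (2 * S + 2 * (1 / real (Suc i)))))"
  proof (intro Liminf_mono always_eventually allI)
    fix i
    \<comment> \<open>The crude bound for the norm of a sum is the origin of the factor 2 in the
      final constant.\<close>
    have "sqnorm (g i) = sqnorm (\<lambda>p. f p - (f p - g i p))" by simp
    also have "\<dots> \<le> 2 * sqnorm f + 2 * sqnorm (\<lambda>p. f p - g i p)" by (rule sqnorm_diff_le) measurable
    also have "\<dots> \<le> 2 * ennreal S + 2 * ennreal (1 / real (Suc i))"
      unfolding S(1) by (intro add_left_mono mult_left_mono g) simp
    also have "\<dots> = ennreal (2 * S + 2 * (1 / real (Suc i)))"
    proof -
      have "2 * ennreal a + 2 * ennreal b = ennreal (2 * a + 2 * b)" if "0 \<le> a" "0 \<le> b" for a b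
        using that by (simp add: ennreal_plus ennreal_mult)
      then show ?thesis using S(2) by simp
    qed
    finally have "ennreal ?C * sqnorm (g i) \<le> ennreal ?C * ennreal (2 * S + 2 * (1 / real (Suc i)))"
      by (rule mult_left_mono) simp
    have "(\<integral>\<^sup>+p. u i p \<partial>lborel) \<le> ennreal ?C * sqnorm (g i)"
      unfolding u_def biparam_const_def by (rule square_\<Theta>[OF g(1,2)])
    show "(\<integral>\<^sup>+p. u i p \<partial>lborel) \<le> ennreal (?C * (2 * S + 2 * (1 / real (Suc i))))"
    proof -
      have "ennreal ?C * ennreal (2 * S + 2 * (1 / real (Suc i))) = ennreal (?C * (2 * S + 2 * (1 / real (Suc i))))"
        using C0 S(2) by (intro ennreal_mult[symmetric]) auto
      then show ?thesis
        using \<open>ennreal ?C * sqnorm (g i) \<le> ennreal ?C * ennreal (2 * S + 2 * (1 / real (Suc i)))\<close>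
          \<open>(\<integral>\<^sup>+p. u i p \<partial>lborel) \<le> ennreal ?C * sqnorm (g i)\<close> by (simp only:)
    qed
  qed
  also have "\<dots> = ennreal (?C * (2 * S + 2 * 0))"
  proof -
    have "(\<lambda>i. 1 / real (Suc i)) \<longlonglongrightarrow> 0" by (rule LIMSEQ_Suc[OF lim_1_over_n])
    then have "(\<lambda>i. ?C * (2 * S + 2 * (1 / real (Suc i)))) \<longlonglongrightarrow> ?C * (2 * S + 2 * 0)"
      by (intro tendsto_mult tendsto_add tendsto_const)
    then show ?thesis by (intro lim_imp_Liminf tendsto_ennrealI) auto
  qed
  also have "\<dots> = ennreal (2 * ?C) * sqnorm f" using C0 S by (simp add: mult.commute mult.left_commute flip: ennreal_mult)
  finally show ?thesis .
qed

end

subsection \<open>Borel versions of Lebesgue measurable kernels\<close>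

text \<open>Makes the invariance of negligible sets under differentiable maps available for
  statements almost everywhere.\<close>

lemma AE_lborel_iff_negligible: "(AE x in lborel. P x) \<longleftrightarrow> negligible {x :: 'a::euclidean_space. \<not> P x}"
proof -
  have "(AE x in lborel. P x) \<longleftrightarrow> (AE x in lebesgue. P x)" by (simp add: AE_completion_iff)
  also have "\<dots> \<longleftrightarrow> negligible {x. \<not> P x}"
    unfolding eventually_ae_filter negligible_iff_null_sets
    using negligible_subset[unfolded negligible_iff_null_sets] by auto
  finally show ?thesis .
qed

text \<open>Used to permute the variables of a null set.\<close>

lemma AE_lborel_linear:
  fixes h :: "'a::euclidean_space \<Rightarrow> 'b::euclidean_space" and h' :: "'b \<Rightarrow> 'a"
  assumes "AE z in lborel. P z" "linear h'" "DIM('b) \<le> DIM('a)" "\<And>w. h' (h w) = w"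
  shows "AE w in lborel. P (h w)"
proof -
  have "negligible (h' ` {z. \<not> P z})"
    using assms by (intro negligible_differentiable_image_negligible linear_imp_differentiable_on)
      (auto simp: AE_lborel_iff_negligible)
  moreover have "{w. \<not> P (h w)} \<subseteq> h' ` {z. \<not> P z}"
  proof
    fix w assume "w \<in> {w. \<not> P (h w)}"
    then show "w \<in> h' ` {z. \<not> P z}" using assms(4)[of w] by (intro image_eqI[of _ _ "h w"]) auto
  qed
  ultimately show ?thesis using negligible_subset by (auto simp: AE_lborel_iff_negligible)
qed

lemma AE_lborel_pairD:
  assumes "AE p in lborel. P p"
  shows "AE x in lborel. AE y in lborel. P (x :: 'a::euclidean_space, y :: 'b::euclidean_space)"
proof (rule lborel_pair.AE_pair)
  show "AE p in lborel \<Otimes>\<^sub>M lborel. P p" using assms by (simp only: lborel_prod)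
qed

text \<open>The measurability of \<open>f\<close> is a conclusion drawn from agreement with a Borel
  function outside a null set. It applies to sections of the original kernel, whose measurability is
  not known beforehand.\<close>

lemma lebesgue_integral_eq_lborel:
  fixes f g :: "'a::euclidean_space \<Rightarrow> complex"
  assumes g [measurable]: "g \<in> borel_measurable borel" and ae: "AE x in lborel. f x = g x"
  shows "(LINT x|lebesgue. f x) = (LINT x|lborel. g x)"
proof -
  obtain N where N: "N \<in> null_sets lborel" "{x. f x \<noteq> g x} \<subseteq> N"
    using ae unfolding eventually_ae_filter by auto
  have "f \<in> borel_measurable lebesgue"
  proof (rule borel_measurableI)
    fix S :: "complex set" assume "open S"
    have "f -` S \<inter> N \<in> null_sets lebesgue"
      by (rule null_sets_completion_subset[of _ N]) (use N null_sets_completionI in auto)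
    moreover have "g -` S - N \<in> sets lebesgue"
      using measurable_sets[OF g, of S] N(1) \<open>open S\<close> by (auto intro!: sets.Diff)
    ultimately have "(g -` S - N) \<union> (f -` S \<inter> N) \<in> sets lebesgue" by auto
    also have "(g -` S - N) \<union> (f -` S \<inter> N) = f -` S \<inter> space lebesgue" using N(2) by auto
    finally show "f -` S \<inter> space lebesgue \<in> sets lebesgue" .
  qed
  moreover have "g \<in> borel_measurable lebesgue" using g by (intro measurable_completion) simp
  ultimately have "(LINT x|lebesgue. f x) = (LINT x|lebesgue. g x)"
    using ae by (intro integral_cong_AE AE_completion) auto
  then show ?thesis by (simp add: integral_completion)
qed

lemma lebesgue_measurable_borel_version:
  fixes f :: "'a::euclidean_space \<Rightarrow> complex"
  assumes "f \<in> borel_measurable lebesgue"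
  shows "\<exists>g\<in>borel_measurable borel. AE x in lborel. f x = g x"
proof -
  have "(\<lambda>x. Re (f x)) \<in> borel_measurable lebesgue" "(\<lambda>x. Im (f x)) \<in> borel_measurable lebesgue"
    using assms by measurable
  then obtain a b where ab: "a \<in> borel_measurable lborel" "AE x in lborel. Re (f x) = a x"
     "b \<in> borel_measurable lborel" "AE x in lborel. Im (f x) = b x"
    using completion_ex_borel_measurable_real by metis
  have [measurable]: "a \<in> borel_measurable borel" "b \<in> borel_measurable borel" using ab by auto
  show ?thesis
  proof (intro bexI)
    show "AE x in lborel. f x = complex_of_real (a x) + \<i> * complex_of_real (b x)"
      using ab(2,4) by eventually_elim (simp add: complex_eq_iff)
  qed measurable
qed

lemma measurable_kernel_borel_version:
  assumes "measurable_kernel (s :: ('n::finite, 'm::finite) kernel)"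
  obtains g where "g \<in> borel_measurable borel"
    "AE z in lborel. case z of (t1, t2, x, y) \<Rightarrow> 0 < t1 \<longrightarrow> 0 < t2 \<longrightarrow> s t1 t2 x y = g z"
proof -
  let ?D = "{0<..} \<times> {0<..} \<times> UNIV \<times> UNIV :: (real \<times> real \<times> ((real ^ 'n) \<times> (real ^ 'm)) \<times> ((real ^ 'n) \<times> (real ^ 'm))) set"
  let ?s = "\<lambda>(t1, t2, x, y). s t1 t2 x y"
  have "open ?D" by (intro open_Times) auto
  then have D: "?D \<inter> space lebesgue \<in> sets lebesgue" by simp
  have "(\<lambda>z. indicator ?D z *\<^sub>R ?s z) \<in> borel_measurable lebesgue"
    using assms borel_measurable_restrict_space_iff[OF D, of ?s] unfolding measurable_kernel_def by simp
  then obtain g where g: "g \<in> borel_measurable borel" "AE z in lborel. indicator ?D z *\<^sub>R ?s z = g z"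
    using lebesgue_measurable_borel_version by blast
  show thesis
  proof (rule that[OF g(1)])
    show "AE z in lborel. case z of (t1, t2, x, y) \<Rightarrow> 0 < t1 \<longrightarrow> 0 < t2 \<longrightarrow> s t1 t2 x y = g z"
      using g(2) by eventually_elim (auto simp: indicator_def split: if_splits)
  qed
qed

subsection \<open>The kernels of the theorem\<close>

lemma AE_lborel_tripleD:
  assumes "AE p in lborel. P p"
  shows "AE x in lborel. AE y in lborel. AE z in lborel.
    P (x :: 'a::euclidean_space, y :: 'b::euclidean_space, z :: 'c::euclidean_space)"
  using AE_lborel_pairD[OF assms] by (rule eventually_mono) (rule AE_lborel_pairD)

text \<open>For differences of the kernel at two points: both sections must be good.\<close>

lemma AE_double:
  assumes "AE x in M. P x"
  shows "AE x in M. AE y in M. P x \<and> P y"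
  using assms
proof (rule eventually_mono)
  show "AE y in M. P x \<and> P y" if "P x" for x
    using assms by (rule eventually_mono) (use that in simp)
qed

text \<open>Transfers the estimates of the original kernel \<open>ks\<close> to its Borel version
  \<open>k\<close>. Two constants occur: \<open>C\<close> bounds \<open>k\<close> at every point and
  yields integrability, while the quantitative \<open>A\<close> reaches \<open>k\<close> only almost
  everywhere, through \<open>ks\<close>. For difference kernels \<open>A\<close> carries a Hoelder
  factor that the cut-off does not preserve pointwise.\<close>

lemma carleson_kernelI:
  fixes k ks :: "real \<Rightarrow> real ^ 'd \<Rightarrow> real ^ 'd \<Rightarrow> complex"
  assumes k: "(\<lambda>(t, x, y). k t x y) \<in> borel_measurable borel"
    and bound: "\<And>t x y. 0 < t \<Longrightarrow> norm (k t x y) \<le> C * size_factor \<alpha> t x y"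
    and eq: "AE p in lborel. AE y in lborel. 0 < snd p \<longrightarrow> ks (snd p) (fst p) y = k (snd p) (fst p) y"
    and size: "\<And>t x y. 0 < t \<Longrightarrow> norm (ks t x y) \<le> A * size_factor \<alpha> t x y"
    and box: "\<And>I. is_cube I \<Longrightarrow> (\<integral>\<^sup>+(x, t)\<in>carleson_box I.
        ennreal ((norm (LINT y:I|lebesgue. ks t x y))\<^sup>2 / t) \<partial>lebesgue) \<le> ennreal ((A * sqrt (measure lebesgue I))\<^sup>2)"
    and A: "0 \<le> A" and \<alpha>: "0 < \<alpha>"
  shows "carleson_kernel k \<alpha> A"
    and "AE t in lborel. AE x in lborel. AE y in lborel. 0 < t \<longrightarrow> ks t x y = k t x y"
proof -
  have km [measurable (raw)]: "(\<lambda>w. k (a w) (b w) (c w)) \<in> borel_measurable M"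
    if "a \<in> M \<rightarrow>\<^sub>M borel" "b \<in> M \<rightarrow>\<^sub>M borel" "c \<in> M \<rightarrow>\<^sub>M borel" for a b c and M :: "'w measure"
    using measurable_compose[of "\<lambda>w. (a w, b w, c w)" M borel, OF _ k] that by simp
  have "AE p in (lborel :: (real \<times> (real ^ 'd)) measure). AE y in lborel.
    0 < fst p \<longrightarrow> ks (fst p) (snd p) y = k (fst p) (snd p) y"
    using AE_lborel_linear[OF eq, where h="\<lambda>p. (snd p, fst p)" and h'="\<lambda>p. (snd p, fst p)"]
    by (simp add: linear_iff)
  from AE_lborel_pairD[OF this]
  show eq': "AE t in lborel. AE x in lborel. AE y in lborel. 0 < t \<longrightarrow> ks t x y = k t x y" by simp
  show "carleson_kernel k \<alpha> A"
  proof
    show "integrable lborel (k t x)" if "0 < t" for t x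
    proof (rule Bochner_Integration.integrable_bound)
      show "integrable lborel (\<lambda>y. C * size_factor \<alpha> t x y)"
        by (intro integrable_mult_right integrable_size_factor that \<alpha>)
      show "AE y in lborel. norm (k t x y) \<le> norm (C * size_factor \<alpha> t x y)"
        using bound[OF that] by (intro AE_I2) (auto intro: order_trans[OF _ abs_ge_self])
    qed measurable
    show "AE t in lborel. 0 < t \<longrightarrow> (AE x in lborel. AE y in lborel. norm (k t x y) \<le> A * size_factor \<alpha> t x y)"
      using eq'
    proof (rule eventually_mono, intro impI)
      fix t :: real assume t: "0 < t" and *: "AE x in lborel. AE y in lborel. 0 < t \<longrightarrow> ks t x y = k t x y"
      show "AE x in lborel. AE y in lborel. norm (k t x y) \<le> A * size_factor \<alpha> t x y"
        using *
      proof (rule eventually_mono, elim eventually_mono)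
        fix x y assume "0 < t \<longrightarrow> ks t x y = k t x y"
        then show "norm (k t x y) \<le> A * size_factor \<alpha> t x y" using t size[of t x y] by simp
      qed
    qed
    fix j :: int and x0 :: "real ^ 'd"
    let ?I = "dcube j x0" and ?V = "(2::real) powi (j * int CARD('d))"
    let ?N = "\<lambda>t x. ennreal ((norm (LINT y|lborel. indicator ?I y * k t x y))\<^sup>2)"
    have av: "avker j x0 x = ?V * indicator ?I x" for x
      by (simp add: avker_def mem_dcube indicator_def)
    have I [measurable]: "?I \<in> sets borel" by measurable
    \<comment> \<open>The density of the averaging kernel is the reciprocal of the measure of the
      cube; this cancels the measure on the right of the box condition.\<close>
    have VI: "ennreal ?V * emeasure lborel ?I = 1"
      using nn_integral_avker[of j x0] by (simp add: av ennreal_mult nn_integral_cmult_indicator ennreal_indicator)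
    then have "emeasure lborel ?I < \<infinity>" by (auto simp: less_top[symmetric] ennreal_mult_top)
    then have meas: "emeasure lborel ?I = ennreal (measure lebesgue ?I)"
      by (simp add: emeasure_eq_ennreal_measure)
    let ?F = "\<lambda>p. (case p of (x, t) \<Rightarrow> ennreal ((norm (LINT y:?I|lebesgue. ks t x y))\<^sup>2 / t)) * indicator (carleson_box ?I) p"
    let ?G = "\<lambda>p. indicator ?I (fst p) * (dtt (snd p) * indicator {t. j \<le> gen t} (snd p) * ?N (snd p) (fst p))"
    have [measurable]: "{t. j \<le> gen t} \<in> sets borel" by measurable
    have "(\<integral>\<^sup>+x. ennreal (avker j x0 x) * (\<integral>\<^sup>+t. dtt t * indicator {t. j \<le> gen t} t * ?N t x \<partial>lborel) \<partial>lborel)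
      = ennreal ?V * (\<integral>\<^sup>+x. \<integral>\<^sup>+t. ?G (x, t) \<partial>lborel \<partial>lborel)"
      by (simp add: av ennreal_mult mult.assoc nn_integral_cmult ennreal_indicator)
    also have "\<dots> \<le> ennreal ?V * (emeasure lborel ?I * ennreal (A\<^sup>2))"
    proof (rule mult_left_mono)
      have "(\<integral>\<^sup>+x. \<integral>\<^sup>+t. ?G (x, t) \<partial>lborel \<partial>lborel) = (\<integral>\<^sup>+p. ?G p \<partial>lborel)"
        by (rule nn_integral_pair[symmetric]) measurable
      also have "\<dots> \<le> (\<integral>\<^sup>+p. ?F p \<partial>lborel)"
      proof (rule nn_integral_mono_AE, use eq AE_lborel_snd[OF AE_not_power] in eventually_elim)
        case (elim p)
        obtain x t where p: "p = (x, t)" by fastforce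
        show ?case
        proof (cases "x \<in> ?I \<and> 0 < t \<and> j \<le> gen t")
          case True
          \<comment> \<open>The condition on \<open>gen t\<close> gives t at most the sidelength,
            whereas the box is open at the top; equality is excluded since it makes t a power of
            two.\<close>
          have "t \<le> 2 powi (- gen t)" using gen_bounds True by blast
          also have "\<dots> \<le> 2 powi (- j)" using True by (intro power_int_increasing) auto
          finally have "t < 2 powi (- j)" using elim(2) p by (auto simp: order_less_le)
          then have "p \<in> carleson_box ?I" using True by (simp add: p carleson_box_def sidelength_dcube)
          moreover have "(LINT y:?I|lebesgue. ks t x y) = (LINT y|lborel. indicator ?I y * k t x y)"
            unfolding set_lebesgue_integral_def
          proof (rule lebesgue_integral_eq_lborel)
            show "AE y in lborel. indicat_real ?I y *\<^sub>R ks t x y = indicator ?I y * k t x y"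
              using elim(1) by (rule eventually_mono) (use True in \<open>auto simp: p indicator_def\<close>)
          qed measurable
          ultimately show ?thesis using True
            by (simp add: p dtt_def ennreal_mult'[symmetric])
        qed (auto simp: p dtt_def)
      qed
      also have "\<dots> = (\<integral>\<^sup>+p. ?F p \<partial>lebesgue)" by (simp only: nn_integral_completion)
      also have "\<dots> \<le> ennreal ((A * sqrt (measure lebesgue ?I))\<^sup>2)" by (rule box[OF is_cube_dcube])
      also have "\<dots> = emeasure lborel ?I * ennreal (A\<^sup>2)"
        unfolding meas by (simp add: power_mult_distrib ennreal_mult mult.commute)
      finally show "(\<integral>\<^sup>+x. \<integral>\<^sup>+t. ?G (x, t) \<partial>lborel \<partial>lborel) \<le> emeasure lborel ?I * ennreal (A\<^sup>2)" .
    qed simp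
    also have "\<dots> = ennreal (A\<^sup>2)"
      by (simp only: mult.assoc[symmetric] VI mult_1)
    finally show "(\<integral>\<^sup>+x. ennreal (avker j x0 x) * (\<integral>\<^sup>+t. dtt t * indicator {t. j \<le> gen t} t * ?N t x \<partial>lborel) \<partial>lborel) \<le> ennreal (A\<^sup>2)" .
  qed (use k A \<alpha> in auto)
qed

lemma t1_kernelI:
  fixes k ks :: "real \<Rightarrow> real ^ 'd \<Rightarrow> real ^ 'd \<Rightarrow> complex"
  assumes k: "(\<lambda>(t, x, y). k t x y) \<in> borel_measurable borel"
    and bound: "\<And>t x y. 0 < t \<Longrightarrow> norm (k t x y) \<le> C * size_factor \<alpha> t x y"
    and eq: "AE p in lborel. AE y in lborel. 0 < snd p \<longrightarrow> ks (snd p) (fst p) y = k (snd p) (fst p) y"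
    and size: "\<And>t x y. 0 < t \<Longrightarrow> norm (ks t x y) \<le> A * size_factor \<alpha> t x y"
    and box: "\<And>I. is_cube I \<Longrightarrow> (\<integral>\<^sup>+(x, t)\<in>carleson_box I.
        ennreal ((norm (LINT y:I|lebesgue. ks t x y))\<^sup>2 / t) \<partial>lebesgue) \<le> ennreal ((A * sqrt (measure lebesgue I))\<^sup>2)"
    and A: "0 \<le> A" and \<alpha>: "0 < \<alpha>"
    and holder: "\<And>t x y y'. 0 < t \<Longrightarrow> norm (y - y') < t / 2 \<Longrightarrow>
        norm (ks t x y - ks t x y') \<le> A * holder_factor \<alpha> t x y y'"
  shows "t1_kernel k \<alpha> A"
proof -
  interpret carleson_kernel k \<alpha> A
    by (rule carleson_kernelI(1)[where ks=ks and C=C]) (fact k bound eq size box A \<alpha>)+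
  have eq': "AE t in lborel. AE x in lborel. AE y in lborel. 0 < t \<longrightarrow> ks t x y = k t x y"
    by (rule carleson_kernelI(2)[where ks=ks and C=C and A=A and \<alpha>=\<alpha>]) (fact k bound eq size box A \<alpha>)+
  show ?thesis
  proof
    show "AE t in lborel. 0 < t \<longrightarrow> (AE x in lborel. AE y in lborel. AE y' in lborel.
      norm (y - y') < t / 2 \<longrightarrow> norm (k t x y - k t x y') \<le> A * holder_factor \<alpha> t x y y')"
      using eq'
    proof (rule eventually_mono, intro impI)
      fix t :: real assume t: "0 < t" and *: "AE x in lborel. AE y in lborel. 0 < t \<longrightarrow> ks t x y = k t x y"
      show "AE x in lborel. AE y in lborel. AE y' in lborel.
        norm (y - y') < t / 2 \<longrightarrow> norm (k t x y - k t x y') \<le> A * holder_factor \<alpha> t x y y'"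
        using *
      proof (rule eventually_mono)
        fix x assume "AE y in lborel. 0 < t \<longrightarrow> ks t x y = k t x y"
        from AE_double[OF this]
        show "AE y in lborel. AE y' in lborel.
          norm (y - y') < t / 2 \<longrightarrow> norm (k t x y - k t x y') \<le> A * holder_factor \<alpha> t x y y'"
        proof (rule eventually_mono, elim eventually_mono)
          fix y y' assume "(0 < t \<longrightarrow> ks t x y = k t x y) \<and> (0 < t \<longrightarrow> ks t x y' = k t x y')"
          then show "norm (y - y') < t / 2 \<longrightarrow> norm (k t x y - k t x y') \<le> A * holder_factor \<alpha> t x y y'"
            using t holder[of t y y' x] by simp
        qed
      qed
    qed
  qed
qed

lemma AE_lborel_quintupleD:
  assumes "AE p in lborel. P p"
  shows "AE a in lborel. AE b in lborel. AE c in lborel. AE d in lborel. AE e in lborel.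
    P (a :: 'a::euclidean_space, b :: 'b::euclidean_space, c :: 'c::euclidean_space, d :: 'd::euclidean_space, e :: 'e::euclidean_space)"
  using AE_lborel_tripleD[OF assms]
proof (rule eventually_mono)
  fix a assume "AE b in lborel. AE r in lborel. P (a, b, r)"
  then show "AE b in lborel. AE c in lborel. AE d in lborel. AE e in lborel. P (a, b, c, d, e)"
    by (rule eventually_mono) (rule AE_lborel_tripleD)
qed

text \<open>Permuted coordinates, then Fubini for null sets, in the three orders needed: first
  slices, second slices, and the kernel integrated in y for \<open>theta\<close>.\<close>

lemma AE_kernel_sections:
  fixes P :: "real \<times> real \<times> ((real ^ 'n::finite) \<times> (real ^ 'm::finite)) \<times> ((real ^ 'n) \<times> (real ^ 'm)) \<Rightarrow> bool"
  assumes "AE z in lborel. P z"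
  shows "AE t2 in lborel. AE x2 in lborel. AE y2 in lborel. AE p in lborel. AE y1 in lborel. P (snd p, t2, (fst p, x2), (y1, y2))"
    and "AE t1 in lborel. AE x1 in lborel. AE y1 in lborel. AE p in lborel. AE y2 in lborel. P (t1, snd p, (x1, fst p), (y1, y2))"
    and "AE v in lborel. AE u in lborel. AE y in lborel. P (snd u, snd v, (fst u, fst v), y)"
proof -
  let ?c = "\<lambda>w. snd (snd (snd w))"
  have "AE w :: real \<times> (real ^ 'm) \<times> (real ^ 'm) \<times> ((real ^ 'n) \<times> real) \<times> (real ^ 'n) in lborel.
      P (snd (fst (?c w)), fst w, (fst (fst (?c w)), fst (snd w)), (snd (?c w), fst (snd (snd w))))"
    by (rule AE_lborel_linear[where h'="\<lambda>z. (fst (snd z), snd (fst (snd (snd z))), snd (snd (snd (snd z))),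
          (fst (fst (snd (snd z))), fst z), fst (snd (snd (snd z))))", OF assms])
       (simp_all add: linear_iff)
  from AE_lborel_quintupleD[OF this]
  show "AE t2 in lborel. AE x2 in lborel. AE y2 in lborel. AE p in lborel. AE y1 in lborel. P (snd p, t2, (fst p, x2), (y1, y2))"
    by (simp only: fst_conv snd_conv)
  have "AE w :: real \<times> (real ^ 'n) \<times> (real ^ 'n) \<times> ((real ^ 'm) \<times> real) \<times> (real ^ 'm) in lborel.
      P (fst w, snd (fst (?c w)), (fst (snd w), fst (fst (?c w))), (fst (snd (snd w)), snd (?c w)))"
    by (rule AE_lborel_linear[where h'="\<lambda>z. (fst z, fst (fst (snd (snd z))), fst (snd (snd (snd z))),
          (snd (fst (snd (snd z))), fst (snd z)), snd (snd (snd (snd z))))", OF assms])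
       (simp_all add: linear_iff)
  from AE_lborel_quintupleD[OF this]
  show "AE t1 in lborel. AE x1 in lborel. AE y1 in lborel. AE p in lborel. AE y2 in lborel. P (t1, snd p, (x1, fst p), (y1, y2))"
    by (simp only: fst_conv snd_conv)
  have "AE w :: ((real ^ 'm) \<times> real) \<times> ((real ^ 'n) \<times> real) \<times> ((real ^ 'n) \<times> (real ^ 'm)) in lborel.
      P (snd (fst (snd w)), snd (fst w), (fst (fst (snd w)), fst (fst w)), snd (snd w))"
    by (rule AE_lborel_linear[where h'="\<lambda>z. ((snd (fst (snd (snd z))), fst (snd z)),
          (fst (fst (snd (snd z))), fst z), snd (snd (snd z)))", OF assms])
       (simp_all add: linear_iff)
  from AE_lborel_tripleD[OF this]
  show "AE v in lborel. AE u in lborel. AE y in lborel. P (snd u, snd v, (fst u, fst v), y)"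
    by (simp only: fst_conv snd_conv)
qed

section \<open>The estimates with a common constant, and the slices of the kernel\<close>

lemma holder_factor_nonneg: "0 \<le> holder_factor \<alpha> t x y z"
  by (simp add: holder_factor_def)

lemma full_standard_estimatesD:
  assumes s: "full_standard_estimates \<alpha> \<beta> K1 s" and K: "K1 \<le> K" and t: "0 < t1" "0 < t2"
  shows "norm (s t1 t2 (x1, x2) (y1, y2)) \<le> K * size_factor \<alpha> t1 x1 y1 * size_factor \<beta> t2 x2 y2"
    and "norm (y1 - z1) < t1 / 2 \<Longrightarrow> norm (y2 - z2) < t2 / 2 \<Longrightarrow>
      norm (s t1 t2 (x1, x2) (y1, y2) - s t1 t2 (x1, x2) (z1, y2)
            - s t1 t2 (x1, x2) (y1, z2) + s t1 t2 (x1, x2) (z1, z2))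
        \<le> K * holder_factor \<alpha> t1 x1 y1 z1 * holder_factor \<beta> t2 x2 y2 z2"
    and "norm (y2 - z2) < t2 / 2 \<Longrightarrow>
      norm (s t1 t2 (x1, x2) (y1, y2) - s t1 t2 (x1, x2) (y1, z2))
        \<le> K * size_factor \<alpha> t1 x1 y1 * holder_factor \<beta> t2 x2 y2 z2"
    and "norm (y1 - z1) < t1 / 2 \<Longrightarrow>
      norm (s t1 t2 (x1, x2) (y1, y2) - s t1 t2 (x1, x2) (z1, y2))
        \<le> K * holder_factor \<alpha> t1 x1 y1 z1 * size_factor \<beta> t2 x2 y2"
proof -
  note F = s[unfolded full_standard_estimates_def]
  have m: "K1 * a * b \<le> K * a * b" if "0 \<le> a" "0 \<le> b" for a b
    using K that by (intro mult_right_mono)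
  note m = m[OF size_factor_nonneg size_factor_nonneg] m[OF size_factor_nonneg holder_factor_nonneg]
    m[OF holder_factor_nonneg size_factor_nonneg] m[OF holder_factor_nonneg holder_factor_nonneg]
  show "norm (s t1 t2 (x1, x2) (y1, y2)) \<le> K * size_factor \<alpha> t1 x1 y1 * size_factor \<beta> t2 x2 y2"
    by (rule order_trans[OF F[THEN conjunct1, rule_format, OF t] m(1)])
  show "norm (s t1 t2 (x1, x2) (y1, y2) - s t1 t2 (x1, x2) (z1, y2)
            - s t1 t2 (x1, x2) (y1, z2) + s t1 t2 (x1, x2) (z1, z2))
        \<le> K * holder_factor \<alpha> t1 x1 y1 z1 * holder_factor \<beta> t2 x2 y2 z2"
    if "norm (y1 - z1) < t1 / 2" "norm (y2 - z2) < t2 / 2"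
    by (rule order_trans[OF F[THEN conjunct2, THEN conjunct1, rule_format, OF t that] m(4)])
  show "norm (s t1 t2 (x1, x2) (y1, y2) - s t1 t2 (x1, x2) (y1, z2))
        \<le> K * size_factor \<alpha> t1 x1 y1 * holder_factor \<beta> t2 x2 y2 z2"
    if "norm (y2 - z2) < t2 / 2"
    by (rule order_trans[OF F[THEN conjunct2, THEN conjunct2, THEN conjunct1, rule_format, OF t that] m(2)])
  show "norm (s t1 t2 (x1, x2) (y1, y2) - s t1 t2 (x1, x2) (z1, y2))
        \<le> K * holder_factor \<alpha> t1 x1 y1 z1 * size_factor \<beta> t2 x2 y2"
    if "norm (y1 - z1) < t1 / 2"
    by (rule order_trans[OF F[THEN conjunct2, THEN conjunct2, THEN conjunct2, rule_format, OF t that] m(3)])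
qed

lemma carleson_standard_estimatesD:
  assumes s: "carleson_standard_estimates \<alpha> \<beta> K2 s" and K: "0 \<le> K2" "K2 \<le> K"
  shows "is_cube I \<Longrightarrow> 0 < t2 \<Longrightarrow> (\<integral>\<^sup>+(x1, t1)\<in>carleson_box I.
        ennreal ((norm (LINT y1:I|lebesgue. s t1 t2 (x1, x2) (y1, y2)))\<^sup>2 / t1) \<partial>lebesgue)
      \<le> ennreal ((K * size_factor \<beta> t2 x2 y2 * sqrt (measure lebesgue I))\<^sup>2)"
    and "is_cube J \<Longrightarrow> 0 < t1 \<Longrightarrow> (\<integral>\<^sup>+(x2, t2)\<in>carleson_box J.
        ennreal ((norm (LINT y2:J|lebesgue. s t1 t2 (x1, x2) (y1, y2)))\<^sup>2 / t2) \<partial>lebesgue)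
      \<le> ennreal ((K * size_factor \<alpha> t1 x1 y1 * sqrt (measure lebesgue J))\<^sup>2)"
    and "is_cube I \<Longrightarrow> 0 < t2 \<Longrightarrow> norm (y2 - z2) < t2 / 2 \<Longrightarrow> (\<integral>\<^sup>+(x1, t1)\<in>carleson_box I.
        ennreal ((norm (LINT y1:I|lebesgue. s t1 t2 (x1, x2) (y1, y2) - s t1 t2 (x1, x2) (y1, z2)))\<^sup>2 / t1) \<partial>lebesgue)
      \<le> ennreal ((K * holder_factor \<beta> t2 x2 y2 z2 * sqrt (measure lebesgue I))\<^sup>2)"
    and "is_cube J \<Longrightarrow> 0 < t1 \<Longrightarrow> norm (y1 - z1) < t1 / 2 \<Longrightarrow> (\<integral>\<^sup>+(x2, t2)\<in>carleson_box J.
        ennreal ((norm (LINT y2:J|lebesgue. s t1 t2 (x1, x2) (y1, y2) - s t1 t2 (x1, x2) (z1, y2)))\<^sup>2 / t2) \<partial>lebesgue)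
      \<le> ennreal ((K * holder_factor \<alpha> t1 x1 y1 z1 * sqrt (measure lebesgue J))\<^sup>2)"
proof -
  note F = s[unfolded carleson_standard_estimates_def]
  have m: "ennreal ((K2 * a * sqrt (measure M b))\<^sup>2) \<le> ennreal ((K * a * sqrt (measure M b))\<^sup>2)" if "0 \<le> a" for a b and M :: "'w measure"
    using K that by (intro ennreal_leI power_mono mult_right_mono mult_nonneg_nonneg real_sqrt_ge_zero measure_nonneg) auto
  have m': "ennreal ((K2 * sqrt (measure M b) * a)\<^sup>2) \<le> ennreal ((K * a * sqrt (measure M b))\<^sup>2)" if "0 \<le> a" for a b and M :: "'w measure"
    using m[OF that, of M b] by (simp only: mult.assoc mult.commute[of a])
  show "(\<integral>\<^sup>+(x1, t1)\<in>carleson_box I.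
        ennreal ((norm (LINT y1:I|lebesgue. s t1 t2 (x1, x2) (y1, y2)))\<^sup>2 / t1) \<partial>lebesgue)
      \<le> ennreal ((K * size_factor \<beta> t2 x2 y2 * sqrt (measure lebesgue I))\<^sup>2)" if "is_cube I" "0 < t2"
    by (rule order_trans[OF F[THEN conjunct1, rule_format, OF that] m'[OF size_factor_nonneg]])
  show "(\<integral>\<^sup>+(x2, t2)\<in>carleson_box J.
        ennreal ((norm (LINT y2:J|lebesgue. s t1 t2 (x1, x2) (y1, y2)))\<^sup>2 / t2) \<partial>lebesgue)
      \<le> ennreal ((K * size_factor \<alpha> t1 x1 y1 * sqrt (measure lebesgue J))\<^sup>2)" if "is_cube J" "0 < t1"
    by (rule order_trans[OF F[THEN conjunct2, THEN conjunct1, rule_format, OF that] m[OF size_factor_nonneg]])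
  show "(\<integral>\<^sup>+(x1, t1)\<in>carleson_box I.
        ennreal ((norm (LINT y1:I|lebesgue. s t1 t2 (x1, x2) (y1, y2) - s t1 t2 (x1, x2) (y1, z2)))\<^sup>2 / t1) \<partial>lebesgue)
      \<le> ennreal ((K * holder_factor \<beta> t2 x2 y2 z2 * sqrt (measure lebesgue I))\<^sup>2)"
    if "is_cube I" "0 < t2" "norm (y2 - z2) < t2 / 2"
    by (rule order_trans[OF F[THEN conjunct2, THEN conjunct2, THEN conjunct1, rule_format, OF that] m'[OF holder_factor_nonneg]])
  show "(\<integral>\<^sup>+(x2, t2)\<in>carleson_box J.
        ennreal ((norm (LINT y2:J|lebesgue. s t1 t2 (x1, x2) (y1, y2) - s t1 t2 (x1, x2) (z1, y2)))\<^sup>2 / t2) \<partial>lebesgue)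
      \<le> ennreal ((K * holder_factor \<alpha> t1 x1 y1 z1 * sqrt (measure lebesgue J))\<^sup>2)"
    if "is_cube J" "0 < t1" "norm (y1 - z1) < t1 / 2"
    by (rule order_trans[OF F[THEN conjunct2, THEN conjunct2, THEN conjunct2, rule_format, OF that] m[OF holder_factor_nonneg]])
qed

lemma six_variables_measurable:
  fixes q :: "real \<Rightarrow> real \<Rightarrow> real ^ 'n \<Rightarrow> real ^ 'm \<Rightarrow> real ^ 'n \<Rightarrow> real ^ 'm \<Rightarrow> complex"
  assumes q: "(\<lambda>(t1, t2, x1, x2, y1, y2). q t1 t2 x1 x2 y1 y2) \<in> borel_measurable borel"
    and "a \<in> M \<rightarrow>\<^sub>M borel" "b \<in> M \<rightarrow>\<^sub>M borel" "c \<in> M \<rightarrow>\<^sub>M borel" "d \<in> M \<rightarrow>\<^sub>M borel" "e \<in> M \<rightarrow>\<^sub>M borel" "f \<in> M \<rightarrow>\<^sub>M borel"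
  shows "(\<lambda>w. q (a w) (b w) (c w) (d w) (e w) (f w)) \<in> borel_measurable M"
proof -
  have "(\<lambda>w. (a w, b w, c w, d w, e w, f w)) \<in> M \<rightarrow>\<^sub>M borel" by (intro borel_measurable_Pair assms)
  from measurable_compose[OF this q] show ?thesis by simp
qed

text \<open>Agreement of \<open>q\<close> with \<open>s\<close> enters through the hypotheses of the
  slice lemmas, each time for the section at hand. \<open>K\<close> majorizes the constants of (A)
  and (B), so a slice has one constant.\<close>

locale borel_kernel =
  fixes s :: "('n::finite, 'm::finite) kernel"
    and q :: "real \<Rightarrow> real \<Rightarrow> real ^ 'n \<Rightarrow> real ^ 'm \<Rightarrow> real ^ 'n \<Rightarrow> real ^ 'm \<Rightarrow> complex"
    and \<alpha> \<beta> K1 K2 K :: real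
  assumes q_meas: "(\<lambda>(t1, t2, x1, x2, y1, y2). q t1 t2 x1 x2 y1 y2) \<in> borel_measurable borel"
    and q_size: "\<And>t1 t2 x1 x2 y1 y2. 0 < t1 \<Longrightarrow> 0 < t2 \<Longrightarrow>
      norm (q t1 t2 x1 x2 y1 y2) \<le> K * size_factor \<alpha> t1 x1 y1 * size_factor \<beta> t2 x2 y2"
    and full: "full_standard_estimates \<alpha> \<beta> K1 s" and carleson: "carleson_standard_estimates \<alpha> \<beta> K2 s"
    and K: "0 \<le> K2" "K1 \<le> K" "K2 \<le> K" and \<alpha>: "0 < \<alpha>" and \<beta>: "0 < \<beta>"
begin

lemmas full_bounds = full_standard_estimatesD[OF full K(2)]
lemmas carleson_bounds = carleson_standard_estimatesD[OF carleson K(1,3)]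
lemmas q_measurable [measurable (raw)] = six_variables_measurable[OF q_meas]

lemma K_nonneg: "0 \<le> K" using K by linarith

lemma q_size': "0 < t1 \<Longrightarrow> 0 < t2 \<Longrightarrow>
   norm (q t1 t2 x1 x2 y1 y2) \<le> (K * size_factor \<beta> t2 x2 y2) * size_factor \<alpha> t1 x1 y1"
  using q_size[of t1 t2 x1 x2 y1 y2] by (simp only: mult.assoc mult.commute[of "size_factor \<alpha> t1 x1 y1"])

lemma slice2:
  assumes t2: "0 < t2" and eq: "AE p in lborel. AE y1 in lborel. 0 < snd p \<longrightarrow> 0 < t2 \<longrightarrow>
      s (snd p) t2 (fst p, x2) (y1, y2) = q (snd p) t2 (fst p) x2 y1 y2"
  shows "t1_kernel (\<lambda>t1 x1 y1. q t1 t2 x1 x2 y1 y2) \<alpha> (K * size_factor \<beta> t2 x2 y2)"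
proof (rule t1_kernelI[where ks="\<lambda>t1 x1 y1. s t1 t2 (x1, x2) (y1, y2)" and C="K * size_factor \<beta> t2 x2 y2"])
  show "(\<lambda>(t, x, y). q t t2 x x2 y y2) \<in> borel_measurable borel"
    unfolding case_prod_beta by (rule q_measurable; measurable)
  show "norm (q t t2 x x2 y y2) \<le> K * size_factor \<beta> t2 x2 y2 * size_factor \<alpha> t x y" if "0 < t" for t x y
    by (rule q_size'[OF that t2])
  show "AE p in lborel. AE y in lborel. 0 < snd p \<longrightarrow> s (snd p) t2 (fst p, x2) (y, y2) = q (snd p) t2 (fst p) x2 y y2"
    using eq by (simp only: t2 simp_thms)
  show "norm (s t t2 (x, x2) (y, y2)) \<le> K * size_factor \<beta> t2 x2 y2 * size_factor \<alpha> t x y" if "0 < t" for t x y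
    using full_bounds(1)[OF that t2, of x x2 y y2] by (simp only: mult.assoc mult.commute[of "size_factor \<alpha> t x y"])
  show "norm (s t t2 (x, x2) (y, y2) - s t t2 (x, x2) (y', y2)) \<le> K * size_factor \<beta> t2 x2 y2 * holder_factor \<alpha> t x y y'"
    if "0 < t" "norm (y - y') < t / 2" for t x y y'
    using full_bounds(4)[OF that(1) t2 that(2), of x x2 y2] by (simp only: mult.assoc mult.commute[of "holder_factor \<alpha> t x y y'"])
qed (rule carleson_bounds(1) t2 \<alpha> mult_nonneg_nonneg K_nonneg size_factor_nonneg | assumption)+

text \<open>For a difference in y2, the mixed estimate of (A) is the size bound, the full Hoelder
  estimate is the Hoelder bound in y1, and the third inequality of (B) is the box bound.\<close>

lemma slice2_diff:
  assumes t2: "0 < t2" and yz: "norm (y2 - z2) < t2 / 2"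
    and eq: "AE p in lborel. AE y1 in lborel. 0 < snd p \<longrightarrow> 0 < t2 \<longrightarrow>
      s (snd p) t2 (fst p, x2) (y1, y2) = q (snd p) t2 (fst p) x2 y1 y2"
      "AE p in lborel. AE y1 in lborel. 0 < snd p \<longrightarrow> 0 < t2 \<longrightarrow>
      s (snd p) t2 (fst p, x2) (y1, z2) = q (snd p) t2 (fst p) x2 y1 z2"
  shows "t1_kernel (\<lambda>t1 x1 y1. q t1 t2 x1 x2 y1 y2 - q t1 t2 x1 x2 y1 z2) \<alpha> (K * holder_factor \<beta> t2 x2 y2 z2)"
proof (rule t1_kernelI[where ks="\<lambda>t1 x1 y1. s t1 t2 (x1, x2) (y1, y2) - s t1 t2 (x1, x2) (y1, z2)"
      and C="K * size_factor \<beta> t2 x2 y2 + K * size_factor \<beta> t2 x2 z2"])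
  show "(\<lambda>(t, x, y). q t t2 x x2 y y2 - q t t2 x x2 y z2) \<in> borel_measurable borel"
    unfolding case_prod_beta by (rule borel_measurable_diff; rule q_measurable; measurable)
  show "norm (q t t2 x x2 y y2 - q t t2 x x2 y z2) \<le> (K * size_factor \<beta> t2 x2 y2 + K * size_factor \<beta> t2 x2 z2) * size_factor \<alpha> t x y"
    if "0 < t" for t x y
    unfolding distrib_right by (rule order_trans[OF norm_triangle_ineq4 add_mono[OF q_size'[OF that t2] q_size'[OF that t2]]])
  show "AE p in lborel. AE y in lborel. 0 < snd p \<longrightarrow> s (snd p) t2 (fst p, x2) (y, y2) - s (snd p) t2 (fst p, x2) (y, z2)
      = q (snd p) t2 (fst p) x2 y y2 - q (snd p) t2 (fst p) x2 y z2"
    using eq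
  proof eventually_elim
    case (elim p)
    then show ?case by eventually_elim (simp add: t2)
  qed
  show "norm (s t t2 (x, x2) (y, y2) - s t t2 (x, x2) (y, z2)) \<le> K * holder_factor \<beta> t2 x2 y2 z2 * size_factor \<alpha> t x y"
    if "0 < t" for t x y
    using full_bounds(3)[OF that t2 yz, of x x2 y] by (simp only: mult.assoc mult.commute[of "size_factor \<alpha> t x y"])
  have d: "(a - b) - (c - d) = a - c - b + d" for a b c d :: complex by simp
  show "norm ((s t t2 (x, x2) (y, y2) - s t t2 (x, x2) (y, z2)) - (s t t2 (x, x2) (y', y2) - s t t2 (x, x2) (y', z2)))
      \<le> K * holder_factor \<beta> t2 x2 y2 z2 * holder_factor \<alpha> t x y y'"
    if "0 < t" "norm (y - y') < t / 2" for t x y y'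
    unfolding d using full_bounds(2)[OF that(1) t2 that(2) yz, of x x2]
    by (simp only: mult.assoc mult.commute[of "holder_factor \<alpha> t x y y'"])
qed (rule carleson_bounds(3) t2 yz \<alpha> mult_nonneg_nonneg K_nonneg holder_factor_nonneg | assumption)+

lemma slice1:
  assumes t1: "0 < t1" and eq: "AE p in lborel. AE y2 in lborel. 0 < t1 \<longrightarrow> 0 < snd p \<longrightarrow>
      s t1 (snd p) (x1, fst p) (y1, y2) = q t1 (snd p) x1 (fst p) y1 y2"
  shows "carleson_kernel (\<lambda>t2 x2 y2. q t1 t2 x1 x2 y1 y2) \<beta> (K * size_factor \<alpha> t1 x1 y1)"
proof (rule carleson_kernelI(1)[where ks="\<lambda>t2 x2 y2. s t1 t2 (x1, x2) (y1, y2)" and C="K * size_factor \<alpha> t1 x1 y1"])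
  show "(\<lambda>(t, x, y). q t1 t x1 x y1 y) \<in> borel_measurable borel"
    unfolding case_prod_beta by (rule q_measurable; measurable)
  show "AE p in lborel. AE y in lborel. 0 < snd p \<longrightarrow> s t1 (snd p) (x1, fst p) (y1, y) = q t1 (snd p) x1 (fst p) y1 y"
    using eq by (simp only: t1 simp_thms)
qed (rule q_size[OF t1] full_bounds(1)[OF t1] carleson_bounds(2) t1 \<beta> mult_nonneg_nonneg K_nonneg size_factor_nonneg | assumption)+

text \<open>Size comes from the mixed estimate with the Hoelder factor in the first variable, the
  box bound from the fourth inequality of (B).\<close>

lemma slice1_diff:
  assumes t1: "0 < t1" and yz: "norm (y1 - z1) < t1 / 2"
    and eq: "AE p in lborel. AE y2 in lborel. 0 < t1 \<longrightarrow> 0 < snd p \<longrightarrow>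
      s t1 (snd p) (x1, fst p) (y1, y2) = q t1 (snd p) x1 (fst p) y1 y2"
      "AE p in lborel. AE y2 in lborel. 0 < t1 \<longrightarrow> 0 < snd p \<longrightarrow>
      s t1 (snd p) (x1, fst p) (z1, y2) = q t1 (snd p) x1 (fst p) z1 y2"
  shows "carleson_kernel (\<lambda>t2 x2 y2. q t1 t2 x1 x2 y1 y2 - q t1 t2 x1 x2 z1 y2) \<beta> (K * holder_factor \<alpha> t1 x1 y1 z1)"
proof (rule carleson_kernelI(1)[where ks="\<lambda>t2 x2 y2. s t1 t2 (x1, x2) (y1, y2) - s t1 t2 (x1, x2) (z1, y2)"
      and C="K * size_factor \<alpha> t1 x1 y1 + K * size_factor \<alpha> t1 x1 z1"])
  show "(\<lambda>(t, x, y). q t1 t x1 x y1 y - q t1 t x1 x z1 y) \<in> borel_measurable borel"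
    unfolding case_prod_beta by (rule borel_measurable_diff; rule q_measurable; measurable)
  show "norm (q t1 t x1 x y1 y - q t1 t x1 x z1 y) \<le> (K * size_factor \<alpha> t1 x1 y1 + K * size_factor \<alpha> t1 x1 z1) * size_factor \<beta> t x y"
    if "0 < t" for t x y
    unfolding distrib_right by (rule order_trans[OF norm_triangle_ineq4 add_mono[OF q_size[OF t1 that] q_size[OF t1 that]]])
  show "AE p in lborel. AE y in lborel. 0 < snd p \<longrightarrow> s t1 (snd p) (x1, fst p) (y1, y) - s t1 (snd p) (x1, fst p) (z1, y)
      = q t1 (snd p) x1 (fst p) y1 y - q t1 (snd p) x1 (fst p) z1 y"
    using eq
  proof eventually_elim
    case (elim p)
    then show ?case by eventually_elim (simp add: t1)
  qed
qed (rule full_bounds(4)[OF t1 _ yz] carleson_bounds(4) t1 yz \<beta> mult_nonneg_nonneg K_nonneg holder_factor_nonneg | assumption)+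

lemma theta_one:
  assumes t: "0 < t1" "0 < t2" and eq: "AE y in lborel. s t1 t2 (x1, x2) y = q t1 t2 x1 x2 (fst y) (snd y)"
  shows "theta s t1 t2 (\<lambda>_. 1) (x1, x2) = (LINT y1|lborel. LINT y2|lborel. q t1 t2 x1 x2 y1 y2)"
proof -
  have m: "(\<lambda>y. q t1 t2 x1 x2 (fst y) (snd y)) \<in> borel_measurable borel" by (rule q_measurable; measurable)
  have "theta s t1 t2 (\<lambda>_. 1) (x1, x2) = (LINT y|lborel. q t1 t2 x1 x2 (fst y) (snd y))"
    unfolding theta_def mult_1_right by (rule lebesgue_integral_eq_lborel[OF m eq])
  also have "\<dots> = (LINT y1|lborel. LINT y2|lborel. q t1 t2 x1 x2 (fst (y1, y2)) (snd (y1, y2)))"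
  proof (rule lborel_integral_pair(1), rule Bochner_Integration.integrable_bound)
    have "integrable lborel (\<lambda>y. complex_of_real (size_factor \<alpha> t1 x1 y))" "integrable lborel (\<lambda>y. complex_of_real (size_factor \<beta> t2 x2 y))"
      by (intro integrable_of_real integrable_size_factor t \<alpha> \<beta>)+
    then show "integrable lborel (\<lambda>p. complex_of_real K * (complex_of_real (size_factor \<alpha> t1 x1 (fst p)) * complex_of_real (size_factor \<beta> t2 x2 (snd p))))"
      by (intro integrable_mult_right integrable_tensor)
    show "(\<lambda>y. q t1 t2 x1 x2 (fst y) (snd y)) \<in> borel_measurable lborel" using m by simp
    show "AE p in lborel. norm (q t1 t2 x1 x2 (fst p) (snd p))
      \<le> norm (complex_of_real K * (complex_of_real (size_factor \<alpha> t1 x1 (fst p)) * complex_of_real (size_factor \<beta> t2 x2 (snd p))))"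
    proof (rule AE_I2)
      fix p
      show "norm (q t1 t2 x1 x2 (fst p) (snd p))
        \<le> norm (complex_of_real K * (complex_of_real (size_factor \<alpha> t1 x1 (fst p)) * complex_of_real (size_factor \<beta> t2 x2 (snd p))))"
        using q_size[OF t, of x1 x2 "fst p" "snd p"] K_nonneg
        by (simp only: norm_mult norm_of_real abs_of_nonneg[OF size_factor_nonneg] abs_of_nonneg mult.assoc)
    qed
  qed
  finally show ?thesis by (simp only: fst_conv snd_conv)
qed

lemma biparam:
  assumes eq: "AE z in lborel. 0 < fst z \<longrightarrow> 0 < fst (snd z) \<longrightarrow>
      s (fst z) (fst (snd z)) (fst (snd (snd z))) (snd (snd (snd z)))
      = q (fst z) (fst (snd z)) (fst (fst (snd (snd z)))) (snd (fst (snd (snd z)))) (fst (snd (snd (snd z)))) (snd (snd (snd (snd z))))"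
    and bc: "biparameter_carleson_condition B s" and B: "0 \<le> B"
  shows "biparam_kernel q \<alpha> \<beta> K B"
    and "AE v in lborel. AE u in lborel. AE y in lborel. 0 < snd u \<longrightarrow> 0 < snd v \<longrightarrow>
      s (snd u) (snd v) (fst u, fst v) y = q (snd u) (snd v) (fst u) (fst v) (fst y) (snd y)"
proof -
  show E3: "AE v in lborel. AE u in lborel. AE y in lborel. 0 < snd u \<longrightarrow> 0 < snd v \<longrightarrow>
      s (snd u) (snd v) (fst u, fst v) y = q (snd u) (snd v) (fst u) (fst v) (fst y) (snd y)"
    using AE_kernel_sections(3)[OF eq] by (simp only: fst_conv snd_conv)
  have E2: "AE t2 in lborel. AE x2 in lborel. AE y2 in lborel. AE p in lborel. AE y1 in lborel. 0 < snd p \<longrightarrow> 0 < t2 \<longrightarrow>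
      s (snd p) t2 (fst p, x2) (y1, y2) = q (snd p) t2 (fst p) x2 y1 y2"
    using AE_kernel_sections(1)[OF eq] by (simp only: fst_conv snd_conv)
  have E1: "AE t1 in lborel. AE x1 in lborel. AE y1 in lborel. AE p in lborel. AE y2 in lborel. 0 < t1 \<longrightarrow> 0 < snd p \<longrightarrow>
      s t1 (snd p) (x1, fst p) (y1, y2) = q t1 (snd p) x1 (fst p) y1 y2"
    using AE_kernel_sections(2)[OF eq] by (simp only: fst_conv snd_conv)
  have kernel2: "AE t2 in lborel. 0 < t2 \<longrightarrow> (AE x2 in lborel. AE y2 in lborel.
      t1_kernel (\<lambda>t1 x1 y1. q t1 t2 x1 x2 y1 y2) \<alpha> (K * size_factor \<beta> t2 x2 y2))"
    using E2
  proof (rule eventually_mono, intro impI)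
    fix t2 :: real assume t2: "0 < t2" and *: "AE x2 in lborel. AE y2 in lborel. AE p in lborel. AE y1 in lborel. 0 < snd p \<longrightarrow> 0 < t2 \<longrightarrow>
      s (snd p) t2 (fst p, x2) (y1, y2) = q (snd p) t2 (fst p) x2 y1 y2"
    show "AE x2 in lborel. AE y2 in lborel. t1_kernel (\<lambda>t1 x1 y1. q t1 t2 x1 x2 y1 y2) \<alpha> (K * size_factor \<beta> t2 x2 y2)"
      using * by (rule eventually_mono) (erule eventually_mono, rule slice2[OF t2])
  qed
  have kernel2_diff: "AE t2 in lborel. 0 < t2 \<longrightarrow> (AE x2 in lborel. AE y2 in lborel. AE z2 in lborel.
      norm (y2 - z2) < t2 / 2 \<longrightarrow>
      t1_kernel (\<lambda>t1 x1 y1. q t1 t2 x1 x2 y1 y2 - q t1 t2 x1 x2 y1 z2) \<alpha> (K * holder_factor \<beta> t2 x2 y2 z2))"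
    using E2
  proof (rule eventually_mono, intro impI)
    fix t2 :: real assume t2: "0 < t2" and *: "AE x2 in lborel. AE y2 in lborel. AE p in lborel. AE y1 in lborel. 0 < snd p \<longrightarrow> 0 < t2 \<longrightarrow>
      s (snd p) t2 (fst p, x2) (y1, y2) = q (snd p) t2 (fst p) x2 y1 y2"
    show "AE x2 in lborel. AE y2 in lborel. AE z2 in lborel. norm (y2 - z2) < t2 / 2 \<longrightarrow>
      t1_kernel (\<lambda>t1 x1 y1. q t1 t2 x1 x2 y1 y2 - q t1 t2 x1 x2 y1 z2) \<alpha> (K * holder_factor \<beta> t2 x2 y2 z2)"
      using *
    proof (rule eventually_mono)
      fix x2 assume "AE y2 in lborel. AE p in lborel. AE y1 in lborel. 0 < snd p \<longrightarrow> 0 < t2 \<longrightarrow>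
        s (snd p) t2 (fst p, x2) (y1, y2) = q (snd p) t2 (fst p) x2 y1 y2"
      from AE_double[OF this]
      show "AE y2 in lborel. AE z2 in lborel. norm (y2 - z2) < t2 / 2 \<longrightarrow>
        t1_kernel (\<lambda>t1 x1 y1. q t1 t2 x1 x2 y1 y2 - q t1 t2 x1 x2 y1 z2) \<alpha> (K * holder_factor \<beta> t2 x2 y2 z2)"
        by (rule eventually_mono) (erule eventually_mono, intro impI, erule conjE, rule slice2_diff[OF t2])
    qed
  qed
  have kernel1: "AE t1 in lborel. 0 < t1 \<longrightarrow> (AE x1 in lborel. AE y1 in lborel.
      carleson_kernel (\<lambda>t2 x2 y2. q t1 t2 x1 x2 y1 y2) \<beta> (K * size_factor \<alpha> t1 x1 y1))"
    using E1
  proof (rule eventually_mono, intro impI)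
    fix t1 :: real assume t1: "0 < t1" and *: "AE x1 in lborel. AE y1 in lborel. AE p in lborel. AE y2 in lborel. 0 < t1 \<longrightarrow> 0 < snd p \<longrightarrow>
      s t1 (snd p) (x1, fst p) (y1, y2) = q t1 (snd p) x1 (fst p) y1 y2"
    show "AE x1 in lborel. AE y1 in lborel. carleson_kernel (\<lambda>t2 x2 y2. q t1 t2 x1 x2 y1 y2) \<beta> (K * size_factor \<alpha> t1 x1 y1)"
      using * by (rule eventually_mono) (erule eventually_mono, rule slice1[OF t1])
  qed
  have kernel1_diff: "AE t1 in lborel. 0 < t1 \<longrightarrow> (AE x1 in lborel. AE y1 in lborel. AE z1 in lborel.
      norm (y1 - z1) < t1 / 2 \<longrightarrow>
      carleson_kernel (\<lambda>t2 x2 y2. q t1 t2 x1 x2 y1 y2 - q t1 t2 x1 x2 z1 y2) \<beta> (K * holder_factor \<alpha> t1 x1 y1 z1))"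
    using E1
  proof (rule eventually_mono, intro impI)
    fix t1 :: real assume t1: "0 < t1" and *: "AE x1 in lborel. AE y1 in lborel. AE p in lborel. AE y2 in lborel. 0 < t1 \<longrightarrow> 0 < snd p \<longrightarrow>
      s t1 (snd p) (x1, fst p) (y1, y2) = q t1 (snd p) x1 (fst p) y1 y2"
    show "AE x1 in lborel. AE y1 in lborel. AE z1 in lborel. norm (y1 - z1) < t1 / 2 \<longrightarrow>
      carleson_kernel (\<lambda>t2 x2 y2. q t1 t2 x1 x2 y1 y2 - q t1 t2 x1 x2 z1 y2) \<beta> (K * holder_factor \<alpha> t1 x1 y1 z1)"
      using *
    proof (rule eventually_mono)
      fix x1 assume "AE y1 in lborel. AE p in lborel. AE y2 in lborel. 0 < t1 \<longrightarrow> 0 < snd p \<longrightarrow>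
        s t1 (snd p) (x1, fst p) (y1, y2) = q t1 (snd p) x1 (fst p) y1 y2"
      from AE_double[OF this]
      show "AE y1 in lborel. AE z1 in lborel. norm (y1 - z1) < t1 / 2 \<longrightarrow>
        carleson_kernel (\<lambda>t2 x2 y2. q t1 t2 x1 x2 y1 y2 - q t1 t2 x1 x2 z1 y2) \<beta> (K * holder_factor \<alpha> t1 x1 y1 z1)"
        by (rule eventually_mono) (erule eventually_mono, intro impI, erule conjE, rule slice1_diff[OF t1])
    qed
  qed
  \<comment> \<open>The image of the constant one, computed from the Borel version so that it is
    jointly measurable; \<open>theta_one\<close> identifies it with \<open>theta\<close> almost
    everywhere.\<close>
  define c :: "('n, 'm) half_spaces \<Rightarrow> ennreal" where "c p = ennreal ((norm (LINT y1|lborel. LINT y2|lborel.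
     q (fst (fst p)) (fst (snd p)) (snd (fst p)) (snd (snd p)) y1 y2))\<^sup>2)" for p
  have c_meas: "c \<in> borel_measurable borel" unfolding c_def by measurable
  have c_eq: "AE v in lborel. AE u in lborel. 0 < snd u \<longrightarrow> 0 < snd v \<longrightarrow>
      c ((snd u, fst u), (snd v, fst v)) = ennreal ((norm (theta s (snd u) (snd v) (\<lambda>_. 1) (fst u, fst v)))\<^sup>2)"
    using E3
  proof (rule eventually_mono, elim eventually_mono, intro impI)
    fix v :: "(real ^ 'm) \<times> real" and u :: "(real ^ 'n) \<times> real"
    assume ae: "AE y in lborel. 0 < snd u \<longrightarrow> 0 < snd v \<longrightarrow>
      s (snd u) (snd v) (fst u, fst v) y = q (snd u) (snd v) (fst u) (fst v) (fst y) (snd y)" and t: "0 < snd u" "0 < snd v"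
    have "AE y in lborel. s (snd u) (snd v) (fst u, fst v) y = q (snd u) (snd v) (fst u) (fst v) (fst y) (snd y)"
      using ae by (simp only: t simp_thms)
    from theta_one[OF t this]
    show "c ((snd u, fst u), (snd v, fst v)) = ennreal ((norm (theta s (snd u) (snd v) (\<lambda>_. 1) (fst u, fst v)))\<^sup>2)"
      by (simp only: c_def fst_conv snd_conv)
  qed
  show "biparam_kernel q \<alpha> \<beta> K B"
  proof (rule biparam_kernel.intro)
    fix G :: "('n, 'm) half_spaces set" and \<Omega> :: "((real ^ 'n) \<times> (real ^ 'm)) set"
    assume A: "G \<in> sets borel" "\<Omega> \<in> sets borel" "emeasure lborel \<Omega> < \<infinity>"
      "\<And>x. x \<in> \<Omega> \<Longrightarrow> \<exists>k l. dcube k (fst x) \<times> dcube l (snd x) \<subseteq> \<Omega>"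
      "\<And>t1 x1 t2 x2. ((t1, x1), (t2, x2)) \<in> G \<Longrightarrow> dcube (gen t1) x1 \<times> dcube (gen t2) x2 \<subseteq> \<Omega>"
    show "(\<integral>\<^sup>+p. dtt (fst (fst p)) * dtt (fst (snd p)) *
          ennreal ((norm (LINT y1|lborel. LINT y2|lborel. q (fst (fst p)) (fst (snd p)) (snd (fst p)) (snd (snd p)) y1 y2))\<^sup>2)
          * indicator G p \<partial>lborel) \<le> ennreal B * emeasure lborel \<Omega>"
      by (rule carleson_condition_level_set[OF c_meas c_eq bc, unfolded c_def]) (fact A)+
  qed (fact q_meas q_size kernel2 kernel2_diff kernel1 kernel1_diff \<alpha> \<beta> K_nonneg B)+
qed

end

text \<open>A Borel version may violate the size bound on a null set, which would spoil
  integrability of some sections. Cutting it off there restores the bound at every point.\<close>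

lemma borel_kernel_exists:
  fixes s :: "('n::finite, 'm::finite) kernel" and \<alpha> \<beta> K1 K2 K3 :: real
  assumes pos: "\<alpha> > 0" "\<beta> > 0" "K1 > 0" "K2 > 0" "K3 > 0"
    and s: "measurable_kernel s" "full_standard_estimates \<alpha> \<beta> K1 s"
      "carleson_standard_estimates \<alpha> \<beta> K2 s" "biparameter_carleson_condition K3 s"
  obtains q where "biparam_kernel q \<alpha> \<beta> (max K1 K2) K3"
    "AE v in lborel. AE u in lborel. AE y in lborel. 0 < snd u \<longrightarrow> 0 < snd v \<longrightarrow>
      s (snd u) (snd v) (fst u, fst v) y = q (snd u) (snd v) (fst u) (fst v) (fst y) (snd y)"
proof -
  define K where "K = max K1 K2"
  have K: "0 \<le> K2" "K1 \<le> K" "K2 \<le> K" "0 \<le> K" using pos by (simp_all add: K_def)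
  obtain g where [measurable]: "g \<in> borel_measurable borel"
    and g: "AE z in lborel. case z of (t1, t2, x, y) \<Rightarrow> 0 < t1 \<longrightarrow> 0 < t2 \<longrightarrow> s t1 t2 x y = g z"
    using measurable_kernel_borel_version[OF s(1)] by blast
  define b :: "real \<times> real \<times> ((real ^ 'n) \<times> (real ^ 'm)) \<times> ((real ^ 'n) \<times> (real ^ 'm)) \<Rightarrow> real"
    where "b z = K * size_factor \<alpha> (fst z) (fst (fst (snd (snd z)))) (fst (snd (snd (snd z))))
      * size_factor \<beta> (fst (snd z)) (snd (fst (snd (snd z)))) (snd (snd (snd (snd z))))" for z
  have [measurable]: "b \<in> borel_measurable borel" unfolding b_def by measurable
  have b0: "0 \<le> b z" for z unfolding b_def by (intro mult_nonneg_nonneg K size_factor_nonneg)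
  \<comment> \<open>For positive parameters the cut-off changes \<open>g\<close> on a null set only:
    almost everywhere \<open>g\<close> equals \<open>s\<close>, which obeys the bound.\<close>
  define Q where "Q z = (if norm (g z) \<le> b z then g z else 0)" for z
  have Q_meas: "Q \<in> borel_measurable borel" unfolding Q_def by measurable
  have Q_le: "norm (Q z) \<le> b z" for z using b0 unfolding Q_def by simp
  define q where "q t1 t2 x1 x2 y1 y2 = Q (t1, t2, (x1, x2), (y1, y2))" for t1 t2 x1 x2 y1 y2
  have q_meas: "(\<lambda>(t1, t2, x1, x2, y1, y2). q t1 t2 x1 x2 y1 y2) \<in> borel_measurable borel"
    unfolding q_def case_prod_beta
    by (rule measurable_compose[OF _ Q_meas], intro borel_measurable_continuous_onI continuous_intros)
  interpret borel_kernel s q \<alpha> \<beta> K1 K2 K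
  proof
    show "norm (q t1 t2 x1 x2 y1 y2) \<le> K * size_factor \<alpha> t1 x1 y1 * size_factor \<beta> t2 x2 y2" for t1 t2 x1 x2 y1 y2
      using Q_le[of "(t1, t2, (x1, x2), (y1, y2))"] by (simp only: q_def b_def fst_conv snd_conv)
  qed (fact q_meas s pos K)+
  have eq: "AE z in lborel. 0 < fst z \<longrightarrow> 0 < fst (snd z) \<longrightarrow>
      s (fst z) (fst (snd z)) (fst (snd (snd z))) (snd (snd (snd z)))
      = q (fst z) (fst (snd z)) (fst (fst (snd (snd z)))) (snd (fst (snd (snd z)))) (fst (snd (snd (snd z)))) (snd (snd (snd (snd z))))"
    using g
  proof (rule eventually_mono, intro impI)
    fix z :: "real \<times> real \<times> ((real ^ 'n) \<times> (real ^ 'm)) \<times> ((real ^ 'n) \<times> (real ^ 'm))"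
    assume *: "case z of (t1, t2, x, y) \<Rightarrow> 0 < t1 \<longrightarrow> 0 < t2 \<longrightarrow> s t1 t2 x y = g z"
      and t: "0 < fst z" "0 < fst (snd z)"
    have sg: "s (fst z) (fst (snd z)) (fst (snd (snd z))) (snd (snd (snd z))) = g z"
      using * t unfolding case_prod_beta by blast
    have "norm (g z) \<le> b z"
      using full_bounds(1)[OF t, of "fst (fst (snd (snd z)))" "snd (fst (snd (snd z)))" "fst (snd (snd (snd z)))" "snd (snd (snd (snd z)))"]
      by (simp only: sg prod.collapse b_def)
    then show "s (fst z) (fst (snd z)) (fst (snd (snd z))) (snd (snd (snd z)))
      = q (fst z) (fst (snd z)) (fst (fst (snd (snd z)))) (snd (fst (snd (snd z)))) (fst (snd (snd (snd z)))) (snd (snd (snd (snd z))))"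
      by (simp only: sg q_def prod.collapse Q_def if_True)
  qed
  have "0 \<le> K3" using pos by simp
  from biparam[OF eq s(4) this] show thesis using that unfolding K_def by blast
qed

theorem theorem2p5:
  fixes \<alpha> \<beta> K1 K2 K3 :: real
  assumes "\<alpha> > 0" and "\<beta> > 0" and "K1 > 0" and "K2 > 0" and "K3 > 0"
  shows "\<exists>C::real. \<forall>s :: ('n::finite, 'm::finite) kernel.
    measurable_kernel s \<longrightarrow>
    full_standard_estimates \<alpha> \<beta> K1 s \<longrightarrow>
    carleson_standard_estimates \<alpha> \<beta> K2 s \<longrightarrow>
    biparameter_carleson_condition K3 s \<longrightarrow>
    (\<forall>f :: (real ^ 'n) \<times> (real ^ 'm) \<Rightarrow> complex. square_integrable f \<longrightarrow>
      (\<integral>\<^sup>+(x2, t2)\<in>UNIV \<times> {0<..}. (\<integral>\<^sup>+(x1, t1)\<in>UNIV \<times> {0<..}.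
          ennreal ((norm (theta s t1 t2 f (x1, x2)))\<^sup>2 / t1 / t2) \<partial>lebesgue) \<partial>lebesgue)
        \<le> ennreal (C * (L2_norm f)\<^sup>2))"
proof (intro exI allI impI)
  \<comment> \<open>Fixed before the kernel is introduced, so it depends on the dimensions, the
    exponents and the three implicit constants alone.\<close>
  let ?C = "2 * biparam_const CARD('n) CARD('m) \<alpha> \<beta> (max K1 K2) K3"
  fix s :: "('n, 'm) kernel" and f :: "(real ^ 'n) \<times> (real ^ 'm) \<Rightarrow> complex"
  assume s: "measurable_kernel s" "full_standard_estimates \<alpha> \<beta> K1 s"
      "carleson_standard_estimates \<alpha> \<beta> K2 s" "biparameter_carleson_condition K3 s" and f: "square_integrable f"
  obtain q where q: "biparam_kernel q \<alpha> \<beta> (max K1 K2) K3"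
    and eq: "AE v in lborel. AE u in lborel. AE y in lborel. 0 < snd u \<longrightarrow> 0 < snd v \<longrightarrow>
      s (snd u) (snd v) (fst u, fst v) y = q (snd u) (snd v) (fst u) (fst v) (fst y) (snd y)"
    by (rule borel_kernel_exists[OF assms s])
  interpret B: biparam_kernel q \<alpha> \<beta> "max K1 K2" K3 by (rule q)
  \<comment> \<open>The function, too, is replaced by a Borel version; neither its norm nor
    \<open>theta\<close> changes.\<close>
  obtain f' where f' [measurable]: "f' \<in> borel_measurable borel" and ff': "AE x in lborel. f x = f' x"
    using f lebesgue_measurable_borel_version unfolding square_integrable_def by blast
  have norm_f': "sqnorm f' = ennreal ((L2_norm f)\<^sup>2)"
  proof -
    have "sqnorm f' = (\<integral>\<^sup>+p. ennreal ((norm (f p))\<^sup>2) \<partial>lebesgue)"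
      unfolding sqnorm_def nn_integral_completion
      by (rule nn_integral_cong_AE, use ff' in eventually_elim) simp
    also have "\<dots> = ennreal (LINT p|lebesgue. (norm (f p))\<^sup>2)"
      using f unfolding square_integrable_def by (intro nn_integral_eq_integral) auto
    also have "(LINT p|lebesgue. (norm (f p))\<^sup>2) = (L2_norm f)\<^sup>2"
      unfolding L2_norm_def by (rule real_sqrt_pow2[symmetric]) (rule Bochner_Integration.integral_nonneg, simp)
    finally show ?thesis .
  qed
  define F where "F p = dtt (fst (fst p)) * dtt (fst (snd p)) * ennreal ((norm (B.\<Theta> f' (fst p) (snd p)))\<^sup>2)"
    for p :: "('n, 'm) half_spaces"
  have F_meas: "F \<in> borel_measurable borel" unfolding F_def B.\<Theta>_def by measurable
  have theta: "ennreal ((norm (theta s (snd u) (snd v) f (fst u, fst v)))\<^sup>2 / snd u / snd v) = F ((snd u, fst u), (snd v, fst v))"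
    if t: "0 < snd u" "0 < snd v" and ae: "AE y in lborel. 0 < snd u \<longrightarrow> 0 < snd v \<longrightarrow>
      s (snd u) (snd v) (fst u, fst v) y = q (snd u) (snd v) (fst u) (fst v) (fst y) (snd y)"
    for u v
  proof -
    have "theta s (snd u) (snd v) f (fst u, fst v) = B.\<Theta> f' (snd u, fst u) (snd v, fst v)"
      unfolding theta_def B.\<Theta>_def
    proof (rule lebesgue_integral_eq_lborel)
      show "AE y in lborel. s (snd u) (snd v) (fst u, fst v) y * f y
        = q (fst (snd u, fst u)) (fst (snd v, fst v)) (snd (snd u, fst u)) (snd (snd v, fst v)) (fst y) (snd y) * f' y"
        using ae ff' by eventually_elim (simp add: t)
    qed measurable
    moreover have "ennreal (r / snd u / snd v) = dtt (snd u) * dtt (snd v) * ennreal r" if "0 \<le> r" for r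
    proof -
      have "r / snd u / snd v = 1 / snd u * (1 / snd v) * r" by simp
      then show ?thesis using t that by (simp only: dtt_def) (simp add: ennreal_mult'[symmetric])
    qed
    ultimately show ?thesis by (simp add: F_def)
  qed
  have "(\<integral>\<^sup>+(x2, t2)\<in>UNIV \<times> {0<..}. (\<integral>\<^sup>+(x1, t1)\<in>UNIV \<times> {0<..}.
          ennreal ((norm (theta s t1 t2 f (x1, x2)))\<^sup>2 / t1 / t2) \<partial>lebesgue) \<partial>lebesgue)
    \<le> (\<integral>\<^sup>+v. \<integral>\<^sup>+u. F ((snd u, fst u), (snd v, fst v)) \<partial>lborel \<partial>lborel)"
    unfolding nn_integral_completion
  proof (rule nn_integral_mono_AE, use eq in \<open>rule eventually_mono\<close>)
    fix v :: "(real ^ 'm) \<times> real"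
    assume v: "AE u in lborel. AE y in lborel. 0 < snd u \<longrightarrow> 0 < snd v \<longrightarrow>
      s (snd u) (snd v) (fst u, fst v) y = q (snd u) (snd v) (fst u) (fst v) (fst y) (snd y)"
    have "(\<integral>\<^sup>+p. (case p of (x1, t1) \<Rightarrow> ennreal ((norm (theta s t1 (snd v) f (x1, fst v)))\<^sup>2 / t1 / snd v)) *
        indicator (UNIV \<times> {0<..}) p \<partial>lborel) \<le> (\<integral>\<^sup>+u. F ((snd u, fst u), (snd v, fst v)) \<partial>lborel)" if "0 < snd v"
    proof (rule nn_integral_mono_AE, use v in \<open>rule eventually_mono\<close>)
      fix u :: "(real ^ 'n) \<times> real"
      assume u: "AE y in lborel. 0 < snd u \<longrightarrow> 0 < snd v \<longrightarrow>
        s (snd u) (snd v) (fst u, fst v) y = q (snd u) (snd v) (fst u) (fst v) (fst y) (snd y)"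
      show "(case u of (x1, t1) \<Rightarrow> ennreal ((norm (theta s t1 (snd v) f (x1, fst v)))\<^sup>2 / t1 / snd v)) *
        indicator (UNIV \<times> {0<..}) u \<le> F ((snd u, fst u), (snd v, fst v))"
      proof (cases "0 < snd u")
        case True
        then show ?thesis using theta[OF True that u] by (simp add: case_prod_beta indicator_def)
      qed (simp add: indicator_def mem_Times_iff)
    qed
    then show "(case v of (x2, t2) \<Rightarrow> \<integral>\<^sup>+p. (case p of (x1, t1) \<Rightarrow> ennreal ((norm (theta s t1 t2 f (x1, x2)))\<^sup>2 / t1 / t2)) *
        indicator (UNIV \<times> {0<..}) p \<partial>lborel) * indicator (UNIV \<times> {0<..}) v \<le> (\<integral>\<^sup>+u. F ((snd u, fst u), (snd v, fst v)) \<partial>lborel)"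
      by (cases "0 < snd v") (simp_all add: case_prod_beta indicator_def mem_Times_iff)
  qed
  also have "\<dots> = (\<integral>\<^sup>+p. F p \<partial>lborel)" by (rule nn_integral_half_spaces[OF F_meas])
  also have "\<dots> \<le> ennreal ?C * sqnorm f'"
    unfolding F_def by (rule B.square_L2[OF f']) (simp add: norm_f')
  also have "\<dots> = ennreal (?C * (L2_norm f)\<^sup>2)"
    using biparam_const_nonneg[of \<alpha> \<beta> K3 "CARD('n)" "CARD('m)" "max K1 K2"] assms
    unfolding norm_f' by (intro ennreal_mult[symmetric]) auto
  finally show "(\<integral>\<^sup>+(x2, t2)\<in>UNIV \<times> {0<..}. (\<integral>\<^sup>+(x1, t1)\<in>UNIV \<times> {0<..}.
          ennreal ((norm (theta s t1 t2 f (x1, x2)))\<^sup>2 / t1 / t2) \<partial>lebesgue) \<partial>lebesgue)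
        \<le> ennreal (?C * (L2_norm f)\<^sup>2)" .
qed

end
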